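(* Let $\mathbf C$ be a cubic ring of geometric nature, i.e. a cubic ring over $\mathbf D=\mathbf k[[t]]$, where $\mathbf k$ is an algebraically closed field, and let $n\ge0$ be an integer. Then $\operatorname{par}(\mathbf C)\le n$ if and only if $\mathbf C$ dominates (i.e. contains as a subring) one of the singularities, in the same algebra $\mathbf L$, of type $E_{12n+i}$ $(6\le i\le8)$ or $E_{2n+1,q}$ $(q\ge0)$.
   Context: Let $\mathbf k$ be an algebraically closed field, $\mathbf D=\mathbf k[[t]]$, $\mathbf K=\mathbf k((t))$. A cubic ring over $\mathbf D$ is a $\mathbf D$-subalgebra $\mathbf C$ of a $3$-dimensional (commutative) semisimple $\mathbf K$-algebra $\mathbf L$ that is a free $\mathbf D$-module of rank $3$. $\mathbf A$ is the integral closure of $\mathbf D$ in $\mathbf L$, assumed to be a finitely generated $\mathbf D$-module. A cubic ring $\mathbf B$ in $\mathbf L$ dominates a cubic ring $\mathbf C$ in $\mathbf L$ if $\mathbf C\subseteq\mathbf B$. A $\mathbf C$-ideal is a finitely generated $\mathbf C$-submodule $M\subseteq\mathbf L$ with $\mathbf KM=\mathbf L$; isomorphism means isomorphism of $\mathbf C$-modules. Number of parameters: $\operatorname{par}(\mathbf C)$ is the minimal $p$ for which there is a finite set of (algebraic) families of $\mathbf C$-ideals of dimensions at most $p$ such that every $\mathbf C$-ideal is isomorphic to one belonging to some of these families. Concretely: choose $N$ with $t^N\mathbf A\subseteq\mathbf C$. Every $\mathbf C$-ideal is isomorphic to an ideal $M$ with $\mathbf AM=\mathbf A$, and then $t^N\mathbf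 A\subseteq M\subseteq\mathbf A$, so such ideals are points of a locally closed subset $X$ of the (disjoint union of the) Grassmannians of subspaces of the finite dimensional $\mathbf k$-vector space $\mathbf A/t^N\mathbf A$. A family of ideals of dimension $p$ is a locally closed subvariety of $X$ of dimension $p$. Types of singularities (cubic rings) used here. Exactly one of the following cases occurs. One branch: $\mathbf L$ is a field, $\tau\mathbf A$ is the maximal ideal of $\mathbf A$, $t\mathbf A=\tau^3\mathbf A$, $v$ is the normalized valuation of $\mathbf A$. The rings of type $E_{6r}$ are $\mathbf C_{2r}(\alpha)=\mathbf D+t^r\alpha\mathbf D+t^{2r}\mathbf A$ with $v(\alpha)=1$; the rings of type $E_{6r+2}$ are $\mathbf C_{2r+1}(\alpha)=\mathbf D+t^r\alpha\mathbf D+t^{2r+1}\mathbf A$ with $v(\alpha)=2$. Two branches: $\mathbf L=\mathbf K_1\times\mathbf K$ with $\mathbf K_1$ a quadratic field extension of $\mathbf K$, $\mathbf A=\mathbf D_1\times\mathbf D$, $\tau\mathbf D_1$ is the maximal ideal of $\mathbf D_1$, $t\mathbf D_1=\tau^2\mathbf D_1$, $v$ is the normalized valuation of $\mathbf D_1$, $e$ is the idempotent with $e\mathbf A=\mathbf D_1$. For $\alpha\in\mathbf D_1$ with $v(\alpha)=1$: the rings of type $E_{6r+1}$ are $\mathbf C_r(\alpha)=\mathbf D+t^r\alpha\mathbf D+t^{2r+1}\mathbf A$; the rings of type $E_{l,2q+1}$ are $\mathbf C_{l,q}(\alpha)=\mathbf D+t^l(e+t^q\alpha)\mathbf D+t^{2l+q}\mathbf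 A$. Three branches: $\mathbf L=\mathbf K^3$, $\mathbf A=\mathbf D^3$. The rings of type $E_{l,2q}$ are $\mathbf C_{l,q}(\alpha)=\mathbf D+t^l\alpha\mathbf D+t^{2l+q}\mathbf A$ with $\alpha=e+t^qae'$, where $e\ne e'$ are primitive idempotents of $\mathbf A$, $a\in\mathbf D^\times$, and $a\not\equiv1\pmod t$ if $q=0$. Here $r,l,q\ge0$ are integers, $\mathbf D$ is embedded diagonally in $\mathbf A$, and $\mathbf D_1$ is identified with $e\mathbf A$. *)

theory Defs
  imports
    "HOL-Computational_Algebra.Formal_Laurent_Series"
    "HOL-Analysis.Function_Topology"
    "HOL-Library.Extended_Nat"
    "Jordan_Normal_Form.Determinant"
begin

text \<open>
  Throughout, \<open>D = k[[t]]\<close> is the type \<open>'k fps\<close> and \<open>K = k((t))\<close> is \<open>'k fls\<close>.  A commutative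
  \<open>K\<close>-algebra \<open>L\<close> is a type \<open>'l\<close> of class \<open>comm_ring_1\<close> together with its structure map
  \<open>\<iota> : K \<rightarrow> L\<close>, a unital ring homomorphism.
\<close>

definition Kscale :: "('k::field fls \<Rightarrow> 'l::comm_ring_1) \<Rightarrow> 'k fls \<Rightarrow> 'l \<Rightarrow> 'l"
  where "Kscale \<iota> c x = \<iota> c * x"

definition Demb :: "('k::field fls \<Rightarrow> 'l::comm_ring_1) \<Rightarrow> 'k fps \<Rightarrow> 'l"
  where "Demb \<iota> f = \<iota> (fps_to_fls f)"

definition Dscale :: "('k::field fls \<Rightarrow> 'l::comm_ring_1) \<Rightarrow> 'k fps \<Rightarrow> 'l \<Rightarrow> 'l"
  where "Dscale \<iota> f x = Demb \<iota> f * x"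

definition kscale :: "('k::field fls \<Rightarrow> 'l::comm_ring_1) \<Rightarrow> 'k \<Rightarrow> 'l \<Rightarrow> 'l"
  where "kscale \<iota> c x = Demb \<iota> (fps_const c) * x"

definition t_elt :: "('k::field fls \<Rightarrow> 'l::comm_ring_1) \<Rightarrow> 'l"
  where "t_elt \<iota> = Demb \<iota> fps_X"

subsection \<open>Submodules of \<open>L\<close>\<close>

text \<open>\<open>R\<close> is a subset of \<open>L\<close> closed under multiplication: a subring, \<open>L\<close> itself, or \<open>e A\<close> for an
  idempotent \<open>e\<close>.\<close>

definition submodule_of :: "'l::comm_ring_1 set \<Rightarrow> 'l set \<Rightarrow> bool"
  where "submodule_of R M \<longleftrightarrow>
    0 \<in> M \<and> (\<forall>x\<in>M. \<forall>y\<in>M. x - y \<in> M) \<and> (\<forall>c\<in>R. \<forall>x\<in>M. c * x \<in> M)"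

definition module_iso :: "'l::comm_ring_1 set \<Rightarrow> 'l set \<Rightarrow> 'l set \<Rightarrow> bool"
  where "module_iso R M M' \<longleftrightarrow>
    (\<exists>f. bij_betw f M M' \<and> (\<forall>x\<in>M. \<forall>y\<in>M. f (x + y) = f x + f y) \<and>
         (\<forall>c\<in>R. \<forall>x\<in>M. f (c * x) = c * f x))"

text \<open>Semisimplicity of the regular module: every ideal is a direct summand.\<close>

definition semisimple_ring :: "'l::comm_ring_1 itself \<Rightarrow> bool"
  where "semisimple_ring _ \<longleftrightarrow>
    (\<forall>I::'l set. submodule_of UNIV I \<longrightarrow>
       (\<exists>J. submodule_of UNIV J \<and> I \<inter> J = {0} \<and> {x + y | x y. x \<in> I \<and> y \<in> J} = UNIV))"

subsection \<open>Cubic rings\<close>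

definition integral_closure :: "('k::field fls \<Rightarrow> 'l::comm_ring_1) \<Rightarrow> 'l set"
  where "integral_closure \<iota> =
    {x. \<exists>p :: 'k fps poly. lead_coeff p = 1 \<and> poly (map_poly (Demb \<iota>) p) x = 0}"

definition cubic_algebra :: "('k::field fls \<Rightarrow> 'l::comm_ring_1) \<Rightarrow> bool"
  where "cubic_algebra \<iota> \<longleftrightarrow>
    \<iota> 1 = 1 \<and> (\<forall>x y. \<iota> (x + y) = \<iota> x + \<iota> y) \<and> (\<forall>x y. \<iota> (x * y) = \<iota> x * \<iota> y) \<and>
    vector_space.dim (Kscale \<iota>) (UNIV :: 'l set) = 3 \<and>
    semisimple_ring TYPE('l) \<and>
    (\<exists>S. finite S \<and> module.span (Dscale \<iota>) S = integral_closure \<iota>)"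

definition cubic_ring :: "('k::field fls \<Rightarrow> 'l::comm_ring_1) \<Rightarrow> 'l set \<Rightarrow> bool"
  where "cubic_ring \<iota> C \<longleftrightarrow>
    module.subspace (Dscale \<iota>) C \<and> 1 \<in> C \<and> (\<forall>x\<in>C. \<forall>y\<in>C. x * y \<in> C) \<and>
    (\<exists>B. card B = 3 \<and> \<not> module.dependent (Dscale \<iota>) B \<and> module.span (Dscale \<iota>) B = C)"

definition dominates :: "('k::field fls \<Rightarrow> 'l::comm_ring_1) \<Rightarrow> 'l set \<Rightarrow> 'l set \<Rightarrow> bool"
  where "dominates \<iota> B C \<longleftrightarrow> cubic_ring \<iota> B \<and> cubic_ring \<iota> C \<and> C \<subseteq> B"

definition tA :: "('k::field fls \<Rightarrow> 'l::comm_ring_1) \<Rightarrow> nat \<Rightarrow> 'l set"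
  where "tA \<iota> m = (*) (t_elt \<iota> ^ m) ` integral_closure \<iota>"

definition C_ideal :: "('k::field fls \<Rightarrow> 'l::comm_ring_1) \<Rightarrow> 'l set \<Rightarrow> 'l set \<Rightarrow> bool"
  where "C_ideal \<iota> C M \<longleftrightarrow>
    (\<exists>S. finite S \<and> M = submodule_of C hull S) \<and> module.span (Kscale \<iota>) M = UNIV"

subsection \<open>The Zariski topology on the Grassmannians of \<open>A / t\<^sup>N A\<close>\<close>

text \<open>
  Subspaces of \<open>V / W\<close> are represented by the intermediate \<open>k\<close>-subspaces \<open>W \<subseteq> U \<subseteq> V\<close>.
  A frame is a sequence \<open>v 0, \<dots>, v (d - 1)\<close> in \<open>U\<close> whose residues form a basis of \<open>U / W\<close>.
\<close>

definition frame ::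
  "('k::field fls \<Rightarrow> 'l::comm_ring_1) \<Rightarrow> 'l set \<Rightarrow> 'l set \<Rightarrow> nat \<Rightarrow> (nat \<Rightarrow> 'l) \<Rightarrow> bool"
  where "frame \<iota> W U d v \<longleftrightarrow> (\<forall>i<d. v i \<in> U) \<and>
    (\<forall>u\<in>U. \<exists>!c. c \<in> extensional {..<d} \<and> u - (\<Sum>i<d. kscale \<iota> (c i) (v i)) \<in> W)"

definition Grassmannian ::
  "('k::field fls \<Rightarrow> 'l::comm_ring_1) \<Rightarrow> 'l set \<Rightarrow> 'l set \<Rightarrow> nat \<Rightarrow> 'l set set"
  where "Grassmannian \<iota> V W d =
    {U. module.subspace (kscale \<iota>) U \<and> W \<subseteq> U \<and> U \<subseteq> V \<and> (\<exists>v. frame \<iota> W U d v)}"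

text \<open>
  Homogeneous polynomials of degree \<open>m\<close> in the Pluecker coordinates of a frame.  In coordinate-free
  terms these coordinates are the minors \<open>det (\<phi>\<^sub>i (v\<^sub>j))\<close>, with \<open>\<phi>\<^sub>i\<close> linear forms vanishing on
  \<open>W\<close>; taking the \<open>\<phi>\<^sub>i\<close> in a dual basis of \<open>V / W\<close> gives the usual finite set of coordinates, and
  the others are linear combinations of these.
\<close>

inductive plucker_form ::
  "('k::field fls \<Rightarrow> 'l::comm_ring_1) \<Rightarrow> 'l set \<Rightarrow> nat \<Rightarrow> nat \<Rightarrow> ((nat \<Rightarrow> 'l) \<Rightarrow> 'k) \<Rightarrow> bool"
  for \<iota> W d where
  const: "plucker_form \<iota> W d 0 (\<lambda>v. c)"
| coord: "(\<And>i. i < d \<Longrightarrow> Vector_Spaces.linear (kscale \<iota>) (*) (\<phi> i)) \<Longrightarrow>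
    (\<And>i w. i < d \<Longrightarrow> w \<in> W \<Longrightarrow> \<phi> i w = 0) \<Longrightarrow>
    plucker_form \<iota> W d 1 (\<lambda>v. det (mat d d (\<lambda>(i, j). \<phi> i (v j))))"
| add: "plucker_form \<iota> W d m f \<Longrightarrow> plucker_form \<iota> W d m g \<Longrightarrow> plucker_form \<iota> W d m (\<lambda>v. f v + g v)"
| mult: "plucker_form \<iota> W d m f \<Longrightarrow> plucker_form \<iota> W d n g \<Longrightarrow>
    plucker_form \<iota> W d (m + n) (\<lambda>v. f v * g v)"

text \<open>
  The disjoint union over \<open>d\<close> of the Grassmannians; the non-vanishing loci of homogeneous forms in
  the Pluecker coordinates are a basis of the topology.  Whether such a form vanishes does not depend
  on the frame, since a change of frame multiplies it by a power of the determinant.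
\<close>

definition zariski_Gr ::
  "('k::field fls \<Rightarrow> 'l::comm_ring_1) \<Rightarrow> 'l set \<Rightarrow> 'l set \<Rightarrow> 'l set topology"
  where "zariski_Gr \<iota> V W = topology_generated_by
    {{U \<in> Grassmannian \<iota> V W d. \<forall>v. frame \<iota> W U d v \<longrightarrow> f v \<noteq> 0} | d m f. plucker_form \<iota> W d m f}"

definition irreducible_closedin :: "'a topology \<Rightarrow> 'a set \<Rightarrow> bool"
  where "irreducible_closedin T Z \<longleftrightarrow> closedin T Z \<and> Z \<noteq> {} \<and>
    (\<forall>P Q. closedin T P \<longrightarrow> closedin T Q \<longrightarrow> Z \<subseteq> P \<union> Q \<longrightarrow> Z \<subseteq> P \<or> Z \<subseteq> Q)"

definition krull_dim :: "'a topology \<Rightarrow> enat"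
  where "krull_dim T = Sup {enat n | n. \<exists>Z. (\<forall>i\<le>n. irreducible_closedin T (Z i)) \<and>
    (\<forall>i<n. Z i \<subset> Z (Suc i))}"

definition locally_closedin :: "'a topology \<Rightarrow> 'a set \<Rightarrow> bool"
  where "locally_closedin T F \<longleftrightarrow> (\<exists>P Q. openin T P \<and> closedin T Q \<and> F = P \<inter> Q)"

subsection \<open>The number of parameters\<close>

definition ideal_space ::
  "('k::field fls \<Rightarrow> 'l::comm_ring_1) \<Rightarrow> 'l set \<Rightarrow> nat \<Rightarrow> 'l set topology"
  where "ideal_space \<iota> C N = subtopology (zariski_Gr \<iota> (integral_closure \<iota>) (tA \<iota> N))
    {M. C_ideal \<iota> C M \<and> submodule_of (integral_closure \<iota>) hull M = integral_closure \<iota>}"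

definition ideal_family ::
  "('k::field fls \<Rightarrow> 'l::comm_ring_1) \<Rightarrow> 'l set \<Rightarrow> nat \<Rightarrow> enat \<Rightarrow> 'l set set \<Rightarrow> bool"
  where "ideal_family \<iota> C N p F \<longleftrightarrow>
    locally_closedin (ideal_space \<iota> C N) F \<and> krull_dim (subtopology (ideal_space \<iota> C N) F) = p"

text \<open>The choice of \<open>N\<close> is immaterial: enlarging it embeds one space of ideals homeomorphically
  onto the other.\<close>

definition par :: "('k::field fls \<Rightarrow> 'l::comm_ring_1) \<Rightarrow> 'l set \<Rightarrow> enat"
  where "par \<iota> C = Inf {enat p | p. \<exists>N \<F>. tA \<iota> N \<subseteq> C \<and> finite \<F> \<and>
    (\<forall>F\<in>\<F>. \<exists>q\<le>enat p. ideal_family \<iota> C N q F) \<and>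
    (\<forall>M. C_ideal \<iota> C M \<longrightarrow> (\<exists>F\<in>\<F>. \<exists>M'\<in>F. module_iso C M M'))}"

subsection \<open>Types of singularities\<close>

text \<open>\<open>R\<close> is a discrete valuation ring inside \<open>L\<close>, possibly with an identity element other than
  \<open>1\<close>.\<close>

definition maximal_ideal_of :: "'l::comm_ring_1 set \<Rightarrow> 'l set \<Rightarrow> bool"
  where "maximal_ideal_of R I \<longleftrightarrow> submodule_of R I \<and> I \<subset> R \<and>
    (\<forall>J. submodule_of R J \<and> I \<subseteq> J \<and> J \<subset> R \<longrightarrow> J = I)"

definition has_valuation :: "'l::comm_ring_1 set \<Rightarrow> 'l \<Rightarrow> nat \<Rightarrow> bool"
  where "has_valuation R \<alpha> m \<longleftrightarrow> \<alpha> \<in> R \<and>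
    (\<exists>\<tau>\<in>R. {I. maximal_ideal_of R I} = {(*) \<tau> ` R} \<and> (*) \<alpha> ` R = (*) (\<tau> ^ m) ` R)"

text \<open>The set \<open>D + \<beta> D + t\<^sup>m A\<close>.\<close>

definition ring_of :: "('k::field fls \<Rightarrow> 'l::comm_ring_1) \<Rightarrow> 'l \<Rightarrow> nat \<Rightarrow> 'l set"
  where "ring_of \<iota> \<beta> m =
    {Demb \<iota> f + \<beta> * Demb \<iota> g + x | f g x. x \<in> tA \<iota> m}"

text \<open>The subring \<open>e L\<close>, whose identity element is \<open>e\<close>, is a field.\<close>

definition idem_field :: "'l::comm_ring_1 \<Rightarrow> bool"
  where "idem_field e \<longleftrightarrow> e * e = e \<and> e \<noteq> 0 \<and>
    (\<forall>x\<in>range ((*) e). x \<noteq> 0 \<longrightarrow> (\<exists>y\<in>range ((*) e). x * y = e))"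

definition one_branch :: "'l::comm_ring_1 itself \<Rightarrow> bool"
  where "one_branch _ \<longleftrightarrow> idem_field (1 :: 'l)"

text \<open>\<open>L = K\<^sub>1 \<times> K\<close> with \<open>K\<^sub>1 = e L\<close> a quadratic extension of \<open>K\<close> and \<open>K = (1 - e) L\<close>.\<close>

definition two_branches :: "('k::field fls \<Rightarrow> 'l::comm_ring_1) \<Rightarrow> 'l \<Rightarrow> bool"
  where "two_branches \<iota> e \<longleftrightarrow> idem_field e \<and>
    vector_space.dim (Kscale \<iota>) (range ((*) e)) = 2 \<and>
    vector_space.dim (Kscale \<iota>) (range ((*) (1 - e))) = 1"

definition K_algebra_hom :: "('k::field fls \<Rightarrow> 'l::comm_ring_1) \<Rightarrow> ('l \<Rightarrow> 'k fls) \<Rightarrow> bool"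
  where "K_algebra_hom \<iota> \<pi> \<longleftrightarrow> (\<forall>x y. \<pi> (x + y) = \<pi> x + \<pi> y) \<and>
    (\<forall>x y. \<pi> (x * y) = \<pi> x * \<pi> y) \<and> (\<forall>c. \<pi> (\<iota> c) = c)"

definition three_branches :: "('k::field fls \<Rightarrow> 'l::comm_ring_1) \<Rightarrow> bool"
  where "three_branches \<iota> \<longleftrightarrow>
    (\<exists>\<pi>1 \<pi>2 \<pi>3. K_algebra_hom \<iota> \<pi>1 \<and> K_algebra_hom \<iota> \<pi>2 \<and> K_algebra_hom \<iota> \<pi>3 \<and>
       bij (\<lambda>x. (\<pi>1 x, \<pi>2 x, \<pi>3 x)))"

definition primitive_idempotent :: "'l::comm_ring_1 set \<Rightarrow> 'l \<Rightarrow> bool"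
  where "primitive_idempotent R e \<longleftrightarrow> e \<in> R \<and> e * e = e \<and> e \<noteq> 0 \<and>
    \<not> (\<exists>f\<in>R. \<exists>g\<in>R. f * f = f \<and> g * g = g \<and> f * g = 0 \<and> f \<noteq> 0 \<and> g \<noteq> 0 \<and> e = f + g)"

text \<open>\<open>E\<^sub>m\<close> is defined for \<open>m\<close> congruent to 0, 1 or 2 modulo 6.\<close>

definition type_E :: "('k::field fls \<Rightarrow> 'l::comm_ring_1) \<Rightarrow> nat \<Rightarrow> 'l set \<Rightarrow> bool"
  where "type_E \<iota> m B \<longleftrightarrow>
    (\<exists>r \<alpha>. m = 6 * r \<and> one_branch TYPE('l) \<and> has_valuation (integral_closure \<iota>) \<alpha> 1 \<and>
       B = ring_of \<iota> (t_elt \<iota> ^ r * \<alpha>) (2 * r)) \<or>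
    (\<exists>r e \<alpha>. m = 6 * r + 1 \<and> two_branches \<iota> e \<and>
       has_valuation ((*) e ` integral_closure \<iota>) \<alpha> 1 \<and>
       B = ring_of \<iota> (t_elt \<iota> ^ r * \<alpha>) (2 * r + 1)) \<or>
    (\<exists>r \<alpha>. m = 6 * r + 2 \<and> one_branch TYPE('l) \<and> has_valuation (integral_closure \<iota>) \<alpha> 2 \<and>
       B = ring_of \<iota> (t_elt \<iota> ^ r * \<alpha>) (2 * r + 1))"

definition type_E2 :: "('k::field fls \<Rightarrow> 'l::comm_ring_1) \<Rightarrow> nat \<Rightarrow> nat \<Rightarrow> 'l set \<Rightarrow> bool"
  where "type_E2 \<iota> l m B \<longleftrightarrow>
    (\<exists>q e \<alpha>. m = 2 * q + 1 \<and> two_branches \<iota> e \<and>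
       has_valuation ((*) e ` integral_closure \<iota>) \<alpha> 1 \<and>
       B = ring_of \<iota> (t_elt \<iota> ^ l * (e + t_elt \<iota> ^ q * \<alpha>)) (2 * l + q)) \<or>
    (\<exists>q e e' a. m = 2 * q \<and> three_branches \<iota> \<and>
       primitive_idempotent (integral_closure \<iota>) e \<and>
       primitive_idempotent (integral_closure \<iota>) e' \<and> e \<noteq> e' \<and>
       a dvd 1 \<and> (q = 0 \<longrightarrow> \<not> fps_X dvd a - 1) \<and>
       B = ring_of \<iota> (t_elt \<iota> ^ l * (e + t_elt \<iota> ^ q * Demb \<iota> a * e')) (2 * l + q))"

end

(* In a suitable basis 1, w, z of A the multiplication is governed by a binary cubic form f, the index
   form. Up to isomorphism every C-ideal is a lattice D + t^a (w + Y z) D + t^b A, or one with w and z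
   exchanged.  If t^(2n+1) x lies in C for some x in A not in D + tA, then a <= 2n+1, the parameter Y is
   known up to few coefficients, and multiplication by units removes all but n of the others.
   Otherwise C lies in D + t^(2n+2) A, all lattices with a = n+1 and b = 2n+2 are C-ideals, and Y modulo
   t^(n+1) is read off rationally from the isomorphism class, so n parameters do not suffice.
   Finally, if t^(2n+1) x lies in C and f(x) has order j, then C contains the ring
   D + t^(2n+1) x D + t^(4n+2+j) A, which is one of the singularities: the factorization of f
   modulo t (triple root, double root, distinct roots) tells the number of branches, and j the type. *)

theory Submission
  imports Defs "HOL-Library.Function_Algebras" "Jordan_Normal_Form.Char_Poly"
begin

section \<open>Polynomial functions\<close>

text \<open>The number 2n+1 comes from balancing two counts. For a <= n, a unit 1 + \<lambda> t^a (w
  + Yz) moves Y by multiples of t^(a+j), where j is the order of f(1,Y), and below t^j only finitely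
  many values of Y are possible; at most a coefficients remain. For a > n, the element t^(2n+1) x of
  C leaves at most 2n+1-a coefficients free. Both numbers are at most n. Maximality of A enters in
  one place: a multiple root of f modulo t never lifts to a root modulo t^2. Hence for every j the
  solutions of f(1,Y) = 0 modulo t^j lie in finitely many classes modulo t^j. The obstacle in the
  lower bound is that an isomorphism of ideals is no algebraic map: the class has to be read off the
  unknown isomorphic ideal, as the quotient of two determinants whose common factor, a norm,
  cancels. Dimension is the length of chains of irreducible closed sets. It is bounded above by
  counting monomials in p+2 independent functions against monomials in p parameters, and below by
  hyperplane sections.\<close>

lemma exists_linear_relation:
  fixes M :: "'i \<Rightarrow> 'j \<Rightarrow> 'k::field"
  assumes "finite J" "finite I" "card J < card I"
  shows "\<exists>c. (\<exists>i\<in>I. c i \<noteq> 0) \<and> (\<forall>j\<in>J. (\<Sum>i\<in>I. c i * M i j) = 0)"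
  using assms
proof (induction J arbitrary: I M rule: finite_induct)
  case empty
  then obtain i where "i \<in> I" by fastforce
  then show ?case by (intro exI[of _ "\<lambda>_. 1"]) auto
next
  case (insert j J)
  show ?case
  proof (cases "\<forall>i\<in>I. M i j = 0")
    case True
    from insert.hyps insert.prems have "card J < card I" by simp
    from insert.IH[OF insert.prems(1) this, of M] obtain c
      where "\<exists>i\<in>I. c i \<noteq> 0" "\<forall>j\<in>J. (\<Sum>i\<in>I. c i * M i j) = 0" by blast
    with True show ?thesis by (intro exI[of _ c]) simp
  next
    case False
    then obtain i0 where i0: "i0 \<in> I" "M i0 j \<noteq> 0" by blast
    define I' where "I' = I - {i0}"
    have fin: "finite I'" and crd: "card J < card I'" and I: "I = insert i0 I'" and ni: "i0 \<notin> I'"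
      using insert.hyps insert.prems i0 by (auto simp: I'_def)
    \<comment> \<open>Gaussian elimination: equation \<open>j\<close> is solved for the unknown
      \<open>i0\<close>, and \<open>M'\<close> is the system left for the other unknowns.\<close>
    define M' where "M' i j' = M i j' - M i j / M i0 j * M i0 j'" for i j'
    from insert.IH[OF fin crd, of M'] obtain c where
      c: "\<exists>i\<in>I'. c i \<noteq> 0" "\<And>j'. j' \<in> J \<Longrightarrow> (\<Sum>i\<in>I'. c i * M' i j') = 0" by blast
    define c' where "c' i = (if i = i0 then - (\<Sum>i\<in>I'. c i * M i j) / M i0 j else c i)" for i
    have sum_c': "(\<Sum>i\<in>I. c' i * M i j') =
      (\<Sum>i\<in>I'. c i * M i j') - (\<Sum>i\<in>I'. c i * M i j) / M i0 j * M i0 j'" for j'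
    proof -
      have "(\<Sum>i\<in>I'. c' i * M i j') = (\<Sum>i\<in>I'. c i * M i j')"
        using ni by (intro sum.cong) (auto simp: c'_def)
      then show ?thesis using fin ni by (simp add: I c'_def)
    qed
    have "(\<Sum>i\<in>I. c' i * M i j) = 0" using i0 by (simp add: sum_c')
    moreover have "(\<Sum>i\<in>I. c' i * M i j') = 0" if "j' \<in> J" for j'
    proof -
      have "(\<Sum>i\<in>I'. c i * M' i j') = (\<Sum>i\<in>I'. c i * M i j') -
        (\<Sum>i\<in>I'. c i * M i j) / M i0 j * M i0 j'"
        by (simp add: M'_def algebra_simps sum_subtractf sum_distrib_left sum_divide_distrib)
      then show ?thesis using c(2)[OF that] by (simp add: sum_c')
    qed
    moreover have "\<exists>i\<in>I. c' i \<noteq> 0" using c(1) ni by (auto simp: c'_def I)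
    ultimately show ?thesis by (intro exI[of _ c']) auto
  qed
qed

text \<open>The degree is bounded in each variable separately, so the monomials form a box with
  exactly (e+1)^p members; this is the number compared in \<open>krull_dim_le\<close>.\<close>

definition poly_deg_le :: "nat \<Rightarrow> nat \<Rightarrow> ((nat \<Rightarrow> 'k::field) \<Rightarrow> 'k) \<Rightarrow> bool"
  where "poly_deg_le p e F \<longleftrightarrow>
    (\<exists>c. \<forall>h. F h = (\<Sum>z\<in>{..<p} \<rightarrow>\<^sub>E {..e}. c z * (\<Prod>i<p. h i ^ z i)))"

lemma poly_deg_le_0: "poly_deg_le p e (\<lambda>_. 0)"
  unfolding poly_deg_le_def by (intro exI[of _ "\<lambda>_. 0"]) simp

lemma poly_deg_le_add:
  assumes "poly_deg_le p e F" "poly_deg_le p e G"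
  shows "poly_deg_le p e (\<lambda>h. F h + G h)"
proof -
  from assms obtain c d where
    "\<And>h. F h = (\<Sum>z\<in>{..<p} \<rightarrow>\<^sub>E {..e}. c z * (\<Prod>i<p. h i ^ z i))"
    "\<And>h. G h = (\<Sum>z\<in>{..<p} \<rightarrow>\<^sub>E {..e}. d z * (\<Prod>i<p. h i ^ z i))"
    unfolding poly_deg_le_def by blast
  then show ?thesis unfolding poly_deg_le_def
    by (intro exI[of _ "\<lambda>z. c z + d z"]) (simp add: algebra_simps sum.distrib)
qed

lemma poly_deg_le_sum:
  "(\<And>i. i \<in> I \<Longrightarrow> poly_deg_le p e (F i)) \<Longrightarrow> poly_deg_le p e (\<lambda>h. \<Sum>i\<in>I. F i h)"
  by (induction I rule: infinite_finite_induct) (auto intro: poly_deg_le_0 poly_deg_le_add)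

lemma poly_deg_le_monomial:
  assumes "\<And>i. i < p \<Longrightarrow> l i \<le> e"
  shows "poly_deg_le p e (\<lambda>h. c * (\<Prod>i<p. h i ^ l i))"
proof -
  let ?g = "restrict l {..<p}"
  have "(\<Sum>z\<in>{..<p} \<rightarrow>\<^sub>E {..e}. (if z = ?g then c else 0) * (\<Prod>i<p. h i ^ z i))
      = (\<Sum>z\<in>{..<p} \<rightarrow>\<^sub>E {..e}. if ?g = z then c * (\<Prod>i<p. h i ^ z i) else 0)" for h :: "nat \<Rightarrow> 'a"
    by (intro sum.cong) auto
  also have "\<dots> h = c * (\<Prod>i<p. h i ^ ?g i)" for h
    using assms by (subst sum.delta') (auto intro!: finite_PiE)
  also have "\<dots> h = c * (\<Prod>i<p. h i ^ l i)" for h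
    by (intro arg_cong[of _ _ "(*) c"] prod.cong) auto
  finally show ?thesis unfolding poly_deg_le_def
    by (intro exI[of _ "\<lambda>z. if z = ?g then c else 0"]) simp
qed

lemma poly_deg_le_const: "poly_deg_le p e (\<lambda>_. c)"
  using poly_deg_le_monomial[of p "\<lambda>_. 0" e c] by simp

lemma poly_deg_le_var:
  assumes "i < p" "0 < e"
  shows "poly_deg_le p e (\<lambda>h. h i)"
proof -
  have "(\<Prod>j<p. h j ^ (if j = i then 1 else 0)) = h i" for h :: "nat \<Rightarrow> 'a"
  proof -
    have "(\<Prod>j<p. h j ^ (if j = i then 1 else 0)) = (\<Prod>j<p. if i = j then h j else 1)"
      by (intro prod.cong) auto
    then show ?thesis using assms by (simp add: prod.delta)
  qed
  moreover have "poly_deg_le p e (\<lambda>h :: nat \<Rightarrow> 'a. 1 * (\<Prod>j<p. h j ^ (if j = i then 1 else 0)))"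
    using assms by (intro poly_deg_le_monomial) auto
  ultimately show ?thesis by simp
qed

lemma poly_deg_le_mult:
  assumes "poly_deg_le p e F" "poly_deg_le p e' G"
  shows "poly_deg_le p (e + e') (\<lambda>h. F h * G h)"
proof -
  from assms obtain c d where
    F: "\<And>h. F h = (\<Sum>z\<in>{..<p} \<rightarrow>\<^sub>E {..e}. c z * (\<Prod>i<p. h i ^ z i))" and
    G: "\<And>h. G h = (\<Sum>z\<in>{..<p} \<rightarrow>\<^sub>E {..e'}. d z * (\<Prod>i<p. h i ^ z i))"
    unfolding poly_deg_le_def by blast
  have "F h * G h = (\<Sum>z\<in>{..<p} \<rightarrow>\<^sub>E {..e}. \<Sum>w\<in>{..<p} \<rightarrow>\<^sub>E {..e'}.
      (c z * d w) * (\<Prod>i<p. h i ^ (z i + w i)))" for h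
    by (simp add: F G sum_product power_add prod.distrib mult_ac)
  moreover have "poly_deg_le p (e + e') (\<lambda>h. \<Sum>z\<in>{..<p} \<rightarrow>\<^sub>E {..e}. \<Sum>w\<in>{..<p} \<rightarrow>\<^sub>E {..e'}.
      (c z * d w) * (\<Prod>i<p. h i ^ (z i + w i)))"
    by (intro poly_deg_le_sum poly_deg_le_monomial add_mono) auto
  ultimately show ?thesis by simp
qed

lemma poly_deg_le_prod:
  "finite I \<Longrightarrow> (\<And>i. i \<in> I \<Longrightarrow> poly_deg_le p e (F i)) \<Longrightarrow>
    poly_deg_le p (e * card I) (\<lambda>h. \<Prod>i\<in>I. F i h)"
  by (induction I rule: finite_induct)
    (auto intro: poly_deg_le_const dest: poly_deg_le_mult)

text \<open>Polynomials are kept as functions. The field is infinite, so being non-zero somewhere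
  stands for being a non-zero polynomial, and a non-vanishing locus for a non-empty open set of
  affine space.\<close>

inductive_set poly_fun :: "nat \<Rightarrow> ((nat \<Rightarrow> 'k::field) \<Rightarrow> 'k) set" for m where
  const: "(\<lambda>_. c) \<in> poly_fun m"
| var: "i < m \<Longrightarrow> (\<lambda>h. h i) \<in> poly_fun m"
| add: "f \<in> poly_fun m \<Longrightarrow> g \<in> poly_fun m \<Longrightarrow> (\<lambda>h. f h + g h) \<in> poly_fun m"
| mult: "f \<in> poly_fun m \<Longrightarrow> g \<in> poly_fun m \<Longrightarrow> (\<lambda>h. f h * g h) \<in> poly_fun m"

lemma poly_fun_cong:
  assumes "f \<in> poly_fun m" "\<And>i. i < m \<Longrightarrow> h i = h' i"
  shows "f h = f h'"
  using assms by induction auto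

lemma poly_fun_specialize:
  assumes "f \<in> poly_fun (Suc m)"
  shows "(\<lambda>h. f (h(m := c))) \<in> poly_fun m"
  using assms
proof induction
  case (var i)
  then show ?case by (cases "i = m") (auto intro: poly_fun.intros)
qed (auto intro: poly_fun.intros)

lemma poly_fun_line:
  assumes "f \<in> poly_fun m"
  shows "\<exists>P. \<forall>s. f (\<lambda>i. p i + s * v i) = poly P s"
  using assms
proof induction
  case (const c)
  show ?case by (intro exI[of _ "[:c:]"]) simp
next
  case (var i)
  show ?case by (intro exI[of _ "[:p i, v i:]"]) simp
next
  case (add f g)
  then obtain P Q where "\<forall>s. f (\<lambda>i. p i + s * v i) = poly P s" "\<forall>s. g (\<lambda>i. p i + s * v i) = poly Q s"
    by blast
  then show ?case by (intro exI[of _ "P + Q"]) simp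
next
  case (mult f g)
  then obtain P Q where "\<forall>s. f (\<lambda>i. p i + s * v i) = poly P s" "\<forall>s. g (\<lambda>i. p i + s * v i) = poly Q s"
    by blast
  then show ?case by (intro exI[of _ "P * Q"]) simp
qed

lemma infinite_alg_closed: "infinite (UNIV :: 'k::alg_closed_field set)"
proof
  assume fin: "finite (UNIV :: 'k set)"
  \<comment> \<open>Over a finite field the product vanishes everywhere, so adding 1 gives a
    non-constant polynomial without roots.\<close>
  define p :: "'k poly" where "p = (\<Prod>a\<in>UNIV. [:-a, 1:]) + 1"
  have val: "poly p x = 1" for x
    using fin by (auto simp: p_def poly_prod)
  have "degree (\<Prod>a\<in>(UNIV::'k set). [:-a, 1:]) = card (UNIV :: 'k set)"
    by (subst degree_prod_eq_sum_degree) auto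
  moreover have "card (UNIV :: 'k set) > 0" using fin by (simp add: card_gt_0_iff)
  ultimately have "degree p > 0"
    unfolding p_def by (subst degree_add_eq_left) auto
  then obtain x where "poly p x = 0" using alg_closed_imp_poly_has_root by blast
  with val show False by simp
qed

text \<open>Restriction to the line through points of non-vanishing.\<close>

lemma poly_fun_mult_nonzero:
  fixes f g :: "(nat \<Rightarrow> 'k::alg_closed_field) \<Rightarrow> 'k"
  assumes "f \<in> poly_fun m" "g \<in> poly_fun m" "f p \<noteq> 0" "g q \<noteq> 0"
  shows "\<exists>r. f r \<noteq> 0 \<and> g r \<noteq> 0"
proof -
  define v where "v i = q i - p i" for i
  obtain P Q where P: "\<And>s. f (\<lambda>i. p i + s * v i) = poly P s"
    and Q: "\<And>s. g (\<lambda>i. p i + s * v i) = poly Q s"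
    using poly_fun_line[OF assms(1)] poly_fun_line[OF assms(2)] by metis
  have "poly P 0 \<noteq> 0" "poly Q 1 \<noteq> 0"
    using P[of 0] Q[of 1] assms(3,4) by (simp_all add: v_def)
  then have "P * Q \<noteq> 0" by auto
  then have "finite {s. poly (P * Q) s = 0}" by (rule poly_roots_finite)
  then obtain s where "poly (P * Q) s \<noteq> 0"
    using infinite_alg_closed ex_new_if_finite by blast
  then have "f (\<lambda>i. p i + s * v i) \<noteq> 0 \<and> g (\<lambda>i. p i + s * v i) \<noteq> 0"
    by (simp add: P Q)
  then show ?thesis by blast
qed

text \<open>Affine space is irreducible: finitely many non-empty open sets have a common point, and
  the product of their equations defines an open set inside all of them.\<close>

lemma poly_fun_prod_nonzero:
  fixes F :: "((nat \<Rightarrow> 'k::alg_closed_field) \<Rightarrow> 'k) set"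
  assumes "finite F" "F \<subseteq> poly_fun m" "\<And>f. f \<in> F \<Longrightarrow> \<exists>p. f p \<noteq> 0"
  shows "\<exists>g\<in>poly_fun m. \<exists>p. g p \<noteq> 0 \<and> (\<forall>q. g q \<noteq> 0 \<longrightarrow> (\<forall>f\<in>F. f q \<noteq> 0))"
  using assms
proof (induction F rule: finite_induct)
  case empty
  show ?case by (intro bexI[of _ "\<lambda>_. 1"]) (auto intro: poly_fun.intros)
next
  case (insert f F)
  from insert.IH insert.prems obtain g p where
    g: "g \<in> poly_fun m" "g p \<noteq> 0" "\<forall>q. g q \<noteq> 0 \<longrightarrow> (\<forall>f\<in>F. f q \<noteq> 0)" by (metis insert_subset insertI2)
  from insert.prems obtain q where q: "f q \<noteq> 0" by blast
  from insert.prems have "f \<in> poly_fun m" by simp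
  from poly_fun_mult_nonzero[OF this g(1) q g(2)] obtain r where "f r \<noteq> 0" "g r \<noteq> 0" by auto
  then show ?case using g insert.prems
    by (intro bexI[of _ "\<lambda>h. f h * g h"]) (auto intro: poly_fun.intros)
qed

section \<open>Noetherian subrings\<close>

text \<open>Rings and ideals are subsets of one ambient type because they will be rings of
  functions, enlarged by one function at a time.\<close>

inductive_set ideal_gen :: "'a::comm_ring_1 set \<Rightarrow> 'a set \<Rightarrow> 'a set" for R X where
  zero: "0 \<in> ideal_gen R X"
| step: "u \<in> R \<Longrightarrow> x \<in> X \<Longrightarrow> y \<in> ideal_gen R X \<Longrightarrow> u * x + y \<in> ideal_gen R X"

definition subring_set :: "'a::comm_ring_1 set \<Rightarrow> bool"
  where "subring_set R \<longleftrightarrow> 1 \<in> R \<and> (\<forall>x\<in>R. \<forall>y\<in>R. x - y \<in> R \<and> x * y \<in> R)"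

lemma subring_setD:
  assumes "subring_set R"
  shows "1 \<in> R" "0 \<in> R" "x \<in> R \<Longrightarrow> y \<in> R \<Longrightarrow> x - y \<in> R" "x \<in> R \<Longrightarrow> y \<in> R \<Longrightarrow> x * y \<in> R"
    "x \<in> R \<Longrightarrow> - x \<in> R" "x \<in> R \<Longrightarrow> y \<in> R \<Longrightarrow> x + y \<in> R"
proof -
  have 1: "1 \<in> R" and m: "\<And>x y. x \<in> R \<Longrightarrow> y \<in> R \<Longrightarrow> x - y \<in> R"
    using assms by (auto simp: subring_set_def)
  from m[OF 1 1] have 0: "0 \<in> R" by simp
  have n: "- x \<in> R" if "x \<in> R" for x using m[OF 0 that] by simp
  show "x \<in> R \<Longrightarrow> y \<in> R \<Longrightarrow> x + y \<in> R" using m[of x "- y"] n by simp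
  show "x \<in> R \<Longrightarrow> y \<in> R \<Longrightarrow> x * y \<in> R" using assms by (simp add: subring_set_def)
  show "1 \<in> R" "0 \<in> R" "x \<in> R \<Longrightarrow> y \<in> R \<Longrightarrow> x - y \<in> R" "x \<in> R \<Longrightarrow> - x \<in> R" by fact+
qed

lemma subring_sum: "subring_set R \<Longrightarrow> (\<And>i. i \<in> I \<Longrightarrow> f i \<in> R) \<Longrightarrow> sum f I \<in> R"
  by (induction I rule: infinite_finite_induct) (auto intro: subring_setD)

lemma ideal_gen_add:
  "x \<in> ideal_gen R X \<Longrightarrow> y \<in> ideal_gen R X \<Longrightarrow> x + y \<in> ideal_gen R X"
  by (induction rule: ideal_gen.induct) (auto simp: add.assoc intro: ideal_gen.intros)

lemma ideal_gen_mult: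
  "x \<in> ideal_gen R X \<Longrightarrow> subring_set R \<Longrightarrow> c \<in> R \<Longrightarrow> c * x \<in> ideal_gen R X"
  by (induction rule: ideal_gen.induct)
    (auto simp: distrib_left mult.assoc[symmetric] intro: ideal_gen.intros subring_setD)

lemma ideal_gen_base: "x \<in> X \<Longrightarrow> subring_set R \<Longrightarrow> x \<in> ideal_gen R X"
  using ideal_gen.step[of 1 R x X 0] by (simp add: subring_setD ideal_gen.zero)

lemma ideal_gen_subset:
  assumes "subring_set R" "X \<subseteq> ideal_gen R Y"
  shows "ideal_gen R X \<subseteq> ideal_gen R Y"
proof
  fix x assume "x \<in> ideal_gen R X"
  then show "x \<in> ideal_gen R Y"
    by induction (use assms in \<open>auto intro: ideal_gen.zero ideal_gen_add ideal_gen_mult\<close>)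
qed

lemma ideal_gen_finite:
  assumes "x \<in> ideal_gen R X"
  shows "\<exists>Y\<subseteq>X. finite Y \<and> x \<in> ideal_gen R Y"
  using assms
proof induction
  case zero
  show ?case by (intro exI[of _ "{}"]) (auto intro: ideal_gen.zero)
next
  case (step u x y)
  then obtain Y where Y: "Y \<subseteq> X" "finite Y" "y \<in> ideal_gen R Y" by blast
  from Y(3) have "y \<in> ideal_gen R (insert x Y)"
    by induction (auto intro: ideal_gen.intros)
  then show ?case using step.hyps Y
    by (intro exI[of _ "insert x Y"]) (auto intro: ideal_gen.intros)
qed

lemma ideal_gen_finite_subset:
  assumes "finite F" "F \<subseteq> ideal_gen R X" "subring_set R"
  shows "\<exists>Y\<subseteq>X. finite Y \<and> F \<subseteq> ideal_gen R Y"
  using assms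
proof (induction F rule: finite_induct)
  case empty
  then show ?case by auto
next
  case (insert x F)
  then obtain Y where Y: "Y \<subseteq> X" "finite Y" "F \<subseteq> ideal_gen R Y" by auto
  obtain Y' where Y': "Y' \<subseteq> X" "finite Y'" "x \<in> ideal_gen R Y'"
    using ideal_gen_finite[of x R X] insert.prems by blast
  have "Z \<subseteq> Z' \<Longrightarrow> ideal_gen R Z \<subseteq> ideal_gen R Z'" for Z Z'
    using insert.prems by (intro ideal_gen_subset) (auto intro: ideal_gen_base)
  then have "ideal_gen R Y \<subseteq> ideal_gen R (Y \<union> Y')" "ideal_gen R Y' \<subseteq> ideal_gen R (Y \<union> Y')"
    by auto
  then show ?case using Y Y' by (intro exI[of _ "Y \<union> Y'"]) auto
qed

lemma ideal_gen_image:
  fixes N :: nat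
  assumes "x \<in> ideal_gen R (a ` {..<N})" "subring_set R"
  shows "\<exists>u. (\<forall>i. u i \<in> R) \<and> x = (\<Sum>i<N. u i * a i)"
  using assms(1)
proof induction
  case zero
  show ?case using assms by (intro exI[of _ "\<lambda>_. 0"]) (auto intro: subring_setD)
next
  case (step v x y)
  then obtain u n where u: "\<And>i. u i \<in> R" "y = (\<Sum>i<N. u i * a i)" and n: "n < N" "x = a n" by blast
  have "v * a n = (\<Sum>i<N. if n = i then v * a i else 0)"
    using n by (subst sum.delta') auto
  then have "v * x + y = (\<Sum>i<N. (if n = i then v * a i else 0) + u i * a i)"
    using n by (simp add: u sum.distrib)
  also have "\<dots> = (\<Sum>i<N. (if i = n then v + u i else u i) * a i)"
    by (intro sum.cong) (auto simp: distrib_right)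
  finally show ?case using u step.hyps assms
    by (intro exI[of _ "\<lambda>i. if i = n then v + u i else u i"]) (auto intro: subring_setD)
qed

text \<open>The generators are taken inside \<open>X\<close> itself. For a sequence this says that
  some member lies in the ideal of its predecessors, which is how the condition is used.\<close>

definition noetherian_subring :: "'a::comm_ring_1 set \<Rightarrow> bool"
  where "noetherian_subring R \<longleftrightarrow> subring_set R \<and>
    (\<forall>X\<subseteq>R. \<exists>Y\<subseteq>X. finite Y \<and> X \<subseteq> ideal_gen R Y)"

definition adjoin :: "'a::comm_ring_1 set \<Rightarrow> 'a \<Rightarrow> 'a set"
  where "adjoin R x = {poly p x | p. \<forall>i. coeff p i \<in> R}"

lemma adjoin_superset:
  assumes "subring_set R"
  shows "R \<subseteq> adjoin R x" "x \<in> adjoin R x"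
proof -
  have "y \<in> adjoin R x" if "y \<in> R" for y
    using that assms unfolding adjoin_def
    by (intro CollectI exI[of _ "[:y:]"]) (auto simp: coeff_pCons subring_setD split: nat.split)
  then show "R \<subseteq> adjoin R x" by blast
  show "x \<in> adjoin R x" unfolding adjoin_def
    using assms by (intro CollectI exI[of _ "[:0, 1:]"]) (auto simp: coeff_pCons subring_setD split: nat.split)
qed

lemma subring_adjoin:
  assumes "subring_set R"
  shows "subring_set (adjoin R x)"
  unfolding subring_set_def
proof (intro conjI ballI)
  show "1 \<in> adjoin R x" using adjoin_superset[OF assms] subring_setD[OF assms] by blast
  fix a b assume "a \<in> adjoin R x" "b \<in> adjoin R x"
  then obtain p q where "\<forall>i. coeff p i \<in> R" "\<forall>i. coeff q i \<in> R" "a = poly p x" "b = poly q x"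
    unfolding adjoin_def by blast
  moreover from this have "\<forall>i. coeff (p - q) i \<in> R" "\<forall>i. coeff (p * q) i \<in> R"
    using assms by (auto intro!: subring_sum subring_setD(4) intro: subring_setD(3) simp: coeff_mult)
  moreover have "a - b = poly (p - q) x" "a * b = poly (p * q) x"
    using calculation by simp_all
  ultimately show "a - b \<in> adjoin R x" "a * b \<in> adjoin R x" unfolding adjoin_def by blast+
qed

text \<open>Hilbert's basis theorem for a subring generated by one more element, which need not be
  transcendental: a sequence of polynomials of minimal degree whose values avoid the ideal of the
  earlier values has leading coefficients violating the chain condition in \<open>R\<close>.\<close>

theorem hilbert_basis:
  assumes "noetherian_subring R"
  shows "noetherian_subring (adjoin R x)"
proof -
  let ?S = "adjoin R x"
  have R: "subring_set R" using assms by (simp add: noetherian_subring_def)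
  have S: "subring_set ?S" using subring_adjoin[OF R] .
  have "\<exists>Y\<subseteq>X. finite Y \<and> X \<subseteq> ideal_gen ?S Y" if "X \<subseteq> ?S" for X
  proof (rule ccontr)
    assume no: "\<not> ?thesis"
    let ?I = "ideal_gen ?S X"
    have IS: "?I \<subseteq> ?S"
    proof
      fix y assume "y \<in> ?I"
      then show "y \<in> ?S" by induction (use that S in \<open>auto intro: subring_setD\<close>)
    qed
    define good where "good F f \<longleftrightarrow> (\<forall>i. coeff f i \<in> R) \<and> poly f x \<in> ?I - ideal_gen ?S F" for F f
    have ex_good: "\<exists>f. good F f" if "finite F" "F \<subseteq> ?I" for F
    proof -
      from ideal_gen_finite_subset[OF that S] obtain Y where
        Y: "Y \<subseteq> X" "finite Y" "F \<subseteq> ideal_gen ?S Y" by blast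
      then have "\<not> X \<subseteq> ideal_gen ?S Y" using no by blast
      then have "\<not> X \<subseteq> ideal_gen ?S F" using ideal_gen_subset[OF S Y(3)] by blast
      then obtain y where y: "y \<in> ?I" "y \<notin> ideal_gen ?S F"
        using ideal_gen_base[OF _ S] by blast
      with IS obtain p where "\<forall>i. coeff p i \<in> R" "y = poly p x" unfolding adjoin_def by blast
      with y show ?thesis by (auto simp: good_def)
    qed
    \<comment> \<open>A polynomial of least degree whose value lies in the ideal of \<open>X\<close>
      but not in that of \<open>F\<close>.\<close>
    define pick where "pick F = arg_min degree (good F)" for F
    have pick: "good F (pick F)" "good F g \<Longrightarrow> degree (pick F) \<le> degree g"
      if "finite F" "F \<subseteq> ?I" for F g
      using ex_good[OF that] arg_min_natI[of "good F" _ degree] arg_min_nat_le[of "good F" _ degree]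
      by (auto simp: pick_def)
    define Fs where "Fs = rec_nat {} (\<lambda>_ F. insert (poly (pick F) x) F)"
    have Fs_simps: "Fs 0 = {}" "Fs (Suc n) = insert (poly (pick (Fs n)) x) (Fs n)" for n
      by (simp_all add: Fs_def)
    have Fs: "finite (Fs n) \<and> Fs n \<subseteq> ?I" for n
      by (induction n) (use pick(1) in \<open>auto simp: Fs_simps good_def\<close>)
    define f where "f n = pick (Fs n)" for n
    have Fs_eq: "Fs n = (\<lambda>i. poly (f i) x) ` {..<n}" for n
      by (induction n) (auto simp: Fs_simps f_def lessThan_Suc)
    have good_f: "good (Fs n) (f n)" for n using pick Fs by (simp add: f_def)
    \<comment> \<open>The sets \<open>Fs\<close> grow, so a later choice was already a candidate at
      every earlier stage.\<close>
    have deg: "degree (f i) \<le> degree (f n)" if "i \<le> n" for i n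
    proof -
      have "Fs i \<subseteq> Fs n" using that by (auto simp: Fs_eq)
      then have "ideal_gen ?S (Fs i) \<subseteq> ideal_gen ?S (Fs n)"
        by (intro ideal_gen_subset[OF S]) (auto intro: ideal_gen_base[OF _ S])
      then have "good (Fs i) (f n)" using good_f[of n] by (auto simp: good_def)
      then show ?thesis using pick(2)[of "Fs i"] Fs by (simp add: f_def)
    qed
    define a where "a n = lead_coeff (f n)" for n
    have "range a \<subseteq> R" using good_f by (auto simp: a_def good_def)
    then obtain Y where Y: "Y \<subseteq> range a" "finite Y" "range a \<subseteq> ideal_gen R Y"
      using assms unfolding noetherian_subring_def by meson
    obtain B where B: "finite B" "Y = a ` B" using finite_subset_image[OF Y(2,1)] by blast
    obtain N where N: "B \<subseteq> {..<N}" using finite_nat_iff_bounded[THEN iffD1, OF B(1)] by blast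
    have "Y \<subseteq> ideal_gen R (a ` {..<N})" using B N by (auto intro: ideal_gen_base[OF _ R])
    from ideal_gen_subset[OF R this] Y(3) have "a N \<in> ideal_gen R (a ` {..<N})" by blast
    from ideal_gen_image[OF this R] obtain u where
      u: "\<And>i. u i \<in> R" "a N = (\<Sum>i<N. u i * a i)" by blast
    define d where "d = degree (f N)"
    \<comment> \<open>The relation between the leading coefficients, lifted to polynomials of degree
      at most \<open>d\<close>. Subtracting \<open>q\<close> cancels the leading term of
      \<open>f N\<close> but stays outside the ideal of \<open>Fs N\<close>, against
      minimality.\<close>
    define q where "q = (\<Sum>i<N. monom (u i) (d - degree (f i)) * f i)"
    have cq: "coeff q j \<in> R" for j unfolding q_def coeff_sum
    proof (intro subring_sum[OF R])
      fix i assume "i \<in> {..<N}"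
      show "coeff (monom (u i) (d - degree (f i)) * f i) j \<in> R"
        unfolding coeff_mult using good_f u R
        by (intro subring_sum[OF R] subring_setD(4)[OF R]) (auto simp: good_def coeff_monom subring_setD)
    qed
    have fS: "poly p x \<in> ?S" if "\<And>i. coeff p i \<in> R" for p
      using that unfolding adjoin_def by blast
    have ideal_sum: "(\<Sum>i\<in>I. h i) \<in> ideal_gen ?S F"
      if "\<And>i. i \<in> I \<Longrightarrow> h i \<in> ideal_gen ?S F" for I :: "nat set" and h F
      using that by (induction I rule: infinite_finite_induct) (auto intro: ideal_gen.zero ideal_gen_add)
    have qI: "poly q x \<in> ideal_gen ?S (Fs N)" unfolding q_def poly_sum poly_mult
      by (intro ideal_sum ideal_gen_mult[OF _ S] ideal_gen_base[OF _ S] fS)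
        (use u R in \<open>auto simp: Fs_eq coeff_monom subring_setD\<close>)
    have FsI: "ideal_gen ?S (Fs N) \<subseteq> ?I" using Fs by (intro ideal_gen_subset[OF S]) blast
    define g where "g = f N - q"
    have fN: "poly (f N) x \<in> ?I" "poly (f N) x \<notin> ideal_gen ?S (Fs N)" "\<And>i. coeff (f N) i \<in> R"
      using good_f[of N] by (auto simp: good_def)
    have m1: "- 1 \<in> ?S" using subring_setD[OF S] by blast
    have "poly g x \<in> ?I"
      using ideal_gen_add[OF fN(1) ideal_gen_mult[OF _ S m1]] FsI qI by (auto simp: g_def)
    moreover have "poly g x \<notin> ideal_gen ?S (Fs N)"
      using ideal_gen_add[OF _ qI, of "poly g x"] fN(2) by (auto simp: g_def)
    moreover have "\<forall>i. coeff g i \<in> R" using fN(3) cq R by (auto simp: g_def subring_setD)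
    ultimately have "good (Fs N) g" by (simp add: good_def)
    then have le: "d \<le> degree g" using pick(2) Fs by (auto simp: d_def f_def)
    have "degree q \<le> d" unfolding q_def
    proof (intro degree_sum_le)
      fix i assume "i \<in> {..<N}"
      then have "degree (f i) \<le> d" using deg by (simp add: d_def)
      then show "degree (monom (u i) (d - degree (f i)) * f i) \<le> d"
        using degree_mult_le[of "monom (u i) (d - degree (f i))" "f i"]
          degree_monom_le[of "u i" "d - degree (f i)"] by linarith
    qed simp
    then have "degree g \<le> d" by (simp add: g_def d_def degree_diff_le)
    have "coeff (monom (u i) (d - degree (f i)) * f i) d = u i * a i" if "i < N" for i
      using deg[of i N] that by (simp add: coeff_monom_mult a_def d_def)
    then have "coeff q d = a N" by (simp add: q_def coeff_sum u)
    then have "coeff g d = 0" by (simp add: g_def a_def d_def)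
    with le \<open>degree g \<le> d\<close> have "g = 0" by auto
    then have "poly g x \<in> ideal_gen ?S (Fs N)" by (simp add: ideal_gen.zero)
    with \<open>poly g x \<notin> _\<close> show False by blast
  qed
  then show ?thesis using S by (simp add: noetherian_subring_def)
qed

lemma noetherian_constants: "noetherian_subring (range (\<lambda>(c::'k::field) (_::'x). c))"
proof -
  let ?R = "range (\<lambda>(c::'k) (_::'x). c)"
  have R: "subring_set ?R" unfolding subring_set_def
    by (auto simp: fun_eq_iff image_iff)
  have "\<exists>Y\<subseteq>X. finite Y \<and> X \<subseteq> ideal_gen ?R Y" if X: "X \<subseteq> ?R" for X
  proof (cases "X \<subseteq> {0}")
    case True
    then show ?thesis by (intro exI[of _ "{}"]) (auto intro: ideal_gen.zero)
  next
    case False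
    then obtain x where x: "x \<in> X" "x \<noteq> 0" by blast
    then obtain c where c: "x = (\<lambda>_. c)" "c \<noteq> 0" using X by (auto simp: zero_fun_def)
    have "y \<in> ideal_gen ?R {x}" if "y \<in> X" for y
    proof -
      obtain d where d: "y = (\<lambda>_. d)" using subsetD[OF X \<open>y \<in> X\<close>] by auto
      have "y = (\<lambda>_. d / c) * x + 0" using c d by (simp add: fun_eq_iff times_fun_def zero_fun_def plus_fun_def)
      then show ?thesis using ideal_gen.step[of "\<lambda>_. d / c" ?R x "{x}" 0] ideal_gen.zero by auto
    qed
    then show ?thesis using x by (intro exI[of _ "{x}"]) auto
  qed
  then show ?thesis using R by (simp add: noetherian_subring_def)
qed

text \<open>Hilbert's basis theorem, once for each function in \<open>G\<close>, starting from the
  constants.\<close>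

lemma noetherian_function_algebra:
  fixes G :: "('x \<Rightarrow> 'k::field) set"
  assumes "finite G"
  shows "\<exists>R. noetherian_subring R \<and> range (\<lambda>c _. c) \<subseteq> R \<and> G \<subseteq> R"
  using assms
proof (induction G rule: finite_induct)
  case empty
  then show ?case using noetherian_constants by blast
next
  case (insert g G)
  then obtain R where R: "noetherian_subring R" "range (\<lambda>c _. c) \<subseteq> R" "G \<subseteq> R" by blast
  then have "subring_set R" by (simp add: noetherian_subring_def)
  from adjoin_superset[OF this, of g] R hilbert_basis[OF R(1), of g] show ?case
    by (intro exI[of _ "adjoin R g"]) auto
qed

section \<open>Chains of irreducible closed sets\<close>

definition has_chain :: "'a topology \<Rightarrow> nat \<Rightarrow> bool"
  where "has_chain T n \<longleftrightarrow> (\<exists>Z. (\<forall>i\<le>n. irreducible_closedin T (Z i)) \<and> (\<forall>i<n. Z i \<subset> Z (Suc i)))"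

lemma krull_dim_ge: "has_chain T n \<Longrightarrow> enat n \<le> krull_dim T"
  unfolding krull_dim_def has_chain_def by (intro Sup_upper) blast

lemma krull_dim_leI: "(\<And>r. has_chain T r \<Longrightarrow> r \<le> n) \<Longrightarrow> krull_dim T \<le> enat n"
  unfolding krull_dim_def has_chain_def[symmetric] by (intro Sup_least) auto

lemma has_chain_less:
  assumes "has_chain T n" "m \<le> n"
  shows "has_chain T m"
proof -
  from assms(1) obtain Z where "\<forall>i\<le>n. irreducible_closedin T (Z i)" "\<forall>i<n. Z i \<subset> Z (Suc i)"
    unfolding has_chain_def by blast
  then show ?thesis using assms(2) unfolding has_chain_def by (intro exI[of _ Z]) auto
qed

text \<open>Intersecting with \<open>S\<close> recovers \<open>Z\<close> from its closure, so strict
  chains in a subspace become strict chains in the whole space.\<close>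

lemma irreducible_closure:
  assumes "irreducible_closedin (subtopology T S) Z"
  shows "irreducible_closedin T (T closure_of Z)" "S \<inter> T closure_of Z = Z"
proof -
  have cl: "closedin (subtopology T S) Z" and ne: "Z \<noteq> {}" and irr:
    "\<And>P Q. closedin (subtopology T S) P \<Longrightarrow> closedin (subtopology T S) Q \<Longrightarrow> Z \<subseteq> P \<union> Q \<Longrightarrow> Z \<subseteq> P \<or> Z \<subseteq> Q"
    using assms by (auto simp: irreducible_closedin_def)
  have top: "Z \<subseteq> topspace T" "Z \<subseteq> S" using closedin_subset[OF cl] by auto
  have sub: "Z \<subseteq> T closure_of Z" using closure_of_subset[OF top(1)] .
  obtain C where C: "closedin T C" "Z = C \<inter> S" using cl by (auto simp: closedin_subtopology)
  then have "T closure_of Z \<subseteq> C" by (intro closure_of_minimal) auto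
  then show "S \<inter> T closure_of Z = Z" using C sub by auto
  show "irreducible_closedin T (T closure_of Z)" unfolding irreducible_closedin_def
  proof (intro conjI allI impI)
    show "T closure_of Z \<noteq> {}" using ne sub by blast
    fix P Q assume PQ: "closedin T P" "closedin T Q" "T closure_of Z \<subseteq> P \<union> Q"
    have "closedin (subtopology T S) (P \<inter> S)" "closedin (subtopology T S) (Q \<inter> S)"
      using PQ by (auto simp: closedin_subtopology)
    from irr[OF this] have "Z \<subseteq> P \<or> Z \<subseteq> Q" using PQ sub top by blast
    then show "T closure_of Z \<subseteq> P \<or> T closure_of Z \<subseteq> Q" using PQ closure_of_minimal by blast
  qed simp
qed

lemma has_chain_subtopology:
  assumes "has_chain (subtopology T S) n"
  shows "has_chain T n"
proof -
  from assms obtain Z where Z: "\<And>i. i \<le> n \<Longrightarrow> irreducible_closedin (subtopology T S) (Z i)"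
    "\<And>i. i < n \<Longrightarrow> Z i \<subset> Z (Suc i)" unfolding has_chain_def by blast
  have "T closure_of Z i \<subset> T closure_of Z (Suc i)" if "i < n" for i
  proof -
    have "S \<inter> T closure_of Z i = Z i" "S \<inter> T closure_of Z (Suc i) = Z (Suc i)"
      using irreducible_closure(2)[OF Z(1)] that by simp_all
    moreover have "T closure_of Z i \<subseteq> T closure_of Z (Suc i)"
      using Z(2)[OF that] by (intro closure_of_mono) auto
    ultimately show ?thesis using Z(2)[OF that] by blast
  qed
  then show ?thesis unfolding has_chain_def
    using irreducible_closure(1)[OF Z(1)] by (intro exI[of _ "\<lambda>i. T closure_of Z i"]) auto
qed

lemma irreducible_closedin_subspace:
  assumes "irreducible_closedin (subtopology T S) Z" "closedin T S"
  shows "irreducible_closedin T Z"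
proof -
  have Z: "closedin T Z"
    using assms by (auto simp: irreducible_closedin_def closedin_closed_subtopology)
  then have "T closure_of Z = Z" by (simp add: closure_of_eq)
  with irreducible_closure(1)[OF assms(1)] show ?thesis by simp
qed

definition noetherian_space :: "'a topology \<Rightarrow> bool"
  where "noetherian_space T \<longleftrightarrow> wf {(X, Y). closedin T X \<and> closedin T Y \<and> X \<subset> Y}"

lemma noetherian_subtopology:
  assumes "noetherian_space T"
  shows "noetherian_space (subtopology T S)"
proof -
  have eq: "S \<inter> T closure_of X = X" if "closedin (subtopology T S) X" for X
  proof -
    from that obtain C where C: "closedin T C" "X = C \<inter> S" by (auto simp: closedin_subtopology)
    then have "X \<subseteq> topspace T" using closedin_subset[OF C(1)] by blast
    then have "X \<subseteq> T closure_of X" by (rule closure_of_subset)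
    moreover have "T closure_of X \<subseteq> C" using C by (intro closure_of_minimal) auto
    ultimately show ?thesis using C by auto
  qed
  have lt: "T closure_of X \<subset> T closure_of Y"
    if "closedin (subtopology T S) X" "closedin (subtopology T S) Y" "X \<subset> Y" for X Y
  proof -
    have "T closure_of X \<subseteq> T closure_of Y" using that(3) by (intro closure_of_mono) auto
    then show ?thesis using eq[OF that(1)] eq[OF that(2)] that(3) by blast
  qed
  have "{(X, Y). closedin (subtopology T S) X \<and> closedin (subtopology T S) Y \<and> X \<subset> Y}
    \<subseteq> inv_image {(X, Y). closedin T X \<and> closedin T Y \<and> X \<subset> Y} ((closure_of) T)"
    unfolding in_inv_image subset_iff using lt by simp
  then show ?thesis using assms unfolding noetherian_space_def
    by (meson wf_inv_image wf_subset)
qed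

text \<open>Noetherian induction: a non-empty closed set that is not irreducible is a union of two
  proper closed subsets.\<close>

lemma irreducible_components:
  assumes "noetherian_space T" "closedin T Z"
  shows "\<exists>\<X>. finite \<X> \<and> (\<forall>X\<in>\<X>. irreducible_closedin T X) \<and> \<Union>\<X> = Z"
  using assms(1)[unfolded noetherian_space_def] assms(2)
proof (induction Z rule: wf_induct_rule)
  case (less Z)
  show ?case
  proof (cases "Z = {} \<or> irreducible_closedin T Z")
    case True
    then show ?thesis
      by (elim disjE) (auto intro: exI[of _ "{}"] exI[of _ "{Z}"])
  next
    case False
    then obtain P Q where PQ: "closedin T P" "closedin T Q" "Z \<subseteq> P \<union> Q" "\<not> Z \<subseteq> P" "\<not> Z \<subseteq> Q"
      using less.prems unfolding irreducible_closedin_def by blast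
    have "\<exists>\<X>. finite \<X> \<and> (\<forall>X\<in>\<X>. irreducible_closedin T X) \<and> \<Union>\<X> = Z \<inter> R"
      if "closedin T R" "\<not> Z \<subseteq> R" for R
      using that less.prems by (intro less.IH) auto
    from this[OF PQ(1,4)] this[OF PQ(2,5)] obtain X1 X2 where X:
      "finite X1" "\<forall>X\<in>X1. irreducible_closedin T X" "\<Union>X1 = Z \<inter> P"
      "finite X2" "\<forall>X\<in>X2. irreducible_closedin T X" "\<Union>X2 = Z \<inter> Q" by blast
    then have "\<Union>(X1 \<union> X2) = Z" using PQ(3) by auto
    then show ?thesis using X by (intro exI[of _ "X1 \<union> X2"]) auto
  qed
qed

lemma irreducible_closedin_closure_point:
  assumes "x \<in> topspace T"
  shows "irreducible_closedin T (T closure_of {x})"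
  unfolding irreducible_closedin_def
proof (intro conjI allI impI)
  have x: "x \<in> T closure_of {x}" using closure_of_subset[of "{x}" T] assms by auto
  then show "T closure_of {x} \<noteq> {}" by blast
  fix P Q assume "closedin T P" "closedin T Q" "T closure_of {x} \<subseteq> P \<union> Q"
  then show "T closure_of {x} \<subseteq> P \<or> T closure_of {x} \<subseteq> Q"
    using x closure_of_minimal[of "{x}" P T] closure_of_minimal[of "{x}" Q T] by blast
qed simp

text \<open>A dominant component need not map onto affine space, so the induction is over finite families
  of spaces whose images cover a non-empty open set: a general hyperplane section of the dominant
  components covers a non-empty open set of the hyperplane.\<close>

lemma chain_of_parameters:
  fixes \<T> :: "('p topology \<times> ('p \<Rightarrow> nat \<Rightarrow> 'k::alg_closed_field)) set"
  assumes "finite \<T>"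
    and "\<And>T y. (T, y) \<in> \<T> \<Longrightarrow> noetherian_space T"
    and "\<And>T y f. (T, y) \<in> \<T> \<Longrightarrow> f \<in> poly_fun m \<Longrightarrow> closedin T {x\<in>topspace T. f (y x) = 0}"
    and "g \<in> poly_fun m" "g p \<noteq> 0"
    and "\<And>q. g q \<noteq> 0 \<Longrightarrow> \<exists>(T, y)\<in>\<T>. \<exists>x\<in>topspace T. \<forall>j<m. y x j = q j"
  shows "\<exists>(T, y)\<in>\<T>. has_chain T m"
  using assms
proof (induction m arbitrary: \<T> g p)
  case 0
  then obtain T y x where "(T, y) \<in> \<T>" "x \<in> topspace T" by blast
  then have "has_chain T 0" unfolding has_chain_def
    by (intro exI[of _ "\<lambda>_. T closure_of {x}"]) (auto intro: irreducible_closedin_closure_point)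
  with \<open>(T, y) \<in> \<T>\<close> show ?case by blast
next
  case (Suc m)
  define comp where "comp T = (SOME \<X>. finite \<X> \<and> (\<forall>X\<in>\<X>. irreducible_closedin T X) \<and> \<Union>\<X> = topspace T)" for T :: "'p topology"
  have comp: "finite (comp T)" "\<And>X. X \<in> comp T \<Longrightarrow> irreducible_closedin T X" "\<Union>(comp T) = topspace T"
    if "(T, y) \<in> \<T>" for T y
  proof -
    have "\<exists>\<X>. finite \<X> \<and> (\<forall>X\<in>\<X>. irreducible_closedin T X) \<and> \<Union>\<X> = topspace T"
      using irreducible_components[OF Suc.prems(2)[OF that]] by blast
    from someI_ex[OF this] show "finite (comp T)" "\<And>X. X \<in> comp T \<Longrightarrow> irreducible_closedin T X" "\<Union>(comp T) = topspace T"
      by (simp_all add: comp_def)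
  qed
  define C where "C = (\<Union>(T, y)\<in>\<T>. (\<lambda>X. (T, y, X)) ` comp T)"
  have finC: "finite C" using Suc.prems(1) comp(1) by (auto simp: C_def)
  \<comment> \<open>The parameters of the points of \<open>X\<close> satisfy no polynomial equation:
    they are Zariski dense in affine space.\<close>
  define dominant where "dominant y X \<longleftrightarrow> \<not> (\<exists>f\<in>poly_fun (Suc m). (\<exists>q. f q \<noteq> 0) \<and> (\<forall>x\<in>X. f (y x) = 0))"
    for y :: "'p \<Rightarrow> nat \<Rightarrow> 'k" and X
  define h where "h y X = (SOME f. f \<in> poly_fun (Suc m) \<and> (\<exists>q. f q \<noteq> 0) \<and> (\<forall>x\<in>X. f (y x) = 0))"
    for y :: "'p \<Rightarrow> nat \<Rightarrow> 'k" and X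
  have h: "h y X \<in> poly_fun (Suc m)" "\<exists>q. h y X q \<noteq> 0" "\<And>x. x \<in> X \<Longrightarrow> h y X (y x) = 0"
    if "\<not> dominant y X" for y X
  proof -
    from that have "\<exists>f. f \<in> poly_fun (Suc m) \<and> (\<exists>q. f q \<noteq> 0) \<and> (\<forall>x\<in>X. f (y x) = 0)"
      by (auto simp: dominant_def)
    from someI_ex[OF this] show "h y X \<in> poly_fun (Suc m)" "\<exists>q. h y X q \<noteq> 0" "\<And>x. x \<in> X \<Longrightarrow> h y X (y x) = 0"
      by (simp_all add: h_def)
  qed
  \<comment> \<open>Where all these functions are non-zero, a point of affine space lies in the
    covered open set and can come only from a dominant component.\<close>
  define F where "F = insert g ((\<lambda>(T, y, X). h y X) ` {(T, y, X)\<in>C. \<not> dominant y X})"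
  have "finite F" using finC by (auto simp: F_def intro: finite_subset)
  moreover have "F \<subseteq> poly_fun (Suc m)" using Suc.prems h(1) by (auto simp: F_def)
  moreover have "\<exists>q. f q \<noteq> 0" if "f \<in> F" for f
    using that Suc.prems h(2) by (auto simp: F_def)
  ultimately obtain G r where G: "G \<in> poly_fun (Suc m)" "G r \<noteq> 0"
    "\<And>q f. G q \<noteq> 0 \<Longrightarrow> f \<in> F \<Longrightarrow> f q \<noteq> 0"
    using poly_fun_prod_nonzero[of F "Suc m"] by blast
  \<comment> \<open>The hyperplane is taken through a point where \<open>G\<close> is non-zero, so
    that \<open>G\<close> still defines a non-empty open set on it.\<close>
  define c where "c = r m"
  define H where "H y X = {x\<in>X. y x m = c}" for y :: "'p \<Rightarrow> nat \<Rightarrow> 'k" and X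
  define \<T>' where "\<T>' = (\<lambda>(T, y, X). (subtopology T (H y X), y)) ` {(T, y, X)\<in>C. dominant y X}"
  have memC: "(T, y) \<in> \<T> \<and> X \<in> comp T" if "(T, y, X) \<in> C" for T y X
    using that by (auto simp: C_def)
  have clX: "closedin T X" "irreducible_closedin T X" if "(T, y, X) \<in> C" for T y X
    using memC[OF that] comp(2) unfolding irreducible_closedin_def by blast+
  have clH: "closedin T (H y X)" if "(T, y, X) \<in> C" for T y X
  proof -
    have "(\<lambda>q. q m + (- c)) \<in> poly_fun (Suc m)" by (intro poly_fun.intros) auto
    from Suc.prems(3)[OF conjunct1[OF memC[OF that]] this]
    have "closedin T (X \<inter> {x\<in>topspace T. y x m + (- c) = 0})"
      using clX[OF that] by blast
    moreover have "X \<inter> {x\<in>topspace T. y x m + (- c) = 0} = H y X"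
      using closedin_subset[OF clX(1)[OF that]] by (auto simp: H_def)
    ultimately show ?thesis by simp
  qed
  have "\<exists>(T, y)\<in>\<T>'. has_chain T m"
  proof (rule Suc.IH)
    show "finite \<T>'" using finC by (auto simp: \<T>'_def intro: finite_subset)
    show "noetherian_space T" if "(T, y) \<in> \<T>'" for T y
      using that Suc.prems(2) memC unfolding \<T>'_def by (fast intro: noetherian_subtopology)
    show "(\<lambda>q. G (q(m := c))) \<in> poly_fun m" using poly_fun_specialize[OF G(1)] .
    show "G (r(m := c)) \<noteq> 0" using G(2) by (simp add: c_def)
    show "closedin T {x\<in>topspace T. f (y x) = 0}" if Ty: "(T, y) \<in> \<T>'" and f: "f \<in> poly_fun m" for T y f
    proof -
      from Ty obtain T0 X where T0: "T = subtopology T0 (H y X)" "(T0, y, X) \<in> C"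
        by (auto simp: \<T>'_def)
      from f have "f \<in> poly_fun (Suc m)"
        by induction (auto intro: poly_fun.intros)
      from Suc.prems(3)[OF conjunct1[OF memC[OF T0(2)]] this]
      show ?thesis unfolding T0 closedin_subtopology
        by (intro exI[of _ "{x\<in>topspace T0. f (y x) = 0}"]) auto
    qed
    show "\<exists>(T, y)\<in>\<T>'. \<exists>x\<in>topspace T. \<forall>j<m. y x j = q j" if "G (q(m := c)) \<noteq> 0" for q
    proof -
      have "g (q(m := c)) \<noteq> 0" using G(3)[OF that] by (auto simp: F_def)
      from Suc.prems(6)[OF this] obtain T y x where
        x: "(T, y) \<in> \<T>" "x \<in> topspace T" "\<And>j. j < Suc m \<Longrightarrow> y x j = (q(m := c)) j" by auto
      then obtain X where X: "X \<in> comp T" "x \<in> X" using comp(3) by blast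
      have inC: "(T, y, X) \<in> C" using x X by (auto simp: C_def)
      have "dominant y X"
      proof (rule ccontr)
        assume nd: "\<not> dominant y X"
        then have "h y X \<in> F" using inC by (force simp: F_def)
        from G(3)[OF that this] have "h y X (q(m := c)) \<noteq> 0" .
        moreover have "h y X (q(m := c)) = h y X (y x)"
          using x(3) by (intro poly_fun_cong[OF h(1)[OF nd]]) auto
        ultimately show False using h(3)[OF nd X(2)] by simp
      qed
      moreover have "x \<in> H y X" using x(3)[of m] X by (simp add: H_def)
      ultimately have "(subtopology T (H y X), y) \<in> \<T>'" "x \<in> topspace (subtopology T (H y X))"
        using inC x by (force simp: \<T>'_def)+
      moreover have "\<forall>j<m. y x j = q j" using x(3) by simp
      ultimately show ?thesis by blast
    qed
  qed
  then obtain T y X where TX: "(T, y, X) \<in> C" "dominant y X" "has_chain (subtopology T (H y X)) m"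
    by (auto simp: \<T>'_def)
  then obtain Z where Z: "\<And>i. i \<le> m \<Longrightarrow> irreducible_closedin (subtopology T (H y X)) (Z i)"
    "\<And>i. i < m \<Longrightarrow> Z i \<subset> Z (Suc i)" unfolding has_chain_def by blast
  let ?f = "\<lambda>q. q m + (- c)"
  have f: "?f \<in> poly_fun (Suc m)" by (intro poly_fun.intros) auto
  have f_ne: "\<exists>q. ?f q \<noteq> 0" by (intro exI[of _ "\<lambda>_. c + 1"]) simp
  have "\<not> (\<forall>x\<in>X. ?f (y x) = 0)"
  proof
    assume "\<forall>x\<in>X. ?f (y x) = 0"
    with f f_ne have "\<exists>f\<in>poly_fun (Suc m). (\<exists>q. f q \<noteq> 0) \<and> (\<forall>x\<in>X. f (y x) = 0)"
      by (intro bexI[of _ ?f] conjI)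
    with TX(2) show False by (simp only: dominant_def) simp
  qed
  \<comment> \<open>A dominant component is not contained in the hyperplane; put on top of the chain
    of its section, it makes the chain longer by one.\<close>
  then have HX: "H y X \<subset> X" by (auto simp: H_def)
  have "Z m \<subseteq> H y X"
    using Z(1)[of m] closedin_subset by (fastforce simp: irreducible_closedin_def)
  with HX have top: "Z m \<subset> X" by blast
  have "has_chain T (Suc m)" unfolding has_chain_def
  proof (intro exI[of _ "\<lambda>i. if i \<le> m then Z i else X"] conjI allI impI)
    fix i
    show "irreducible_closedin T (if i \<le> m then Z i else X)"
      using Z(1) clX[OF TX(1)] clH[OF TX(1)] by (auto intro: irreducible_closedin_subspace)
    assume "i < Suc m"
    then show "(if i \<le> m then Z i else X) \<subset> (if Suc i \<le> m then Z (Suc i) else X)"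
      using Z(2) top by (cases "i = m") auto
  qed
  then show ?case using memC[OF TX(1)] by blast
qed

section \<open>Spaces whose closed sets are cut out by graded functions\<close>

text \<open>Homogeneous coordinates without a projective space: a member of \<open>P m\<close>
  stands for a form of degree m evaluated at some chosen frame of the point, so only its vanishing
  and ratios in equal degree are geometric. \<open>unit\<close> says that the functions of degree 1
  have no common zero.\<close>

locale graded_zariski =
  fixes T :: "'p topology" and P :: "nat \<Rightarrow> ('p \<Rightarrow> 'k::alg_closed_field) set"
  assumes const: "(\<lambda>_. c) \<in> P 0"
    and add: "f \<in> P m \<Longrightarrow> g \<in> P m \<Longrightarrow> (\<lambda>x. f x + g x) \<in> P m"
    and mult: "f \<in> P m \<Longrightarrow> g \<in> P m' \<Longrightarrow> (\<lambda>x. f x * g x) \<in> P (m + m')"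
    and unit: "x \<in> topspace T \<Longrightarrow> \<exists>f\<in>P 1. f x \<noteq> 0"
    and open_nonzero: "f \<in> P m \<Longrightarrow> openin T {x\<in>topspace T. f x \<noteq> 0}"
    and basis: "openin T W \<Longrightarrow> x \<in> W \<Longrightarrow>
      \<exists>m. \<exists>f\<in>P m. f x \<noteq> 0 \<and> (\<forall>y\<in>topspace T. f y \<noteq> 0 \<longrightarrow> y \<in> W)"
begin

lemma closed_zero: "f \<in> P m \<Longrightarrow> closedin T {x\<in>topspace T. f x = 0}"
  unfolding closedin_def
  by (intro conjI, blast, drule open_nonzero, erule back_subst[of "openin T"]) auto

lemma power_mem: "f \<in> P m \<Longrightarrow> (\<lambda>x. f x ^ k) \<in> P (m * k)"
proof (induction k)
  case (Suc k)
  from mult[OF Suc.prems Suc.IH[OF Suc.prems]] show ?case by simp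
qed (simp add: const)

lemma prod_mem:
  assumes "finite I" "\<And>i. i \<in> I \<Longrightarrow> f i \<in> P (m i)"
  shows "(\<lambda>x. \<Prod>i\<in>I. f i x) \<in> P (\<Sum>i\<in>I. m i)"
  using assms by (induction I rule: finite_induct) (auto intro: const mult)

lemma sum_mem:
  assumes "finite I" "I \<noteq> {}" "\<And>i. i \<in> I \<Longrightarrow> f i \<in> P m"
  shows "(\<lambda>x. \<Sum>i\<in>I. f i x) \<in> P m"
  using assms by (induction I rule: finite_ne_induct) (auto intro: add)

lemma scale_mem: "f \<in> P m \<Longrightarrow> (\<lambda>x. c * f x) \<in> P m"
  using mult[OF const] by simp

text \<open>A strictly descending chain yields functions \<open>f i\<close> that vanish on
  \<open>Z (Suc i)\<close> but not at a point \<open>x i\<close> of \<open>Z i\<close>. All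
  predecessors of \<open>f N\<close> vanish at \<open>x N\<close>, so \<open>f N\<close> is never in
  their ideal.\<close>

lemma noetherian:
  assumes "noetherian_subring R" "\<And>m. P m \<subseteq> R"
  shows "noetherian_space T"
  unfolding noetherian_space_def
proof (rule ccontr)
  assume "\<not> wf {(X, Y). closedin T X \<and> closedin T Y \<and> X \<subset> Y}"
  then obtain Z where "\<forall>i::nat. (Z (Suc i), Z i) \<in> {(X, Y). closedin T X \<and> closedin T Y \<and> X \<subset> Y}"
    unfolding wf_iff_no_infinite_down_chain by blast
  then have Z: "\<And>i. closedin T (Z i)" "\<And>i::nat. Z (Suc i) \<subset> Z i" by simp_all
  have anti: "Z j \<subseteq> Z i" if "i \<le> j" for i j
    using that by (induction rule: dec_induct) (use Z(2) in blast)+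
  have "\<exists>x f. x \<in> Z i \<and> (\<exists>m. f \<in> P m) \<and> f x \<noteq> 0 \<and> (\<forall>y\<in>Z (Suc i). f y = 0)" for i
  proof -
    obtain x where x: "x \<in> Z i" "x \<notin> Z (Suc i)" using Z(2) by blast
    have xt: "x \<in> topspace T" using x(1) closedin_subset[OF Z(1)] by blast
    with basis[of "topspace T - Z (Suc i)" x] x Z(1)[of "Suc i"] obtain m f where
      "f \<in> P m" "f x \<noteq> 0" "\<forall>y\<in>topspace T. f y \<noteq> 0 \<longrightarrow> y \<notin> Z (Suc i)"
      by (auto simp: closedin_def)
    then show ?thesis using x(1) closedin_subset[OF Z(1)] by blast
  qed
  then obtain x f where xf: "\<And>i. x i \<in> Z i" "\<And>i. \<exists>m. f i \<in> P m" "\<And>i. f i (x i) \<noteq> 0"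
    "\<And>i y. y \<in> Z (Suc i) \<Longrightarrow> f i y = 0" by metis
  have "range f \<subseteq> R" using xf(2) assms(2) by blast
  with assms(1) obtain Y where Y: "Y \<subseteq> range f" "finite Y" "range f \<subseteq> ideal_gen R Y"
    unfolding noetherian_subring_def by meson
  obtain B where B: "finite B" "Y = f ` B" using finite_subset_image[OF Y(2,1)] by blast
  obtain N where N: "B \<subseteq> {..<N}" using finite_nat_iff_bounded[THEN iffD1, OF B(1)] by blast
  have "g (x N) = 0" if "g \<in> Y" for g
  proof -
    from that B N obtain i where i: "i < N" "g = f i" by auto
    then have "x N \<in> Z (Suc i)" using xf(1)[of N] anti[of "Suc i" N] by auto
    then show ?thesis using xf(4) i by simp
  qed
  note Y0 = this
  have "g (x N) = 0" if "g \<in> ideal_gen R Y" for g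
    using that by induction (simp_all add: Y0)
  then show False using Y(3) xf(3)[of N] by blast
qed

text \<open>A chain of \<open>r + 1\<close> irreducible closed sets gives \<open>r + 1\<close> functions of equal degree which are
  algebraically independent in the homogeneous sense.\<close>

lemma chain_functions:
  assumes "\<And>i. i \<le> r \<Longrightarrow> irreducible_closedin T (Z i)" "\<And>i. i < r \<Longrightarrow> Z i \<subset> Z (Suc i)"
  shows "\<exists>e g. (\<forall>i\<le>r. g i \<in> P e \<and> (\<exists>x\<in>Z i. g i x \<noteq> 0) \<and> (\<forall>j<i. \<forall>x\<in>Z j. g i x = 0))"
proof -
  have cl: "closedin T (Z i)" "Z i \<noteq> {}" if "i \<le> r" for i
    using assms(1)[OF that] by (auto simp: irreducible_closedin_def)
  have mono: "Z j \<subseteq> Z i" if "j \<le> i" "i \<le> r" for i j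
    using that
  proof (induction i rule: dec_induct)
    case (step n)
    then show ?case using assms(2)[of n] by auto
  qed simp
  have "\<exists>m f x. f \<in> P m \<and> x \<in> Z i \<and> f x \<noteq> 0 \<and> (\<forall>j<i. \<forall>y\<in>Z j. f y = 0)" if i: "i \<le> r" for i
  proof (cases i)
    case 0
    obtain x where "x \<in> Z i" using cl(2)[OF i] by blast
    then show ?thesis using const[of 1] 0 by (intro exI[of _ 0] exI[of _ "\<lambda>_. 1"]) auto
  next
    case (Suc k)
    then obtain x where x: "x \<in> Z i" "x \<notin> Z k" using assms(2)[of k] i by auto
    have xt: "x \<in> topspace T" using x(1) closedin_subset[OF cl(1)[OF i]] by blast
    have k: "k \<le> r" using Suc i by simp
    with basis[of "topspace T - Z k" x] x xt cl(1)[of k] obtain m f where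
      f: "f \<in> P m" "f x \<noteq> 0" "\<forall>y\<in>topspace T. f y \<noteq> 0 \<longrightarrow> y \<notin> Z k"
      by (auto simp: closedin_def)
    have "f y = 0" if "j < i" "y \<in> Z j" for j y
      using mono[of j k] that Suc k f(3) closedin_subset[OF cl(1)[of k]] by auto
    with f x show ?thesis by blast
  qed
  then obtain m f x where f: "\<And>i. i \<le> r \<Longrightarrow> f i \<in> P (m i)" "\<And>i. i \<le> r \<Longrightarrow> x i \<in> Z i"
    "\<And>i. i \<le> r \<Longrightarrow> f i (x i) \<noteq> 0" "\<And>i j y. i \<le> r \<Longrightarrow> j < i \<Longrightarrow> y \<in> Z j \<Longrightarrow> f i y = 0"
    by metis
  have "\<exists>u\<in>P 1. u (x i) \<noteq> 0" if "i \<le> r" for i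
    using f(2)[OF that] closedin_subset[OF cl(1)[OF that]] by (intro unit) blast
  then obtain u where u: "\<And>i. i \<le> r \<Longrightarrow> u i \<in> P 1" "\<And>i. i \<le> r \<Longrightarrow> u i (x i) \<noteq> 0" by metis
  define e where "e = (\<Sum>i\<le>r. m i)"
  have m_le: "m i \<le> e" if "i \<le> r" for i
    unfolding e_def using that by (intro member_le_sum) auto
  \<comment> \<open>Powers of functions of degree 1, non-zero at \<open>x i\<close>, bring all
    degrees up to \<open>e\<close> and keep the zeros on the smaller sets.\<close>
  define g where "g i y = f i y * u i y ^ (e - m i)" for i y
  have "g i \<in> P e" if "i \<le> r" for i
    using mult[OF f(1)[OF that] power_mem[OF u(1)[OF that], of "e - m i"]] m_le[OF that]
    by (simp add: g_def[abs_def])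
  moreover have "\<exists>x\<in>Z i. g i x \<noteq> 0" if "i \<le> r" for i
    using f(2)[OF that] f(3)[OF that] u(2)[OF that] by (intro bexI[of _ "x i"]) (auto simp: g_def)
  moreover have "g i y = 0" if "i \<le> r" "j < i" "y \<in> Z j" for i j y
    using f(4)[OF that] by (simp add: g_def)
  ultimately show ?thesis by blast
qed

text \<open>Let s be the least exponent of the last function in a relation. The s-th power of that
  function can be cancelled, because the top set is irreducible and the function is not identically
  zero on it. On the next smaller set the function is zero, so only the terms with exponent exactly
  s survive, and they form a relation for the shorter chain.\<close>

lemma monomials_independent:
  assumes "\<And>i. i \<le> r \<Longrightarrow> irreducible_closedin T (Z i)" "\<And>i. i < r \<Longrightarrow> Z i \<subset> Z (Suc i)"
    and "\<And>i. i \<le> r \<Longrightarrow> g i \<in> P e" "\<And>i. i \<le> r \<Longrightarrow> \<exists>x\<in>Z i. g i x \<noteq> 0"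
    and "\<And>i j x. i \<le> r \<Longrightarrow> j < i \<Longrightarrow> x \<in> Z j \<Longrightarrow> g i x = 0"
    and "finite A" "\<And>z. z \<in> A \<Longrightarrow> (\<Sum>i\<le>r. z i) = q \<and> (\<forall>i>r. z i = 0)"
    and "\<And>x. x \<in> Z r \<Longrightarrow> (\<Sum>z\<in>A. c z * (\<Prod>i\<le>r. g i x ^ z i)) = 0"
  shows "\<forall>z\<in>A. c z = (0 :: 'k)"
  using assms
proof (induction r arbitrary: A q c)
  case 0
  obtain x where x: "x \<in> Z 0" "g 0 x \<noteq> 0" using 0(4)[of 0] by blast
  show ?case
  proof
    fix z assume z: "z \<in> A"
    have "w = z" if "w \<in> A" for w
    proof
      fix i show "w i = z i" using 0(7)[OF z] 0(7)[OF that] by (cases i) auto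
    qed
    then have "A = {z}" using z by blast
    then show "c z = 0" using 0(8)[OF x(1)] x(2) by simp
  qed
next
  case (Suc r)
  show ?case
  proof (rule ccontr)
    assume contra: "\<not> ?thesis"
    define B where "B = {z\<in>A. c z \<noteq> 0}"
    have finB: "finite B" and neB: "B \<noteq> {}" and BA: "B \<subseteq> A"
      using Suc.prems(6) contra by (auto simp: B_def)
    define s where "s = Min ((\<lambda>z. z (Suc r)) ` B)"
    have s_le: "s \<le> z (Suc r)" if "z \<in> B" for z using that finB by (auto simp: s_def)
    have s_mem: "s \<in> (\<lambda>z. z (Suc r)) ` B" unfolding s_def using finB neB by (intro Min_in) auto
    define R where "R x = (\<Sum>z\<in>B. c z * ((\<Prod>i\<le>r. g i x ^ z i) * g (Suc r) x ^ (z (Suc r) - s)))" for x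
    have tot: "(\<Sum>i\<le>r. z i) + (z (Suc r) - s) = q - s" if "z \<in> B" for z
      using Suc.prems(7)[of z] that BA s_le[OF that] by auto
    have "R \<in> P (e * (q - s))" unfolding R_def[abs_def]
    proof (intro sum_mem finB neB scale_mem)
      fix z assume z: "z \<in> B"
      have "(\<lambda>x. \<Prod>i\<le>r. g i x ^ z i) \<in> P (\<Sum>i\<le>r. e * z i)"
        using Suc.prems(3) by (intro prod_mem power_mem) auto
      from mult[OF this power_mem[OF Suc.prems(3), of "Suc r" "z (Suc r) - s"]]
      show "(\<lambda>x. (\<Prod>i\<le>r. g i x ^ z i) * g (Suc r) x ^ (z (Suc r) - s)) \<in> P (e * (q - s))"
        using tot[OF z] by (simp add: sum_distrib_left[symmetric] distrib_left[symmetric])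
    qed
    then have clR: "closedin T {x\<in>topspace T. R x = 0}" by (rule closed_zero)
    have clg: "closedin T {x\<in>topspace T. g (Suc r) x = 0}" using Suc.prems(3) by (intro closed_zero) auto
    have sub: "Z i \<subseteq> topspace T" if "i \<le> Suc r" for i
      using Suc.prems(1)[OF that] closedin_subset by (auto simp: irreducible_closedin_def)
    have prodR: "g (Suc r) x ^ s * R x = 0" if x: "x \<in> Z (Suc r)" for x
    proof -
      have "g (Suc r) x ^ s * R x = (\<Sum>z\<in>B. c z * (\<Prod>i\<le>Suc r. g i x ^ z i))"
        unfolding R_def sum_distrib_left
      proof (intro sum.cong refl)
        fix z assume "z \<in> B"
        from s_le[OF this] have "g (Suc r) x ^ s * g (Suc r) x ^ (z (Suc r) - s) = g (Suc r) x ^ z (Suc r)"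
          by (simp flip: power_add)
        then show "g (Suc r) x ^ s * (c z * ((\<Prod>i\<le>r. g i x ^ z i) * g (Suc r) x ^ (z (Suc r) - s))) =
            c z * (\<Prod>i\<le>Suc r. g i x ^ z i)"
          by (simp add: mult_ac)
      qed
      also have "\<dots> = (\<Sum>z\<in>A. c z * (\<Prod>i\<le>Suc r. g i x ^ z i))"
        using Suc.prems(6) by (intro sum.mono_neutral_left) (auto simp: B_def)
      finally show ?thesis using Suc.prems(8)[OF x] by simp
    qed
    have "Z (Suc r) \<subseteq> {x\<in>topspace T. g (Suc r) x = 0} \<union> {x\<in>topspace T. R x = 0}"
      using prodR sub by force
    then have "Z (Suc r) \<subseteq> {x\<in>topspace T. g (Suc r) x = 0} \<or> Z (Suc r) \<subseteq> {x\<in>topspace T. R x = 0}"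
      using Suc.prems(1)[of "Suc r"] clg clR unfolding irreducible_closedin_def by blast
    then have R0: "R x = 0" if "x \<in> Z (Suc r)" for x
      using Suc.prems(4)[of "Suc r"] that by blast
    define B' where "B' = {z\<in>B. z (Suc r) = s}"
    define \<phi> :: "(nat \<Rightarrow> nat) \<Rightarrow> nat \<Rightarrow> nat" where "\<phi> z = z(Suc r := 0)" for z
    define \<psi> :: "(nat \<Rightarrow> nat) \<Rightarrow> nat \<Rightarrow> nat" where "\<psi> z = z(Suc r := s)" for z
    have inv: "\<psi> (\<phi> z) = z" if "z \<in> B'" for z using that by (auto simp: \<phi>_def \<psi>_def B'_def)
    then have inj: "inj_on \<phi> B'" by (intro inj_on_inverseI[of _ \<psi>]) simp
    have "\<forall>w\<in>\<phi> ` B'. c (\<psi> w) = 0"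
    proof (rule Suc.IH[where A = "\<phi> ` B'" and q = "q - s" and c = "\<lambda>w. c (\<psi> w)"])
      show "finite (\<phi> ` B')" using finB by (simp add: B'_def)
      show "(\<Sum>i\<le>r. w i) = q - s \<and> (\<forall>i>r. w i = 0)" if "w \<in> \<phi> ` B'" for w
      proof -
        from that obtain z where z: "z \<in> B" "z (Suc r) = s" "w = \<phi> z" by (auto simp: B'_def)
        have "(\<Sum>i\<le>r. w i) = (\<Sum>i\<le>r. z i)" by (auto simp: z \<phi>_def)
        then show ?thesis using tot[OF z(1)] Suc.prems(7)[of z] z BA by (auto simp: \<phi>_def)
      qed
      show "(\<Sum>w\<in>\<phi> ` B'. c (\<psi> w) * (\<Prod>i\<le>r. g i x ^ w i)) = 0" if x: "x \<in> Z r" for x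
      proof -
        have "(\<Sum>w\<in>\<phi> ` B'. c (\<psi> w) * (\<Prod>i\<le>r. g i x ^ w i)) =
            (\<Sum>z\<in>B'. c z * (\<Prod>i\<le>r. g i x ^ z i))"
          using inv by (subst sum.reindex[OF inj], intro sum.cong) (auto simp: \<phi>_def intro!: prod.cong)
        also have "\<dots> = (\<Sum>z\<in>B'. c z * ((\<Prod>i\<le>r. g i x ^ z i) * g (Suc r) x ^ (z (Suc r) - s)))"
          by (intro sum.cong) (auto simp: B'_def)
        also have "\<dots> = R x" unfolding R_def
        proof (intro sum.mono_neutral_left finB ballI)
          fix z assume "z \<in> B - B'"
          with s_le[of z] have "0 < z (Suc r) - s" by (auto simp: B'_def)
          moreover have "g (Suc r) x = 0" using Suc.prems(5)[of "Suc r" r x] x by simp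
          ultimately show "c z * ((\<Prod>i\<le>r. g i x ^ z i) * g (Suc r) x ^ (z (Suc r) - s)) = 0" by simp
        qed (auto simp: B'_def)
        also have "\<dots> = 0" using R0 Suc.prems(2)[of r] x by blast
        finally show ?thesis .
      qed
    qed (use Suc.prems(1-5) in auto)
    moreover obtain z where "z \<in> B'" using s_mem by (auto simp: B'_def)
    ultimately have "c z = 0" using inv by fastforce
    with \<open>z \<in> B'\<close> show False by (auto simp: B'_def B_def)
  qed
qed

text \<open>A chain of length p+1 gives p+2 independent functions of one degree e. Their monomials
  of degree q number on the order of q^(p+1), while the pullbacks are polynomials in p variables of
  degree at most D e q in each, a space of dimension (D e q + 1)^p. For large q the pullbacks are
  therefore dependent; by density the relation holds on the whole space. The factor \<rho> absorbs
  the choice of frames.\<close>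

theorem krull_dim_le:
  assumes top: "\<And>h. h \<in> H \<Longrightarrow> \<phi> h \<in> topspace T" and dense: "T closure_of (\<phi> ` H) = topspace T"
    and \<rho>: "\<And>h. h \<in> H \<Longrightarrow> \<rho> h \<noteq> 0"
    and pull: "\<And>m f. f \<in> P m \<Longrightarrow>
      \<exists>F. poly_deg_le p (D * m) F \<and> (\<forall>h\<in>H. F h = \<rho> h ^ m * f (\<phi> h))"
  shows "krull_dim T \<le> enat p"
proof (rule krull_dim_leI, rule ccontr)
  fix r0 assume "has_chain T r0" "\<not> r0 \<le> p"
  then have "has_chain T (Suc p)" using has_chain_less[of T r0 "Suc p"] by simp
  then obtain Z where Z: "\<And>i. i \<le> Suc p \<Longrightarrow> irreducible_closedin T (Z i)"
    "\<And>i. i < Suc p \<Longrightarrow> Z i \<subset> Z (Suc i)" unfolding has_chain_def by blast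
  from chain_functions[of "Suc p" Z] Z obtain e g where
    g: "\<And>i. i \<le> Suc p \<Longrightarrow> g i \<in> P e" "\<And>i. i \<le> Suc p \<Longrightarrow> \<exists>x\<in>Z i. g i x \<noteq> 0"
      "\<And>i j x. i \<le> Suc p \<Longrightarrow> j < i \<Longrightarrow> x \<in> Z j \<Longrightarrow> g i x = 0" by metis
  \<comment> \<open>Chosen so that ((D e (p+1) + 1) (s+1))^p = s (s+1)^p, which is less than the
    number (s+1)^(p+1) of monomials.\<close>
  define s where "s = (D * e * Suc p + 1) ^ p"
  define q where "q = Suc p * s"
  define E where "E = ({1..Suc p} \<rightarrow>\<^sub>E {..s} :: (nat \<Rightarrow> nat) set)"
  \<comment> \<open>The exponents of \<open>g 1\<close> to \<open>g (Suc p)\<close> run freely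
    through a box; that of \<open>g 0\<close> fills up the total degree to \<open>q\<close>.\<close>
  define \<psi> where "\<psi> z i = (if i = 0 then q - (\<Sum>j\<in>{1..Suc p}. z j) else if i \<le> Suc p then z i else 0)"
    for z :: "nat \<Rightarrow> nat" and i
  have inj: "inj_on \<psi> E"
  proof (rule inj_onI)
    fix z w assume z: "z \<in> E" and w: "w \<in> E" and eq: "\<psi> z = \<psi> w"
    show "z = w" using z[unfolded E_def] w[unfolded E_def]
    proof (rule PiE_ext)
      fix i assume "i \<in> {1..Suc p}"
      then show "z i = w i" using fun_cong[OF eq, of i] by (simp add: \<psi>_def)
    qed
  qed
  have card_E: "card E = (s + 1) ^ Suc p" and finE: "finite E"
    by (simp_all add: E_def card_PiE finite_PiE)
  define A where "A = \<psi> ` E"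
  have card_A: "card A = (s + 1) ^ Suc p" and finA: "finite A"
    using card_image[OF inj] card_E finE by (simp_all add: A_def)
  have A: "(\<Sum>i\<le>Suc p. z i) = q \<and> (\<forall>i>Suc p. z i = 0)" if "z \<in> A" for z
  proof -
    from that obtain w where w: "w \<in> E" "z = \<psi> w" by (auto simp: A_def)
    have "(\<Sum>j\<in>{1..Suc p}. w j) \<le> (\<Sum>j\<in>{1..Suc p}. s)"
      using w(1) unfolding E_def by (intro sum_mono) (auto dest!: PiE_mem)
    then have le: "(\<Sum>j\<in>{1..Suc p}. w j) \<le> q" by (simp add: q_def)
    have "{..Suc p} = insert 0 {1..Suc p}" by auto
    then have "(\<Sum>i\<le>Suc p. z i) = z 0 + (\<Sum>i\<in>{1..Suc p}. z i)" by (simp only:) simp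
    also have "(\<Sum>i\<in>{1..Suc p}. z i) = (\<Sum>i\<in>{1..Suc p}. w i)"
      by (intro sum.cong) (auto simp: w \<psi>_def)
    also have "z 0 = q - (\<Sum>i\<in>{1..Suc p}. w i)" by (simp add: w \<psi>_def)
    finally show ?thesis using le by (auto simp: w \<psi>_def)
  qed
  define mon where "mon z x = (\<Prod>i\<le>Suc p. g i x ^ z i)" for z :: "nat \<Rightarrow> nat" and x
  have mon: "mon z \<in> P (e * q)" if "z \<in> A" for z
  proof -
    have "mon z \<in> P (\<Sum>i\<le>Suc p. e * z i)"
      unfolding mon_def[abs_def] using g(1) by (intro prod_mem power_mem) auto
    then show ?thesis using A[OF that] by (simp only: sum_distrib_left[symmetric])
  qed
  have "\<exists>F. poly_deg_le p (D * (e * q)) F \<and> (\<forall>h\<in>H. F h = \<rho> h ^ (e * q) * mon z (\<phi> h))" if "z \<in> A" for z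
    using pull[OF mon[OF that]] .
  then obtain F where F: "\<And>z. z \<in> A \<Longrightarrow> poly_deg_le p (D * (e * q)) (F z)"
    "\<And>z h. z \<in> A \<Longrightarrow> h \<in> H \<Longrightarrow> F z h = \<rho> h ^ (e * q) * mon z (\<phi> h)" by metis
  let ?J = "{..<p} \<rightarrow>\<^sub>E {..D * (e * q)}"
  have "\<forall>z\<in>A. \<exists>M. \<forall>h. F z h = (\<Sum>j\<in>?J. M j * (\<Prod>i<p. h i ^ j i))"
    using F(1) by (simp add: poly_deg_le_def)
  from bchoice[OF this] obtain M where
    M: "\<And>z h. z \<in> A \<Longrightarrow> F z h = (\<Sum>j\<in>?J. M z j * (\<Prod>i<p. h i ^ j i))" by blast
  have "D * (e * q) + 1 \<le> (D * e * Suc p + 1) * (s + 1)" by (simp add: q_def algebra_simps)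
  then have "(D * (e * q) + 1) ^ p \<le> ((D * e * Suc p + 1) * (s + 1)) ^ p"
    by (intro power_mono) auto
  also have "\<dots> = s * (s + 1) ^ p" by (simp only: s_def power_mult_distrib)
  finally have "(D * (e * q) + 1) ^ p \<le> s * (s + 1) ^ p" .
  also have "\<dots> < (s + 1) ^ Suc p" by simp
  finally have "card ?J < card A" by (simp add: card_PiE card_A)
  from exists_linear_relation[OF _ finA this, of M] obtain c where
    c: "\<exists>z\<in>A. c z \<noteq> 0" "\<And>j. j \<in> ?J \<Longrightarrow> (\<Sum>z\<in>A. c z * M z j) = 0" by (auto simp: finite_PiE)
  have neA: "A \<noteq> {}" using c(1) by blast
  have relF: "(\<Sum>z\<in>A. c z * F z h) = 0" for h
  proof -
    have "(\<Sum>z\<in>A. c z * F z h) = (\<Sum>z\<in>A. \<Sum>j\<in>?J. c z * M z j * (\<Prod>i<p. h i ^ j i))"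
      by (intro sum.cong) (simp_all add: M sum_distrib_left mult_ac)
    also have "\<dots> = (\<Sum>j\<in>?J. (\<Sum>z\<in>A. c z * M z j) * (\<Prod>i<p. h i ^ j i))"
      by (subst sum.swap) (simp add: sum_distrib_right)
    finally show ?thesis using c(2) by simp
  qed
  define f where "f x = (\<Sum>z\<in>A. c z * mon z x)" for x
  have "f \<in> P (e * q)" unfolding f_def[abs_def]
    by (intro sum_mem finA neA scale_mem mon)
  then have clf: "closedin T {x\<in>topspace T. f x = 0}" by (rule closed_zero)
  have "f (\<phi> h) = 0" if h: "h \<in> H" for h
  proof -
    have "\<rho> h ^ (e * q) * f (\<phi> h) = (\<Sum>z\<in>A. c z * F z h)"
      unfolding f_def sum_distrib_left by (intro sum.cong) (auto simp: F(2) h)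
    then show ?thesis using relF \<rho>[OF h] by simp
  qed
  then have "\<phi> ` H \<subseteq> {x\<in>topspace T. f x = 0}" using top by auto
  then have "topspace T \<subseteq> {x\<in>topspace T. f x = 0}"
    using closure_of_minimal[OF _ clf, of "\<phi> ` H"] dense by simp
  moreover have "Z (Suc p) \<subseteq> topspace T"
    using Z(1)[of "Suc p"] closedin_subset by (auto simp: irreducible_closedin_def)
  ultimately have rel: "(\<Sum>z\<in>A. c z * (\<Prod>i\<le>Suc p. g i x ^ z i)) = 0" if "x \<in> Z (Suc p)" for x
    using that unfolding f_def mon_def by blast
  have "\<forall>z\<in>A. c z = 0"
  proof (rule monomials_independent[where Z = Z and g = g and r = "Suc p" and e = e and q = q])
    show "\<And>i. i \<le> Suc p \<Longrightarrow> irreducible_closedin T (Z i)" "\<And>i. i < Suc p \<Longrightarrow> Z i \<subset> Z (Suc i)" by fact+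
    show "\<And>i. i \<le> Suc p \<Longrightarrow> g i \<in> P e" "\<And>i. i \<le> Suc p \<Longrightarrow> \<exists>x\<in>Z i. g i x \<noteq> 0"
      "\<And>i j x. i \<le> Suc p \<Longrightarrow> j < i \<Longrightarrow> x \<in> Z j \<Longrightarrow> g i x = 0" by fact+
    show "finite A" "\<And>z. z \<in> A \<Longrightarrow> (\<Sum>i\<le>Suc p. z i) = q \<and> (\<forall>i>Suc p. z i = 0)" by fact+
    show "\<And>x. x \<in> Z (Suc p) \<Longrightarrow> (\<Sum>z\<in>A. c z * (\<Prod>i\<le>Suc p. g i x ^ z i)) = 0" by fact
  qed
  with c(1) show False by blast
qed

end

section \<open>Algebras over the field of Laurent series\<close>

abbreviation X :: "'k::field fps"
  where "X \<equiv> fps_X"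

abbreviation fl :: "'k::field fps \<Rightarrow> 'k fls"
  where "fl \<equiv> fps_to_fls"

abbreviation res :: "'k::field fps \<Rightarrow> 'k"
  where "res f \<equiv> fps_nth f 0"

locale fls_algebra =
  fixes \<iota> :: "'k::alg_closed_field fls \<Rightarrow> 'l::comm_ring_1"
  assumes \<iota>_1 [simp]: "\<iota> 1 = 1"
    and \<iota>_add: "\<iota> (x + y) = \<iota> x + \<iota> y"
    and \<iota>_mult: "\<iota> (x * y) = \<iota> x * \<iota> y"
begin

abbreviation "A \<equiv> integral_closure \<iota>"
abbreviation "\<delta> \<equiv> Demb \<iota>"
abbreviation "t \<equiv> t_elt \<iota>"

lemma \<iota>_0 [simp]: "\<iota> 0 = 0"
  using \<iota>_add[of 0 0] by simp

lemma \<iota>_minus: "\<iota> (- x) = - \<iota> x"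
  using \<iota>_add[of x "- x"] by (simp add: eq_neg_iff_add_eq_0 add.commute)

lemma \<iota>_diff: "\<iota> (x - y) = \<iota> x - \<iota> y"
  using \<iota>_add[of x "- y"] by (simp add: \<iota>_minus)

lemma \<iota>_power: "\<iota> (x ^ n) = \<iota> x ^ n"
  by (induction n) (simp_all add: \<iota>_mult)

lemma \<iota>_eq_0_iff [simp]: "\<iota> x = 0 \<longleftrightarrow> x = 0"
proof
  assume "\<iota> x = 0"
  show "x = 0"
  proof (rule ccontr)
    assume "x \<noteq> 0"
    then have "\<iota> x * \<iota> (1 / x) = 1" using \<iota>_mult[of x "1 / x"] by simp
    with \<open>\<iota> x = 0\<close> show False by simp
  qed
qed simp

lemma \<iota>_inject [simp]: "\<iota> x = \<iota> y \<longleftrightarrow> x = y"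
  using \<iota>_eq_0_iff[of "x - y"] by (simp add: \<iota>_diff del: \<iota>_eq_0_iff)

lemma \<delta>_simps [simp]: "\<delta> 0 = 0" "\<delta> 1 = 1"
  by (simp_all add: Demb_def)

lemma \<delta>_add: "\<delta> (f + g) = \<delta> f + \<delta> g" and \<delta>_mult: "\<delta> (f * g) = \<delta> f * \<delta> g"
  and \<delta>_minus: "\<delta> (- f) = - \<delta> f" and \<delta>_diff: "\<delta> (f - g) = \<delta> f - \<delta> g"
  by (simp_all add: Demb_def \<iota>_add \<iota>_mult \<iota>_minus \<iota>_diff fls_times_fps_to_fls)

lemma \<delta>_power: "\<delta> (f ^ n) = \<delta> f ^ n"
  by (induction n) (simp_all add: \<delta>_mult)

lemma \<delta>_inject [simp]: "\<delta> f = \<delta> g \<longleftrightarrow> f = g"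
  by (simp add: Demb_def)

lemma t_elt_power: "t ^ m = \<delta> (X ^ m)"
  by (simp add: t_elt_def \<delta>_power)

lemma t_elt_cancel [simp]: "t ^ m * x = t ^ m * y \<longleftrightarrow> x = y"
proof
  assume eq: "t ^ m * x = t ^ m * y"
  have "\<iota> (fls_X_inv ^ m) * t ^ m = \<iota> (fls_X_inv ^ m * fls_X ^ m)"
    by (simp add: t_elt_def Demb_def \<iota>_mult \<iota>_power)
  also have "fls_X_inv ^ m * fls_X ^ m = (1 :: 'k fls)"
    by (simp add: fls_X_inv_conv_shift_1 fls_X_times_conv_shift flip: power_mult_distrib)
  finally have inv: "\<iota> (fls_X_inv ^ m) * t ^ m = 1" by simp
  have "x = \<iota> (fls_X_inv ^ m) * t ^ m * x" using inv by simp
  also have "\<dots> = \<iota> (fls_X_inv ^ m) * t ^ m * y" using eq by (simp add: mult.assoc)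
  finally show "x = y" using inv by simp
qed simp

sublocale K: vector_space "Kscale \<iota>"
  by unfold_locales (simp_all add: Kscale_def \<iota>_add \<iota>_mult algebra_simps)

sublocale D: Modules.module "Dscale \<iota>"
  by unfold_locales (simp_all add: Dscale_def \<delta>_add \<delta>_mult algebra_simps)

sublocale k: vector_space "kscale \<iota>"
proof
  fix a b :: 'k and x y :: 'l
  have "fps_const (a + b) = fps_const a + fps_const b" "fps_const (a * b) = fps_const a * fps_const b"
    by (simp_all flip: fps_const_mult)
  then show "kscale \<iota> (a + b) x = kscale \<iota> a x + kscale \<iota> b x"
    "kscale \<iota> a (kscale \<iota> b x) = kscale \<iota> (a * b) x"
    by (simp_all only: kscale_def \<delta>_add \<delta>_mult algebra_simps)
qed (simp_all add: kscale_def algebra_simps)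

sublocale \<delta>: comm_ring_hom "Demb \<iota>"
  by unfold_locales (simp_all add: \<delta>_add \<delta>_mult)

lemma eval_hom: "comm_ring_hom (\<lambda>p. poly (map_poly \<delta> p) x)"
proof -
  interpret m: map_poly_comm_ring_hom \<delta> ..
  show ?thesis by unfold_locales (simp_all add: m.hom_add m.hom_mult)
qed

lemma eval_eq_sum: "poly (map_poly \<delta> p) x = (\<Sum>i\<le>degree p. \<delta> (coeff p i) * x ^ i)"
proof -
  interpret h: comm_ring_hom "\<lambda>p. poly (map_poly \<delta> p) x" by (rule eval_hom)
  have "poly (map_poly \<delta> (\<Sum>i\<le>degree p. monom (coeff p i) i)) x = (\<Sum>i\<le>degree p. \<delta> (coeff p i) * x ^ i)"
    unfolding h.hom_sum by (simp add: map_poly_monom poly_monom)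
  then show ?thesis by (simp add: poly_as_sum_of_monoms)
qed

text \<open>The determinant trick: the adjugate of x - P shows that det (x - P) kills every
  \<open>v i\<close>, hence also 1. The coefficients \<open>c\<close> may lie anywhere in L, so the
  \<open>v i\<close> need only generate the unit ideal of L.\<close>

lemma integral_of_matrix:
  fixes n :: nat
  assumes "\<And>i. i < n \<Longrightarrow> x * v i = (\<Sum>j<n. \<delta> (P i j) * v j)" and one: "1 = (\<Sum>i<n. c i * v i)"
  shows "x \<in> A"
proof -
  interpret h: comm_ring_hom "\<lambda>p. poly (map_poly \<delta> p) x" by (rule eval_hom)
  let ?h = "\<lambda>p. poly (map_poly \<delta> p) x"
  define M where "M = mat n n (\<lambda>(i, j). P i j)"
  define B where "B = map_mat ?h (char_poly_matrix M)"
  have M: "M \<in> carrier_mat n n" by (simp add: M_def)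
  have B: "B \<in> carrier_mat n n" using M by (simp add: B_def)
  have const: "?h [:a:] = \<delta> a" for a
    by (cases "a = 0") (simp_all add: map_poly_pCons)
  have Bij: "B $$ (i, j) = (if i = j then x else 0) - \<delta> (P i j)" if "i < n" "j < n" for i j
    using that M const[of "- P i j"]
    by (auto simp: B_def char_poly_matrix_def M_def map_poly_pCons \<delta>_minus)
  have Bv: "(\<Sum>j<n. B $$ (i, j) * v j) = 0" if i: "i < n" for i
  proof -
    have "(\<Sum>j<n. B $$ (i, j) * v j) = (\<Sum>j<n. (if i = j then x * v j else 0) - \<delta> (P i j) * v j)"
      using i by (intro sum.cong) (auto simp: Bij algebra_simps)
    then show ?thesis using i assms(1)[OF i] by (simp add: sum_subtractf)
  qed
  note adj = adj_mat[OF B]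
  have "det B * v k = 0" if k: "k < n" for k
  proof -
    have ent: "(\<Sum>i<n. adj_mat B $$ (k, i) * B $$ (i, j)) = (if k = j then det B else 0)" if j: "j < n" for j
    proof -
      have "(adj_mat B * B) $$ (k, j) = (\<Sum>i<n. adj_mat B $$ (k, i) * B $$ (i, j))"
        using adj(1) B k j by (simp add: scalar_prod_def atLeast0LessThan)
      then show ?thesis using adj(3) k j by (simp split: if_splits)
    qed
    have "det B * v k = (\<Sum>j<n. if k = j then det B * v j else 0)" using k by simp
    also have "\<dots> = (\<Sum>j<n. (\<Sum>i<n. adj_mat B $$ (k, i) * B $$ (i, j)) * v j)"
      by (intro sum.cong) (auto simp: ent)
    also have "\<dots> = (\<Sum>i<n. adj_mat B $$ (k, i) * (\<Sum>j<n. B $$ (i, j) * v j))"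
      unfolding sum_distrib_left sum_distrib_right by (subst sum.swap) (simp add: mult_ac)
    finally show ?thesis using Bv by simp
  qed
  then have "(\<Sum>i<n. c i * (det B * v i)) = 0" by simp
  moreover have "(\<Sum>i<n. c i * (det B * v i)) = det B * (\<Sum>i<n. c i * v i)"
    by (simp add: sum_distrib_left mult_ac)
  ultimately have "det B = 0" using one by simp
  moreover have "det B = ?h (char_poly M)" by (simp add: B_def char_poly_def h.hom_det)
  moreover have "lead_coeff (char_poly M) = 1" using degree_monic_char_poly[OF M] by simp
  ultimately have "lead_coeff (char_poly M) = 1 \<and> ?h (char_poly M) = 0" by simp
  then show ?thesis unfolding integral_closure_def by blast
qed

lemma integral_of_module:
  assumes G: "finite G" and one: "1 \<in> D.span G" and stable: "\<And>g. g \<in> G \<Longrightarrow> x * g \<in> D.span G"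
  shows "x \<in> A"
proof -
  obtain v and n :: nat where v: "bij_betw v {..<n} G"
    using ex_bij_betw_nat_finite[OF G] unfolding atLeast0LessThan by blast
  have span: "\<exists>u. y = (\<Sum>j<n. \<delta> (u j) * v j)" if "y \<in> D.span G" for y
  proof -
    from that obtain u where "y = (\<Sum>g\<in>G. Dscale \<iota> (u g) g)" using D.span_finite[OF G] by auto
    also have "\<dots> = (\<Sum>j<n. Dscale \<iota> (u (v j)) (v j))" by (rule sum.reindex_bij_betw[OF v, symmetric])
    finally show ?thesis by (intro exI[of _ "u \<circ> v"]) (simp add: Dscale_def)
  qed
  have "\<exists>u. x * v i = (\<Sum>j<n. \<delta> (u j) * v j)" if "i < n" for i
    using that v by (intro span stable) (auto simp: bij_betw_def)
  then obtain P where "\<And>i. i < n \<Longrightarrow> x * v i = (\<Sum>j<n. \<delta> (P i j) * v j)" by metis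
  moreover from span[OF one] obtain u where "1 = (\<Sum>j<n. \<delta> (u j) * v j)" by blast
  ultimately show ?thesis using integral_of_matrix[of n x v P "\<lambda>j. \<delta> (u j)"] by blast
qed

lemma integral_monic:
  assumes "x \<in> A"
  shows "\<exists>n c. 0 < n \<and> x ^ n = (\<Sum>i<n. \<delta> (c i) * x ^ i)"
proof -
  from assms obtain p where p: "lead_coeff p = 1" "poly (map_poly \<delta> p) x = 0"
    by (auto simp: integral_closure_def)
  have eq: "(\<Sum>i<degree p. \<delta> (coeff p i) * x ^ i) + x ^ degree p = 0"
    using p by (simp add: eval_eq_sum lessThan_Suc_atMost[symmetric])
  then have "degree p \<noteq> 0" by (intro notI) simp
  moreover have "x ^ degree p = (\<Sum>i<degree p. \<delta> (- coeff p i) * x ^ i)"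
    using eq by (simp add: \<delta>_minus sum_negf eq_neg_iff_add_eq_0 add.commute)
  ultimately show ?thesis by (intro exI[of _ "degree p"] exI[of _ "\<lambda>i. - coeff p i"]) simp
qed

text \<open>The monomials x^i y^j below the degrees of the two monic equations span a finite module
  that contains 1 and is stable under x and y.\<close>

lemma integral_add_mult:
  assumes "x \<in> A" "y \<in> A"
  shows "x + y \<in> A" "x * y \<in> A"
proof -
  obtain n c where n: "0 < n" "x ^ n = (\<Sum>i<n. \<delta> (c i) * x ^ i)" using integral_monic[OF assms(1)] by blast
  obtain m d where m: "0 < m" "y ^ m = (\<Sum>i<m. \<delta> (d i) * y ^ i)" using integral_monic[OF assms(2)] by blast
  define G where "G = (\<lambda>(i, j). x ^ i * y ^ j) ` ({..<n} \<times> {..<m})"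
  let ?V = "D.span G"
  have fin: "finite G" by (simp add: G_def)
  have gen: "x ^ i * y ^ j \<in> ?V" if "i < n" "j < m" for i j
    using that by (intro D.span_base) (auto simp: G_def)
  have xn: "x ^ n * y ^ j \<in> ?V" if "j < m" for j
  proof -
    have "x ^ n * y ^ j = (\<Sum>i<n. Dscale \<iota> (c i) (x ^ i * y ^ j))"
      by (simp add: n(2) sum_distrib_right Dscale_def mult.assoc)
    then show ?thesis using gen that by (auto intro!: D.span_sum D.span_scale)
  qed
  have ym: "x ^ i * y ^ m \<in> ?V" if "i < n" for i
  proof -
    have "x ^ i * y ^ m = (\<Sum>j<m. Dscale \<iota> (d j) (x ^ i * y ^ j))"
      by (simp add: m(2) sum_distrib_left Dscale_def mult_ac)
    then show ?thesis using gen that by (auto intro!: D.span_sum D.span_scale)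
  qed
  have x_gen: "x * g \<in> ?V" if "g \<in> G" for g
  proof -
    from that obtain i j where ij: "i < n" "j < m" "g = x ^ i * y ^ j" by (auto simp: G_def)
    have "x * g = x ^ Suc i * y ^ j" by (simp add: ij mult_ac)
    then show ?thesis using gen[of "Suc i" j] xn[of j] ij by (cases "Suc i = n") (auto simp del: power_Suc)
  qed
  have y_gen: "y * g \<in> ?V" if "g \<in> G" for g
  proof -
    from that obtain i j where ij: "i < n" "j < m" "g = x ^ i * y ^ j" by (auto simp: G_def)
    have "y * g = x ^ i * y ^ Suc j" by (simp add: ij mult_ac)
    then show ?thesis using gen[of i "Suc j"] ym[of i] ij by (cases "Suc j = m") (auto simp del: power_Suc)
  qed
  have x_span: "x * g \<in> ?V" if "g \<in> ?V" for g
    using that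
  proof (induction rule: D.span_induct_alt)
    case (step c g h)
    have "x * (Dscale \<iota> c g + h) = Dscale \<iota> c (x * g) + x * h" by (simp add: Dscale_def algebra_simps)
    then show ?case using step x_gen by (auto intro: D.span_add D.span_scale)
  qed (simp add: D.span_zero)
  have one: "1 \<in> ?V" using gen[of 0 0] n m by simp
  show "x + y \<in> A" "x * y \<in> A"
    using x_gen y_gen by (auto intro!: integral_of_module[OF fin one] D.span_add x_span intro: D.span_base simp: distrib_right mult.assoc)
qed

lemma \<delta>_in_A [simp, intro]: "\<delta> f \<in> A"
proof -
  have "lead_coeff [:- f, 1:] = 1" by simp
  moreover have "poly (map_poly \<delta> [:- f, 1:]) (\<delta> f) = 0" by (simp add: map_poly_pCons \<delta>_minus)
  ultimately show ?thesis unfolding integral_closure_def by blast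
qed

lemma A_ring: "1 \<in> A" "0 \<in> A" "x \<in> A \<Longrightarrow> y \<in> A \<Longrightarrow> x - y \<in> A" "x \<in> A \<Longrightarrow> - x \<in> A"
proof -
  show "1 \<in> A" "0 \<in> A" using \<delta>_in_A[of 1] \<delta>_in_A[of 0] by simp_all
  have m: "- x \<in> A" if "x \<in> A" for x using integral_add_mult(2)[OF \<delta>_in_A[of "- 1"] that] by (simp add: \<delta>_minus)
  then show "x \<in> A \<Longrightarrow> - x \<in> A" .
  show "x \<in> A \<Longrightarrow> y \<in> A \<Longrightarrow> x - y \<in> A" using integral_add_mult(1)[of x "- y"] m by simp
qed

text \<open>D is integrally closed, seen in the component e L: if f had a pole, f^n would have a
  pole of higher order than every other term of a monic equation of degree n. For e = 1 this says
  that A meets K in D.\<close>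

lemma integral_fls:
  assumes e: "e * e = e" "e \<noteq> 0" and A: "\<iota> f * e \<in> A"
  shows "\<exists>g. f = fl g"
proof (rule ccontr)
  assume no: "\<not> ?thesis"
  then have "\<not> 0 \<le> fls_subdegree f" using fls_regpart_to_fls_trivial[of f] by metis
  then have neg: "fls_subdegree f < 0" by simp
  obtain n c where n: "0 < n" "(\<iota> f * e) ^ n = (\<Sum>i<n. \<delta> (c i) * (\<iota> f * e) ^ i)"
    using integral_monic[OF A] by blast
  have e_pow: "e * (\<iota> f * e) ^ i = e * \<iota> (f ^ i)" for i
  proof (induction i)
    case (Suc i)
    have "e * (\<iota> f * e) ^ Suc i = \<iota> f * (e * (e * (\<iota> f * e) ^ i))" by (simp add: mult_ac)
    also have "\<dots> = \<iota> f * (e * (e * \<iota> (f ^ i)))" by (simp only: Suc)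
    also have "\<dots> = e * e * (\<iota> f * \<iota> (f ^ i))" by (simp only: mult_ac)
    finally show ?case by (simp add: e \<iota>_mult)
  qed simp
  define S where "S = (\<Sum>i<n. fl (c i) * f ^ i)"
  have "\<iota> S = (\<Sum>i<n. \<delta> (c i) * \<iota> (f ^ i))"
  proof -
    have "\<iota> (sum h I) = (\<Sum>i\<in>I. \<iota> (h i))" for h and I :: "nat set"
      by (induction I rule: infinite_finite_induct) (simp_all add: \<iota>_add)
    then show ?thesis by (simp add: S_def Demb_def \<iota>_mult)
  qed
  then have "e * \<iota> S = (\<Sum>i<n. \<delta> (c i) * (e * \<iota> (f ^ i)))"
    by (simp add: sum_distrib_left mult_ac)
  also have "\<dots> = (\<Sum>i<n. e * (\<delta> (c i) * (\<iota> f * e) ^ i))"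
    by (simp flip: e_pow add: mult.left_commute)
  also have "\<dots> = e * (\<iota> f * e) ^ n" by (simp add: n(2) sum_distrib_left)
  also have "\<dots> = e * \<iota> (f ^ n)" by (rule e_pow)
  finally have "e * \<iota> (f ^ n - S) = 0" by (simp add: \<iota>_diff right_diff_distrib)
  then have "e * (\<iota> (f ^ n - S) * \<iota> (1 / (f ^ n - S))) = 0" by (simp flip: mult.assoc)
  then have "f ^ n = S" using e(2) by (cases "f ^ n = S") (simp_all flip: \<iota>_mult)
  have f0: "f \<noteq> 0" using neg by auto
  have pow_nth: "fls_nth (f ^ i) j = 0" if "j < int i * fls_subdegree f" for i j
    using that f0 by (intro fls_eq0_below_subdegree) (simp add: fls_subdegree_pow)
  have "fls_nth S (int n * fls_subdegree f) = (\<Sum>i<n. fls_nth (fl (c i) * f ^ i) (int n * fls_subdegree f))"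
    by (simp add: S_def fls_nth_sum)
  also have "\<dots> = 0"
  proof (intro sum.neutral ballI)
    fix i assume i: "i \<in> {..<n}"
    show "fls_nth (fl (c i) * f ^ i) (int n * fls_subdegree f) = 0"
    proof (cases "c i = 0")
      case False
      have "int n * fls_subdegree f < int i * fls_subdegree f"
        using i neg by (intro mult_strict_right_mono_neg) auto
      also have "\<dots> \<le> fls_subdegree (fl (c i) * f ^ i)"
        using False f0 by (simp add: fls_subdegree_pow fls_subdegree_fls_to_fps_gt0)
      finally show ?thesis by (rule fls_eq0_below_subdegree)
    qed simp
  qed
  finally have "fls_nth (f ^ n) (int n * fls_subdegree f) = 0" using \<open>f ^ n = S\<close> by simp
  moreover have "int n * fls_subdegree f = fls_subdegree (f ^ n)" by (simp add: fls_subdegree_pow)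
  ultimately show False using f0 by (metis nth_fls_subdegree_zero_iff power_not_zero)
qed


text \<open>Multiplying by a high power of \<open>t\<close> makes the matrix of multiplication by \<open>x\<close> integral.\<close>

lemma integral_multiple:
  assumes rep: "\<And>x. \<exists>x0 x1 x2. x = \<iota> x0 + \<iota> x1 * e1 + \<iota> x2 * e2"
  shows "\<exists>s. t ^ s * x \<in> A"
proof -
  define v where "v i = [1, e1, e2] ! i" for i
  have "\<exists>c. y = (\<Sum>j<3. \<iota> (c j) * v j)" for y
  proof -
    from rep[of y] obtain x0 x1 x2 where "y = \<iota> x0 + \<iota> x1 * e1 + \<iota> x2 * e2" by blast
    then show ?thesis
      by (intro exI[of _ "\<lambda>j. [x0, x1, x2] ! j"]) (simp add: v_def eval_nat_numeral add_ac)
  qed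
  then have "\<forall>i. \<exists>c. x * v i = (\<Sum>j<3. \<iota> (c j) * v j)" by blast
  from choice[OF this] obtain c where c: "\<And>i. x * v i = (\<Sum>j<3. \<iota> (c i j) * v j)" by blast
  \<comment> \<open>One exponent that clears the poles of all nine matrix entries.\<close>
  define s where "s = (\<Sum>i<3. \<Sum>j<3. nat (- fls_subdegree (c i j)))"
  have s: "nat (- fls_subdegree (c i j)) \<le> s" if "i < 3" "j < 3" for i j
  proof -
    have "nat (- fls_subdegree (c i j)) \<le> (\<Sum>j<3. nat (- fls_subdegree (c i j)))"
      using that by (intro member_le_sum) auto
    also have "\<dots> \<le> s" unfolding s_def using that by (intro member_le_sum) auto
    finally show ?thesis .
  qed
  have "\<exists>P. fls_X ^ s * c i j = fl P" if "i < 3" "j < 3" for i j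
  proof -
    have "0 \<le> fls_subdegree (fls_X ^ s * c i j)"
      using s[OF that] by (cases "c i j = 0") auto
    then show ?thesis by (metis fls_regpart_to_fls_trivial)
  qed
  then obtain P where P: "\<And>i j. i < 3 \<Longrightarrow> j < 3 \<Longrightarrow> fls_X ^ s * c i j = fl (P i j)" by metis
  have t: "t ^ s = \<iota> (fls_X ^ s)" by (simp add: t_elt_def Demb_def \<iota>_power)
  have "t ^ s * x * v i = (\<Sum>j<3. \<delta> (P i j) * v j)" if "i < 3" for i
  proof -
    have "t ^ s * x * v i = \<iota> (fls_X ^ s) * (\<Sum>j<3. \<iota> (c i j) * v j)"
      by (simp only: t mult.assoc c)
    also have "\<dots> = (\<Sum>j<3. \<delta> (P i j) * v j)"
      using P[OF that] by (simp add: sum_distrib_left Demb_def \<iota>_mult[symmetric] mult.assoc[symmetric])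
    finally show ?thesis .
  qed
  moreover have "1 = (\<Sum>j<3. \<iota> (if j = 0 then 1 else 0) * v j)"
    by (simp add: v_def eval_nat_numeral)
  ultimately have "t ^ s * x \<in> A"
    using integral_of_matrix[of 3 "t ^ s * x" v P "\<lambda>j. \<iota> (if j = 0 then 1 else 0)"] by blast
  then show ?thesis by blast
qed

lemma fls_eq_fps_times:
  assumes "y \<noteq> (0 :: 'k fls)" "x \<noteq> 0 \<Longrightarrow> fls_subdegree y \<le> fls_subdegree x"
  shows "\<exists>g. x = fl g * y"
proof -
  have "0 \<le> fls_subdegree (x * inverse y)" using assms by (cases "x = 0") auto
  then obtain g where "x * inverse y = fl g" by (metis fls_regpart_to_fls_trivial)
  with assms(1) show ?thesis by (intro exI[of _ g]) (simp flip: \<open>x * inverse y = _\<close>)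
qed

text \<open>Echelon form over the discrete valuation ring D: \<open>z\<close> has the least order of
  the last coordinate on A, and \<open>w\<close> the least order of the middle coordinate among the
  elements without last coordinate. What remains of an element lies in both A and K, hence in
  D.\<close>

lemma integral_basis:
  assumes rep: "\<And>x. \<exists>x0 x1 x2. x = \<iota> x0 + \<iota> x1 * e1 + \<iota> x2 * e2"
    and indep: "\<And>x0 x1 x2. \<iota> x0 + \<iota> x1 * e1 + \<iota> x2 * e2 = 0 \<Longrightarrow> x0 = 0 \<and> x1 = 0 \<and> x2 = 0"
    and fin: "finite S" "D.span S = A"
  shows "\<exists>w z. A = {\<delta> f0 + \<delta> f1 * w + \<delta> f2 * z | f0 f1 f2. True} \<and>
    (\<forall>x. \<exists>x0 x1 x2. x = \<iota> x0 + \<iota> x1 * w + \<iota> x2 * z) \<and>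
    (\<forall>x0 x1 x2. \<iota> x0 + \<iota> x1 * w + \<iota> x2 * z = 0 \<longrightarrow> x0 = 0 \<and> x1 = 0 \<and> x2 = 0)"
proof -
  obtain p0 p1 p2 where p: "\<And>x. x = \<iota> (p0 x) + \<iota> (p1 x) * e1 + \<iota> (p2 x) * e2"
    using rep by metis
  have uniq: "p0 x = x0 \<and> p1 x = x1 \<and> p2 x = x2" if "x = \<iota> x0 + \<iota> x1 * e1 + \<iota> x2 * e2" for x x0 x1 x2
  proof -
    have "\<iota> (p0 x - x0) + \<iota> (p1 x - x1) * e1 + \<iota> (p2 x - x2) * e2 = 0"
      using p[of x] that by (simp add: \<iota>_diff algebra_simps)
    from indep[OF this] show ?thesis by simp
  qed
  have p_add: "p1 (x + y) = p1 x + p1 y \<and> p2 (x + y) = p2 x + p2 y" for x y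
  proof -
    have "x + y = \<iota> (p0 x + p0 y) + \<iota> (p1 x + p1 y) * e1 + \<iota> (p2 x + p2 y) * e2"
      unfolding \<iota>_add using arg_cong2[OF p[of x] p[of y], of "(+)"]
      by (simp only: algebra_simps)
    from uniq[OF this] show ?thesis by simp
  qed
  have p_scale: "p1 (\<iota> c * x) = c * p1 x \<and> p2 (\<iota> c * x) = c * p2 x" for c x
  proof -
    have "\<iota> c * x = \<iota> (c * p0 x) + \<iota> (c * p1 x) * e1 + \<iota> (c * p2 x) * e2"
      unfolding \<iota>_mult using arg_cong[OF p[of x], of "\<lambda>y. \<iota> c * y"] by (simp add: algebra_simps)
    from uniq[OF this] show ?thesis by simp
  qed
  have p_diff: "p1 (x - y) = p1 x - p1 y \<and> p2 (x - y) = p2 x - p2 y" for x y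
    using p_add[of "x - y" y] by simp
  \<comment> \<open>Finite generation of A enters here: the orders of the coordinates are bounded
    below on the generators, hence on A, so the minima exist.\<close>
  define B where "B = - (\<Sum>s\<in>S. \<bar>fls_subdegree (p1 s)\<bar> + \<bar>fls_subdegree (p2 s)\<bar>)"
  define ok where "ok c \<longleftrightarrow> (c \<noteq> 0 \<longrightarrow> B \<le> fls_subdegree c)" for c :: "'k fls"
  have ok_add: "ok (c + d)" if "ok c" "ok d" for c d
  proof -
    have "c + d \<noteq> 0 \<Longrightarrow> min (fls_subdegree c) (fls_subdegree d) \<le> fls_subdegree (c + d)"
      by (rule fls_plus_subdegree)
    then show ?thesis using that unfolding ok_def by (cases "c = 0"; cases "d = 0") auto
  qed
  have ok_scale: "ok (fl f * c)" if "ok c" for f c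
    using that fls_subdegree_fls_to_fps_gt0[of f] by (auto simp: ok_def)
  have ok_S: "ok (p1 s) \<and> ok (p2 s)" if "s \<in> S" for s
  proof -
    have "\<bar>fls_subdegree (p1 s)\<bar> + \<bar>fls_subdegree (p2 s)\<bar> \<le> - B"
      unfolding B_def using that fin by (auto intro!: member_le_sum[of s S "\<lambda>s. \<bar>fls_subdegree (p1 s)\<bar> + \<bar>fls_subdegree (p2 s)\<bar>"])
    then show ?thesis by (auto simp: ok_def)
  qed
  have p_0: "p1 0 = 0 \<and> p2 0 = 0" using uniq[of 0 0 0 0] by simp
  have ok_A: "ok (p1 x) \<and> ok (p2 x)" if "x \<in> A" for x
    using that unfolding fin(2)[symmetric]
  proof (induction rule: D.span_induct_alt)
    case base
    show ?case using p_0 by (simp add: ok_def)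
  next
    case (step c x y)
    then show ?case using ok_S p_add p_scale by (auto simp: Dscale_def Demb_def intro!: ok_add ok_scale)
  qed
  have minimal: "\<exists>x\<in>V. h x \<noteq> 0 \<and> (\<forall>y\<in>V. h y \<noteq> 0 \<longrightarrow> fls_subdegree (h x) \<le> fls_subdegree (h y))"
    if "\<exists>x\<in>V. h x \<noteq> 0" "\<And>x. x \<in> V \<Longrightarrow> ok (h x)" for V and h :: "'l \<Rightarrow> 'k fls"
  proof -
    from that(1) obtain x where x: "x \<in> V \<and> h x \<noteq> 0" by blast
    define m where "m x = nat (fls_subdegree (h x) - B)" for x
    obtain x where x: "x \<in> V \<and> h x \<noteq> 0" and min: "\<And>y. y \<in> V \<and> h y \<noteq> 0 \<Longrightarrow> m x \<le> m y"
      using ex_has_least_nat[of "\<lambda>x. x \<in> V \<and> h x \<noteq> 0" x m] x by blast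
    have "fls_subdegree (h x) \<le> fls_subdegree (h y)" if "y \<in> V" "h y \<noteq> 0" for y
      using min[of y] that \<open>\<And>x. x \<in> V \<Longrightarrow> ok (h x)\<close>[of x] \<open>\<And>x. x \<in> V \<Longrightarrow> ok (h x)\<close>[of y] x
      by (auto simp: m_def ok_def)
    with x show ?thesis by blast
  qed
  have t_inv: "\<exists>x\<in>A. \<exists>c. c \<noteq> 0 \<and> x = \<iota> c * e" for e
  proof -
    from integral_multiple[OF rep, of e] obtain s where "t ^ s * e \<in> A" by blast
    moreover have "t ^ s = \<iota> (fls_X ^ s)" by (simp add: t_elt_def Demb_def \<iota>_power)
    ultimately show ?thesis by (metis fls_X_nonzero power_not_zero)
  qed
  have p_e: "p1 e1 = 1" "p2 e1 = 0" "p2 e2 = 1"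
    using uniq[of e1 0 1 0] uniq[of e2 0 0 1] by simp_all
  have "\<exists>x\<in>A. p2 x \<noteq> 0"
  proof -
    from t_inv[of e2] obtain c where "\<iota> c * e2 \<in> A" "c \<noteq> 0" by blast
    then show ?thesis using p_scale[of c e2] p_e by (intro bexI[of _ "\<iota> c * e2"]) auto
  qed
  with minimal[of A p2] ok_A obtain z where z: "z \<in> A" "p2 z \<noteq> 0"
    "\<And>y. y \<in> A \<Longrightarrow> p2 y \<noteq> 0 \<Longrightarrow> fls_subdegree (p2 z) \<le> fls_subdegree (p2 y)" by blast
  have "\<exists>x\<in>{x\<in>A. p2 x = 0}. p1 x \<noteq> 0"
  proof -
    from t_inv[of e1] obtain c where "\<iota> c * e1 \<in> A" "c \<noteq> 0" by blast
    then show ?thesis using p_scale[of c e1] p_e by (intro bexI[of _ "\<iota> c * e1"]) auto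
  qed
  with minimal[of "{x\<in>A. p2 x = 0}" p1] ok_A obtain w where w: "w \<in> A" "p2 w = 0" "p1 w \<noteq> 0"
    "\<And>y. y \<in> A \<Longrightarrow> p2 y = 0 \<Longrightarrow> p1 y \<noteq> 0 \<Longrightarrow> fls_subdegree (p1 w) \<le> fls_subdegree (p1 y)" by blast
  have "\<exists>f0 f1 f2. x = \<delta> f0 + \<delta> f1 * w + \<delta> f2 * z" if "x \<in> A" for x
  proof -
    obtain f2 where f2: "p2 x = fl f2 * p2 z"
      using fls_eq_fps_times[OF z(2), of "p2 x"] z(3) \<open>x \<in> A\<close> by blast
    define y where "y = x - \<delta> f2 * z"
    have y: "y \<in> A" "p2 y = 0"
      using \<open>x \<in> A\<close> z f2 by (auto simp: y_def p_diff p_scale Demb_def[of \<iota> f2]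
        intro!: integral_add_mult A_ring \<delta>_in_A[unfolded Demb_def])
    obtain f1 where f1: "p1 y = fl f1 * p1 w"
      using fls_eq_fps_times[OF w(3), of "p1 y"] w(4) y by blast
    define u where "u = y - \<delta> f1 * w"
    have u: "u \<in> A" "p2 u = 0" "p1 u = 0"
      using y w f1 by (auto simp: u_def p_diff p_scale Demb_def[of \<iota> f1]
        intro!: integral_add_mult A_ring \<delta>_in_A[unfolded Demb_def])
    have "\<iota> (p0 u) * 1 \<in> A" using p[of u] u by simp
    from integral_fls[OF _ _ this] obtain g where "p0 u = fl g" by auto
    then have "u = \<delta> g" using p[of u] u by (simp add: Demb_def)
    then have "x = \<delta> g + \<delta> f1 * w + \<delta> f2 * z" by (simp add: u_def y_def algebra_simps)
    then show ?thesis by blast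
  qed
  moreover have "\<delta> f0 + \<delta> f1 * w + \<delta> f2 * z \<in> A" for f0 f1 f2
    using w z by (intro integral_add_mult) auto
  ultimately have "A = {\<delta> f0 + \<delta> f1 * w + \<delta> f2 * z | f0 f1 f2. True}" by blast
  moreover have "\<exists>x0 x1 x2. x = \<iota> x0 + \<iota> x1 * w + \<iota> x2 * z" for x
  proof -
    define x2 where "x2 = p2 x / p2 z"
    define x1 where "x1 = (p1 x - x2 * p1 z) / p1 w"
    define u where "u = x - \<iota> x2 * z - \<iota> x1 * w"
    have "p2 u = 0" "p1 u = 0" using z w by (simp_all add: u_def p_diff p_scale x1_def x2_def)
    then have "u = \<iota> (p0 u)" using p[of u] by simp
    then have "x = \<iota> (p0 u) + \<iota> x1 * w + \<iota> x2 * z" by (simp add: u_def algebra_simps)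
    then show ?thesis by blast
  qed
  moreover have "x0 = 0 \<and> x1 = 0 \<and> x2 = 0" if eq: "\<iota> x0 + \<iota> x1 * w + \<iota> x2 * z = 0" for x0 x1 x2
  proof -
    have p_x0: "p1 (\<iota> x0) = 0 \<and> p2 (\<iota> x0) = 0" using uniq[of "\<iota> x0" x0 0 0] by simp
    have "x2 * p2 z = 0" using arg_cong[OF eq, of p2] p_add p_scale w p_0 p_x0 by simp
    then have x2: "x2 = 0" using z by simp
    have "x1 * p1 w = 0" using arg_cong[OF eq, of p1] p_add p_scale w p_0 p_x0 x2 by simp
    then show ?thesis using w eq x2 by simp
  qed
  ultimately show ?thesis by blast
qed

end

section \<open>Cubic algebras and their index form\<close>

text \<open>A basis \<open>1, w, z\<close> of \<open>A\<close> in the normal form of Delone and Faddeev: the multiplication table is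
  governed by the binary cubic form \<open>aX\<^sup>3 + bX\<^sup>2Y + cXY\<^sup>2 + dY\<^sup>3\<close>, the index form of \<open>A\<close>.\<close>

locale cubic_order = fls_algebra \<iota>
  for \<iota> :: "'k::alg_closed_field fls \<Rightarrow> 'l::comm_ring_1" +
  fixes w z :: 'l and fa fb fc fd :: "'k fps"
  assumes rep: "\<exists>x0 x1 x2. x = \<iota> x0 + \<iota> x1 * w + \<iota> x2 * z"
    and indep: "\<iota> x0 + \<iota> x1 * w + \<iota> x2 * z = 0 \<Longrightarrow> x0 = 0 \<and> x1 = 0 \<and> x2 = 0"
    and A_eq: "A = {\<delta> f0 + \<delta> f1 * w + \<delta> f2 * z | f0 f1 f2. True}"
    and ww: "w * w = \<delta> (- fa * fc) + \<delta> fb * w - \<delta> fa * z"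
    and wz: "w * z = \<delta> (- fa * fd)"
    and zz: "z * z = \<delta> (- fb * fd) + \<delta> fd * w - \<delta> fc * z"
begin

definition E :: "'k fls \<Rightarrow> 'k fls \<Rightarrow> 'k fls \<Rightarrow> 'l"
  where "E x0 x1 x2 = \<iota> x0 + \<iota> x1 * w + \<iota> x2 * z"

definition el :: "'k fps \<Rightarrow> 'k fps \<Rightarrow> 'k fps \<Rightarrow> 'l"
  where "el x0 x1 x2 = \<delta> x0 + \<delta> x1 * w + \<delta> x2 * z"

lemma el_E: "el x0 x1 x2 = E (fl x0) (fl x1) (fl x2)"
  by (simp add: el_def E_def Demb_def)

lemma E_add: "E x0 x1 x2 + E y0 y1 y2 = E (x0 + y0) (x1 + y1) (x2 + y2)"
  and E_diff: "E x0 x1 x2 - E y0 y1 y2 = E (x0 - y0) (x1 - y1) (x2 - y2)"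
  and E_scale: "\<iota> c * E x0 x1 x2 = E (c * x0) (c * x1) (c * x2)"
  by (simp_all add: E_def \<iota>_add \<iota>_diff \<iota>_mult algebra_simps)

lemma E_inject [simp]: "E x0 x1 x2 = E y0 y1 y2 \<longleftrightarrow> x0 = y0 \<and> x1 = y1 \<and> x2 = y2"
proof
  assume "E x0 x1 x2 = E y0 y1 y2"
  then have "E (x0 - y0) (x1 - y1) (x2 - y2) = 0" by (simp flip: E_diff)
  from indep[OF this[unfolded E_def]] show "x0 = y0 \<and> x1 = y1 \<and> x2 = y2" by simp
qed simp

lemma E_ex: "\<exists>x0 x1 x2. x = E x0 x1 x2"
  using rep[of x] by (simp add: E_def)

lemma E_mult: "E x0 x1 x2 * E y0 y1 y2 =
  (let a = fl fa; b = fl fb; c = fl fc; d = fl fd in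
   E (x0 * y0 - a * c * (x1 * y1) - a * d * (x1 * y2 + x2 * y1) - b * d * (x2 * y2))
     (x0 * y1 + x1 * y0 + b * (x1 * y1) + d * (x2 * y2))
     (x0 * y2 + x2 * y0 - a * (x1 * y1) - c * (x2 * y2)))"
proof -
  let ?u = "\<iota> x0" and ?v = "\<iota> x1" and ?r = "\<iota> x2" and ?u' = "\<iota> y0" and ?v' = "\<iota> y1" and ?r' = "\<iota> y2"
  let ?a = "\<iota> (fl fa)" and ?b = "\<iota> (fl fb)" and ?c = "\<iota> (fl fc)" and ?d = "\<iota> (fl fd)"
  have "E x0 x1 x2 * E y0 y1 y2 = ?u * ?u' + (?u * ?v' + ?v * ?u') * w + (?u * ?r' + ?r * ?u') * z
      + ?v * ?v' * (w * w) + (?v * ?r' + ?r * ?v') * (w * z) + ?r * ?r' * (z * z)"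
    unfolding E_def by (simp only: algebra_simps)
  also have "\<dots> = ?u * ?u' + (?u * ?v' + ?v * ?u') * w + (?u * ?r' + ?r * ?u') * z
      + ?v * ?v' * (- (?a * ?c) + ?b * w - ?a * z) + (?v * ?r' + ?r * ?v') * (- (?a * ?d))
      + ?r * ?r' * (- (?b * ?d) + ?d * w - ?c * z)"
    unfolding ww wz zz by (simp add: Demb_def \<iota>_mult \<iota>_minus fls_times_fps_to_fls)
  also have "\<dots> = (?u * ?u' - ?a * ?c * (?v * ?v') - ?a * ?d * (?v * ?r' + ?r * ?v') - ?b * ?d * (?r * ?r'))
     + (?u * ?v' + ?v * ?u' + ?b * (?v * ?v') + ?d * (?r * ?r')) * w
     + (?u * ?r' + ?r * ?u' - ?a * (?v * ?v') - ?c * (?r * ?r')) * z"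
    by (simp add: algebra_simps)
  finally show ?thesis unfolding Let_def E_def by (simp only: \<iota>_add \<iota>_diff \<iota>_mult)
qed

lemma el_add: "el x0 x1 x2 + el y0 y1 y2 = el (x0 + y0) (x1 + y1) (x2 + y2)"
  and el_diff: "el x0 x1 x2 - el y0 y1 y2 = el (x0 - y0) (x1 - y1) (x2 - y2)"
  and el_scale: "\<delta> c * el x0 x1 x2 = el (c * x0) (c * x1) (c * x2)"
  by (simp_all add: el_def \<delta>_add \<delta>_diff \<delta>_mult algebra_simps)

lemma el_inject [simp]: "el x0 x1 x2 = el y0 y1 y2 \<longleftrightarrow> x0 = y0 \<and> x1 = y1 \<and> x2 = y2"
  by (simp add: el_E)

lemma el_mult: "el x0 x1 x2 * el y0 y1 y2 =
   el (x0 * y0 - fa * fc * (x1 * y1) - fa * fd * (x1 * y2 + x2 * y1) - fb * fd * (x2 * y2))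
     (x0 * y1 + x1 * y0 + fb * (x1 * y1) + fd * (x2 * y2))
     (x0 * y2 + x2 * y0 - fa * (x1 * y1) - fc * (x2 * y2))"
  by (simp add: el_E E_mult Let_def fls_times_fps_to_fls)

lemma el_in_A [simp, intro]: "el x0 x1 x2 \<in> A"
  unfolding A_eq el_def by blast

lemma A_ex: "x \<in> A \<Longrightarrow> \<exists>x0 x1 x2. x = el x0 x1 x2"
  unfolding A_eq el_def by blast

lemma el_special: "\<delta> f = el f 0 0" "w = el 0 1 0" "z = el 0 0 1" "1 = el 1 0 0" "0 = el 0 0 0"
  by (simp_all add: el_def)

lemma \<iota>_eq_E: "\<iota> f = E f 0 0"
  by (simp add: E_def)

lemma E_in_A_iff: "E x0 x1 x2 \<in> A \<longleftrightarrow>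
    (\<exists>f. x0 = fl f) \<and> (\<exists>f. x1 = fl f) \<and> (\<exists>f. x2 = fl f)"
proof
  assume "E x0 x1 x2 \<in> A"
  then obtain f0 f1 f2 where "E x0 x1 x2 = el f0 f1 f2" using A_ex by blast
  then show "(\<exists>f. x0 = fl f) \<and> (\<exists>f. x1 = fl f) \<and> (\<exists>f. x2 = fl f)"
    by (auto simp: el_E)
next
  assume "(\<exists>f. x0 = fl f) \<and> (\<exists>f. x1 = fl f) \<and> (\<exists>f. x2 = fl f)"
  then show "E x0 x1 x2 \<in> A" by (auto simp flip: el_E)
qed

lemma integral_cubic:
  assumes "x * x * x = \<delta> p * (x * x) + \<delta> q * x + \<delta> r"
  shows "x \<in> A"
proof -
  have "poly (map_poly \<delta> [:- r, - q, - p, 1:]) x = x * x * x - \<delta> p * (x * x) - \<delta> q * x - \<delta> r"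
    by (subst eval_eq_sum) (simp add: eval_nat_numeral \<delta>_minus algebra_simps)
  then have "poly (map_poly \<delta> [:- r, - q, - p, 1:]) x = 0" using assms by simp
  moreover have "lead_coeff [:- r, - q, - p, 1:] = 1" by simp
  ultimately show ?thesis unfolding integral_closure_def by blast
qed

text \<open>The exchange of basis elements has determinant -1, and besides exchanging its variables
  the index form changes by this sign. Every result on lattices led by \<open>w\<close> thus has a
  mirror image led by \<open>z\<close>.\<close>

lemma swap: "cubic_order \<iota> z w (- fd) (- fc) (- fb) (- fa)"
proof
  show "\<exists>x0 x1 x2. x = \<iota> x0 + \<iota> x1 * z + \<iota> x2 * w" for x
    using rep[of x] by (metis add.assoc add.commute)
  show "x0 = 0 \<and> x1 = 0 \<and> x2 = 0" if "\<iota> x0 + \<iota> x1 * z + \<iota> x2 * w = 0" for x0 x1 x2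
    using indep[of x0 x2 x1] that by (simp add: add_ac)
  have eq: "\<delta> f0 + \<delta> f1 * w + \<delta> f2 * z = \<delta> f0 + \<delta> f2 * z + \<delta> f1 * w" for f0 f1 f2
    by (simp add: add_ac)
  show "A = {\<delta> f0 + \<delta> f1 * z + \<delta> f2 * w | f0 f1 f2. True}"
    unfolding A_eq by (intro Collect_cong) (metis eq)
qed (simp_all add: ww zz wz \<delta>_minus mult_ac mult.commute[of z w])

text \<open>For the index form f, the coefficients of 1, T and T^2 in f(1, Y + T) are
  \<open>shift_a\<close>, \<open>shift_b\<close> and \<open>shift_c\<close>; that of T^3 is
  \<open>fd\<close>.\<close>

definition shift_a where "shift_a Y = fa + fb * Y + fc * Y\<^sup>2 + fd * Y ^ 3"
definition shift_b where "shift_b Y = fb + 2 * fc * Y + 3 * fd * Y\<^sup>2"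
definition shift_c where "shift_c Y = fc + 3 * fd * Y"

text \<open>The scalars added to w + Yz and to z are those that make the product of the two new
  basis elements a scalar again. The new index form is f(X1, Y X1 + X2).\<close>

lemma shift: "cubic_order \<iota> (el (fc * Y + fd * Y\<^sup>2) 1 Y) (el (- fd * Y) 0 1)
    (shift_a Y) (shift_b Y) (shift_c Y) fd" (is "cubic_order \<iota> ?w ?z _ _ _ _")
proof
  define y where "y = fl Y"
  define u where "u = fl (fc * Y + fd * Y\<^sup>2)"
  define v where "v = fl (- fd * Y)"
  have eq: "\<iota> x0 + \<iota> x1 * ?w + \<iota> x2 * ?z = E (x0 + x1 * u + x2 * v) x1 (x1 * y + x2)" for x0 x1 x2
    by (simp add: el_E u_def v_def y_def \<iota>_eq_E[of x0] E_scale E_add)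
  show "\<exists>x0 x1 x2. x = \<iota> x0 + \<iota> x1 * ?w + \<iota> x2 * ?z" for x
  proof -
    obtain x0 x1 x2 where "x = E x0 x1 x2" using E_ex by blast
    then show ?thesis unfolding eq
      by (intro exI[of _ "x0 - x1 * u - (x2 - x1 * y) * v"] exI[of _ x1] exI[of _ "x2 - x1 * y"]) simp
  qed
  show "x0 = 0 \<and> x1 = 0 \<and> x2 = 0" if "\<iota> x0 + \<iota> x1 * ?w + \<iota> x2 * ?z = 0" for x0 x1 x2
    using that unfolding eq \<iota>_0[symmetric] \<iota>_eq_E[of 0] by auto
  have eqd: "\<delta> x0 + \<delta> x1 * ?w + \<delta> x2 * ?z =
      el (x0 + x1 * (fc * Y + fd * Y\<^sup>2) - x2 * (fd * Y)) x1 (x1 * Y + x2)" for x0 x1 x2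
    by (simp add: el_special(1)[of x0] el_scale el_add)
  show "A = {\<delta> f0 + \<delta> f1 * ?w + \<delta> f2 * ?z | f0 f1 f2. True}"
  proof
    show "A \<subseteq> {\<delta> f0 + \<delta> f1 * ?w + \<delta> f2 * ?z | f0 f1 f2. True}"
    proof
      fix x assume "x \<in> A"
      then obtain x0 x1 x2 where "x = el x0 x1 x2" using A_ex by blast
      then have "x = \<delta> (x0 - x1 * (fc * Y + fd * Y\<^sup>2) + (x2 - x1 * Y) * (fd * Y)) + \<delta> x1 * ?w + \<delta> (x2 - x1 * Y) * ?z"
        unfolding eqd by simp
      then show "x \<in> {\<delta> f0 + \<delta> f1 * ?w + \<delta> f2 * ?z | f0 f1 f2. True}" by blast
    qed
  next
    show "{\<delta> f0 + \<delta> f1 * ?w + \<delta> f2 * ?z | f0 f1 f2. True} \<subseteq> A"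
      by (auto intro!: integral_add_mult)
  qed
  show "?w * ?w = \<delta> (- shift_a Y * shift_c Y) + \<delta> (shift_b Y) * ?w - \<delta> (shift_a Y) * ?z"
    "?w * ?z = \<delta> (- shift_a Y * fd)"
    "?z * ?z = \<delta> (- shift_b Y * fd) + \<delta> fd * ?w - \<delta> (shift_c Y) * ?z"
    unfolding el_special(1) el_scale el_mult el_add el_diff el_inject shift_a_def shift_b_def shift_c_def
    by (auto simp: algebra_simps power2_eq_square power3_eq_cube)
qed

end

text \<open>Subtracting scalars from w and z makes wz a scalar. Associativity of w w z and of w z z
  then determines the scalar parts of the whole multiplication table.\<close>

lemma (in fls_algebra) cubic_order_exists:
  assumes A_eq: "A = {\<delta> f0 + \<delta> f1 * w + \<delta> f2 * z | f0 f1 f2. True}"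
    and rep: "\<And>x. \<exists>x0 x1 x2. x = \<iota> x0 + \<iota> x1 * w + \<iota> x2 * z"
    and indep: "\<And>x0 x1 x2. \<iota> x0 + \<iota> x1 * w + \<iota> x2 * z = 0 \<Longrightarrow> x0 = 0 \<and> x1 = 0 \<and> x2 = 0"
  shows "\<exists>w z a b c d. cubic_order \<iota> w z a b c d"
proof -
  have wzA: "w \<in> A" "z \<in> A"
    unfolding A_eq by (intro CollectI exI[of _ 0] exI[of _ 1]; simp)+
  then obtain p q r where wz: "w * z = \<delta> p + \<delta> q * w + \<delta> r * z"
    using integral_add_mult(2)[of w z] unfolding A_eq by blast
  define w' z' where "w' = w - \<delta> r" and "z' = z - \<delta> q"
  define n where "n = p + q * r"
  have n: "w' * z' = \<delta> n"
    using wz by (simp add: w'_def z'_def n_def \<delta>_add \<delta>_mult algebra_simps)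
  have A': "\<exists>f0 f1 f2. x = \<delta> f0 + \<delta> f1 * w' + \<delta> f2 * z'" if "x \<in> A" for x
  proof -
    from that obtain f0 f1 f2 where "x = \<delta> f0 + \<delta> f1 * w + \<delta> f2 * z" unfolding A_eq by blast
    then have "x = \<delta> (f0 + f1 * r + f2 * q) + \<delta> f1 * w' + \<delta> f2 * z'"
      by (simp add: w'_def z'_def \<delta>_add \<delta>_mult algebra_simps)
    then show ?thesis by blast
  qed
  have wzA': "w' \<in> A" "z' \<in> A" using wzA A_ring by (auto simp: w'_def z'_def)
  have indep': "x0 = 0 \<and> x1 = 0 \<and> x2 = 0" if "\<iota> x0 + \<iota> x1 * w' + \<iota> x2 * z' = 0" for x0 x1 x2
  proof -
    have "\<iota> (x0 - x1 * fl r - x2 * fl q) + \<iota> x1 * w + \<iota> x2 * z = 0"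
      using that by (simp add: w'_def z'_def Demb_def \<iota>_diff \<iota>_add \<iota>_mult algebra_simps)
    from indep[OF this] show ?thesis by auto
  qed
  have uniq: "x0 = y0 \<and> x1 = y1 \<and> x2 = y2"
    if "\<delta> x0 + \<delta> x1 * w' + \<delta> x2 * z' = \<delta> y0 + \<delta> y1 * w' + \<delta> y2 * z'" for x0 x1 x2 y0 y1 y2
  proof -
    have "\<iota> (fl (x0 - y0)) + \<iota> (fl (x1 - y1)) * w' + \<iota> (fl (x2 - y2)) * z' = 0"
      using that unfolding Demb_def[symmetric] \<delta>_diff by (simp add: algebra_simps)
    from indep'[OF this] show ?thesis by simp
  qed
  obtain m b a' where ww: "w' * w' = \<delta> m + \<delta> b * w' + \<delta> a' * z'"
    using A'[OF integral_add_mult(2)[OF wzA'(1) wzA'(1)]] by blast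
  obtain l d c' where zz: "z' * z' = \<delta> l + \<delta> d * w' + \<delta> c' * z'"
    using A'[OF integral_add_mult(2)[OF wzA'(2) wzA'(2)]] by blast
  define a c where "a = - a'" and "c = - c'"
  have "w' * w' * z' = \<delta> (b * n + a' * l) + \<delta> (a' * d) * w' + \<delta> (m + a' * c') * z'"
  proof -
    have "w' * w' * z' = \<delta> m * z' + \<delta> b * (w' * z') + \<delta> a' * (z' * z')"
      unfolding ww by (simp add: algebra_simps)
    then show ?thesis unfolding n zz by (simp add: \<delta>_add \<delta>_mult algebra_simps)
  qed
  moreover have "w' * w' * z' = \<delta> 0 + \<delta> n * w' + \<delta> 0 * z'"
  proof -
    have "w' * w' * z' = w' * (w' * z')" by (simp add: mult_ac)
    then show ?thesis by (simp add: n mult.commute)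
  qed
  ultimately have 1: "m = - a' * c'" "n = a' * d" using uniq by (metis add_eq_0_iff2 mult_minus_left)+
  have "w' * (z' * z') = \<delta> (d * m + c' * n) + \<delta> (l + d * b) * w' + \<delta> (d * a') * z'"
  proof -
    have "w' * (z' * z') = \<delta> l * w' + \<delta> d * (w' * w') + \<delta> c' * (w' * z')"
      unfolding zz by (simp add: algebra_simps)
    then show ?thesis unfolding n ww by (simp add: \<delta>_add \<delta>_mult algebra_simps)
  qed
  moreover have "w' * (z' * z') = \<delta> 0 + \<delta> 0 * w' + \<delta> n * z'"
  proof -
    have "w' * (z' * z') = (w' * z') * z'" by (simp add: mult_ac)
    then show ?thesis by (simp add: n)
  qed
  ultimately have 2: "l = - d * b" using uniq by (metis add_eq_0_iff2 mult_minus_left)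
  have "cubic_order \<iota> w' z' a b c d"
  proof
    show "\<exists>x0 x1 x2. x = \<iota> x0 + \<iota> x1 * w' + \<iota> x2 * z'" for x
    proof -
      from rep[of x] obtain x0 x1 x2 where "x = \<iota> x0 + \<iota> x1 * w + \<iota> x2 * z" by blast
      then have "x = \<iota> (x0 + x1 * fl r + x2 * fl q) + \<iota> x1 * w' + \<iota> x2 * z'"
        by (simp add: w'_def z'_def Demb_def \<iota>_add \<iota>_mult algebra_simps)
      then show ?thesis by blast
    qed
    show "x0 = 0 \<and> x1 = 0 \<and> x2 = 0" if "\<iota> x0 + \<iota> x1 * w' + \<iota> x2 * z' = 0" for x0 x1 x2
      by (rule indep'[OF that])
    show "A = {\<delta> f0 + \<delta> f1 * w' + \<delta> f2 * z' | f0 f1 f2. True}"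
      using A' wzA' by (auto intro!: integral_add_mult)
    show "w' * w' = \<delta> (- a * c) + \<delta> b * w' - \<delta> a * z'" "w' * z' = \<delta> (- a * d)"
      "z' * z' = \<delta> (- b * d) + \<delta> d * w' - \<delta> c * z'"
      using ww zz n 1 2 by (simp_all add: a_def c_def \<delta>_minus mult_ac)
  qed
  then show ?thesis by blast
qed

lemma cubic_order_of_algebra:
  fixes \<iota> :: "'k::alg_closed_field fls \<Rightarrow> 'l::comm_ring_1"
  assumes "cubic_algebra \<iota>"
  shows "\<exists>w z a b c d. cubic_order \<iota> w z a b c d"
proof -
  interpret fls_algebra \<iota> using assms by unfold_locales (auto simp: cubic_algebra_def)
  have dim: "K.dim UNIV = 3" using assms by (simp add: cubic_algebra_def)
  obtain S where S: "finite S" "D.span S = A" using assms by (auto simp: cubic_algebra_def)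
  have "K.independent {1}" by (simp add: K.dependent_single)
  then obtain B where B: "{1} \<subseteq> B" "K.independent B" "UNIV \<subseteq> K.span B"
    using K.maximal_independent_subset_extend[of "{1}" UNIV] by (metis subset_UNIV)
  then have "K.span B = K.span UNIV" using K.span_mono[of B UNIV] by auto
  then have card: "card B = 3" using K.dim_eq_card[of B UNIV] B dim by simp
  then have fin: "finite B" by (simp add: card_ge_0_finite)
  have "card (B - {1}) = 2" using B card fin by simp
  then obtain e1 e2 where e: "B - {1} = {e1, e2}" "e1 \<noteq> e2" by (auto simp: card_2_iff)
  have Beq: "B = {1, e1, e2}" and ne: "e1 \<noteq> 1" "e2 \<noteq> 1" using e B by auto
  have rep: "\<exists>x0 x1 x2. x = \<iota> x0 + \<iota> x1 * e1 + \<iota> x2 * e2" for x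
  proof -
    have "x \<in> K.span B" using B by blast
    then obtain u where "x = (\<Sum>v\<in>B. Kscale \<iota> (u v) v)" using K.span_finite[OF fin] by auto
    then have "x = \<iota> (u 1) + \<iota> (u e1) * e1 + \<iota> (u e2) * e2"
      using e ne by (simp add: Beq Kscale_def add_ac)
    then show ?thesis by blast
  qed
  have indep: "x0 = 0 \<and> x1 = 0 \<and> x2 = 0" if "\<iota> x0 + \<iota> x1 * e1 + \<iota> x2 * e2 = 0" for x0 x1 x2
  proof -
    define u where "u v = (if v = 1 then x0 else if v = e1 then x1 else x2)" for v
    have "(\<Sum>v\<in>B. Kscale \<iota> (u v) v) = 0"
      using that e ne by (simp add: Beq u_def Kscale_def add_ac)
    from K.independentD[OF B(2) fin subset_refl this] have "u v = 0" if "v \<in> B" for v using that .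
    from this[of 1] this[of e1] this[of e2] show ?thesis using e ne by (auto simp: Beq u_def)
  qed
  from integral_basis[OF rep indep S] obtain w z where
    "A = {\<delta> f0 + \<delta> f1 * w + \<delta> f2 * z | f0 f1 f2. True}"
    "\<And>x. \<exists>x0 x1 x2. x = \<iota> x0 + \<iota> x1 * w + \<iota> x2 * z"
    "\<And>x0 x1 x2. \<iota> x0 + \<iota> x1 * w + \<iota> x2 * z = 0 \<Longrightarrow> x0 = 0 \<and> x1 = 0 \<and> x2 = 0" by blast
  then show ?thesis by (rule cubic_order_exists)
qed

subsection \<open>Norms\<close>

definition det3 :: "'a::comm_ring_1 \<Rightarrow> 'a \<Rightarrow> 'a \<Rightarrow> 'a \<Rightarrow> 'a \<Rightarrow> 'a \<Rightarrow> 'a \<Rightarrow> 'a \<Rightarrow> 'a \<Rightarrow> 'a"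
  where "det3 a1 a2 a3 b1 b2 b3 c1 c2 c3 =
    a1 * (b2 * c3 - b3 * c2) - a2 * (b1 * c3 - b3 * c1) + a3 * (b1 * c2 - b2 * c1)"

lemma det3_mult:
  "det3 (a1 * x1 + a2 * y1 + a3 * z1) (a1 * x2 + a2 * y2 + a3 * z2) (a1 * x3 + a2 * y3 + a3 * z3)
        (b1 * x1 + b2 * y1 + b3 * z1) (b1 * x2 + b2 * y2 + b3 * z2) (b1 * x3 + b2 * y3 + b3 * z3)
        (c1 * x1 + c2 * y1 + c3 * z1) (c1 * x2 + c2 * y2 + c3 * z2) (c1 * x3 + c2 * y3 + c3 * z3) =
   det3 a1 a2 a3 b1 b2 b3 c1 c2 c3 * det3 x1 x2 x3 y1 y2 y3 z1 z2 z3"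
  unfolding det3_def by (simp add: algebra_simps)

lemma det3_cong:
  assumes "a1 = a1'" "a2 = a2'" "a3 = a3'" "b1 = b1'" "b2 = b2'" "b3 = b3'" "c1 = c1'" "c2 = c2'" "c3 = c3'"
  shows "det3 a1 a2 a3 b1 b2 b3 c1 c2 c3 = det3 a1' a2' a3' b1' b2' b3' c1' c2' c3'"
  by (simp only: assms)

text \<open>The determinant of multiplication by \<open>x0 + x1 w + x2 z\<close>; the rows are its products with \<open>1, w, z\<close>.\<close>

definition norm_form :: "'a::comm_ring_1 \<Rightarrow> 'a \<Rightarrow> 'a \<Rightarrow> 'a \<Rightarrow> 'a \<Rightarrow> 'a \<Rightarrow> 'a \<Rightarrow> 'a"
  where "norm_form a b c d x0 x1 x2 = det3 x0 x1 x2
    (- a * c * x1 - a * d * x2) (x0 + b * x1) (- a * x1)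
    (- a * d * x1 - b * d * x2) (d * x2) (x0 - c * x2)"

text \<open>The matrix of a product is the product of the matrices. As an identity in every
  commutative ring it serves both D and K.\<close>

lemma norm_form_mult:
  "norm_form a b c d x0 x1 x2 * norm_form a b c d y0 y1 y2 = norm_form a b c d
    (x0 * y0 - a * c * (x1 * y1) - a * d * (x1 * y2 + x2 * y1) - b * d * (x2 * y2))
     (x0 * y1 + x1 * y0 + b * (x1 * y1) + d * (x2 * y2))
     (x0 * y2 + x2 * y0 - a * (x1 * y1) - c * (x2 * y2))"
  unfolding norm_form_def det3_mult[symmetric]
  by (rule det3_cong) (simp_all add: algebra_simps)

text \<open>The coefficients of the characteristic polynomial of \<open>x0 + x1 w + x2 z\<close>.\<close>

definition char1 where "char1 (a::'a::comm_ring_1) b c d x0 x1 x2 = 3 * x0 + b * x1 - c * x2"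
definition char2 where "char2 (a::'a::comm_ring_1) b c d x0 x1 x2 = 3 * x0\<^sup>2 + 2 * x0 * (b * x1 - c * x2)
    + a * c * x1\<^sup>2 + (3 * a * d - b * c) * x1 * x2 + b * d * x2\<^sup>2"

lemma norm_form_shift:
  "norm_form a b c d (x0 + s) x1 x2 =
    s ^ 3 + char1 a b c d x0 x1 x2 * s\<^sup>2 + char2 a b c d x0 x1 x2 * s + norm_form a b c d x0 x1 x2"
  unfolding norm_form_def det3_def char1_def char2_def
  by (simp add: algebra_simps power2_eq_square power3_eq_cube)

lemma norm_form_const: "norm_form a b c d x0 0 0 = x0 ^ 3"
  by (simp add: norm_form_def det3_def power3_eq_cube)

lemma norm_form_scale: "norm_form a b c d (s * x0) (s * x1) (s * x2) = s ^ 3 * norm_form a b c d x0 x1 x2"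
  unfolding norm_form_def det3_def by (simp add: algebra_simps power3_eq_cube)

lemma norm_form_cong0: "res (norm_form a b c d x0 x1 x2) =
    norm_form (res a) (res b) (res c) (res d) (res x0) (res x1) (res x2)"
  unfolding norm_form_def det3_def by simp

lemma fps_X_dvd_iff: "X dvd f \<longleftrightarrow> res f = 0"
proof
  assume "res f = 0"
  then have "f = X * fps_shift 1 f" by (intro fps_ext) simp
  then show "X dvd f" by (rule dvdI)
qed (auto simp: dvd_def)

lemma fps_X_factor: "res f = 0 \<Longrightarrow> \<exists>g. f = X * g"
  by (auto simp flip: fps_X_dvd_iff simp: dvd_def)

context cubic_order
begin

abbreviation "norm_fps \<equiv> norm_form fa fb fc fd"
abbreviation "norm_fls \<equiv> norm_form (fl fa) (fl fb) (fl fc) (fl fd)"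

lemma norm_fps_to_fls: "fl (norm_fps x0 x1 x2) = norm_fls (fl x0) (fl x1) (fl x2)"
  unfolding norm_form_def det3_def by (simp add: fls_times_fps_to_fls)

lemma cayley_hamilton:
  assumes "x = E x0 x1 x2"
  shows "x * x * x = \<iota> (char1 (fl fa) (fl fb) (fl fc) (fl fd) x0 x1 x2) * (x * x)
    - \<iota> (char2 (fl fa) (fl fb) (fl fc) (fl fd) x0 x1 x2) * x
    + \<iota> (norm_fls x0 x1 x2)"
  unfolding assms \<iota>_eq_E[of "norm_fls x0 x1 x2"]
  unfolding E_mult Let_def E_scale E_add E_diff E_inject char1_def char2_def norm_form_def det3_def
  by (auto simp: algebra_simps power2_eq_square power3_eq_cube)

text \<open>By the Cayley-Hamilton equation, x (x^2 - s1 x + s2) is the norm of x, and the second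
  factor lies in A.\<close>

lemma el_unit:
  assumes "res (norm_fps x0 x1 x2) \<noteq> 0"
  shows "\<exists>y\<in>A. el x0 x1 x2 * y = 1"
proof -
  let ?x = "el x0 x1 x2"
  let ?n = "norm_fps x0 x1 x2"
  define s1 where "s1 = char1 fa fb fc fd x0 x1 x2"
  define s2 where "s2 = char2 fa fb fc fd x0 x1 x2"
  have "?x * ?x * ?x = \<delta> s1 * (?x * ?x) - \<delta> s2 * ?x + \<delta> ?n"
  proof -
    have "fl s1 = char1 (fl fa) (fl fb) (fl fc) (fl fd) (fl x0) (fl x1) (fl x2)"
      by (simp add: s1_def char1_def fls_times_fps_to_fls)
    moreover have "fl s2 = char2 (fl fa) (fl fb) (fl fc) (fl fd) (fl x0) (fl x1) (fl x2)"
      by (simp add: s2_def char2_def fls_times_fps_to_fls power2_eq_square)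
    ultimately show ?thesis
      using cayley_hamilton[of ?x, OF el_E] by (simp add: Demb_def norm_fps_to_fls)
  qed
  then have "?x * (?x * ?x - \<delta> s1 * ?x + \<delta> s2) = \<delta> ?n" by (simp add: algebra_simps)
  then have "\<delta> (inverse ?n) * (?x * (?x * ?x - \<delta> s1 * ?x + \<delta> s2)) = \<delta> (inverse ?n * ?n)"
    by (simp only: \<delta>_mult)
  then have "?x * (\<delta> (inverse ?n) * (?x * ?x - \<delta> s1 * ?x + \<delta> s2)) = \<delta> (inverse ?n * ?n)"
    by (simp only: mult.left_commute)
  also have "inverse ?n * ?n = 1" using assms by (rule inverse_mult_eq_1)
  finally have "?x * (\<delta> (inverse ?n) * (?x * ?x - \<delta> s1 * ?x + \<delta> s2)) = 1" by simp
  moreover have "\<delta> (inverse ?n) * (?x * ?x - \<delta> s1 * ?x + \<delta> s2) \<in> A"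
    by (intro integral_add_mult A_ring) auto
  ultimately show ?thesis by blast
qed

lemma el_unit_norm:
  assumes "el x0 x1 x2 * y = 1" "y \<in> A"
  shows "res (norm_fps x0 x1 x2) \<noteq> 0"
proof -
  obtain y0 y1 y2 where y: "y = el y0 y1 y2" using A_ex[OF assms(2)] by blast
  have "norm_fps x0 x1 x2 * norm_fps y0 y1 y2 = norm_fps 1 0 0"
    using assms(1) unfolding y el_mult el_special(4) el_inject norm_form_mult by simp
  then have "res (norm_fps x0 x1 x2 * norm_fps y0 y1 y2) = 1" by (simp add: norm_form_const)
  then show ?thesis by auto
qed

lemma E_unit:
  assumes "norm_fls x0 x1 x2 \<noteq> 0"
  shows "\<exists>y. E x0 x1 x2 * y = 1"
proof -
  let ?x = "E x0 x1 x2"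
  from cayley_hamilton[of ?x] obtain s1 s2 where
    "?x * ?x * ?x = \<iota> s1 * (?x * ?x) - \<iota> s2 * ?x + \<iota> (norm_fls x0 x1 x2)" by blast
  then have "?x * (?x * ?x - \<iota> s1 * ?x + \<iota> s2) = \<iota> (norm_fls x0 x1 x2)" by (simp add: algebra_simps)
  then have "\<iota> (1 / norm_fls x0 x1 x2) * (?x * (?x * ?x - \<iota> s1 * ?x + \<iota> s2)) = \<iota> (1 / norm_fls x0 x1 x2 * norm_fls x0 x1 x2)"
    by (simp only: \<iota>_mult)
  then have "?x * (\<iota> (1 / norm_fls x0 x1 x2) * (?x * ?x - \<iota> s1 * ?x + \<iota> s2)) = 1"
    using assms by (simp add: mult.left_commute)
  then show ?thesis by blast
qed

text \<open>If all translates of \<open>x\<close> by constants have integral norm, so have the coefficients of the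
  characteristic polynomial of \<open>x\<close>, because \<open>k\<close> is infinite.\<close>

lemma integral_of_norms:
  assumes "\<And>c. \<exists>f. norm_fls (x0 + fls_const c) x1 x2 = fl f"
  shows "E x0 x1 x2 \<in> A"
proof -
  define s1 where "s1 = char1 (fl fa) (fl fb) (fl fc) (fl fd) x0 x1 x2"
  define s2 where "s2 = char2 (fl fa) (fl fb) (fl fc) (fl fd) x0 x1 x2"
  define s3 where "s3 = norm_fls x0 x1 x2"
  have zero: "fls_nth s1 i = 0 \<and> fls_nth s2 i = 0 \<and> fls_nth s3 i = 0" if i: "i < 0" for i
  proof -
    \<comment> \<open>At a fixed negative exponent the norm of the translate by c has this quadratic
      polynomial in c as coefficient, since c^3 contributes only to exponent 0. It vanishes for all
      c.\<close>
    define p where "p = [:fls_nth s3 i, fls_nth s2 i, fls_nth s1 i:]"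
    have "poly p c = 0" for c
    proof -
      from assms[of c] obtain f where f: "norm_fls (x0 + fls_const c) x1 x2 = fl f" by blast
      have "fls_const c ^ 3 + s1 * fls_const c ^ 2 + s2 * fls_const c + s3 = fl f"
        unfolding f[symmetric] norm_form_shift s1_def s2_def s3_def by simp
      then have "fls_nth (fls_const (c ^ 3) + fls_const (c ^ 2) * s1 + fls_const c * s2 + s3) i = fls_nth (fl f) i"
        by (simp add: fls_const_power mult.commute)
      then show ?thesis using i by (simp add: p_def power2_eq_square algebra_simps)
    qed
    then have "p = 0" using poly_roots_finite[of p] infinite_alg_closed by auto
    then show ?thesis by (simp add: p_def split: if_splits)
  qed
  have fps: "\<exists>f. s = fl f" if "\<And>i. i < 0 \<Longrightarrow> fls_nth s i = 0" for s :: "'k fls"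
  proof -
    have "0 \<le> fls_subdegree s" using that by (cases "s = 0") (auto intro: fls_subdegree_geI)
    then show ?thesis by (metis fls_regpart_to_fls_trivial)
  qed
  from fps[of s1] fps[of s2] fps[of s3] zero obtain f1 f2 f3 where
    f: "s1 = fl f1" "s2 = fl f2" "s3 = fl f3" by blast
  show ?thesis
    using cayley_hamilton[OF refl, of x0 x1 x2] f
    by (intro integral_cubic[of _ f1 "- f2" f3]) (simp add: Demb_def \<iota>_minus s1_def s2_def s3_def)
qed

subsection \<open>Consequences of integral closedness\<close>

lemma divided_basis_not_integral: "\<iota> (inverse fls_X) * w \<notin> A"
proof
  assume "\<iota> (inverse fls_X) * w \<in> A"
  moreover have "\<iota> (inverse fls_X) * w = E 0 (inverse fls_X) 0" by (simp add: E_def)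
  ultimately obtain f :: "'k fps" where "inverse fls_X = fl f" by (auto simp: E_in_A_iff)
  then have "fls_subdegree (inverse fls_X :: 'k fls) = int (subdegree f)" by (simp add: fls_subdegree_fls_to_fps)
  then show False by simp
qed

text \<open>Since w^3 = fb w^2 - fa fc w + fa^2 fd, these divisibilities would make w/t
  integral.\<close>

lemma divided_basis_cubic:
  assumes "fb = X * b'" "fa * fc = X ^ 2 * m'" "fa\<^sup>2 * fd = X ^ 3 * n'"
  shows False
proof -
  let ?i = "inverse fls_X :: 'k fls"
  let ?x = "E 0 ?i 0"
  have i: "fls_X * ?i = 1" by simp
  have "?x * ?x * ?x = \<delta> b' * (?x * ?x) + \<delta> (- m') * ?x + \<delta> n'"
  proof -
    have b: "fl fb = fls_X * fl b'" using assms(1) by (simp add: fls_times_fps_to_fls)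
    have m: "fl fa * fl fc = fls_X ^ 2 * fl m'"
      using arg_cong[OF assms(2), of fl] by (simp add: fls_times_fps_to_fls fps_to_fls_power)
    have n: "fl fa * fl fa * fl fd = fls_X ^ 3 * fl n'"
      using arg_cong[OF assms(3), of fl]
      by (simp add: fls_times_fps_to_fls fps_to_fls_power power2_eq_square)
    have b: "fl b' = fl fb * ?i" unfolding b by (simp add: mult_ac)
    have m: "fl m' = fl fa * fl fc * ?i\<^sup>2"
      unfolding m by (simp add: mult_ac power_mult_distrib[symmetric])
    have n: "fl n' = fl fa * fl fa * fl fd * ?i ^ 3"
      unfolding n by (simp add: mult_ac power_mult_distrib[symmetric])
    have n': "\<delta> n' = E (fl fa * fl fa * fl fd * ?i ^ 3) 0 0"
      by (simp only: Demb_def n \<iota>_eq_E)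
    show ?thesis
      unfolding n' unfolding Demb_def E_mult Let_def fps_to_fls_uminus b m E_scale E_add E_inject
      by (simp add: algebra_simps power2_eq_square power3_eq_cube)
  qed
  then have "?x \<in> A" by (rule integral_cubic)
  moreover have "?x = \<iota> ?i * w" by (simp add: E_def)
  ultimately show False using divided_basis_not_integral by simp
qed

lemma form_nonzero:
  "\<not> (res fa = 0 \<and> res fb = 0 \<and> res fc = 0 \<and> res fd = 0)"
proof
  assume "res fa = 0 \<and> res fb = 0 \<and> res fc = 0 \<and> res fd = 0"
  then obtain a b c d where abcd: "fa = X * a" "fb = X * b" "fc = X * c" "fd = X * d"
    by (auto simp flip: fps_X_dvd_iff simp: dvd_def)
  show False
    by (rule divided_basis_cubic[of b "a * c" "a\<^sup>2 * d"])
      (simp_all add: abcd power2_eq_square power3_eq_cube mult_ac)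
qed

text \<open>Here maximality of A is put to work: if f(1, Y) has a multiple root modulo t at 0, its
  value there has order exactly 1. After \<open>shift\<close> the same holds at every multiple
  root.\<close>

lemma form_not_double: "\<not> (X ^ 2 dvd fa \<and> X dvd fb)"
proof
  assume "X ^ 2 dvd fa \<and> X dvd fb"
  then obtain a b where ab: "fa = X ^ 2 * a" "fb = X * b" by (auto simp: dvd_def)
  show False
    by (rule divided_basis_cubic[of b "a * fc" "X * (a\<^sup>2 * fd)"])
      (simp_all add: ab power2_eq_square power3_eq_cube mult_ac)
qed

end

section \<open>The Zariski topology in terms of frames\<close>

context graded_zariski
begin

text \<open>A ratio of functions of equal degree, hence in the application independent of the chosen
  frames; a single fraction describes it on the whole space.\<close>

definition regular :: "('p \<Rightarrow> 'k) \<Rightarrow> bool"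
  where "regular r \<longleftrightarrow> (\<exists>m. \<exists>q\<in>P m. \<exists>p\<in>P m. \<forall>x\<in>topspace T. p x \<noteq> 0 \<and> r x = q x / p x)"

lemma regular_const: "regular (\<lambda>_. c)"
  unfolding regular_def by (intro exI[of _ 0] bexI[OF _ const[of c]] bexI[OF _ const[of 1]]) auto

lemma regular_add:
  assumes "regular r" "regular s"
  shows "regular (\<lambda>x. r x + s x)"
proof -
  from assms obtain m q p m' q' p' where
    "q \<in> P m" "p \<in> P m" "\<And>x. x \<in> topspace T \<Longrightarrow> p x \<noteq> 0 \<and> r x = q x / p x"
    "q' \<in> P m'" "p' \<in> P m'" "\<And>x. x \<in> topspace T \<Longrightarrow> p' x \<noteq> 0 \<and> s x = q' x / p' x"
    unfolding regular_def by metis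
  moreover from this have "(\<lambda>x. q x * p' x + p x * q' x) \<in> P (m + m')" "(\<lambda>x. p x * p' x) \<in> P (m + m')"
    by (auto intro!: add mult)
  ultimately show ?thesis unfolding regular_def
    by (intro exI[of _ "m + m'"] bexI[of _ "\<lambda>x. q x * p' x + p x * q' x"] bexI[of _ "\<lambda>x. p x * p' x"])
      (auto simp: field_simps)
qed

lemma regular_mult:
  assumes "regular r" "regular s"
  shows "regular (\<lambda>x. r x * s x)"
proof -
  from assms obtain m q p m' q' p' where
    "q \<in> P m" "p \<in> P m" "\<And>x. x \<in> topspace T \<Longrightarrow> p x \<noteq> 0 \<and> r x = q x / p x"
    "q' \<in> P m'" "p' \<in> P m'" "\<And>x. x \<in> topspace T \<Longrightarrow> p' x \<noteq> 0 \<and> s x = q' x / p' x"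
    unfolding regular_def by metis
  moreover from this have "(\<lambda>x. q x * q' x) \<in> P (m + m')" "(\<lambda>x. p x * p' x) \<in> P (m + m')"
    by (auto intro!: mult)
  ultimately show ?thesis unfolding regular_def
    by (intro exI[of _ "m + m'"] bexI[of _ "\<lambda>x. q x * q' x"] bexI[of _ "\<lambda>x. p x * p' x"])
      (auto simp: field_simps)
qed

lemma regular_sum: "(\<And>i. i \<in> I \<Longrightarrow> regular (r i)) \<Longrightarrow> regular (\<lambda>x. \<Sum>i\<in>I. r i x)"
  by (induction I rule: infinite_finite_induct) (auto intro: regular_const regular_add)

lemma regular_inverse:
  assumes "regular r" "\<And>x. x \<in> topspace T \<Longrightarrow> r x \<noteq> 0"
  shows "regular (\<lambda>x. inverse (r x))"
proof -
  from assms(1) obtain m q p where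
    "q \<in> P m" "p \<in> P m" "\<And>x. x \<in> topspace T \<Longrightarrow> p x \<noteq> 0 \<and> r x = q x / p x"
    unfolding regular_def by metis
  then show ?thesis unfolding regular_def using assms(2)
    by (intro exI[of _ m] bexI[of _ p] bexI[of _ q]) auto
qed

lemma regular_closed_zero:
  assumes "regular r"
  shows "closedin T {x\<in>topspace T. r x = 0}"
proof -
  from assms obtain m q p where
    q: "q \<in> P m" "\<And>x. x \<in> topspace T \<Longrightarrow> p x \<noteq> 0 \<and> r x = q x / p x"
    unfolding regular_def by metis
  then have "{x\<in>topspace T. r x = 0} = {x\<in>topspace T. q x = 0}" by auto
  then show ?thesis using closed_zero[OF q(1)] by simp
qed

lemma regular_poly_fun:
  assumes "f \<in> poly_fun m" "\<And>i. i < m \<Longrightarrow> regular (\<lambda>x. y x i)"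
  shows "regular (\<lambda>x. f (y x))"
  using assms by induction (auto intro: regular_const regular_add regular_mult)

definition regular_fps :: "('p \<Rightarrow> 'k fps) \<Rightarrow> bool"
  where "regular_fps f \<longleftrightarrow> (\<forall>i. regular (\<lambda>x. fps_nth (f x) i))"

lemma regular_fps_const: "regular_fps (\<lambda>_. c)"
  by (simp add: regular_fps_def regular_const)

lemma regular_fps_add: "regular_fps f \<Longrightarrow> regular_fps g \<Longrightarrow> regular_fps (\<lambda>x. f x + g x)"
  by (simp add: regular_fps_def regular_add)

lemma regular_fps_mult: "regular_fps f \<Longrightarrow> regular_fps g \<Longrightarrow> regular_fps (\<lambda>x. f x * g x)"
  by (simp add: regular_fps_def fps_mult_nth regular_mult regular_sum)

lemma regular_fps_minus: "regular_fps f \<Longrightarrow> regular_fps (\<lambda>x. - f x)"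
  using regular_fps_mult[OF regular_fps_const[of "- 1"], of f] by simp

lemma regular_fps_diff: "regular_fps f \<Longrightarrow> regular_fps g \<Longrightarrow> regular_fps (\<lambda>x. f x - g x)"
  using regular_fps_add[OF _ regular_fps_minus, of f g] by simp

lemma regular_fps_shift: "regular_fps f \<Longrightarrow> regular_fps (\<lambda>x. fps_shift n (f x))"
  by (simp add: regular_fps_def)

text \<open>The coefficients of the inverse satisfy a recursion in which the only division is by the
  constant term.\<close>

lemma regular_fps_inverse:
  assumes f: "regular_fps f" "\<And>x. x \<in> topspace T \<Longrightarrow> res (f x) \<noteq> 0"
  shows "regular_fps (\<lambda>x. inverse (f x))"
  unfolding regular_fps_def
proof
  fix n
  have inv0: "regular (\<lambda>x. inverse (res (f x)))"
    using f by (intro regular_inverse) (auto simp: regular_fps_def)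
  show "regular (\<lambda>x. fps_nth (inverse (f x)) n)"
  proof (induction n rule: less_induct)
    case (less n)
    show ?case
    proof (cases n)
      case 0
      then show ?thesis using inv0 by simp
    next
      case (Suc m)
      have "fps_nth (inverse (f x)) n =
          - inverse (res (f x)) * (\<Sum>i=1..n. fps_nth (f x) i * fps_nth (inverse (f x)) (n - i))" for x
        using Suc by (simp add: fps_inverse_def)
      moreover have "regular (\<lambda>x. - 1 * inverse (res (f x)) * (\<Sum>i=1..n. fps_nth (f x) i * fps_nth (inverse (f x)) (n - i)))"
        using f(1) by (intro regular_mult regular_sum regular_const inv0 less.IH) (auto simp: regular_fps_def)
      ultimately show ?thesis by simp
    qed
  qed
qed

end

section \<open>Frames, base change and Pluecker coordinates\<close>

context fls_algebra
begin

definition k_linear :: "('l \<Rightarrow> 'k) \<Rightarrow> bool"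
  where "k_linear e \<longleftrightarrow> Vector_Spaces.linear (kscale \<iota>) (*) e"

lemma k_linear_simps:
  assumes "k_linear e"
  shows "e (x + y) = e x + e y" "e (x - y) = e x - e y" "e (kscale \<iota> c x) = c * e x"
    "e (sum f I) = (\<Sum>i\<in>I. e (f i))" "e 0 = 0"
proof -
  interpret l: Vector_Spaces.linear "kscale \<iota>" "(*)" e using assms by (simp add: k_linear_def)
  show "e (x + y) = e x + e y" "e (x - y) = e x - e y" "e (kscale \<iota> c x) = c * e x"
    "e (sum f I) = (\<Sum>i\<in>I. e (f i))" "e 0 = 0"
    by (simp_all add: l.add l.diff l.scale l.sum l.zero)
qed

lemma k_linearI:
  assumes "\<And>x y. e (x + y) = e x + e y" "\<And>c x. e (kscale \<iota> c x) = c * e x"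
  shows "k_linear e"
  unfolding k_linear_def
  by unfold_locales (simp_all add: assms algebra_simps)

abbreviation "lincomb c v d \<equiv> \<Sum>i<(d::nat). kscale \<iota> (c i) (v i)"

lemma frame_span:
  assumes "frame \<iota> W U d v" "u \<in> U"
  shows "\<exists>c. u - lincomb c v d \<in> W"
  using assms unfolding frame_def by blast

lemma frame_indep:
  assumes fr: "frame \<iota> W U d v" and W: "k.subspace W" and U: "k.subspace U"
    and c: "lincomb c v d \<in> W" and "i < d"
  shows "c i = 0"
proof -
  have "0 \<in> U" using U by (rule k.subspace_0)
  then have ex1: "\<exists>!c. c \<in> extensional {..<d} \<and> 0 - lincomb c v d \<in> W"
    using fr unfolding frame_def by blast
  have "lincomb (restrict c {..<d}) v d = lincomb c v d" by (intro sum.cong) auto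
  then have "restrict c {..<d} \<in> extensional {..<d} \<and> 0 - lincomb (restrict c {..<d}) v d \<in> W"
    using k.subspace_neg[OF W c] by auto
  moreover have "lincomb (restrict (\<lambda>_. 0) {..<d}) v d = 0" by (intro sum.neutral) auto
  then have "restrict (\<lambda>_. 0) {..<d} \<in> extensional {..<d} \<and> 0 - lincomb (restrict (\<lambda>_. 0) {..<d}) v d \<in> W"
    using k.subspace_0[OF W] by simp
  ultimately have "restrict c {..<d} = restrict (\<lambda>_. 0) {..<d}" using ex1 by blast
  then have "restrict c {..<d} i = restrict (\<lambda>_. 0) {..<d} i" by simp
  with \<open>i < d\<close> show ?thesis by simp
qed

lemma frameI:
  assumes v: "\<And>i. i < d \<Longrightarrow> v i \<in> U" and span: "\<And>u. u \<in> U \<Longrightarrow> \<exists>c. u - lincomb c v d \<in> W"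
    and indep: "\<And>c i. lincomb c v d \<in> W \<Longrightarrow> i < d \<Longrightarrow> c i = 0" and W: "k.subspace W"
  shows "frame \<iota> W U d v"
  unfolding frame_def
proof (intro conjI allI impI ballI)
  fix u assume "u \<in> U"
  from span[OF this] obtain c where c: "u - lincomb c v d \<in> W" by blast
  have eq: "lincomb (restrict c {..<d}) v d = lincomb c v d" by (intro sum.cong) auto
  show "\<exists>!c. c \<in> extensional {..<d} \<and> u - lincomb c v d \<in> W"
  proof (rule ex1I[of _ "restrict c {..<d}"])
    show "restrict c {..<d} \<in> extensional {..<d} \<and> u - lincomb (restrict c {..<d}) v d \<in> W"
      using c eq by simp
    fix c' assume c': "c' \<in> extensional {..<d} \<and> u - lincomb c' v d \<in> W"
    have "lincomb (\<lambda>i. c i - c' i) v d = (u - lincomb c' v d) - (u - lincomb c v d)"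
      by (simp add: k.scale_left_diff_distrib sum_subtractf)
    also have "\<dots> \<in> W" using k.subspace_diff[OF W conjunct2[OF c'] c] .
    finally have "c i = c' i" if "i < d" for i using indep that by fastforce
    then show "c' = restrict c {..<d}" using c' by (auto simp: extensional_def)
  qed
qed (use v in auto)

lemma frame_card_unique:
  assumes "frame \<iota> W U d v" "frame \<iota> W U d' v'" and W: "k.subspace W" and U: "k.subspace U"
  shows "d = d'"
proof -
  have le: "d' \<le> d" if fr: "frame \<iota> W U d v" and fr': "frame \<iota> W U d' v'" for d v d' v'
  proof (rule ccontr)
    assume "\<not> d' \<le> d"
    have "v' j \<in> U" if "j < d'" for j using fr' that by (simp add: frame_def)
    then have "\<exists>c. v' j - lincomb c v d \<in> W" if "j < d'" for j using frame_span[OF fr] that by blast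
    then obtain c where c: "\<And>j. j < d' \<Longrightarrow> v' j - lincomb (c j) v d \<in> W" by metis
    from exists_linear_relation[of "{..<d}" "{..<d'}" c] \<open>\<not> d' \<le> d\<close> obtain a where
      a: "\<exists>j<d'. a j \<noteq> 0" "\<And>i. i < d \<Longrightarrow> (\<Sum>j<d'. a j * c j i) = 0" by auto
    have "(\<Sum>j<d'. kscale \<iota> (a j) (lincomb (c j) v d)) = lincomb (\<lambda>i. \<Sum>j<d'. a j * c j i) v d"
      unfolding k.scale_sum_right k.scale_sum_left k.scale_scale by (rule sum.swap)
    also have "\<dots> = 0" using a(2) by simp
    finally have "lincomb a v' d' = (\<Sum>j<d'. kscale \<iota> (a j) (v' j - lincomb (c j) v d))"
      by (simp add: k.scale_right_diff_distrib sum_subtractf)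
    also have "\<dots> \<in> W" using c by (intro k.subspace_sum[OF W] k.subspace_scale[OF W]) auto
    finally show False using frame_indep[OF fr' W U] a(1) by blast
  qed
  show ?thesis using le[OF assms(1,2)] le[OF assms(2,1)] by simp
qed

text \<open>The factor \<open>\<rho>\<close> is the determinant of the base change.\<close>

lemma frame_change:
  assumes fr: "frame \<iota> W U d v" "frame \<iota> W U d v'" and W: "k.subspace W" and U: "k.subspace U"
  shows "\<exists>\<rho>. \<rho> \<noteq> 0 \<and> (\<forall>m f. plucker_form \<iota> W d m f \<longrightarrow> f v' = \<rho> ^ m * f v)"
proof -
  have ex: "\<exists>g. \<forall>j<d. y j - (\<Sum>i<d. kscale \<iota> (g i j) (x i)) \<in> W"
    if "frame \<iota> W U d x" "frame \<iota> W U d y" for x y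
  proof -
    have "y j \<in> U" if "j < d" for j using \<open>frame \<iota> W U d y\<close> that by (simp add: frame_def)
    then have "\<exists>c. y j - lincomb c x d \<in> W" if "j < d" for j
      using frame_span[OF \<open>frame \<iota> W U d x\<close>] that by blast
    then obtain c where "\<And>j. j < d \<Longrightarrow> y j - lincomb (c j) x d \<in> W" by metis
    then show ?thesis by (intro exI[of _ "\<lambda>i j. c j i"]) simp
  qed
  obtain g where g: "\<And>j. j < d \<Longrightarrow> v' j - (\<Sum>i<d. kscale \<iota> (g i j) (v i)) \<in> W" using ex[OF fr] by blast
  obtain g' where g': "\<And>j. j < d \<Longrightarrow> v j - (\<Sum>i<d. kscale \<iota> (g' i j) (v' i)) \<in> W"
    using ex[OF fr(2,1)] by blast
  define G where "G = mat d d (\<lambda>(i, j). g i j)"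
  define G' where "G' = mat d d (\<lambda>(i, j). g' i j)"
  have G: "G \<in> carrier_mat d d" "G' \<in> carrier_mat d d" by (simp_all add: G_def G'_def)
  \<comment> \<open>The base change matrices in the two directions are inverse to each other because
    the frame members are independent modulo \<open>W\<close>.\<close>
  have prod: "(\<Sum>l<d. g i l * g' l j) = (if i = j then 1 else 0)" if ij: "i < d" "j < d" for i j
  proof -
    define c where "c i = (\<Sum>l<d. g i l * g' l j) - (if i = j then 1 else 0)" for i
    have "(\<Sum>i<d. kscale \<iota> (if i = j then 1 else 0) (v i)) = (\<Sum>i<d. if i = j then v i else 0)"
      by (intro sum.cong) auto
    then have vj: "(\<Sum>i<d. kscale \<iota> (if i = j then 1 else 0) (v i)) = v j" using ij by simp
    have "(\<Sum>i<d. kscale \<iota> (\<Sum>l<d. g i l * g' l j) (v i)) = (\<Sum>l<d. kscale \<iota> (g' l j) (\<Sum>i<d. kscale \<iota> (g i l) (v i)))"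
      unfolding k.scale_sum_right k.scale_sum_left k.scale_scale by (subst sum.swap) (simp add: mult.commute)
    then have "lincomb c v d = (\<Sum>l<d. kscale \<iota> (g' l j) (\<Sum>i<d. kscale \<iota> (g i l) (v i))) - v j"
      unfolding c_def k.scale_left_diff_distrib sum_subtractf vj by simp
    also have "\<dots> = - ((\<Sum>l<d. kscale \<iota> (g' l j) (v' l - (\<Sum>i<d. kscale \<iota> (g i l) (v i))))
        + (v j - (\<Sum>l<d. kscale \<iota> (g' l j) (v' l))))"
      by (simp add: k.scale_right_diff_distrib sum_subtractf)
    also have "\<dots> \<in> W"
      using g g' ij by (intro k.subspace_neg[OF W] k.subspace_add[OF W] k.subspace_sum[OF W] k.subspace_scale[OF W]) auto
    finally have "c i = 0" using frame_indep[OF fr(1) W U] ij by blast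
    then show ?thesis by (simp add: c_def)
  qed
  have "G * G' = 1\<^sub>m d"
    using prod by (intro eq_matI) (simp_all add: G_def G'_def scalar_prod_def atLeast0LessThan)
  then have "det G * det G' = 1" using det_mult[OF G] by simp
  then have "det G \<noteq> 0" by auto
  moreover have "f v' = det G ^ m * f v" if "plucker_form \<iota> W d m f" for m f
    using that
  proof induction
    case (coord e)
    let ?M = "mat d d (\<lambda>(i, j). e i (v j))"
    have lin: "k_linear (e i)" if "i < d" for i using coord that by (simp add: k_linear_def)
    have "e i (v' j) = (\<Sum>l<d. e i (v l) * g l j)" if ij: "i < d" "j < d" for i j
    proof -
      have "e i (v' j - (\<Sum>l<d. kscale \<iota> (g l j) (v l))) = 0" using g ij coord by blast
      then have "e i (v' j) = (\<Sum>l<d. g l j * e i (v l))" by (simp add: k_linear_simps[OF lin] ij)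
      then show ?thesis by (simp add: mult.commute)
    qed
    then have "mat d d (\<lambda>(i, j). e i (v' j)) = ?M * G"
      by (intro eq_matI) (simp_all add: G_def scalar_prod_def atLeast0LessThan)
    then show ?case using det_mult[of ?M d G] G by (simp add: mult.commute)
  qed (simp_all add: power_add algebra_simps)
  ultimately show ?thesis by blast
qed

definition coordinates :: "('l \<Rightarrow> 'k) set \<Rightarrow> 'l set \<Rightarrow> 'l set \<Rightarrow> bool"
  where "coordinates B V W \<longleftrightarrow> (\<forall>e\<in>B. k_linear e \<and> (\<forall>x\<in>W. e x = 0)) \<and>
    (\<forall>x\<in>V. (\<forall>e\<in>B. e x = 0) \<longrightarrow> x \<in> W)"

text \<open>Gauss-Jordan elimination, one pivot at a time: the next frame member is non-zero modulo
  \<open>W\<close>, so some form in \<open>B\<close> does not vanish on it. Pivots from a finite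
  \<open>B\<close> will divide a Grassmannian into finitely many pieces.\<close>

lemma reduced_frame:
  assumes fr: "frame \<iota> W U d v" and W: "k.subspace W" and U: "k.subspace U"
    and B: "coordinates B V W" and "U \<subseteq> V"
  shows "\<exists>v' \<psi>. frame \<iota> W U d v' \<and> (\<forall>i<d. \<psi> i \<in> B) \<and> (\<forall>i<d. \<forall>j<d. \<psi> i (v' j) = (if i = j then 1 else 0))"
proof -
  have lin: "k_linear e" if "e \<in> B" for e using B that by (simp add: coordinates_def)
  have sep: "x \<in> W" if "x \<in> U" "\<And>e. e \<in> B \<Longrightarrow> e x = 0" for x
    using B that \<open>U \<subseteq> V\<close> unfolding coordinates_def by blast
  have "\<exists>v' \<psi>. frame \<iota> W U d v' \<and> (\<forall>i<s. \<psi> i \<in> B) \<and> (\<forall>i<s. \<forall>j<d. \<psi> i (v' j) = (if i = j then 1 else 0))"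
    if "s \<le> d" for s
    using that
  proof (induction s)
    case 0
    then show ?case using fr by blast
  next
    case (Suc s)
    then obtain v' \<psi> where v': "frame \<iota> W U d v'" "\<forall>i<s. \<psi> i \<in> B"
      "\<forall>i<s. \<forall>j<d. \<psi> i (v' j) = (if i = j then 1 else 0)" by auto
    have s: "s < d" using Suc.prems by simp
    have vU: "v' i \<in> U" if "i < d" for i using v'(1) that by (simp add: frame_def)
    have lin_ex: "lincomb (\<lambda>i. if i = s then 1 else 0) v' d = v' s"
    proof -
      have "lincomb (\<lambda>i. if i = s then 1 else 0) v' d = (\<Sum>i<d. if i = s then v' i else 0)"
        by (intro sum.cong) auto
      then show ?thesis using s by simp
    qed
    have "v' s \<notin> W" using frame_indep[OF v'(1) W U, of "\<lambda>i. if i = s then 1 else 0" s] s lin_ex by auto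
    with sep[OF vU[OF s]] obtain e where e: "e \<in> B" "e (v' s) \<noteq> 0" by blast
    define x where "x = kscale \<iota> (1 / e (v' s)) (v' s)"
    define v'' where "v'' j = (if j = s then x else v' j - kscale \<iota> (e (v' j)) x)" for j
    have xU: "x \<in> U" unfolding x_def using vU s by (intro k.subspace_scale[OF U]) auto
    have v's: "v' s = kscale \<iota> (e (v' s)) x" using e(2) by (simp add: x_def)
    have fr'': "frame \<iota> W U d v''"
    proof (rule frameI[OF _ _ _ W])
      show "v'' i \<in> U" if "i < d" for i unfolding v''_def
        using vU[OF that] xU by (auto intro: k.subspace_diff[OF U] k.subspace_scale[OF U])
      have lin_v'': "lincomb c v'' d = lincomb c v' d - kscale \<iota> ((\<Sum>i<d. c i * e (v' i)) - c s) x" for c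
      proof -
        have "lincomb c v'' d = (\<Sum>i<d. kscale \<iota> (c i) (v' i) - kscale \<iota> (c i * e (v' i)) x
            + (if i = s then kscale \<iota> (c s) x else 0))"
        proof (intro sum.cong refl)
          fix i
          show "kscale \<iota> (c i) (v'' i) = kscale \<iota> (c i) (v' i) - kscale \<iota> (c i * e (v' i)) x
            + (if i = s then kscale \<iota> (c s) x else 0)"
            using v's by (cases "i = s") (simp_all add: v''_def k.scale_right_diff_distrib flip: k.scale_scale)
        qed
        also have "\<dots> = lincomb c v' d - kscale \<iota> (\<Sum>i<d. c i * e (v' i)) x + kscale \<iota> (c s) x"
          using s by (simp add: sum.distrib sum_subtractf k.scale_sum_left)
        finally show ?thesis by (simp add: k.scale_left_diff_distrib)
      qed
      show "\<exists>c. u - lincomb c v'' d \<in> W" if "u \<in> U" for u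
      proof -
        from frame_span[OF v'(1) that] obtain c where c: "u - lincomb c v' d \<in> W" by blast
        \<comment> \<open>The same vector in the new frame: the coefficient of \<open>x\<close>
          collects the values of \<open>e\<close> on all old members.\<close>
        define c' where "c' i = (if i = s then (\<Sum>i<d. c i * e (v' i)) else c i)" for i
        have "(\<Sum>i<d. kscale \<iota> (c' i) (v' i)) = (\<Sum>i<d. kscale \<iota> (c i) (v' i) + (if i = s then kscale \<iota> (c' s - c s) (v' s) else 0))"
          by (intro sum.cong) (auto simp: c'_def k.scale_left_diff_distrib)
        then have c1: "lincomb c' v' d = lincomb c v' d + kscale \<iota> (c' s - c s) (v' s)"
          using s by (simp add: sum.distrib)
        have "(\<Sum>i<d. c' i * e (v' i)) = (\<Sum>i<d. c i * e (v' i) + (if i = s then (c' s - c s) * e (v' s) else 0))"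
          by (intro sum.cong) (auto simp: c'_def algebra_simps)
        then have c2: "(\<Sum>i<d. c' i * e (v' i)) = c' s + (c' s - c s) * e (v' s)"
          using s by (simp add: sum.distrib c'_def)
        have "lincomb c' v'' d = lincomb c v' d"
          unfolding lin_v'' c1 c2 by (simp add: k.scale_scale[symmetric] v's[symmetric] del: k.scale_scale)
        with c show ?thesis by (metis (no_types))
      qed
      show "c i = 0" if c: "lincomb c v'' d \<in> W" and i: "i < d" for c i
      proof -
        define r where "r = ((\<Sum>i<d. c i * e (v' i)) - c s) / e (v' s)"
        define c' where "c' i = (if i = s then c s - r else c i)" for i
        have "(\<Sum>i<d. kscale \<iota> (c' i) (v' i)) = (\<Sum>i<d. kscale \<iota> (c i) (v' i) - (if i = s then kscale \<iota> r (v' s) else 0))"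
          by (intro sum.cong) (auto simp: c'_def k.scale_left_diff_distrib)
        then have "lincomb c' v' d = lincomb c v' d - kscale \<iota> r (v' s)"
          using s by (simp add: sum_subtractf)
        also have "\<dots> = lincomb c v'' d" unfolding lin_v'' r_def x_def by simp
        finally have "lincomb c' v' d \<in> W" using c by simp
        then have c'0: "c' i = 0" if "i < d" for i using frame_indep[OF v'(1) W U] that by blast
        have ci: "c i = 0" if "i < d" "i \<noteq> s" for i using c'0[OF that(1)] that(2) by (simp add: c'_def)
        have "(\<Sum>i<d. c i * e (v' i)) = (\<Sum>i<d. if i = s then c s * e (v' s) else 0)"
          using ci by (intro sum.cong) auto
        then have "r = (c s * e (v' s) - c s) / e (v' s)" using s by (simp add: r_def)
        moreover have "c s = r" using c'0[OF s] by (simp add: c'_def)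
        ultimately have "c s = 0" using e(2) by (simp add: field_simps)
        then show ?thesis using ci i by (cases "i = s") auto
      qed
    qed
    define \<psi>' where "\<psi>' i = (if i = s then e else \<psi> i)" for i
    have ex: "e x = 1" using e by (simp add: x_def k_linear_simps[OF lin])
    have "\<psi>' i (v'' j) = (if i = j then 1 else 0)" if ij: "i < Suc s" "j < d" for i j
    proof (cases "i = s")
      case True
      then show ?thesis using ex by (auto simp: \<psi>'_def v''_def k_linear_simps[OF lin[OF e(1)]])
    next
      case False
      then have less: "i < s" using ij by simp
      then have "\<psi> i (v' s) = 0" using v'(3) s by auto
      then have "\<psi> i x = 0" using v'(2) less by (simp add: x_def k_linear_simps[OF lin])
      then show ?thesis using False less v'(2,3) ij by (auto simp: \<psi>'_def v''_def k_linear_simps[OF lin])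
    qed
    moreover have "\<psi>' i \<in> B" if "i < Suc s" for i using that e(1) v'(2) by (auto simp: \<psi>'_def)
    ultimately show ?case using fr'' by blast
  qed
  then show ?thesis by blast
qed

text \<open>The zero default keeps all entries in A. The ring generated in
  \<open>noetherian_Gr\<close> consists of functions on all sets, so the identities there must hold
  outside the Grassmannian as well.\<close>

definition some_frame :: "'l set \<Rightarrow> 'l set \<Rightarrow> nat \<Rightarrow> 'l set \<Rightarrow> nat \<Rightarrow> 'l"
  where "some_frame V W d U =
    (if U \<in> Grassmannian \<iota> V W d then SOME v. frame \<iota> W U d v else (\<lambda>_. 0))"

definition plucker :: "'l set \<Rightarrow> 'l set \<Rightarrow> nat \<Rightarrow> nat \<Rightarrow> ('l set \<Rightarrow> 'k) set"
  where "plucker V W d m = {\<lambda>U. f (some_frame V W d U) | f. plucker_form \<iota> W d m f}"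

lemma some_frame: "U \<in> Grassmannian \<iota> V W d \<Longrightarrow> frame \<iota> W U d (some_frame V W d U)"
proof -
  assume "U \<in> Grassmannian \<iota> V W d"
  then have "U \<in> Grassmannian \<iota> V W d" "\<exists>v. frame \<iota> W U d v" by (simp_all add: Grassmannian_def)
  then show ?thesis using someI_ex[of "frame \<iota> W U d"] by (simp add: some_frame_def)
qed

lemma Grassmannian_subspace: "U \<in> Grassmannian \<iota> V W d \<Longrightarrow> k.subspace U"
  by (simp add: Grassmannian_def)

lemma Grassmannian_unique:
  "U \<in> Grassmannian \<iota> V W d \<Longrightarrow> U \<in> Grassmannian \<iota> V W d' \<Longrightarrow> k.subspace W \<Longrightarrow> d = d'"
  using frame_card_unique[of W U d _ d'] by (auto simp: Grassmannian_def)

lemma plucker_at_frame: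
  assumes "frame \<iota> W U d v" and W: "k.subspace W" and U: "U \<in> Grassmannian \<iota> V W d"
  shows "\<exists>\<rho>. \<rho> \<noteq> 0 \<and> (\<forall>m f. plucker_form \<iota> W d m f \<longrightarrow> f v = \<rho> ^ m * f (some_frame V W d U))"
  by (rule frame_change[OF some_frame[OF U] assms(1) W Grassmannian_subspace[OF U]])

lemma Grassmannian_open:
  assumes "k.subspace W"
  shows "openin (zariski_Gr \<iota> V W) (Grassmannian \<iota> V W d)"
proof -
  have "{U \<in> Grassmannian \<iota> V W d. \<forall>v. frame \<iota> W U d v \<longrightarrow> (\<lambda>_. 1 :: 'k) v \<noteq> 0} = Grassmannian \<iota> V W d"
    by auto
  then show ?thesis unfolding zariski_Gr_def
    by (intro topology_generated_by_Basis CollectI exI[of _ d] exI[of _ 0] exI[of _ "\<lambda>_. 1"])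
      (auto intro: plucker_form.const)
qed

lemma topspace_zariski_Gr: "topspace (zariski_Gr \<iota> V W) = (\<Union>d. Grassmannian \<iota> V W d)"
proof
  show "topspace (zariski_Gr \<iota> V W) \<subseteq> (\<Union>d. Grassmannian \<iota> V W d)"
    unfolding zariski_Gr_def topology_generated_by_topspace by auto
  show "(\<Union>d. Grassmannian \<iota> V W d) \<subseteq> topspace (zariski_Gr \<iota> V W)"
  proof
    fix U assume "U \<in> (\<Union>d. Grassmannian \<iota> V W d)"
    then obtain d where U: "U \<in> Grassmannian \<iota> V W d" by blast
    have "{U \<in> Grassmannian \<iota> V W d. \<forall>v. frame \<iota> W U d v \<longrightarrow> (\<lambda>_. 1 :: 'k) v \<noteq> 0} \<subseteq> topspace (zariski_Gr \<iota> V W)"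
      unfolding zariski_Gr_def topology_generated_by_topspace
      by (intro Union_upper CollectI exI[of _ d] exI[of _ 0] exI[of _ "\<lambda>_. 1"]) (auto intro: plucker_form.const)
    then show "U \<in> topspace (zariski_Gr \<iota> V W)" using U by auto
  qed
qed

lemma Grassmannian_closed:
  assumes W: "k.subspace W"
  shows "closedin (zariski_Gr \<iota> V W) (Grassmannian \<iota> V W d)"
proof -
  have "topspace (zariski_Gr \<iota> V W) - Grassmannian \<iota> V W d = (\<Union>d'\<in>- {d}. Grassmannian \<iota> V W d')"
    unfolding topspace_zariski_Gr using Grassmannian_unique[OF _ _ W] by blast
  moreover have "openin (zariski_Gr \<iota> V W) (\<Union>d'\<in>- {d}. Grassmannian \<iota> V W d')"
    using Grassmannian_open[OF W] by (intro openin_Union) auto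
  ultimately show ?thesis unfolding closedin_def by (auto simp: topspace_zariski_Gr)
qed

text \<open>A frame reduced with respect to \<open>B\<close> has a minor equal to 1, so the Pluecker
  coordinates have no common zero. Basic open sets belonging to another dimension do not meet
  \<open>S\<close>.\<close>

lemma graded_zariski_Gr:
  assumes W: "k.subspace W" and S: "S \<subseteq> Grassmannian \<iota> V W d" and B: "coordinates B V W"
  shows "graded_zariski (subtopology (zariski_Gr \<iota> V W) S) (plucker V W d)"
proof -
  let ?Z = "zariski_Gr \<iota> V W"
  let ?T = "subtopology ?Z S"
  have top: "topspace ?T = S" using S by (auto simp: topspace_zariski_Gr)
  have nonzero: "{U \<in> Grassmannian \<iota> V W d. \<forall>v. frame \<iota> W U d v \<longrightarrow> f v \<noteq> 0} \<inter> S = {U\<in>S. f (some_frame V W d U) \<noteq> 0}"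
    if f: "plucker_form \<iota> W d m f" for m f
  proof -
    have "(\<forall>v. frame \<iota> W U d v \<longrightarrow> f v \<noteq> 0) \<longleftrightarrow> f (some_frame V W d U) \<noteq> 0" if U: "U \<in> Grassmannian \<iota> V W d" for U
    proof
      show "\<forall>v. frame \<iota> W U d v \<longrightarrow> f v \<noteq> 0 \<Longrightarrow> f (some_frame V W d U) \<noteq> 0" using some_frame[OF U] by blast
      assume ne: "f (some_frame V W d U) \<noteq> 0"
      show "\<forall>v. frame \<iota> W U d v \<longrightarrow> f v \<noteq> 0"
      proof (intro allI impI)
        fix v assume "frame \<iota> W U d v"
        from plucker_at_frame[OF this W U] f obtain \<rho> where "\<rho> \<noteq> 0" "f v = \<rho> ^ m * f (some_frame V W d U)" by blast
        with ne show "f v \<noteq> 0" by simp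
      qed
    qed
    then show ?thesis using S by auto
  qed
  show ?thesis
  proof
    show "(\<lambda>_. c) \<in> plucker V W d 0" for c
      unfolding plucker_def by (auto intro!: exI[of _ "\<lambda>_. c"] plucker_form.const)
    show "(\<lambda>x. f x + g x) \<in> plucker V W d m" if fg: "f \<in> plucker V W d m" "g \<in> plucker V W d m" for f g m
    proof -
      from fg obtain f' g' where "plucker_form \<iota> W d m f'" "f = (\<lambda>U. f' (some_frame V W d U))"
        "plucker_form \<iota> W d m g'" "g = (\<lambda>U. g' (some_frame V W d U))" unfolding plucker_def by blast
      then show ?thesis unfolding plucker_def
        by (intro CollectI exI[of _ "\<lambda>v. f' v + g' v"]) (auto intro: plucker_form.add)
    qed
    show "(\<lambda>x. f x * g x) \<in> plucker V W d (m + m')" if fg: "f \<in> plucker V W d m" "g \<in> plucker V W d m'" for f g m m'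
    proof -
      from fg obtain f' g' where "plucker_form \<iota> W d m f'" "f = (\<lambda>U. f' (some_frame V W d U))"
        "plucker_form \<iota> W d m' g'" "g = (\<lambda>U. g' (some_frame V W d U))" unfolding plucker_def by blast
      then show ?thesis unfolding plucker_def
        by (intro CollectI exI[of _ "\<lambda>v. f' v * g' v"]) (auto intro: plucker_form.mult)
    qed
    show "\<exists>f\<in>plucker V W d 1. f U \<noteq> 0" if "U \<in> topspace ?T" for U
    proof -
      have U: "U \<in> Grassmannian \<iota> V W d" using that top S by auto
      then have "U \<subseteq> V" by (simp add: Grassmannian_def)
      then obtain v \<psi> where v: "frame \<iota> W U d v" "\<forall>i<d. \<psi> i \<in> B"
        "\<forall>i<d. \<forall>j<d. \<psi> i (v j) = (if i = j then 1 else 0)"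
        using reduced_frame[OF some_frame[OF U] W Grassmannian_subspace[OF U] B] by blast
      define f where "f v = det (mat d d (\<lambda>(i, j). \<psi> i (v j)))" for v
      have f: "plucker_form \<iota> W d 1 f" unfolding f_def[abs_def]
        using v(2) B by (intro plucker_form.coord) (auto simp: coordinates_def k_linear_def)
      have "mat d d (\<lambda>(i, j). \<psi> i (v j)) = 1\<^sub>m d" using v(3) by (intro eq_matI) auto
      then have "f v = 1" by (simp add: f_def)
      moreover from plucker_at_frame[OF v(1) W U] f obtain \<rho> where "f v = \<rho> ^ 1 * f (some_frame V W d U)" by blast
      ultimately have "f (some_frame V W d U) \<noteq> 0" by auto
      then show ?thesis
        using f by (intro bexI[of _ "\<lambda>U. f (some_frame V W d U)"]) (auto simp: plucker_def)
    qed
    show "openin ?T {x \<in> topspace ?T. f x \<noteq> 0}" if "f \<in> plucker V W d m" for f m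
    proof -
      from that obtain f' where f': "plucker_form \<iota> W d m f'" "f = (\<lambda>U. f' (some_frame V W d U))"
        unfolding plucker_def by blast
      have "openin ?Z {U \<in> Grassmannian \<iota> V W d. \<forall>v. frame \<iota> W U d v \<longrightarrow> f' v \<noteq> 0}"
        unfolding zariski_Gr_def using f' by (intro topology_generated_by_Basis) blast
      then have "openin ?T ({U \<in> Grassmannian \<iota> V W d. \<forall>v. frame \<iota> W U d v \<longrightarrow> f' v \<noteq> 0} \<inter> S)"
        by (auto simp: openin_subtopology)
      then show ?thesis unfolding nonzero[OF f'(1)] top f'(2) by simp
    qed
    have base: "\<exists>m f. plucker_form \<iota> W d m f \<and> f (some_frame V W d U) \<noteq> 0 \<and>
        (\<forall>U'\<in>S. f (some_frame V W d U') \<noteq> 0 \<longrightarrow> U' \<in> O')"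
      if "generate_topology_on {{U \<in> Grassmannian \<iota> V W d. \<forall>v. frame \<iota> W U d v \<longrightarrow> f v \<noteq> 0} | d m f. plucker_form \<iota> W d m f} O'"
        and "U \<in> O'" "U \<in> S" for O' U
      using that
    proof (induction arbitrary: U rule: generate_topology_on.induct)
      case (Int a b)
      have "U \<in> a" "U \<in> b" using Int.prems by auto
      from Int.IH(1)[OF this(1) Int.prems(2)] Int.IH(2)[OF this(2) Int.prems(2)]
      obtain m f m' f' where
        "plucker_form \<iota> W d m f" "f (some_frame V W d U) \<noteq> 0" "\<forall>U'\<in>S. f (some_frame V W d U') \<noteq> 0 \<longrightarrow> U' \<in> a"
        "plucker_form \<iota> W d m' f'" "f' (some_frame V W d U) \<noteq> 0" "\<forall>U'\<in>S. f' (some_frame V W d U') \<noteq> 0 \<longrightarrow> U' \<in> b"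
        by (elim exE conjE) (rule that)
      then show ?case
        by (intro exI[of _ "m + m'"] exI[of _ "\<lambda>v. f v * f' v"]) (auto intro: plucker_form.mult)
    next
      case (UN K)
      then obtain a where a: "a \<in> K" "U \<in> a" by blast
      from UN.IH[OF a UN.prems(2)] obtain m f where "plucker_form \<iota> W d m f" "f (some_frame V W d U) \<noteq> 0"
        "\<forall>U'\<in>S. f (some_frame V W d U') \<noteq> 0 \<longrightarrow> U' \<in> a" by (elim exE conjE) (rule that)
      then show ?case using a by (intro exI[of _ m] exI[of _ f]) auto
    next
      case (Basis s)
      then obtain d' m f where s: "s = {U \<in> Grassmannian \<iota> V W d'. \<forall>v. frame \<iota> W U d' v \<longrightarrow> f v \<noteq> 0}"
        "plucker_form \<iota> W d' m f" by blast
      have "d' = d" using Basis.prems s S Grassmannian_unique[OF _ _ W] by blast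
      with s have f: "plucker_form \<iota> W d m f" and s: "s \<inter> S = {U\<in>S. f (some_frame V W d U) \<noteq> 0}"
        using nonzero by auto
      with Basis.prems show ?case by blast
    qed simp
    show "\<exists>m. \<exists>f\<in>plucker V W d m. f U \<noteq> 0 \<and> (\<forall>y\<in>topspace ?T. f y \<noteq> 0 \<longrightarrow> y \<in> O')"
      if "openin ?T O'" "U \<in> O'" for O' U
    proof -
      from that(1) obtain O2 where O2: "openin ?Z O2" "O' = O2 \<inter> S" by (auto simp: openin_subtopology)
      from base[OF O2(1)[unfolded zariski_Gr_def openin_topology_generated_by_iff], of U] that(2) O2(2)
      obtain m f where "plucker_form \<iota> W d m f" "f (some_frame V W d U) \<noteq> 0"
        "\<forall>U'\<in>S. f (some_frame V W d U') \<noteq> 0 \<longrightarrow> U' \<in> O2" by auto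
      then show ?thesis unfolding top using O2(2)
        by (intro exI[of _ m] bexI[of _ "\<lambda>U. f (some_frame V W d U)"]) (auto simp: plucker_def)
    qed
  qed
qed

text \<open>Each term of a minor is a product of d entries, and every entry has degree at most 1 in
  each parameter.\<close>

lemma plucker_form_poly:
  assumes lin: "\<And>e j. k_linear e \<Longrightarrow> j < d \<Longrightarrow> poly_deg_le p 1 (\<lambda>h. e (v h j))"
    and "plucker_form \<iota> W d m f"
  shows "poly_deg_le p (d * m) (\<lambda>h. f (v h))"
  using assms(2)
proof induction
  case (coord e)
  have "poly_deg_le p (d * 1) (\<lambda>h. \<Sum>\<sigma> | \<sigma> permutes {0..<d}. signof \<sigma> * (\<Prod>i = 0..<d. e i (v h (\<sigma> i))))"
  proof (intro poly_deg_le_sum)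
    fix \<sigma> assume "\<sigma> \<in> {\<sigma>. \<sigma> permutes {0..<d}}"
    then have \<sigma>: "\<sigma> i < d" if "i < d" for i using that permutes_in_image[of \<sigma> "{0..<d}" i] by auto
    have "poly_deg_le p (1 * card {0..<d}) (\<lambda>h. \<Prod>i\<in>{0..<d}. e i (v h (\<sigma> i)))"
      using coord by (intro poly_deg_le_prod lin \<sigma>) (auto simp: k_linear_def)
    from poly_deg_le_mult[OF poly_deg_le_const[of p 0 "signof \<sigma>"] this]
    show "poly_deg_le p (d * 1) (\<lambda>h. signof \<sigma> * (\<Prod>i = 0..<d. e i (v h (\<sigma> i))))" by simp
  qed
  moreover have "det (mat d d (\<lambda>(i, j). e i (v h j))) =
      (\<Sum>\<sigma> | \<sigma> permutes {0..<d}. signof \<sigma> * (\<Prod>i = 0..<d. e i (v h (\<sigma> i))))" for h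
    unfolding det_def
    by (auto intro!: sum.cong prod.cong arg_cong2[of _ _ _ _ "(*)"] dest: permutes_in_image)
  ultimately show ?case by simp
next
  case (add m f g)
  then show ?case by (intro poly_deg_le_add)
next
  case (mult m f n g)
  from poly_deg_le_mult[OF mult.IH] show ?case by (simp add: distrib_left)
qed (auto intro: poly_deg_le_const)

text \<open>The closure is taken so that the parametrized subspaces are dense in it by construction.
  Forms at the explicit frame \<open>v h\<close> differ from those at the chosen frame by a power of
  a non-zero factor, the \<rho> of \<open>krull_dim_le\<close>.\<close>

theorem krull_dim_parametrized:
  assumes W: "k.subspace W" and B: "coordinates B V W"
    and H: "\<And>h. h \<in> H \<Longrightarrow> M h \<in> Grassmannian \<iota> V W d \<inter> S"
    and fr: "\<And>h. h \<in> H \<Longrightarrow> frame \<iota> W (M h) d (v h)"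
    and poly: "\<And>e j. k_linear e \<Longrightarrow> j < d \<Longrightarrow> poly_deg_le p 1 (\<lambda>h. e (v h j))"
  defines "Y \<equiv> subtopology (zariski_Gr \<iota> V W) S"
  shows "krull_dim (subtopology Y (Y closure_of (M ` H))) \<le> enat p"
proof -
  let ?F = "Y closure_of (M ` H)"
  have top: "topspace Y = topspace (zariski_Gr \<iota> V W) \<inter> S" by (simp add: Y_def)
  have "closedin Y (S \<inter> Grassmannian \<iota> V W d)"
    unfolding Y_def using Grassmannian_closed[OF W, of V d] by (auto simp: closedin_subtopology)
  then have FG: "?F \<subseteq> S \<inter> Grassmannian \<iota> V W d" using H by (intro closure_of_minimal) auto
  have eqT: "subtopology Y ?F = subtopology (zariski_Gr \<iota> V W) ?F"
    using FG by (simp add: Y_def subtopology_subtopology Int_absorb1)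
  interpret graded_zariski "subtopology Y ?F" "plucker V W d"
    unfolding eqT by (rule graded_zariski_Gr[OF W _ B]) (use FG in auto)
  have MX: "M ` H \<subseteq> topspace Y" using H by (auto simp: top topspace_zariski_Gr)
  have sub: "M ` H \<subseteq> ?F" using closure_of_subset[OF MX] .
  have "\<exists>\<rho>. \<rho> \<noteq> 0 \<and> (\<forall>m f. plucker_form \<iota> W d m f \<longrightarrow> f (v h) = \<rho> ^ m * f (some_frame V W d (M h)))"
    if "h \<in> H" for h
    using plucker_at_frame[OF fr[OF that] W, of V] H[OF that] by blast
  then obtain \<rho> where \<rho>: "\<And>h. h \<in> H \<Longrightarrow> \<rho> h \<noteq> 0"
    "\<And>h m f. h \<in> H \<Longrightarrow> plucker_form \<iota> W d m f \<Longrightarrow> f (v h) = \<rho> h ^ m * f (some_frame V W d (M h))"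
    by metis
  show ?thesis
  proof (rule krull_dim_le[of H M \<rho> p d])
    show "M h \<in> topspace (subtopology Y ?F)" if "h \<in> H" for h using that MX sub by auto
    show "subtopology Y ?F closure_of (M ` H) = topspace (subtopology Y ?F)"
      using sub closure_of_subset_topspace[of Y "M ` H"]
      by (subst closure_of_subtopology) (auto simp: Int_absorb1)
    show "\<rho> h \<noteq> 0" if "h \<in> H" for h using \<rho>(1)[OF that] .
    show "\<exists>F. poly_deg_le p (d * m) F \<and> (\<forall>h\<in>H. F h = \<rho> h ^ m * f (M h))" if "f \<in> plucker V W d m" for m f
    proof -
      from that obtain g where g: "plucker_form \<iota> W d m g" "f = (\<lambda>U. g (some_frame V W d U))"
        unfolding plucker_def by blast
      have "poly_deg_le p (d * m) (\<lambda>h. g (v h))" by (rule plucker_form_poly[OF _ g(1)]) (rule poly)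
      with \<rho>(2)[OF _ g(1)] show ?thesis
        by (intro exI[of _ "\<lambda>h. g (v h)"]) (auto simp: g(2))
    qed
  qed
qed

text \<open>The entries of the reduced frame are quotients of Pluecker coordinates, by Cramer's rule.\<close>

lemma reduced_frame_regular:
  assumes W: "k.subspace W" and B: "coordinates B V W" and S: "S \<subseteq> Grassmannian \<iota> V W d"
    and rf: "\<And>U. U \<in> S \<Longrightarrow> frame \<iota> W U d (rf U)"
    and \<psi>: "\<And>i. i < d \<Longrightarrow> \<psi> i \<in> B"
    and red: "\<And>U i j. U \<in> S \<Longrightarrow> i < d \<Longrightarrow> j < d \<Longrightarrow> \<psi> i (rf U j) = (if i = j then 1 else 0)"
    and e: "k_linear e" "\<And>x. x \<in> W \<Longrightarrow> e x = 0" and j: "j < d"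
  shows "graded_zariski.regular (subtopology (zariski_Gr \<iota> V W) S) (plucker V W d) (\<lambda>U. e (rf U j))"
proof -
  let ?T = "subtopology (zariski_Gr \<iota> V W) S"
  interpret graded_zariski ?T "plucker V W d" by (rule graded_zariski_Gr[OF W S B])
  have top: "topspace ?T = S" using S by (auto simp: topspace_zariski_Gr)
  define p where "p v = det (mat d d (\<lambda>(i, l). \<psi> i (v l)))" for v
  \<comment> \<open>With \<open>e\<close> in place of the j-th pivot form, the minor of a reduced
    frame equals \<open>e\<close> of its j-th member.\<close>
  define q where "q v = det (mat d d (\<lambda>(i, l). (\<psi>(j := e)) i (v l)))" for v
  have p: "plucker_form \<iota> W d 1 p" unfolding p_def[abs_def]
    using \<psi> B by (intro plucker_form.coord) (auto simp: coordinates_def k_linear_def)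
  have "plucker_form \<iota> W d 1 (\<lambda>v. det (mat d d (\<lambda>(i, l). (\<psi>(j := e)) i (v l))))"
    using \<psi> B e by (intro plucker_form.coord) (auto simp: coordinates_def k_linear_def)
  then have q: "plucker_form \<iota> W d 1 q" by (simp add: q_def[abs_def])
  have val: "p (rf U) = 1" "q (rf U) = e (rf U j)" if "U \<in> S" for U
  proof -
    have "mat d d (\<lambda>(i, l). \<psi> i (rf U l)) = 1\<^sub>m d" using red that by (intro eq_matI) auto
    then show "p (rf U) = 1" by (simp add: p_def)
    let ?M = "mat d d (\<lambda>(i, l). (\<psi>(j := e)) i (rf U l))"
    have M: "?M \<in> carrier_mat d d" by simp
    have "det ?M = (\<Sum>i<d. ?M $$ (i, j) * cofactor ?M i j)"
      by (rule laplace_expansion_column[OF M j])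
    also have "\<dots> = (\<Sum>i<d. if i = j then e (rf U j) * cofactor ?M j j else 0)"
      using red[OF that] j by (intro sum.cong) auto
    also have "\<dots> = e (rf U j) * cofactor ?M j j" using j by simp
    also have "cofactor ?M j j = 1"
    proof -
      have "mat_delete ?M j j = 1\<^sub>m (d - 1)"
        using red[OF that] j
        by (intro eq_matI) (auto simp: mat_delete_def)
      then show ?thesis by (simp add: cofactor_def)
    qed
    finally show "q (rf U) = e (rf U j)" by (simp add: q_def)
  qed
  let ?p = "\<lambda>U. p (some_frame V W d U)" and ?q = "\<lambda>U. q (some_frame V W d U)"
  have "?p \<in> plucker V W d 1" "?q \<in> plucker V W d 1" using p q by (auto simp: plucker_def)
  moreover have "?p U \<noteq> 0 \<and> e (rf U j) = ?q U / ?p U" if U: "U \<in> S" for U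
  proof -
    from plucker_at_frame[OF rf[OF U] W, of V] U S obtain \<rho> where
      "\<rho> \<noteq> 0" "\<And>m f. plucker_form \<iota> W d m f \<Longrightarrow> f (rf U) = \<rho> ^ m * f (some_frame V W d U)" by blast
    from this(1) this(2)[OF p] this(2)[OF q] val[OF U]
    have eq: "\<rho> * ?p U = 1" "e (rf U j) = \<rho> * ?q U" by auto
    then have "?p U \<noteq> 0" by auto
    moreover from eq this have "\<rho> = 1 / ?p U" by (simp add: field_simps)
    ultimately show ?thesis using eq by simp
  qed
  ultimately show ?thesis unfolding regular_def top
    by (rule_tac exI[of _ 1], rule_tac bexI[of _ ?q], rule_tac bexI[of _ ?p]) blast+
qed

end

section \<open>Coordinates on A modulo t^N A\<close>

context cubic_order
begin

abbreviation "tAN N \<equiv> tA \<iota> N"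

lemma tA_eq: "tAN N = {el (X ^ N * x0) (X ^ N * x1) (X ^ N * x2) | x0 x1 x2. True}"
proof -
  have "t ^ N * el x0 x1 x2 = el (X ^ N * x0) (X ^ N * x1) (X ^ N * x2)" for x0 x1 x2
    by (simp add: t_elt_power el_scale)
  note eq = this
  show ?thesis unfolding tA_def
  proof (intro Set.set_eqI iffI)
    fix y assume "y \<in> (*) (t ^ N) ` A"
    then obtain x where "x \<in> A" "y = t ^ N * x" by blast
    with A_ex[of x] eq show "y \<in> {el (X ^ N * x0) (X ^ N * x1) (X ^ N * x2) | x0 x1 x2. True}" by auto
  next
    fix y assume "y \<in> {el (X ^ N * x0) (X ^ N * x1) (X ^ N * x2) | x0 x1 x2. True}"
    then obtain x0 x1 x2 where "y = t ^ N * el x0 x1 x2" using eq by auto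
    then show "y \<in> (*) (t ^ N) ` A" by blast
  qed
qed

lemma fps_X_power_dvd_iff: "X ^ N dvd f \<longleftrightarrow> (\<forall>i<N. fps_nth f i = 0)" for f :: "'k fps"
proof
  assume "\<forall>i<N. fps_nth f i = 0"
  then have "f = X ^ N * fps_shift N f"
    by (intro fps_ext) (auto simp: fps_X_power_mult_nth)
  then show "X ^ N dvd f" by (rule dvdI)
qed (auto simp: dvd_def fps_X_power_mult_nth)

lemma el_in_tA_iff: "el x0 x1 x2 \<in> tAN N \<longleftrightarrow> X ^ N dvd x0 \<and> X ^ N dvd x1 \<and> X ^ N dvd x2"
  unfolding tA_eq by (auto simp: dvd_def)

lemma el_kscale: "kscale \<iota> c (el x0 x1 x2) = el (fps_const c * x0) (fps_const c * x1) (fps_const c * x2)"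
  by (simp add: kscale_def el_scale)

lemma el_0: "el 0 0 0 = 0"
  by (simp add: el_def)

lemma tA_subspace: "k.subspace (tAN N)"
  unfolding k.subspace_def
proof (intro conjI ballI allI)
  show "0 \<in> tAN N" using el_in_tA_iff[of 0 0 0 N] by (simp add: el_0)
  fix x y c assume "x \<in> tAN N" "y \<in> tAN N"
  moreover from this obtain x0 x1 x2 y0 y1 y2 where "x = el x0 x1 x2" "y = el y0 y1 y2"
    unfolding tA_eq by blast
  ultimately show "x + y \<in> tAN N" by (simp add: el_in_tA_iff el_add)
next
  fix c x assume "x \<in> tAN N"
  moreover from this obtain x0 x1 x2 where "x = el x0 x1 x2" unfolding tA_eq by blast
  ultimately show "kscale \<iota> c x \<in> tAN N" by (simp add: el_kscale el_in_tA_iff)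
qed

definition co :: "nat \<Rightarrow> 'l \<Rightarrow> 'k fls"
  where "co j x = (THE y. \<exists>x0 x1 x2. x = E x0 x1 x2 \<and> y = [x0, x1, x2] ! j)"

lemma co_E: "co j (E x0 x1 x2) = [x0, x1, x2] ! j"
  unfolding co_def by (rule the_equality) auto

definition coord :: "nat \<times> nat \<Rightarrow> 'l \<Rightarrow> 'k"
  where "coord ij x = fls_nth (co (snd ij) x) (int (fst ij))"

lemma coord_el: "coord (i, j) (el x0 x1 x2) = fps_nth ([x0, x1, x2] ! j) i" if "j < 3"
proof -
  from that have "j = 0 \<or> j = 1 \<or> j = 2" by auto
  then show ?thesis unfolding coord_def el_E co_E by auto
qed

lemma coord_linear: "j < 3 \<Longrightarrow> k_linear (coord (i, j))"
proof (rule k_linearI)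
  assume "j < 3"
  then have j: "j = 0 \<or> j = 1 \<or> j = 2" by auto
  fix x y c
  obtain x0 x1 x2 y0 y1 y2 where xy: "x = E x0 x1 x2" "y = E y0 y1 y2" using E_ex by metis
  show "coord (i, j) (x + y) = coord (i, j) x + coord (i, j) y"
    using j by (auto simp: xy E_add coord_def co_E)
  show "coord (i, j) (kscale \<iota> c x) = c * coord (i, j) x"
    using j by (auto simp: xy kscale_def Demb_def E_scale coord_def co_E)
qed

definition coords where "coords N = coord ` ({..<N} \<times> {..<3})"

lemma coordinates_coords: "coordinates (coords N) A (tAN N)"
  unfolding coordinates_def
proof (intro conjI ballI impI)
  fix e assume "e \<in> coords N"
  then obtain i j where ij: "e = coord (i, j)" "i < N" "j < 3" by (auto simp: coords_def)
  then show "k_linear e" by (simp add: coord_linear)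
  fix x assume "x \<in> tAN N"
  then obtain x0 x1 x2 where x: "x = el (X ^ N * x0) (X ^ N * x1) (X ^ N * x2)" unfolding tA_eq by blast
  from ij have "j = 0 \<or> j = 1 \<or> j = 2" by auto
  then show "e x = 0" unfolding x ij(1) coord_el[OF ij(3)] using ij(2) by (auto simp: fps_X_power_mult_nth)
next
  fix x assume "x \<in> A" and 0: "\<forall>e\<in>coords N. e x = 0"
  then obtain x0 x1 x2 where x: "x = el x0 x1 x2" using A_ex by blast
  have "fps_nth ([x0, x1, x2] ! j) i = 0" if "i < N" "j < 3" for i j
    using 0 that coord_el[of j i x0 x1 x2] by (auto simp: coords_def x)
  from this[of _ 0] this[of _ 1] this[of _ 2] show "x \<in> tAN N"
    by (simp add: x el_in_tA_iff fps_X_power_dvd_iff)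
qed

definition unit_vec :: "nat \<Rightarrow> nat \<Rightarrow> 'l"
  where "unit_vec i j = el (if j = 0 then X ^ i else 0) (if j = 1 then X ^ i else 0) (if j = 2 then X ^ i else 0)"

lemma coord_expansion:
  assumes "x \<in> A"
  shows "x - (\<Sum>i<N. \<Sum>j<3. kscale \<iota> (coord (i, j) x) (unit_vec i j)) \<in> tAN N"
proof -
  obtain x0 x1 x2 where x: "x = el x0 x1 x2" using A_ex[OF assms] by blast
  define c where "c f = (\<Sum>i<N. fps_const (fps_nth f i) * X ^ i)" for f :: "'k fps"
  have c: "X ^ N dvd f - c f" for f
    unfolding fps_X_power_dvd_iff c_def
  proof (intro allI impI)
    fix i assume i: "i < N"
    have "fps_nth (\<Sum>i<N. fps_const (fps_nth f i) * X ^ i) i = (\<Sum>j<N. if i = j then fps_nth f j else 0)"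
      by (simp add: fps_sum_nth fps_X_power_nth if_distrib cong: if_cong)
    then show "fps_nth (f - (\<Sum>i<N. fps_const (fps_nth f i) * X ^ i)) i = 0" using i by simp
  qed
  have inner: "(\<Sum>j<3. kscale \<iota> (coord (i, j) x) (unit_vec i j)) =
      el (fps_const (fps_nth x0 i) * X ^ i) (fps_const (fps_nth x1 i) * X ^ i) (fps_const (fps_nth x2 i) * X ^ i)" for i
    by (simp add: eval_nat_numeral x coord_el unit_vec_def el_kscale el_add)
  have "(\<Sum>i<N. \<Sum>j<3. kscale \<iota> (coord (i, j) x) (unit_vec i j)) = el (c x0) (c x1) (c x2)"
    unfolding inner c_def by (induction N) (simp_all add: el_0 el_add)
  then show ?thesis using c by (simp add: x el_diff el_in_tA_iff)
qed

text \<open>A linear form that vanishes on t^N A is a combination of the finitely many coordinates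
  in \<open>coords N\<close>, so all Pluecker functions are polynomials in the coordinates of the
  frame members.\<close>

lemma noetherian_Gr:
  assumes S: "S \<subseteq> Grassmannian \<iota> A (tAN N) d"
  shows "noetherian_space (subtopology (zariski_Gr \<iota> A (tAN N)) S)"
proof -
  let ?T = "subtopology (zariski_Gr \<iota> A (tAN N)) S"
  interpret graded_zariski ?T "plucker A (tAN N) d"
    by (rule graded_zariski_Gr[OF tA_subspace S coordinates_coords])
  let ?v = "some_frame A (tAN N) d"
  define G where "G = (\<lambda>(e, l) U. e (?v U l)) ` (coords N \<times> {..<d})"
  have "finite G" by (simp add: G_def coords_def)
  then obtain R where R: "noetherian_subring R" "range (\<lambda>c _. c) \<subseteq> R" "G \<subseteq> R"
    using noetherian_function_algebra by blast
  have sub: "subring_set R" using R(1) by (simp add: noetherian_subring_def)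
  have add: "(\<lambda>x. f x + g x) \<in> R" and mul: "(\<lambda>x. f x * g x) \<in> R" if "f \<in> R" "g \<in> R" for f g
    using subring_setD(6,4)[OF sub that] by (simp_all add: plus_fun_def times_fun_def)
  have con: "(\<lambda>_. c) \<in> R" for c using R(2) by blast
  have sm: "(\<lambda>x. \<Sum>i\<in>I. f i x) \<in> R" if "\<And>i. i \<in> I \<Longrightarrow> f i \<in> R" for I :: "'z set" and f
    using that by (induction I rule: infinite_finite_induct) (auto intro: con add)
  have pr: "(\<lambda>x. \<Prod>i\<in>I. f i x) \<in> R" if "\<And>i. i \<in> I \<Longrightarrow> f i \<in> R" for I :: "'z set" and f
    using that by (induction I rule: infinite_finite_induct) (auto intro: con mul)
  have vA: "?v U l \<in> A" if "l < d" for U l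
  proof (cases "U \<in> Grassmannian \<iota> A (tAN N) d")
    case True
    from some_frame[OF True] that have "?v U l \<in> U" by (simp add: frame_def)
    then show ?thesis using True by (auto simp: Grassmannian_def)
  next
    case False
    then show ?thesis using A_ring(2) by (simp add: some_frame_def)
  qed
  have "plucker A (tAN N) d m \<subseteq> R" for m
  proof
    fix F assume "F \<in> plucker A (tAN N) d m"
    then obtain f where f: "plucker_form \<iota> (tAN N) d m f" "F = (\<lambda>U. f (?v U))" by (auto simp: plucker_def)
    from f(1) have "(\<lambda>U. f (?v U)) \<in> R"
    proof induction
      case (coord e)
      have lin: "k_linear (e i)" if "i < d" for i using coord that by (simp add: k_linear_def)
      have "e i (?v U l) = (\<Sum>a<N. \<Sum>b<3. coord (a, b) (?v U l) * e i (unit_vec a b))"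
        if "i < d" "l < d" for i l U
      proof -
        have "e i (?v U l - (\<Sum>a<N. \<Sum>b<3. kscale \<iota> (coord (a, b) (?v U l)) (unit_vec a b))) = 0"
          using coord_expansion[OF vA[OF that(2)]] coord(2) that(1) by blast
        then show ?thesis by (simp add: k_linear_simps[OF lin[OF that(1)]])
      qed
      moreover have "(\<lambda>U. \<Sum>a<N. \<Sum>b<3. coord (a, b) (?v U l) * e i (unit_vec a b)) \<in> R" if "l < d" for i l
        using R(3) that by (intro sm mul con) (auto simp: G_def coords_def)
      ultimately have ent: "(\<lambda>U. e i (?v U l)) \<in> R" if "i < d" "l < d" for i l using that by simp
      have "det (mat d d (\<lambda>(i, j). e i (?v U j))) =
          (\<Sum>\<sigma> | \<sigma> permutes {0..<d}. signof \<sigma> * (\<Prod>i = 0..<d. e i (?v U (\<sigma> i))))" for U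
        unfolding det_def by (auto intro!: sum.cong prod.cong arg_cong2[of _ _ _ _ "(*)"] dest: permutes_in_image)
      moreover have "(\<lambda>U. \<Sum>\<sigma> | \<sigma> permutes {0..<d}. signof \<sigma> * (\<Prod>i = 0..<d. e i (?v U (\<sigma> i)))) \<in> R"
        by (intro sm mul con pr ent) (auto dest: permutes_in_image)
      ultimately show ?case by simp
    qed (auto intro: con add mul)
    then show "F \<in> R" by (simp add: f)
  qed
  then show ?thesis using noetherian[OF R(1)] by blast
qed

end

section \<open>Ideals\<close>

lemma submodule_of_hull: "submodule_of R (submodule_of R hull S)"
  unfolding hull_def submodule_of_def by blast

context fls_algebra
begin

text \<open>Both t^N and t^N x lie in C, so t^N f(x) = f(t^N x 1) = t^N x f(1), and t can be
  cancelled: an isomorphism is multiplication by the image of 1.\<close>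

lemma iso_multiple:
  assumes "module_iso C M M'" and "1 \<in> M" and M: "\<And>x. x \<in> M \<Longrightarrow> t ^ N * x \<in> C" and t: "t ^ N \<in> C"
  shows "\<exists>u. M' = (*) u ` M"
proof -
  from assms(1) obtain f where f: "bij_betw f M M'" "\<And>c x. c \<in> C \<Longrightarrow> x \<in> M \<Longrightarrow> f (c * x) = c * f x"
    by (auto simp: module_iso_def)
  have "f x = f 1 * x" if x: "x \<in> M" for x
  proof -
    have "t ^ N * f x = f (t ^ N * x)" using f(2)[OF t x] by simp
    also have "\<dots> = f ((t ^ N * x) * 1)" by simp
    also have "\<dots> = t ^ N * (f 1 * x)" using f(2)[OF M[OF x] assms(2)] by (simp add: mult_ac)
    finally show ?thesis by simp
  qed
  then have "f ` M = (*) (f 1) ` M" by (rule image_cong[OF refl])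
  then show ?thesis using f(1) by (intro exI[of _ "f 1"]) (simp add: bij_betw_def)
qed

lemma iso_by_multiple:
  assumes "u * y = 1"
  shows "module_iso C M ((*) u ` M)"
proof -
  have "inj_on ((*) u) M"
  proof (rule inj_onI)
    fix x x' assume "u * x = u * x'"
    then have "y * (u * x) = y * (u * x')" by simp
    then show "x = x'" using assms by (simp add: mult.assoc[symmetric] mult.commute[of y u])
  qed
  then show ?thesis unfolding module_iso_def
    by (intro exI[of _ "(*) u"]) (auto simp: bij_betw_def algebra_simps)
qed

end

context cubic_order
begin

text \<open>The lattice \<open>D + t\<^sup>a (w + Yz) D + t\<^sup>b A\<close>, for \<open>a \<le> b\<close>.\<close>

definition lat :: "nat \<Rightarrow> nat \<Rightarrow> 'k fps \<Rightarrow> 'l set"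
  where "lat a b Y = {el x0 x1 x2 | x0 x1 x2. X ^ a dvd x1 \<and> X ^ b dvd x2 - Y * x1}"

lemma el_in_lat_iff: "el x0 x1 x2 \<in> lat a b Y \<longleftrightarrow> X ^ a dvd x1 \<and> X ^ b dvd x2 - Y * x1"
  by (auto simp: lat_def)

lemma lat_subset: "lat a b Y \<subseteq> A"
  by (auto simp: lat_def)

lemma tA_subset_lat: "a \<le> N \<Longrightarrow> b \<le> N \<Longrightarrow> tAN N \<subseteq> lat a b Y"
proof
  fix x assume le: "a \<le> N" "b \<le> N" and "x \<in> tAN N"
  then obtain x0 x1 x2 where x: "x = el (X ^ N * x0) (X ^ N * x1) (X ^ N * x2)" unfolding tA_eq by blast
  have "X ^ a dvd X ^ N * x1" using le by (intro dvd_mult2 le_imp_power_dvd)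
  moreover have "X ^ b dvd X ^ N * (x2 - Y * x1)" using le by (intro dvd_mult2 le_imp_power_dvd)
  ultimately show "x \<in> lat a b Y" by (simp add: x el_in_lat_iff algebra_simps)
qed

text \<open>The elements 1, t^a (w + Yz) and t^b z generate the lattice over D already, and 1 alone
  generates A over A.\<close>

lemma lat_ideal:
  assumes C: "range \<delta> \<subseteq> C" and CM: "\<And>c x. c \<in> C \<Longrightarrow> x \<in> lat a b Y \<Longrightarrow> c * x \<in> lat a b Y"
  shows "C_ideal \<iota> C (lat a b Y)" "submodule_of A hull (lat a b Y) = A"
proof -
  let ?M = "lat a b Y"
  let ?S = "{1, el 0 (X ^ a) (Y * X ^ a), el 0 0 (X ^ b)}"
  have zero: "0 \<in> ?M" using el_in_lat_iff[of 0 0 0] by (simp add: el_0)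
  have one: "1 \<in> ?M" unfolding el_special(4) el_in_lat_iff by simp
  have SM: "?S \<subseteq> ?M" using one by (auto simp: el_in_lat_iff)
  have diff: "x - y \<in> ?M" if "x \<in> ?M" "y \<in> ?M" for x y
  proof -
    from that obtain x0 x1 x2 y0 y1 y2 where xy: "x = el x0 x1 x2" "y = el y0 y1 y2"
      "X ^ a dvd x1" "X ^ b dvd x2 - Y * x1" "X ^ a dvd y1" "X ^ b dvd y2 - Y * y1"
      by (auto simp: lat_def)
    have eq: "(x2 - y2) - Y * (x1 - y1) = (x2 - Y * x1) - (y2 - Y * y1)" by (simp add: algebra_simps)
    have "X ^ b dvd (x2 - y2) - Y * (x1 - y1)" unfolding eq by (rule dvd_diff[OF xy(4,6)])
    with xy show ?thesis by (simp add: el_diff el_in_lat_iff)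
  qed
  have sub: "submodule_of C ?M" unfolding submodule_of_def using zero diff CM by blast
  have gen: "x \<in> T" if T: "submodule_of C T" "?S \<subseteq> T" and "x \<in> ?M" for T x
  proof -
    from \<open>x \<in> ?M\<close> obtain x0 x1 x2 where x: "x = el x0 x1 x2" "X ^ a dvd x1" "X ^ b dvd x2 - Y * x1"
      by (auto simp: lat_def)
    from x(2,3) obtain p q where pq: "x1 = X ^ a * p" "x2 - Y * x1 = X ^ b * q" by (auto simp: dvd_def)
    then have x2: "x2 = Y * x1 + X ^ b * q" by (simp add: algebra_simps)
    have scale: "\<delta> f * y \<in> T" if "y \<in> ?S" for f y
      using T C that unfolding submodule_of_def by blast
    have add: "y + y' \<in> T" if "y \<in> T" "y' \<in> T" for y y'
    proof -
      have "0 - y' \<in> T" using T(1) that unfolding submodule_of_def by blast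
      then have "y - (0 - y') \<in> T" using T(1) that unfolding submodule_of_def by blast
      then show ?thesis by simp
    qed
    have "x = \<delta> x0 * 1 + \<delta> p * el 0 (X ^ a) (Y * X ^ a) + \<delta> q * el 0 0 (X ^ b)"
      unfolding x(1) pq(1) x2 el_special(4) el_scale el_add el_inject by (simp add: mult_ac)
    then show ?thesis using scale[of 1 x0] scale[of "el 0 (X ^ a) (Y * X ^ a)" p]
        scale[of "el 0 0 (X ^ b)" q] by (auto intro!: add)
  qed
  have "?M = submodule_of C hull ?S"
  proof
    show "?M \<subseteq> submodule_of C hull ?S" unfolding hull_def using gen by blast
    show "submodule_of C hull ?S \<subseteq> ?M" using sub SM by (rule hull_minimal[rotated])
  qed
  moreover have "K.span ?M = UNIV"
  proof -
    have "x \<in> K.span ?M" for x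
    proof -
      obtain x0 x1 x2 where x: "x = E x0 x1 x2" using E_ex by blast
      let ?a = "el 0 (X ^ a) (Y * X ^ a)" and ?b = "el 0 0 (X ^ b)"
      define p where "p = x1 * inverse (fls_X ^ a)"
      define q where "q = (x2 - fl Y * x1) * inverse (fls_X ^ b)"
      have p: "p * fls_X ^ a = x1" and q: "q * fls_X ^ b = x2 - fl Y * x1"
        by (simp_all add: p_def q_def)
      have "x = Kscale \<iota> x0 1 + Kscale \<iota> p ?a + Kscale \<iota> q ?b"
        unfolding x Kscale_def el_special(4) el_E E_scale E_add E_inject
        using q by (simp add: p[symmetric] fps_to_fls_power fls_times_fps_to_fls algebra_simps)
      moreover have "1 \<in> K.span ?M" "?a \<in> K.span ?M" "?b \<in> K.span ?M"
        using SM by (auto intro: K.span_base)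
      ultimately show ?thesis by (auto intro!: K.span_add K.span_scale)
    qed
    then show ?thesis by blast
  qed
  moreover have "finite ?S" by simp
  ultimately show "C_ideal \<iota> C ?M" unfolding C_ideal_def by (intro conjI exI[of _ ?S])
  show "submodule_of A hull ?M = A"
  proof
    have "submodule_of A A" unfolding submodule_of_def
      by (intro conjI ballI A_ring integral_add_mult)
    with lat_subset show "submodule_of A hull ?M \<subseteq> A" by (rule hull_minimal)
    show "A \<subseteq> submodule_of A hull ?M"
    proof
      fix x assume "x \<in> A"
      moreover have "1 \<in> submodule_of A hull ?M" using one hull_subset[of ?M "submodule_of A"] by blast
      ultimately have "x * 1 \<in> submodule_of A hull ?M"
        using submodule_of_hull[of A ?M] unfolding submodule_of_def by blast
      then show "x \<in> submodule_of A hull ?M" by simp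
    qed
  qed
qed

section \<open>The lower bound\<close>

text \<open>Modulo D the lattice lies in t^m A, so everything new in a product lies in t^(2m) A,
  whatever Y is. A ring C contained in the lattice therefore acts on it.\<close>

lemma lat_ring:
  assumes "x \<in> lat m (2 * m) Y" "y \<in> lat m (2 * m) Y"
  shows "x * y \<in> lat m (2 * m) Y"
proof -
  from assms obtain x0 x1 x2 y0 y1 y2 where xy: "x = el x0 x1 x2" "y = el y0 y1 y2"
      "X ^ m dvd x1" "X ^ (2 * m) dvd x2 - Y * x1" "X ^ m dvd y1" "X ^ (2 * m) dvd y2 - Y * y1"
    by (auto simp: lat_def)
  then obtain p q p' q' where pq: "x1 = X ^ m * p" "x2 - Y * x1 = X ^ (2 * m) * q"
    "y1 = X ^ m * p'" "y2 - Y * y1 = X ^ (2 * m) * q'" by (auto simp: dvd_def)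
  define s where "s = (X ^ m :: 'k fps)"
  have s: "X ^ (2 * m) = s * s" by (simp add: s_def mult_2 power_add)
  have "x2 = Y * x1 + s * s * q" "y2 = Y * y1 + s * s * q'"
    using pq(2,4) unfolding s by (simp_all add: algebra_simps)
  then have x2: "x2 = s * (Y * p + s * q)" "y2 = s * (Y * p' + s * q')"
    using pq(1,3) by (simp_all add: s_def[symmetric] algebra_simps)
  have x1: "x1 = s * p" "y1 = s * p'" using pq by (simp_all add: s_def)
  have "s dvd x0 * y1 + x1 * y0 + fb * (x1 * y1) + fd * (x2 * y2)"
    unfolding x1 x2 by (intro dvd_add) auto
  moreover have "x0 * y2 + x2 * y0 - fa * (x1 * y1) - fc * (x2 * y2) - Y * (x0 * y1 + x1 * y0 + fb * (x1 * y1) + fd * (x2 * y2))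
      = s * s * (x0 * q' + q * y0 - fa * (p * p') - fc * ((Y * p + s * q) * (Y * p' + s * q'))
        - Y * (fb * (p * p') + fd * ((Y * p + s * q) * (Y * p' + s * q'))))"
    unfolding x1 x2 by (simp add: algebra_simps)
  ultimately show ?thesis unfolding xy(1,2) el_mult el_in_lat_iff s s_def[symmetric] by simp
qed

definition Dw :: "'k fps \<Rightarrow> 'k fps \<Rightarrow> 'k fps \<Rightarrow> 'k fps \<Rightarrow> 'k fps \<Rightarrow> 'k fps \<Rightarrow> 'k fps"
  where "Dw x0 x1 x2 y0 y1 y2 = det3 x0 x1 x2 y0 y1 y2
    (- fa * fc * x1 - fa * fd * x2) (x0 + fb * x1) (- fa * x1)"

definition Dz :: "'k fps \<Rightarrow> 'k fps \<Rightarrow> 'k fps \<Rightarrow> 'k fps \<Rightarrow> 'k fps \<Rightarrow> 'k fps \<Rightarrow> 'k fps"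
  where "Dz x0 x1 x2 y0 y1 y2 = det3 x0 x1 x2 y0 y1 y2
    (- fa * fd * x1 - fb * fd * x2) (fd * x2) (x0 - fc * x2)"

text \<open>\<open>Dw x y\<close> and \<open>Dz x y\<close> are the determinants of \<open>x, y, xw\<close> and of \<open>x, y, xz\<close>; multiplying both
  \<open>x\<close> and \<open>y\<close> by \<open>u\<close> multiplies them by the norm of \<open>u\<close>.\<close>

lemma Dw_Dz_mult:
  assumes "el u0 u1 u2 * el x0 x1 x2 = el x0' x1' x2'" "el u0 u1 u2 * el y0 y1 y2 = el y0' y1' y2'"
  shows "Dw x0' x1' x2' y0' y1' y2' = Dw x0 x1 x2 y0 y1 y2 * norm_fps u0 u1 u2"
    and "Dz x0' x1' x2' y0' y1' y2' = Dz x0 x1 x2 y0 y1 y2 * norm_fps u0 u1 u2"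
proof -
  have eqs:
    "x0' = u0 * x0 - fa * fc * (u1 * x1) - fa * fd * (u1 * x2 + u2 * x1) - fb * fd * (u2 * x2)"
    "x1' = u0 * x1 + u1 * x0 + fb * (u1 * x1) + fd * (u2 * x2)"
    "x2' = u0 * x2 + u2 * x0 - fa * (u1 * x1) - fc * (u2 * x2)"
    "y0' = u0 * y0 - fa * fc * (u1 * y1) - fa * fd * (u1 * y2 + u2 * y1) - fb * fd * (u2 * y2)"
    "y1' = u0 * y1 + u1 * y0 + fb * (u1 * y1) + fd * (u2 * y2)"
    "y2' = u0 * y2 + u2 * y0 - fa * (u1 * y1) - fc * (u2 * y2)"
    using assms by (simp_all add: el_mult)
  show "Dw x0' x1' x2' y0' y1' y2' = Dw x0 x1 x2 y0 y1 y2 * norm_fps u0 u1 u2"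
    unfolding Dw_def norm_form_def det3_mult[symmetric] eqs
    by (rule det3_cong) (simp_all add: algebra_simps)
  show "Dz x0' x1' x2' y0' y1' y2' = Dz x0 x1 x2 y0 y1 y2 * norm_fps u0 u1 u2"
    unfolding Dz_def norm_form_def det3_mult[symmetric] eqs
    by (rule det3_cong) (simp_all add: algebra_simps)
qed

text \<open>Modulo the square of p = t^m the two determinants are p \<kappa> and - p \<kappa> Y with
  the same \<kappa>, so their quotient reveals - Y.\<close>

lemma Dw_Dz_lat:
  fixes p Y :: "'k fps"
  shows "\<exists>R. Dz \<alpha>1 (p * b1) (p * (b1 * Y + p * g1)) \<alpha>2 (p * b2) (p * (b2 * Y + p * g2)) =
      p * (\<alpha>1 * (\<alpha>1 * b2 - \<alpha>2 * b1)) + p * p * R"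
    and "\<exists>R. Dw \<alpha>1 (p * b1) (p * (b1 * Y + p * g1)) \<alpha>2 (p * b2) (p * (b2 * Y + p * g2)) =
      - (p * (\<alpha>1 * (\<alpha>1 * b2 - \<alpha>2 * b1) * Y)) + p * p * R"
proof -
  define c1 c2 where "c1 = b1 * Y + p * g1" and "c2 = b2 * Y + p * g2"
  define s0 s1 s0' where "s0 = - fa * fd * b1 - fb * fd * c1" and "s1 = fd * c1"
    and "s0' = - fa * fc * b1 - fa * fd * c1"
  show "\<exists>R. Dz \<alpha>1 (p * b1) (p * (b1 * Y + p * g1)) \<alpha>2 (p * b2) (p * (b2 * Y + p * g2)) =
      p * (\<alpha>1 * (\<alpha>1 * b2 - \<alpha>2 * b1)) + p * p * R"
    unfolding c1_def[symmetric] c2_def[symmetric]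
    by (intro exI[of _ "- \<alpha>1 * b2 * fc * c1 - \<alpha>1 * c2 * s1 + b1 * \<alpha>2 * fc * c1 + b1 * c2 * p * s0
        + c1 * \<alpha>2 * s1 - c1 * b2 * p * s0"]) (simp add: Dz_def det3_def s0_def s1_def algebra_simps)
  have "Dw \<alpha>1 (p * b1) (p * c1) \<alpha>2 (p * b2) (p * c2) = p * (\<alpha>1 * (\<alpha>2 * c1 - \<alpha>1 * c2)) +
      p * p * (- \<alpha>1 * b2 * fa * b1 - \<alpha>1 * c2 * fb * b1 + b1 * \<alpha>2 * fa * b1 + p * b1 * c2 * s0'
        + c1 * \<alpha>2 * fb * b1 - p * c1 * b2 * s0')"
    by (simp add: Dw_def det3_def s0'_def algebra_simps)
  moreover have "\<alpha>2 * c1 - \<alpha>1 * c2 = - ((\<alpha>1 * b2 - \<alpha>2 * b1) * Y) + p * (\<alpha>2 * g1 - \<alpha>1 * g2)"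
    by (simp add: c1_def c2_def algebra_simps)
  ultimately show "\<exists>R. Dw \<alpha>1 (p * b1) (p * (b1 * Y + p * g1)) \<alpha>2 (p * b2) (p * (b2 * Y + p * g2)) =
      - (p * (\<alpha>1 * (\<alpha>1 * b2 - \<alpha>2 * b1) * Y)) + p * p * R"
    unfolding c1_def[symmetric] c2_def[symmetric]
    by (intro exI[of _ "\<alpha>1 * (\<alpha>2 * g1 - \<alpha>1 * g2) + (- \<alpha>1 * b2 * fa * b1 - \<alpha>1 * c2 * fb * b1 + b1 * \<alpha>2 * fa * b1
       + p * b1 * c2 * s0' + c1 * \<alpha>2 * fb * b1 - p * c1 * b2 * s0')"]) (simp add: algebra_simps)
qed

text \<open>The common unit \<kappa> cancels; dividing by t^m reduces the precision from t^(2m) to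
  t^m.\<close>

lemma ratio_mod:
  fixes Y \<kappa> :: "'k fps"
  assumes "Q = X ^ m * \<kappa> + X ^ m * X ^ m * R"
    and "P = - (X ^ m * (\<kappa> * Y)) + X ^ m * X ^ m * R'"
    and \<kappa>: "res \<kappa> \<noteq> 0" and m: "0 < m" and j: "j < m"
  shows "fps_nth Q m \<noteq> 0" "fps_nth (- (fps_shift m P * inverse (fps_shift m Q))) j = fps_nth Y j"
proof -
  have sQ: "fps_shift m Q = \<kappa> + X ^ m * R"
    unfolding assms(1) by (intro fps_ext) (simp add: fps_X_power_mult_nth mult.assoc)
  have sP: "fps_shift m P = - (\<kappa> * Y) + X ^ m * R'"
    unfolding assms(2) by (intro fps_ext) (simp add: fps_X_power_mult_nth mult.assoc)
  have Q0: "res (fps_shift m Q) \<noteq> 0" using \<kappa> m unfolding sQ by (simp add: fps_X_power_mult_nth)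
  then show "fps_nth Q m \<noteq> 0" by simp
  define y where "y = - (fps_shift m P * inverse (fps_shift m Q))"
  have "y * fps_shift m Q = - fps_shift m P"
    using inverse_mult_eq_1[OF Q0] by (simp add: y_def mult.assoc)
  then have "\<kappa> * (y - Y) = X ^ m * (- R' - y * R)" unfolding sP sQ by (simp add: algebra_simps)
  then have "inverse \<kappa> * (\<kappa> * (y - Y)) = X ^ m * (inverse \<kappa> * (- R' - y * R))" by (simp add: mult_ac)
  then have "y - Y = X ^ m * (inverse \<kappa> * (- R' - y * R))"
    using inverse_mult_eq_1[OF \<kappa>] by (simp add: mult.assoc[symmetric])
  then have "fps_nth (y - Y) j = 0" using j by (simp add: fps_X_power_mult_nth)
  then show "fps_nth (- (fps_shift m P * inverse (fps_shift m Q))) j = fps_nth Y j" by (simp add: y_def)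
qed

text \<open>A frame is determined only modulo t^N A. The truncation is a representative whose
  coefficients are linear forms in x, so that determinants of truncations are regular
  functions.\<close>

definition trunc :: "nat \<Rightarrow> 'l \<Rightarrow> nat \<Rightarrow> 'k fps"
  where "trunc N x j = (\<Sum>l<N. fps_const (coord (l, j) x) * X ^ l)"

lemma trunc_diff:
  assumes "x \<in> A"
  shows "x - el (trunc N x 0) (trunc N x 1) (trunc N x 2) \<in> tAN N"
proof -
  have inner: "(\<Sum>j<3. kscale \<iota> (coord (i, j) x) (unit_vec i j)) =
      el (fps_const (coord (i, 0) x) * X ^ i) (fps_const (coord (i, 1) x) * X ^ i) (fps_const (coord (i, 2) x) * X ^ i)" for i
    by (simp add: eval_nat_numeral unit_vec_def el_kscale el_add)
  have "(\<Sum>i<N. \<Sum>j<3. kscale \<iota> (coord (i, j) x) (unit_vec i j)) = el (trunc N x 0) (trunc N x 1) (trunc N x 2)"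
    unfolding inner trunc_def by (induction N) (simp_all add: el_0 el_add)
  then show ?thesis using coord_expansion[OF assms, of N] by simp
qed

text \<open>The parameter \<open>Y\<close> modulo \<open>t\<^sup>m\<close> is read off the ideal \<open>u (D + t\<^sup>m (w + Yz) D + t\<^bsup>2m\<^esup> A)\<close> from two
  members of any frame.\<close>

lemma lat_multiple_frame:
  assumes U: "U = (*) u ` lat m (2 * m) Y" and u: "u \<in> A" "u * u' = 1" "u' \<in> A"
    and m: "0 < m" "2 * m \<le> N" and fr: "frame \<iota> (tAN N) U d v" and sub: "tAN N \<subseteq> U"
  shows "\<exists>j1<d. \<exists>j2<d. \<forall>Q P. Q = Dz (trunc N (v j1) 0) (trunc N (v j1) 1) (trunc N (v j1) 2)
        (trunc N (v j2) 0) (trunc N (v j2) 1) (trunc N (v j2) 2) \<longrightarrow>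
      P = Dw (trunc N (v j1) 0) (trunc N (v j1) 1) (trunc N (v j1) 2)
        (trunc N (v j2) 0) (trunc N (v j2) 1) (trunc N (v j2) 2) \<longrightarrow>
      fps_nth Q m \<noteq> 0 \<and> (\<forall>j<m. fps_nth (- (fps_shift m P * inverse (fps_shift m Q))) j = fps_nth Y j)"
proof -
  let ?M = "lat m (2 * m) Y"
  obtain u0 u1 u2 where u_el: "u = el u0 u1 u2" using A_ex[OF u(1)] by blast
  have norm: "res (norm_fps u0 u1 u2) \<noteq> 0" using el_unit_norm[of u0 u1 u2 u'] u by (simp add: u_el)
  have UA: "U \<subseteq> A" using U u lat_subset by (auto intro!: integral_add_mult)
  have vU: "v j \<in> U" if "j < d" for j using fr that by (simp add: frame_def)
  define v' where "v' j = el (trunc N (v j) 0) (trunc N (v j) 1) (trunc N (v j) 2)" for j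
  have vv': "v j - v' j \<in> tAN N" if "j < d" for j
    unfolding v'_def using trunc_diff vU[OF that] UA by blast
  have M_add: "x + y \<in> ?M" if xy: "x \<in> ?M" "y \<in> ?M" for x y
  proof -
    from xy obtain x0 x1 x2 y0 y1 y2 where "x = el x0 x1 x2" "y = el y0 y1 y2"
      "X ^ m dvd x1" "X ^ (2 * m) dvd x2 - Y * x1" "X ^ m dvd y1" "X ^ (2 * m) dvd y2 - Y * y1"
      by (auto simp: lat_def)
    moreover have eq: "(x2 + y2) - Y * (x1 + y1) = (x2 - Y * x1) + (y2 - Y * y1)" by (simp add: algebra_simps)
    moreover have "X ^ (2 * m) dvd (x2 + y2) - Y * (x1 + y1)"
      unfolding eq using calculation by (intro dvd_add)
    ultimately show ?thesis by (simp add: el_add el_in_lat_iff)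
  qed
  have tM: "u' * x \<in> tAN N" if "x \<in> tAN N" for x
  proof -
    from that obtain y where "y \<in> A" "x = t ^ N * y" by (auto simp: tA_def)
    then show ?thesis unfolding tA_def using integral_add_mult(2)[OF u(3), of y]
      by (intro image_eqI[of _ _ "u' * y"]) (simp_all add: mult.left_commute)
  qed
  have tsub: "tAN N \<subseteq> ?M" using m by (intro tA_subset_lat) auto
  have u'_neg: "- x \<in> tAN N" if "x \<in> tAN N" for x using k.subspace_neg[OF tA_subspace that] .
  \<comment> \<open>Dividing by u moves the truncated frame back into the lattice, where the shape
    of its coordinates is known.\<close>
  define \<mu> where "\<mu> j = u' * v' j" for j
  have u\<mu>: "u * \<mu> j = v' j" for j using u(2) by (simp add: \<mu>_def mult.assoc[symmetric])
  have \<mu>M: "\<mu> j \<in> ?M" if j: "j < d" for j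
  proof -
    from vU[OF j] U obtain x where x: "x \<in> ?M" "v j = u * x" by blast
    have "\<mu> j = u' * v j - u' * (v j - v' j)" by (simp add: \<mu>_def algebra_simps)
    also have "u' * v j = x" using u(2) by (simp add: x mult.assoc[symmetric] mult.commute[of u' u])
    also have "x - u' * (v j - v' j) = x + - (u' * (v j - v' j))" by simp
    also have "\<dots> \<in> ?M" using x(1) tsub u'_neg[OF tM[OF vv'[OF j]]] by (intro M_add) auto
    finally show ?thesis .
  qed
  define p where "p = (X ^ m :: 'k fps)"
  have "\<exists>\<alpha> b g. \<mu> j = el \<alpha> (p * b) (p * (b * Y + p * g))" if "j < d" for j
  proof -
    from \<mu>M[OF that] obtain x0 x1 x2 where x: "\<mu> j = el x0 x1 x2" "X ^ m dvd x1" "X ^ (2 * m) dvd x2 - Y * x1"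
      by (auto simp: lat_def)
    then obtain b g where "x1 = p * b" "x2 - Y * x1 = p * p * g" by (auto simp: dvd_def p_def mult_2 power_add)
    then have "x1 = p * b" "x2 = p * (b * Y + p * g)" by (simp_all add: algebra_simps)
    with x show ?thesis by blast
  qed
  then obtain \<alpha> b g where \<mu>_el: "\<And>j. j < d \<Longrightarrow> \<mu> j = el (\<alpha> j) (p * b j) (p * (b j * Y + p * g j))" by metis
  have rel: "\<exists>c. el x0 x1 x2 - lincomb c \<mu> d \<in> tAN N" if x: "el x0 x1 x2 \<in> ?M" for x0 x1 x2
  proof -
    have "u * el x0 x1 x2 \<in> U" using x U by blast
    from frame_span[OF fr this] obtain c where c: "u * el x0 x1 x2 - lincomb c v d \<in> tAN N" by blast
    have "lincomb c (\<lambda>j. v j - v' j) d \<in> tAN N"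
      using vv' by (intro k.subspace_sum[OF tA_subspace] k.subspace_scale[OF tA_subspace]) auto
    then have "lincomb c v d - lincomb c v' d \<in> tAN N" by (simp add: k.scale_right_diff_distrib sum_subtractf)
    from k.subspace_add[OF tA_subspace c this] have "u * el x0 x1 x2 - lincomb c v' d \<in> tAN N" by simp
    from tM[OF this] have "u' * (u * el x0 x1 x2) - u' * lincomb c v' d \<in> tAN N" by (simp add: algebra_simps)
    moreover have "u' * lincomb c v' d = lincomb c \<mu> d"
      by (simp add: sum_distrib_left kscale_def \<mu>_def mult_ac)
    moreover have "u' * (u * el x0 x1 x2) = el x0 x1 x2" using u(2) by (simp add: mult.assoc[symmetric] mult.commute[of u' u])
    ultimately show ?thesis by (intro exI[of _ c]) simp
  qed
  have lin_el: "lincomb c \<mu> d = el (\<Sum>j<d. fps_const (c j) * \<alpha> j) (\<Sum>j<d. fps_const (c j) * (p * b j))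
      (\<Sum>j<d. fps_const (c j) * (p * (b j * Y + p * g j)))" for c
  proof -
    have "lincomb c \<mu> d = (\<Sum>j<d. el (fps_const (c j) * \<alpha> j) (fps_const (c j) * (p * b j)) (fps_const (c j) * (p * (b j * Y + p * g j))))"
      by (intro sum.cong) (auto simp: \<mu>_el el_kscale)
    also have "\<dots> = el (\<Sum>j<d. fps_const (c j) * \<alpha> j) (\<Sum>j<d. fps_const (c j) * (p * b j))
      (\<Sum>j<d. fps_const (c j) * (p * (b j * Y + p * g j)))"
      by (induction d) (simp_all add: el_0 el_add)
    finally show ?thesis .
  qed
  \<comment> \<open>Otherwise 1 would not be a combination of the frame modulo t.\<close>
  have "\<exists>j1<d. res (\<alpha> j1) \<noteq> 0"
  proof (rule ccontr)
    assume no: "\<not> ?thesis"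
    have "el 1 0 0 \<in> ?M" by (simp add: el_in_lat_iff)
    from rel[OF this] obtain c where "el 1 0 0 - lincomb c \<mu> d \<in> tAN N" by blast
    then have "X ^ N dvd 1 - (\<Sum>j<d. fps_const (c j) * \<alpha> j)" unfolding lin_el el_diff el_in_tA_iff by simp
    moreover have "0 < N" using m by simp
    ultimately have "res (1 - (\<Sum>j<d. fps_const (c j) * \<alpha> j)) = 0"
      unfolding fps_X_power_dvd_iff by blast
    then show False using no by (simp add: fps_sum_nth)
  qed
  then obtain j1 where j1: "j1 < d" "res (\<alpha> j1) \<noteq> 0" by blast
  \<comment> \<open>Otherwise the leading coefficients of all members are proportional to those of
    member \<open>j1\<close>, and no combination has leading coefficients (0, 1), as p (w + Yz)
    requires.\<close>
  have "\<exists>j2<d. res (\<alpha> j1 * b j2 - \<alpha> j2 * b j1) \<noteq> 0"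
  proof (rule ccontr)
    assume no: "\<not> ?thesis"
    have "el 0 p (p * Y) \<in> ?M" by (simp add: el_in_lat_iff p_def mult.commute)
    from rel[OF this] obtain c where "el 0 p (p * Y) - lincomb c \<mu> d \<in> tAN N" by blast
    then have dv: "X ^ N dvd 0 - (\<Sum>j<d. fps_const (c j) * \<alpha> j)" "X ^ N dvd p - (\<Sum>j<d. fps_const (c j) * (p * b j))"
      unfolding lin_el el_diff el_in_tA_iff by simp_all
    then have 1: "(\<Sum>j<d. c j * res (\<alpha> j)) = 0"
      using m by (auto simp: fps_X_power_dvd_iff fps_sum_nth dest: spec[of _ 0])
    have "p - (\<Sum>j<d. fps_const (c j) * (p * b j)) = X ^ m * (1 - (\<Sum>j<d. fps_const (c j) * b j))"
      by (simp add: p_def right_diff_distrib sum_distrib_left mult_ac)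
    then have "fps_nth (X ^ m * (1 - (\<Sum>j<d. fps_const (c j) * b j))) m = 0"
      using dv(2) m by (simp add: fps_X_power_dvd_iff)
    then have 2: "(\<Sum>j<d. c j * res (b j)) = 1" by (simp add: fps_X_power_mult_nth fps_sum_nth)
    have "(\<Sum>j<d. c j * res (\<alpha> j1 * b j - \<alpha> j * b j1)) =
        res (\<alpha> j1) * (\<Sum>j<d. c j * res (b j)) - res (b j1) * (\<Sum>j<d. c j * res (\<alpha> j))"
      by (simp add: sum_distrib_left sum_subtractf algebra_simps)
    then have "(\<Sum>j<d. c j * res (\<alpha> j1 * b j - \<alpha> j * b j1)) = res (\<alpha> j1)" using 1 2 by simp
    moreover have "(\<Sum>j<d. c j * res (\<alpha> j1 * b j - \<alpha> j * b j1)) = 0" using no by (intro sum.neutral) auto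
    ultimately show False using j1 by simp
  qed
  then obtain j2 where j2: "j2 < d" "res (\<alpha> j1 * b j2 - \<alpha> j2 * b j1) \<noteq> 0" by blast
  define n where "n = norm_fps u0 u1 u2"
  define \<kappa>0 where "\<kappa>0 = \<alpha> j1 * (\<alpha> j1 * b j2 - \<alpha> j2 * b j1)"
  define \<kappa> where "\<kappa> = \<kappa>0 * n"
  have \<kappa>: "res \<kappa> \<noteq> 0" using j1 j2 norm unfolding \<kappa>_def \<kappa>0_def n_def fps_mult_nth_0 by simp
  have prod: "el u0 u1 u2 * el (\<alpha> j) (p * b j) (p * (b j * Y + p * g j)) = el (trunc N (v j) 0) (trunc N (v j) 1) (trunc N (v j) 2)"
    if "j < d" for j using u\<mu>[of j] \<mu>_el[OF that] by (simp add: u_el v'_def)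
  note DD = Dw_Dz_mult[OF prod[OF j1(1)] prod[OF j2(1)]]
  obtain R where R: "Dz (\<alpha> j1) (p * b j1) (p * (b j1 * Y + p * g j1)) (\<alpha> j2) (p * b j2) (p * (b j2 * Y + p * g j2)) =
      p * \<kappa>0 + p * p * R" using Dw_Dz_lat(1) unfolding \<kappa>0_def by blast
  obtain R' where R': "Dw (\<alpha> j1) (p * b j1) (p * (b j1 * Y + p * g j1)) (\<alpha> j2) (p * b j2) (p * (b j2 * Y + p * g j2)) =
      - (p * (\<kappa>0 * Y)) + p * p * R'" using Dw_Dz_lat(2) unfolding \<kappa>0_def by blast
  show ?thesis
  proof (rule exI[of _ j1], rule conjI[OF j1(1)], rule exI[of _ j2], rule conjI[OF j2(1)], intro allI impI)
    fix Q P
    assume "Q = Dz (trunc N (v j1) 0) (trunc N (v j1) 1) (trunc N (v j1) 2)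
        (trunc N (v j2) 0) (trunc N (v j2) 1) (trunc N (v j2) 2)"
    then have Q: "Q = X ^ m * \<kappa> + X ^ m * X ^ m * (R * n)"
      unfolding DD R n_def[symmetric] \<kappa>_def unfolding p_def by (simp add: algebra_simps)
    assume "P = Dw (trunc N (v j1) 0) (trunc N (v j1) 1) (trunc N (v j1) 2)
        (trunc N (v j2) 0) (trunc N (v j2) 1) (trunc N (v j2) 2)"
    then have P: "P = - (X ^ m * (\<kappa> * Y)) + X ^ m * X ^ m * (R' * n)"
      unfolding DD R' n_def[symmetric] \<kappa>_def unfolding p_def by (simp add: algebra_simps)
    show "fps_nth Q m \<noteq> 0 \<and> (\<forall>j<m. fps_nth (- (fps_shift m P * inverse (fps_shift m Q))) j = fps_nth Y j)"
      using ratio_mod[OF Q P \<kappa> m(1)] m(1) by blast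
  qed
qed

lemma par_le_iff:
  "par \<iota> C \<le> enat n \<longleftrightarrow> (\<exists>N \<F>. tA \<iota> N \<subseteq> C \<and> finite \<F> \<and>
    (\<forall>F\<in>\<F>. \<exists>q\<le>enat n. ideal_family \<iota> C N q F) \<and>
    (\<forall>M. C_ideal \<iota> C M \<longrightarrow> (\<exists>F\<in>\<F>. \<exists>M'\<in>F. module_iso C M M')))" (is "_ \<longleftrightarrow> ?R n")
proof
  define S where "S = {enat p | p. ?R p}"
  have par: "par \<iota> C = Inf S" unfolding par_def S_def by (rule arg_cong[of _ _ Inf]) blast
  {
    assume le: "par \<iota> C \<le> enat n"
    then have "S \<noteq> {}" unfolding par by (auto simp: Inf_enat_def)
    then have "Inf S \<in> S" unfolding Inf_enat_def by (auto intro: LeastI)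
    then obtain p where p: "Inf S = enat p" "?R p" unfolding S_def by auto
    then have "enat p \<le> enat n" using le par by simp
    then show "?R n" using p(2) by (meson order_trans)
  next
    assume "?R n"
    then have "enat n \<in> S" by (auto simp: S_def)
    then show "par \<iota> C \<le> enat n" unfolding par by (rule Inf_lower)
  }
qed

lemma cubic_ring_D: "cubic_ring \<iota> C \<Longrightarrow> \<delta> f \<in> C"
  using D.subspace_scale[of C 1 f] by (auto simp: cubic_ring_def Dscale_def)

definition reduced :: "nat \<Rightarrow> nat \<Rightarrow> (nat \<Rightarrow> 'l \<Rightarrow> 'k) \<Rightarrow> 'l set \<Rightarrow> (nat \<Rightarrow> 'l) \<Rightarrow> bool"
  where "reduced N d e U v \<longleftrightarrow> frame \<iota> (tAN N) U d v \<and> (\<forall>i<d. \<forall>j<d. e i (v j) = (if i = j then 1 else 0))"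

text \<open>When the pivot forms vanish on t^N A, a reduced frame is unique modulo t^N A, so the
  choice does not influence its coordinates below t^N.\<close>

definition rf :: "nat \<Rightarrow> nat \<Rightarrow> (nat \<Rightarrow> 'l \<Rightarrow> 'k) \<Rightarrow> 'l set \<Rightarrow> nat \<Rightarrow> 'l"
  where "rf N d e U = (SOME v. reduced N d e U v)"

text \<open>Every choice of n+1 coefficients of Y gives a C-ideal, isomorphic to a member U of one
  of the finitely many families. No algebraic map leads from Y to U, but one leads back: once the
  pivots and two frame members are fixed, Y modulo t^(n+1) is a regular function of U. The resulting
  finitely many pieces together cover affine (n+1)-space, so one of them has a chain of length
  n+1.\<close>

theorem par_lower_bound:
  assumes C: "cubic_ring \<iota> C"
    and sub: "C \<subseteq> {el x0 x1 x2 | x0 x1 x2. X ^ (2 * Suc n) dvd x1 \<and> X ^ (2 * Suc n) dvd x2}"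
  shows "\<not> par \<iota> C \<le> enat n"
proof
  assume "par \<iota> C \<le> enat n"
  then obtain N \<F> where NC: "tAN N \<subseteq> C" and fin: "finite \<F>"
    and fam: "\<And>F. F \<in> \<F> \<Longrightarrow> \<exists>q\<le>enat n. ideal_family \<iota> C N q F"
    and cover: "\<And>M. C_ideal \<iota> C M \<Longrightarrow> \<exists>F\<in>\<F>. \<exists>M'\<in>F. module_iso C M M'"
    unfolding par_le_iff by blast
  define m where "m = Suc n"
  have m: "0 < m" by (simp add: m_def)
  have DC: "range \<delta> \<subseteq> C" using cubic_ring_D[OF C] by blast
  have C_lat: "C \<subseteq> lat m (2 * m) Y" for Y
  proof
    fix x assume "x \<in> C"
    with sub obtain x0 x1 x2 where x: "x = el x0 x1 x2" "X ^ (2 * m) dvd x1" "X ^ (2 * m) dvd x2"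
      by (auto simp: m_def)
    have "X ^ m dvd x1" using x(2) dvd_trans[OF le_imp_power_dvd[of m "2 * m"]] by auto
    then show "x \<in> lat m (2 * m) Y" using x by (simp add: el_in_lat_iff dvd_diff)
  qed
  have N: "2 * m \<le> N"
  proof -
    have "el 0 (X ^ N) 0 \<in> C" using NC el_in_tA_iff[of 0 "X ^ N" 0 N] by auto
    then have "X ^ (2 * m) dvd (X ^ N :: 'k fps)" using sub by (auto simp: m_def)
    then have "\<forall>i<2 * m. fps_nth (X ^ N :: 'k fps) i = 0" by (simp add: fps_X_power_dvd_iff)
    then show ?thesis by (metis fps_X_power_nth not_le one_neq_zero)
  qed
  let ?Z = "zariski_Gr \<iota> A (tAN N)"
  define Qf where "Qf d e j1 j2 U = (let v = rf N d e U in
    Dz (trunc N (v j1) 0) (trunc N (v j1) 1) (trunc N (v j1) 2) (trunc N (v j2) 0) (trunc N (v j2) 1) (trunc N (v j2) 2))"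
    for d e j1 j2 U
  define Pf where "Pf d e j1 j2 U = (let v = rf N d e U in
    Dw (trunc N (v j1) 0) (trunc N (v j1) 1) (trunc N (v j1) 2) (trunc N (v j2) 0) (trunc N (v j2) 1) (trunc N (v j2) 2))"
    for d e j1 j2 U
  \<comment> \<open>The piece of \<open>F\<close> with pivots \<open>e\<close> on which the
    denominator, taken from members \<open>j1\<close> and \<open>j2\<close>, is a unit after
    division by t^m; there \<open>y\<close> is regular.\<close>
  define S where "S F d e j1 j2 = {U\<in>F \<inter> Grassmannian \<iota> A (tAN N) d. (\<exists>v. reduced N d e U v) \<and> fps_nth (Qf d e j1 j2 U) m \<noteq> 0}"
    for F d e j1 j2
  define y where "y d e j1 j2 U j = fps_nth (- (fps_shift m (Pf d e j1 j2 U) * inverse (fps_shift m (Qf d e j1 j2 U)))) j"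
    for d e j1 j2 U j
  \<comment> \<open>Extensional pivot functions and the bound on \<open>d\<close> keep the number of
    pieces finite.\<close>
  define I where "I = (SIGMA F:\<F>. SIGMA d:{..card (coords N)}. SIGMA e:{..<d} \<rightarrow>\<^sub>E coords N. {..<d} \<times> {..<d})"
  have finc: "finite (coords N)" by (simp add: coords_def)
  have finI: "finite I" unfolding I_def using fin finc by (auto intro!: finite_SigmaI finite_PiE)
  have rf: "reduced N d e U (rf N d e U)" if "U \<in> S F d e j1 j2" for F d e j1 j2 U
  proof -
    have "\<exists>v. reduced N d e U v" using that by (simp add: S_def)
    then show ?thesis unfolding rf_def by (rule someI_ex)
  qed
  define \<T> where "\<T> = (\<lambda>(F, d, e, j1, j2). (subtopology ?Z (S F d e j1 j2), y d e j1 j2)) ` I"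
  have SG: "S F d e j1 j2 \<subseteq> Grassmannian \<iota> A (tAN N) d" for F d e j1 j2 by (auto simp: S_def)
  have "\<exists>(T, y)\<in>\<T>. has_chain T m"
  proof (rule chain_of_parameters)
    show "finite \<T>" using finI by (simp add: \<T>_def)
    show "noetherian_space T" if "(T, y') \<in> \<T>" for T y'
      using that noetherian_Gr[OF SG] by (auto simp: \<T>_def)
    \<comment> \<open>All of affine space is covered, so the open set is given by the constant
      1.\<close>
    show "(\<lambda>_. 1) \<in> poly_fun m" by (rule poly_fun.const)
    show "(1::'k) \<noteq> 0" by simp
    show "closedin T {x\<in>topspace T. f (y' x) = 0}" if Ty: "(T, y') \<in> \<T>" and f: "f \<in> poly_fun m" for T y' f
    proof -
      from Ty obtain F d e j1 j2 where i: "(F, d, e, j1, j2) \<in> I" "T = subtopology ?Z (S F d e j1 j2)" "y' = y d e j1 j2"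
        by (auto simp: \<T>_def)
      interpret graded_zariski T "plucker A (tAN N) d"
        unfolding i(2) by (rule graded_zariski_Gr[OF tA_subspace SG coordinates_coords])
      have top: "topspace T = S F d e j1 j2"
        unfolding i(2) topspace_subtopology topspace_zariski_Gr using SG[of F d e j1 j2] by auto
      have tr: "regular_fps (\<lambda>U. trunc N (rf N d e U j) l)" if "j < d" "l < 3" for j l
      proof -
        have "regular (\<lambda>U. coord (i, l) (rf N d e U j))" if "i < N" for i
          unfolding i(2)
        proof (rule reduced_frame_regular[OF tA_subspace coordinates_coords SG])
          show "frame \<iota> (tAN N) U d (rf N d e U)" if "U \<in> S F d e j1 j2" for U
            using rf[OF that] by (simp add: reduced_def)
          show "e i \<in> coords N" if "i < d" for i using i(1) that by (auto simp: I_def)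
          show "e i (rf N d e U j) = (if i = j then 1 else 0)" if "U \<in> S F d e j1 j2" "i < d" "j < d" for U i j
            using rf[OF that(1)] that(2,3) by (simp add: reduced_def)
          show "k_linear (coord (i, l))" using \<open>l < 3\<close> by (rule coord_linear)
          show "coord (i, l) x = 0" if "x \<in> tAN N" for x
            using coordinates_coords[of N] that \<open>i < N\<close> \<open>l < 3\<close> by (auto simp: coordinates_def coords_def)
        qed fact
        moreover have "fps_nth (trunc N x l) i = (if i < N then coord (i, l) x else 0)" for x i
        proof -
          have "fps_nth (trunc N x l) i = (\<Sum>a<N. if i = a then coord (a, l) x else 0)"
            by (simp add: trunc_def fps_sum_nth fps_X_power_nth if_distrib cong: if_cong)
          then show ?thesis by simp
        qed
        ultimately have "regular (\<lambda>U. fps_nth (trunc N (rf N d e U j) l) i)" for i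
          by (cases "i < N") (simp_all add: regular_const)
        then show ?thesis by (simp add: regular_fps_def)
      qed
      have j: "j1 < d" "j2 < d" using i(1) by (auto simp: I_def)
      have rQ: "regular_fps (Qf d e j1 j2)" "regular_fps (Pf d e j1 j2)"
        unfolding Qf_def Pf_def Let_def Dz_def Dw_def det3_def minus_mult_left[symmetric]
        by (intro regular_fps_diff regular_fps_add regular_fps_mult regular_fps_minus regular_fps_const tr j; simp)+
      have "regular_fps (\<lambda>U. - (fps_shift m (Pf d e j1 j2 U) * inverse (fps_shift m (Qf d e j1 j2 U))))"
        using rQ by (intro regular_fps_minus regular_fps_mult regular_fps_shift regular_fps_inverse) (auto simp: top S_def)
      then have "regular (\<lambda>U. y d e j1 j2 U j)" for j by (simp add: regular_fps_def y_def)
      then have "regular (\<lambda>U. f (y' U))" unfolding i(3) by (rule regular_poly_fun[OF f])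
      then show ?thesis by (rule regular_closed_zero)
    qed
    show "\<exists>(T, y)\<in>\<T>. \<exists>x\<in>topspace T. \<forall>j<m. y x j = q j" for q
    proof -
      define Y where "Y = Abs_fps q"
      let ?M = "lat m (2 * m) Y"
      have CM: "c * x \<in> ?M" if "c \<in> C" "x \<in> ?M" for c x using lat_ring C_lat that by blast
      have one: "1 \<in> ?M" unfolding el_special(4) by (simp add: el_in_lat_iff)
      from cover[OF lat_ideal(1)[OF DC CM]] obtain F U where FU: "F \<in> \<F>" "U \<in> F" "module_iso C ?M U" by blast
      have "t ^ N * x \<in> C" if "x \<in> ?M" for x
        using that lat_subset[of m "2 * m" Y] NC unfolding tA_def by blast
      moreover have "t ^ N \<in> C" using DC by (auto simp: t_elt_power)
      ultimately obtain u where u: "U = (*) u ` ?M" using iso_multiple[OF FU(3) one] by blast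
      have FI: "F \<subseteq> topspace (ideal_space \<iota> C N)"
        using fam[OF FU(1)] openin_subset by (fastforce simp: ideal_family_def locally_closedin_def)
      then have Ui: "U \<in> topspace ?Z" "submodule_of A hull U = A" using FU(2) by (auto simp: ideal_space_def)
      then obtain d where d: "U \<in> Grassmannian \<iota> A (tAN N) d" by (auto simp: topspace_zariski_Gr)
      then have UG: "k.subspace U" "tAN N \<subseteq> U" "U \<subseteq> A" by (simp_all add: Grassmannian_def)
      have uA: "u \<in> A" using u one UG(3) by force
      \<comment> \<open>Since U generates A as an A-module, the multiplier u divides 1 in A, hence
        is a unit of A.\<close>
      have "submodule_of A ((*) u ` A)" unfolding submodule_of_def
      proof (intro conjI ballI)
        show "0 \<in> (*) u ` A" using A_ring(2) by (intro image_eqI[of _ _ 0]) auto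
        fix a b assume "a \<in> (*) u ` A" "b \<in> (*) u ` A"
        then show "a - b \<in> (*) u ` A" using A_ring(3) by (auto simp flip: right_diff_distrib)
      next
        fix c a assume "c \<in> A" "a \<in> (*) u ` A"
        then show "c * a \<in> (*) u ` A" using integral_add_mult(2) by (auto simp: mult.left_commute[of c u])
      qed
      moreover have "U \<subseteq> (*) u ` A" unfolding u by (intro image_mono lat_subset)
      ultimately have "submodule_of A hull U \<subseteq> (*) u ` A" by (intro hull_minimal)
      then obtain u' where u': "u' \<in> A" "u * u' = 1" using Ui A_ring(1) by auto
      from reduced_frame[OF some_frame[OF d] tA_subspace UG(1) coordinates_coords UG(3)] obtain v e0 where
        v: "frame \<iota> (tAN N) U d v" "\<forall>i<d. e0 i \<in> coords N" "\<forall>i<d. \<forall>j<d. e0 i (v j) = (if i = j then 1 else 0)" by blast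
      define e where "e = restrict e0 {..<d}"
      have e: "e \<in> {..<d} \<rightarrow>\<^sub>E coords N" using v(2) by (auto simp: e_def)
      have ex: "reduced N d e U v" using v by (auto simp: reduced_def e_def)
      have "inj_on e0 {..<d}"
      proof (rule inj_onI)
        fix i j assume "i \<in> {..<d}" "j \<in> {..<d}" "e0 i = e0 j"
        then show "i = j" using v(3) by (metis lessThan_iff one_neq_zero)
      qed
      \<comment> \<open>Distinct members of a reduced frame have distinct pivots.\<close>
      then have "d \<le> card (coords N)" using card_inj_on_le[of e0 "{..<d}" "coords N"] v(2) finc by auto
      have red: "reduced N d e U (rf N d e U)" unfolding rf_def
        using ex by (rule someI[of "reduced N d e U"])
      then have fr: "frame \<iota> (tAN N) U d (rf N d e U)" by (simp add: reduced_def)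
      obtain j1 j2 where
        j: "j1 < d" "j2 < d" "fps_nth (Qf d e j1 j2 U) m \<noteq> 0" "\<And>j. j < m \<Longrightarrow> y d e j1 j2 U j = fps_nth Y j"
        using lat_multiple_frame[where v = "rf N d e U" and U = U and u = u and Y = Y and m = m
          and N = N and d = d and u' = u', OF u uA u'(2) u'(1) m N fr UG(2)]
        unfolding Qf_def Pf_def y_def Let_def by blast
      have "(F, d, e, j1, j2) \<in> I" using FU(1) e j \<open>d \<le> _\<close> by (auto simp: I_def)
      then have "(subtopology ?Z (S F d e j1 j2), y d e j1 j2) \<in> \<T>" unfolding \<T>_def by force
      moreover have "U \<in> topspace (subtopology ?Z (S F d e j1 j2))"
        using Ui FU(2) d ex j(3) by (auto simp: S_def)
      moreover have "\<forall>j<m. y d e j1 j2 U j = q j" using j(4) by (simp add: Y_def)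
      ultimately show ?thesis by blast
    qed
  qed
  then obtain F d e j1 j2 where i: "(F, d, e, j1, j2) \<in> I" "has_chain (subtopology ?Z (S F d e j1 j2)) m"
    by (auto simp: \<T>_def)
  then have F: "F \<in> \<F>" by (auto simp: I_def)
  from fam[OF F] obtain r where r: "r \<le> enat n" "ideal_family \<iota> C N r F" by blast
  have FI: "F \<subseteq> topspace (ideal_space \<iota> C N)"
    using r(2) openin_subset by (fastforce simp: ideal_family_def locally_closedin_def)
  have "subtopology ?Z (S F d e j1 j2) = subtopology (subtopology (ideal_space \<iota> C N) F) (S F d e j1 j2)"
    unfolding ideal_space_def subtopology_subtopology
    using FI by (intro arg_cong[of _ _ "subtopology ?Z"]) (auto simp: S_def ideal_space_def)
  then have "has_chain (subtopology (ideal_space \<iota> C N) F) m"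
    using i(2) has_chain_subtopology by metis
  then have "enat m \<le> r" using krull_dim_ge r(2) by (metis ideal_family_def)
  then have "enat m \<le> enat n" using r(1) by (rule order_trans)
  then show False by (simp add: m_def)
qed

end

section \<open>The upper bound\<close>

lemma sum_lessThan_add: "(\<Sum>i<m + n. f i) = (\<Sum>i<m. f i) + (\<Sum>i<n. f (m + i))" for m n :: nat
  by (induction n) (simp_all add: add_ac)

lemma fps_order:
  fixes f :: "'k::field fps"
  assumes "f \<noteq> 0"
  shows "\<exists>j e. f = X ^ j * e \<and> res e \<noteq> 0"
proof (intro exI conjI)
  show "f = X ^ subdegree f * fps_shift (subdegree f) f"
    using subdegree_decompose[of f] by (simp add: mult.commute)
  show "res (fps_shift (subdegree f) f) \<noteq> 0" using assms by simp
qed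

lemma fps_X_power_dvd_unit_mult:
  fixes f g :: "'k::field fps"
  assumes "res g \<noteq> 0" "X ^ n dvd f * g"
  shows "X ^ n dvd f"
proof -
  from assms(2) obtain h where "f * g = X ^ n * h" by (auto simp: dvd_def)
  then have "f * g * inverse g = X ^ n * (h * inverse g)" by (simp add: mult.assoc)
  moreover have "g * inverse g = 1" using inverse_mult_eq_1[OF assms(1)] by (simp add: mult.commute)
  ultimately have "f = X ^ n * (h * inverse g)" by (simp add: mult.assoc)
  then show ?thesis by (rule dvdI)
qed

context cubic_order
begin

text \<open>The coordinate x1 is divisible by t^a, so a change of Y by t^(b-a) is absorbed by t^b A.
  Only b-a coefficients of Y count.\<close>

lemma lat_cong:
  assumes "X ^ (b - a) dvd Y - Y'" "a \<le> b"
  shows "lat a b Y = lat a b Y'"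
proof -
  have sub: "lat a b Y \<subseteq> lat a b Y'" if d: "X ^ (b - a) dvd Y - Y'" for Y Y'
  proof
    fix x assume "x \<in> lat a b Y"
    then obtain x0 x1 x2 where x: "x = el x0 x1 x2" "X ^ a dvd x1" "X ^ b dvd x2 - Y * x1"
      by (auto simp: lat_def)
    have "X ^ (b - a) * X ^ a dvd (Y - Y') * x1" using d x(2) by (rule mult_dvd_mono)
    then have "X ^ b dvd (Y - Y') * x1" using assms(2) by (simp flip: power_add)
    from dvd_add[OF x(3) this] have "X ^ b dvd x2 - Y' * x1" by (simp add: algebra_simps)
    then show "x \<in> lat a b Y'" using x by (simp add: el_in_lat_iff)
  qed
  have "X ^ (b - a) dvd Y' - Y" using assms(1) by (simp add: dvd_diff_commute)
  then show ?thesis using sub[OF assms(1)] sub[of Y' Y] by blast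
qed

text \<open>Multiples of 1, w + Yz and z by powers of t, listed until they fall into t^N A. Only the
  middle block involves Y, and linearly.\<close>

definition lat_frame :: "nat \<Rightarrow> nat \<Rightarrow> nat \<Rightarrow> 'k fps \<Rightarrow> nat \<Rightarrow> 'l"
  where "lat_frame N a b Y i = (if i < N then el (X ^ i) 0 0
    else if i < N + (N - a) then el 0 (X ^ (a + (i - N))) (Y * X ^ (a + (i - N)))
    else el 0 0 (X ^ (b + (i - (N + (N - a))))))"

lemma lat_frame:
  assumes "a \<le> b" "b \<le> N"
  shows "frame \<iota> (tAN N) (lat a b Y) (N + (N - a) + (N - b)) (lat_frame N a b Y)"
proof -
  let ?P = "N - a" and ?Q = "N - b"
  let ?v = "lat_frame N a b Y"
  let ?p = "\<lambda>c m. \<Sum>i<(m::nat). fps_const (c i) * X ^ i :: 'k fps"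
  have lin: "lincomb c ?v (N + ?P + ?Q) =
      el (?p c N) (X ^ a * ?p (\<lambda>i. c (N + i)) ?P)
        (Y * (X ^ a * ?p (\<lambda>i. c (N + i)) ?P) + X ^ b * ?p (\<lambda>i. c (N + ?P + i)) ?Q)" for c
  proof -
    have 1: "(\<Sum>i<m. el (fps_const (c i) * X ^ i) 0 0) = el (?p c m) 0 0" for c m
      by (induction m) (simp_all add: el_0 el_add)
    have 2: "(\<Sum>i<m. el 0 (fps_const (c i) * X ^ (a + i)) (fps_const (c i) * (Y * X ^ (a + i)))) =
        el 0 (X ^ a * ?p c m) (Y * (X ^ a * ?p c m))" for c m
      by (induction m) (simp_all add: el_0 el_add power_add algebra_simps)
    have 3: "(\<Sum>i<m. el 0 0 (fps_const (c i) * X ^ (b + i))) = el 0 0 (X ^ b * ?p c m)" for c m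
      by (induction m) (simp_all add: el_0 el_add power_add algebra_simps)
    have "lincomb c ?v (N + ?P + ?Q) = (\<Sum>i<N. el (fps_const (c i) * X ^ i) 0 0)
      + (\<Sum>i<?P. el 0 (fps_const (c (N + i)) * X ^ (a + i)) (fps_const (c (N + i)) * (Y * X ^ (a + i))))
      + (\<Sum>i<?Q. el 0 0 (fps_const (c (N + ?P + i)) * X ^ (b + i)))"
      unfolding sum_lessThan_add by (intro arg_cong2[of _ _ _ _ "(+)"] sum.cong) (auto simp: lat_frame_def el_kscale)
    then show ?thesis unfolding 1 2 3 el_add by simp
  qed
  have p_nth: "fps_nth (?p c m) i = (if i < m then c i else 0)" for c m i
  proof -
    have "fps_nth (?p c m) i = (\<Sum>l<m. if i = l then c l else 0)"
      by (simp add: fps_sum_nth fps_X_power_nth if_distrib cong: if_cong)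
    then show ?thesis by simp
  qed
  have p_dvd: "X ^ (e + m) dvd X ^ e * (f - ?p (fps_nth f) m)" for e m and f :: "'k fps"
    by (auto simp: fps_X_power_dvd_iff fps_X_power_mult_nth p_nth)
  have p_zero: "c i = 0" if "X ^ (e + m) dvd X ^ e * ?p c m" "i < m" for e m c i
  proof -
    have "fps_nth (X ^ e * ?p c m) (e + i) = 0" using that unfolding fps_X_power_dvd_iff by auto
    then show ?thesis using that(2) by (simp add: fps_X_power_mult_nth p_nth)
  qed
  have aN: "a + ?P = N" and bN: "b + ?Q = N" using assms by auto
  show ?thesis
  proof (rule frameI[OF _ _ _ tA_subspace])
    fix i assume "i < N + ?P + ?Q"
    have "X ^ a dvd (X ^ (a + j) :: 'k fps)" "X ^ b dvd (X ^ (b + j) :: 'k fps)" for j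
      by (simp_all add: power_add)
    then show "?v i \<in> lat a b Y" by (simp add: lat_frame_def el_in_lat_iff del: add_diff_assoc)
  next
    fix u assume "u \<in> lat a b Y"
    then obtain x0 x1 x2 where x: "u = el x0 x1 x2" "X ^ a dvd x1" "X ^ b dvd x2 - Y * x1"
      by (auto simp: lat_def)
    then obtain p q where pq: "x1 = X ^ a * p" "x2 - Y * x1 = X ^ b * q" by (auto simp: dvd_def)
    define c where "c i = (if i < N then fps_nth x0 i else if i < N + ?P then fps_nth p (i - N) else fps_nth q (i - (N + ?P)))" for i
    have c: "?p c N = ?p (fps_nth x0) N" "?p (\<lambda>i. c (N + i)) ?P = ?p (fps_nth p) ?P"
      "?p (\<lambda>i. c (N + ?P + i)) ?Q = ?p (fps_nth q) ?Q"
      by (auto simp: c_def intro!: sum.cong)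
    have "u - lincomb c ?v (N + ?P + ?Q) \<in> tAN N"
      unfolding lin c x(1) el_diff el_in_tA_iff
    proof (intro conjI)
      show "X ^ N dvd x0 - ?p (fps_nth x0) N" using p_dvd[of 0 N x0] by simp
      have 1: "X ^ N dvd X ^ a * (p - ?p (fps_nth p) ?P)" using p_dvd[of a ?P p] aN by simp
      then show "X ^ N dvd x1 - X ^ a * ?p (fps_nth p) ?P" by (simp add: pq(1) right_diff_distrib)
      have 2: "X ^ N dvd X ^ b * (q - ?p (fps_nth q) ?Q)" using p_dvd[of b ?Q q] bN by simp
      have "x2 - (Y * (X ^ a * ?p (fps_nth p) ?P) + X ^ b * ?p (fps_nth q) ?Q) =
        X ^ b * (q - ?p (fps_nth q) ?Q) + Y * (X ^ a * (p - ?p (fps_nth p) ?P))"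
        using pq(2) unfolding pq(1) by (simp add: algebra_simps)
      then show "X ^ N dvd x2 - (Y * (X ^ a * ?p (fps_nth p) ?P) + X ^ b * ?p (fps_nth q) ?Q)"
        using dvd_add[OF 2 dvd_mult[OF 1]] by simp
    qed
    then show "\<exists>c. u - lincomb c ?v (N + ?P + ?Q) \<in> tAN N" by blast
  next
    fix c i assume c: "lincomb c ?v (N + ?P + ?Q) \<in> tAN N" and i: "i < N + ?P + ?Q"
    from c have d: "X ^ N dvd ?p c N" "X ^ N dvd X ^ a * ?p (\<lambda>i. c (N + i)) ?P"
      "X ^ N dvd Y * (X ^ a * ?p (\<lambda>i. c (N + i)) ?P) + X ^ b * ?p (\<lambda>i. c (N + ?P + i)) ?Q"
      unfolding lin el_in_tA_iff by simp_all
    have d3: "X ^ N dvd X ^ b * ?p (\<lambda>i. c (N + ?P + i)) ?Q"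
      using dvd_diff[OF d(3) dvd_mult[OF d(2), of Y]] by simp
    consider "i < N" | "N \<le> i" "i < N + ?P" | "N + ?P \<le> i" by linarith
    then show "c i = 0"
    proof cases
      case 1
      then show ?thesis using p_zero[of 0 N c i] d(1) by simp
    next
      case 2
      then show ?thesis using p_zero[of a ?P "\<lambda>i. c (N + i)" "i - N"] d(2) aN by auto
    next
      case 3
      then show ?thesis using p_zero[of b ?Q "\<lambda>i. c (N + ?P + i)" "i - (N + ?P)"] d3 bN i by auto
    qed
  qed
qed

lemma lat_Grassmannian:
  assumes "a \<le> b" "b \<le> N"
  shows "lat a b Y \<in> Grassmannian \<iota> A (tAN N) (N + (N - a) + (N - b))"
proof -
  have "k.subspace (lat a b Y)" unfolding k.subspace_def
  proof (intro conjI ballI allI)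
    show "0 \<in> lat a b Y" using el_in_lat_iff[of 0 0 0] by (simp add: el_0)
    fix x y c assume xy: "x \<in> lat a b Y" "y \<in> lat a b Y"
    then obtain x0 x1 x2 y0 y1 y2 where "x = el x0 x1 x2" "y = el y0 y1 y2"
      "X ^ a dvd x1" "X ^ b dvd x2 - Y * x1" "X ^ a dvd y1" "X ^ b dvd y2 - Y * y1"
      by (auto simp: lat_def)
    moreover have eq: "(x2 + y2) - Y * (x1 + y1) = (x2 - Y * x1) + (y2 - Y * y1)" by (simp add: algebra_simps)
    moreover have "X ^ b dvd (x2 + y2) - Y * (x1 + y1)" unfolding eq using calculation by (intro dvd_add)
    ultimately show "x + y \<in> lat a b Y" by (simp add: el_add el_in_lat_iff)
  next
    fix x c assume "x \<in> lat a b Y"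
    then obtain x0 x1 x2 where "x = el x0 x1 x2" "X ^ a dvd x1" "X ^ b dvd x2 - Y * x1"
      by (auto simp: lat_def)
    moreover have eq: "fps_const c * x2 - Y * (fps_const c * x1) = fps_const c * (x2 - Y * x1)" by (simp add: algebra_simps)
    moreover have "X ^ b dvd fps_const c * x2 - Y * (fps_const c * x1)" unfolding eq using calculation by (intro dvd_mult)
    ultimately show "kscale \<iota> c x \<in> lat a b Y" by (simp add: el_kscale el_in_lat_iff)
  qed
  moreover have "tAN N \<subseteq> lat a b Y" using assms by (intro tA_subset_lat) auto
  ultimately show ?thesis unfolding Grassmannian_def
    using lat_frame[OF assms, of Y] lat_subset by blast
qed

definition ideals :: "'l set \<Rightarrow> 'l set set"
  where "ideals C = {M. C_ideal \<iota> C M \<and> submodule_of A hull M = A}"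

definition param :: "nat \<Rightarrow> nat \<Rightarrow> 'k fps \<Rightarrow> (nat \<Rightarrow> 'k) \<Rightarrow> 'k fps"
  where "param p j c h = c + X ^ j * (\<Sum>i<p. fps_const (h i) * X ^ i)"

text \<open>The closure is locally closed by construction; the ideals it may contain besides the
  parametrized ones cost no dimension.\<close>

definition fam :: "'l set \<Rightarrow> nat \<Rightarrow> nat \<Rightarrow> nat \<Rightarrow> nat \<Rightarrow> nat \<Rightarrow> 'k fps \<Rightarrow> 'l set set"
  where "fam C N a b p j c = ideal_space \<iota> C N closure_of
    ((\<lambda>h. lat a b (param p j c h)) ` {h. lat a b (param p j c h) \<in> ideals C})"

lemma fam_family:
  assumes "a \<le> b" "b \<le> N"
  shows "\<exists>q\<le>enat p. ideal_family \<iota> C N q (fam C N a b p j c)"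
proof -
  let ?d = "N + (N - a) + (N - b)"
  let ?H = "{h. lat a b (param p j c h) \<in> ideals C}"
  have "krull_dim (subtopology (subtopology (zariski_Gr \<iota> A (tAN N)) (ideals C))
      (subtopology (zariski_Gr \<iota> A (tAN N)) (ideals C) closure_of ((\<lambda>h. lat a b (param p j c h)) ` ?H))) \<le> enat p"
  proof (rule krull_dim_parametrized[where d = ?d and v = "\<lambda>h. lat_frame N a b (param p j c h)",
      OF tA_subspace coordinates_coords])
    fix h assume "h \<in> ?H"
    then show "lat a b (param p j c h) \<in> Grassmannian \<iota> A (tAN N) ?d \<inter> ideals C"
      using lat_Grassmannian[OF assms] by simp
    show "frame \<iota> (tAN N) (lat a b (param p j c h)) ?d (lat_frame N a b (param p j c h))"
      by (rule lat_frame[OF assms])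
  next
    fix \<phi> l assume \<phi>: "k_linear \<phi>"
    let ?v = "\<lambda>h. lat_frame N a b (param p j c h) l"
    show "poly_deg_le p 1 (\<lambda>h. \<phi> (?v h))"
    proof (cases "N \<le> l \<and> l < N + (N - a)")
      case False
      \<comment> \<open>Outside the middle block the frame does not depend on the
        parameters.\<close>
      then have eq: "?v h = ?v (\<lambda>_. 0)" for h by (auto simp: lat_frame_def)
      have "(\<lambda>h. \<phi> (?v h)) = (\<lambda>_. \<phi> (?v (\<lambda>_. 0)))" by (rule ext) (rule arg_cong[OF eq])
      then show ?thesis using poly_deg_le_const by metis
    next
      case True
      define e where "e = a + (l - N)"
      have "?v h = el 0 (X ^ e) (c * X ^ e) + (\<Sum>i<p. kscale \<iota> (h i) (el 0 0 (X ^ (e + j + i))))" for h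
      proof -
        have "(\<Sum>i<p. kscale \<iota> (h i) (el 0 0 (X ^ (e + j + i)))) =
            el 0 0 (X ^ j * (\<Sum>i<p. fps_const (h i) * X ^ i) * X ^ e)" for p
          by (induction p) (simp_all add: el_0 el_kscale el_add power_add algebra_simps)
        then show ?thesis using True by (simp add: lat_frame_def param_def e_def el_add algebra_simps)
      qed
      then have "(\<lambda>h. \<phi> (?v h)) = (\<lambda>h. \<phi> (el 0 (X ^ e) (c * X ^ e)) + (\<Sum>i<p. h i * \<phi> (el 0 0 (X ^ (e + j + i)))))"
        by (intro ext) (simp add: k_linear_simps[OF \<phi>])
      moreover have "poly_deg_le p 1 (\<lambda>h. h i * x)" if "i < p" for i and x :: 'k
        using poly_deg_le_mult[OF poly_deg_le_var[OF that, of 1] poly_deg_le_const[of p 0 x]] by simp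
      then have "poly_deg_le p 1 (\<lambda>h. \<phi> (el 0 (X ^ e) (c * X ^ e)) + (\<Sum>i<p. h i * \<phi> (el 0 0 (X ^ (e + j + i)))))"
        by (intro poly_deg_le_add poly_deg_le_const poly_deg_le_sum) auto
      ultimately show ?thesis by simp
    qed
  qed
  then have "krull_dim (subtopology (ideal_space \<iota> C N) (fam C N a b p j c)) \<le> enat p"
    by (simp add: fam_def ideal_space_def ideals_def)
  moreover have "locally_closedin (ideal_space \<iota> C N) (fam C N a b p j c)"
    unfolding locally_closedin_def fam_def
    by (intro exI[of _ "topspace (ideal_space \<iota> C N)"] exI[of _ "ideal_space \<iota> C N closure_of _"] conjI)
      (auto simp: Int_absorb1 closure_of_subset_topspace)
  ultimately show ?thesis unfolding ideal_family_def by blast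
qed

lemma fam_member:
  assumes "a \<le> b" "b \<le> N" "lat a b (param p j c h) \<in> ideals C"
  shows "lat a b (param p j c h) \<in> fam C N a b p j c"
proof -
  let ?X = "(\<lambda>h. lat a b (param p j c h)) ` {h. lat a b (param p j c h) \<in> ideals C}"
  have "?X \<subseteq> topspace (ideal_space \<iota> C N)"
    using lat_Grassmannian[OF assms(1,2)] by (auto simp: ideal_space_def ideals_def topspace_zariski_Gr)
  then have "?X \<subseteq> fam C N a b p j c" unfolding fam_def by (rule closure_of_subset)
  then show ?thesis using assms(3) by blast
qed

text \<open>Changing the generator \<open>1\<close> of the ideal to \<open>u = 1 + \<lambda>t\<^sup>a(w + Yz)\<close>: the value \<open>\<lambda>\<close> is the exact solution
  of the linear equation which makes the ideals for \<open>Y\<close> and \<open>Y'\<close> proportional.\<close>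

lemma lat_iso:
  assumes ab: "a \<le> b" and e: "shift_a Y = X ^ j * e" and Y': "Y' = Y + X ^ (a + j) * h"
    and s: "s = e + X ^ a * h * (fc * Y + fd * Y\<^sup>2)" "res s \<noteq> 0"
    and lam: "lam = h * inverse s" and unit: "res (norm_fps 1 (lam * X ^ a) (Y * (lam * X ^ a))) \<noteq> 0"
  shows "\<exists>u u'. u * u' = 1 \<and> lat a b Y = (*) u ` lat a b Y'"
proof -
  define p where "p = (X ^ a :: 'k fps)"
  define u where "u = el 1 (lam * p) (Y * (lam * p))"
  obtain u' where u': "u' \<in> A" "u * u' = 1" using el_unit[OF unit] unfolding u_def p_def by blast
  define \<eta> where "\<eta> = Y' - Y"
  have "lam * s = h * (inverse s * s)" by (simp only: lam mult.assoc)
  then have lams: "lam * s = h" using inverse_mult_eq_1[OF s(2)] by simp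
  \<comment> \<open>This says that u t^a (w + Y'z) has its w and z coordinates in the ratio 1 :
    Y.\<close>
  have key: "\<eta> * (1 - lam * p * (fc * Y + fd * Y\<^sup>2)) = lam * p * shift_a Y"
  proof -
    have \<eta>: "\<eta> = p * X ^ j * h" by (simp add: \<eta>_def Y' p_def power_add)
    have "h = lam * e + lam * p * h * (fc * Y + fd * Y\<^sup>2)" using lams by (simp add: s(1) p_def algebra_simps)
    then have "h * (1 - lam * p * (fc * Y + fd * Y\<^sup>2)) = lam * e" by (simp add: algebra_simps)
    then have "p * X ^ j * (h * (1 - lam * p * (fc * Y + fd * Y\<^sup>2))) = p * X ^ j * (lam * e)" by (simp only:)
    then show ?thesis unfolding \<eta> e by (simp add: mult_ac)
  qed
  have Y'\<eta>: "Y' = Y + \<eta>" by (simp add: \<eta>_def)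
  define \<kappa> where "\<kappa> = 1 + lam * p * (fb + fd * Y * Y')"
  define x0 where "x0 = p * (- fa * fc * (lam * p) - fa * fd * (lam * p * (Y + Y')) - fb * fd * (lam * p * Y * Y'))"
  have uy: "u * el 0 p (Y' * p) = el x0 (\<kappa> * p) (Y * (\<kappa> * p))"
  proof -
    have "1 * (Y' * p) + Y * (lam * p) * 0 - fa * (lam * p * p) - fc * (Y * (lam * p) * (Y' * p)) - Y * (\<kappa> * p)
      = p * (\<eta> * (1 - lam * p * (fc * Y + fd * Y\<^sup>2)) - lam * p * shift_a Y)"
      unfolding \<kappa>_def Y'\<eta> shift_a_def by (simp add: algebra_simps power2_eq_square power3_eq_cube)
    also have "\<dots> = 0" by (simp add: key)
    finally have "1 * (Y' * p) + Y * (lam * p) * 0 - fa * (lam * p * p) - fc * (Y * (lam * p) * (Y' * p)) = Y * (\<kappa> * p)"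
      by simp
    moreover have "1 * p + lam * p * 0 + fb * (lam * p * p) + fd * (Y * (lam * p) * (Y' * p)) = \<kappa> * p"
      by (simp add: \<kappa>_def algebra_simps)
    moreover have "1 * 0 - fa * fc * (lam * p * p) - fa * fd * (lam * p * (Y' * p) + Y * (lam * p) * p) -
        fb * fd * (Y * (lam * p) * (Y' * p)) = x0"
      by (simp add: x0_def algebra_simps)
    ultimately show ?thesis unfolding u_def el_mult el_inject by blast
  qed
  \<comment> \<open>The determinant of the passage from 1, p (w + Yz) to u, u p (w + Y'z).\<close>
  define D0 where "D0 = \<kappa> - lam * x0"
  have 1: "u * el \<kappa> (- (lam * p)) (- (Y' * (lam * p))) = \<delta> D0"
  proof -
    have "u * el \<kappa> (- (lam * p)) (- (Y' * (lam * p))) = \<delta> \<kappa> * u - \<delta> lam * (u * el 0 p (Y' * p))"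
    proof -
      have "el \<kappa> (- (lam * p)) (- (Y' * (lam * p))) = \<delta> \<kappa> - \<delta> lam * el 0 p (Y' * p)"
        unfolding el_special(1)[of \<kappa>] el_scale el_diff el_inject by (simp add: mult_ac)
      then show ?thesis by (simp only: right_diff_distrib mult.commute[of u "\<delta> \<kappa>"] mult.left_commute)
    qed
    also have "\<dots> = \<delta> D0" unfolding uy unfolding u_def el_scale el_diff
      unfolding el_special(1) el_inject D0_def by (simp add: algebra_simps)
    finally show ?thesis .
  qed
  have 2: "u * el (- x0) p (Y' * p) = \<delta> D0 * el 0 p (Y * p)"
  proof -
    have "el (- x0) p (Y' * p) = el 0 p (Y' * p) - \<delta> x0"
      unfolding el_special(1)[of x0] el_diff by simp
    then have "u * el (- x0) p (Y' * p) = u * el 0 p (Y' * p) - \<delta> x0 * u"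
      by (simp only: right_diff_distrib mult.commute[of u "\<delta> x0"])
    also have "\<dots> = \<delta> D0 * el 0 p (Y * p)" unfolding uy unfolding u_def el_scale el_diff el_inject D0_def
      by (simp add: algebra_simps)
    finally show ?thesis .
  qed
  \<comment> \<open>If t divided D0, it would divide \<kappa> and lam p, because u is a unit of A;
    but \<kappa> is 1 plus a multiple of lam p.\<close>
  have D0: "res D0 \<noteq> 0"
  proof
    assume D00: "res D0 = 0"
    obtain y0 y1 y2 where y: "u' = el y0 y1 y2" using A_ex[OF u'(1)] by blast
    have "el \<kappa> (- (lam * p)) (- (Y' * (lam * p))) = u' * (u * el \<kappa> (- (lam * p)) (- (Y' * (lam * p))))"
      using u'(2) by (simp add: mult.assoc[symmetric] mult.commute[of u' u])
    also have "\<dots> = el (D0 * y0) (D0 * y1) (D0 * y2)" unfolding 1 y by (simp add: el_scale mult.commute[of _ "\<delta> D0"])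
    finally have eq: "\<kappa> = D0 * y0" "- (lam * p) = D0 * y1" unfolding el_inject by simp_all
    have "res \<kappa> = 0" "res (- (lam * p)) = 0" unfolding eq using D00 by simp_all
    then have l0: "res \<kappa> = 0" "res (lam * p) = 0" by simp_all
    have "res \<kappa> = 1 + res (lam * p) * res (fb + fd * Y * Y')"
      by (simp add: \<kappa>_def)
    then show False unfolding l0 by simp
  qed
  define i0 where "i0 = inverse D0"
  have i0: "i0 * D0 = 1" using inverse_mult_eq_1[OF D0] by (simp add: i0_def)
  have lat_el: "x \<in> lat a b Z \<longleftrightarrow> (\<exists>f0 f1 y. y \<in> tAN b \<and> x = \<delta> f0 + \<delta> f1 * el 0 p (Z * p) + y)" for x Z
  proof
    assume "x \<in> lat a b Z"
    then obtain x0 x1 x2 where x: "x = el x0 x1 x2" "X ^ a dvd x1" "X ^ b dvd x2 - Z * x1" by (auto simp: lat_def)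
    then obtain f1 where f1: "x1 = p * f1" by (auto simp: dvd_def p_def)
    have "x = \<delta> x0 + \<delta> f1 * el 0 p (Z * p) + el 0 0 (x2 - Z * x1)"
      unfolding x el_scale unfolding el_special(1) el_add el_inject by (simp add: f1 mult_ac)
    moreover have "el 0 0 (x2 - Z * x1) \<in> tAN b" using x by (simp add: el_in_tA_iff)
    ultimately show "\<exists>f0 f1 y. y \<in> tAN b \<and> x = \<delta> f0 + \<delta> f1 * el 0 p (Z * p) + y" by blast
  next
    assume "\<exists>f0 f1 y. y \<in> tAN b \<and> x = \<delta> f0 + \<delta> f1 * el 0 p (Z * p) + y"
    then obtain f0 f1 y0 y1 y2 where x: "x = \<delta> f0 + \<delta> f1 * el 0 p (Z * p) + el (X ^ b * y0) (X ^ b * y1) (X ^ b * y2)"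
      unfolding tA_eq by blast
    have "x = el (f0 + X ^ b * y0) (f1 * p + X ^ b * y1) (f1 * (Z * p) + X ^ b * y2)"
      unfolding x el_special(1)[of f0] el_scale el_add el_inject by simp
    moreover have "X ^ a dvd f1 * p + X ^ b * y1" unfolding p_def
      using ab by (intro dvd_add dvd_mult dvd_mult2 le_imp_power_dvd) auto
    moreover have "f1 * (Z * p) + X ^ b * y2 - Z * (f1 * p + X ^ b * y1) = X ^ b * (y2 - Z * y1)"
      by (simp add: algebra_simps)
    ultimately show "x \<in> lat a b Z" by (simp add: el_in_lat_iff)
  qed
  have tA_mult: "c * y \<in> tAN b" if "c \<in> A" "y \<in> tAN b" for c y
  proof -
    from that obtain z where "z \<in> A" "y = t ^ b * z" by (auto simp: tA_def)
    then show ?thesis unfolding tA_def using integral_add_mult(2)[OF that(1), of z]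
      by (intro image_eqI[of _ _ "c * z"]) (simp_all add: mult.left_commute)
  qed
  have uA: "u \<in> A" by (simp add: u_def)
  have "lat a b Y = (*) u ` lat a b Y'"
  proof
    show "(*) u ` lat a b Y' \<subseteq> lat a b Y"
    proof
      fix x assume "x \<in> (*) u ` lat a b Y'"
      then obtain v where v: "v \<in> lat a b Y'" "x = u * v" by blast
      then obtain f0 f1 y where y: "y \<in> tAN b" and x: "x = u * (\<delta> f0 + \<delta> f1 * el 0 p (Y' * p) + y)"
        unfolding lat_el by blast
      have "x = \<delta> f0 * u + \<delta> f1 * (u * el 0 p (Y' * p)) + u * y" unfolding x by (simp add: algebra_simps)
      also have "\<dots> = \<delta> (f0 + f1 * x0) + \<delta> (f0 * lam + f1 * \<kappa>) * el 0 p (Y * p) + u * y"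
        unfolding uy unfolding u_def el_scale unfolding el_special(1) el_add by (simp add: algebra_simps)
      finally show "x \<in> lat a b Y" unfolding lat_el using tA_mult[OF uA y] by blast
    qed
    show "lat a b Y \<subseteq> (*) u ` lat a b Y'"
    proof
      fix x assume "x \<in> lat a b Y"
      then obtain f0 f1 y where y: "y \<in> tAN b" and x: "x = \<delta> f0 + \<delta> f1 * el 0 p (Y * p) + y"
        using lat_el by blast
      define v where "v = \<delta> (f0 * i0) * el \<kappa> (- (lam * p)) (- (Y' * (lam * p))) + \<delta> (f1 * i0) * el (- x0) p (Y' * p) + u' * y"
      have "u * v = \<delta> (f0 * i0) * (u * el \<kappa> (- (lam * p)) (- (Y' * (lam * p)))) + \<delta> (f1 * i0) * (u * el (- x0) p (Y' * p)) + u * u' * y"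
        by (simp add: v_def algebra_simps)
      also have "\<dots> = \<delta> (f0 * (i0 * D0)) + \<delta> (f1 * (i0 * D0)) * el 0 p (Y * p) + y"
        unfolding 1 2 u'(2) by (simp add: \<delta>_mult mult_ac)
      also have "\<dots> = x" by (simp add: i0 x)
      finally have "x = u * v" by simp
      moreover have "v = \<delta> (f0 * i0 * \<kappa> - f1 * i0 * x0) + \<delta> (f1 * i0 - f0 * i0 * lam) * el 0 p (Y' * p) + u' * y"
        unfolding v_def el_scale unfolding el_special(1) el_add by (simp add: algebra_simps)
      then have "v \<in> lat a b Y'" unfolding lat_el using tA_mult[OF u'(1) y] by blast
      ultimately show "x \<in> (*) u ` lat a b Y'" by blast
    qed
  qed
  then show ?thesis using u'(2) by blast
qed

text \<open>Modulo t there are finitely many roots. Above a simple root, two solutions modulo t^j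
  agree modulo t^j, because their difference quotient is a unit. Above a multiple root there is no
  solution for j >= 2, by \<open>form_not_double\<close>.\<close>

lemma centers:
  "\<exists>S. finite S \<and> (\<forall>Y. X ^ j dvd shift_a Y \<longrightarrow> (\<exists>c\<in>S. X ^ j dvd Y - c))"
proof (cases "j = 0")
  case True
  then show ?thesis by (intro exI[of _ "{0}"]) auto
next
  case False
  define p where "p = [:res fa, res fb, res fc, res fd:]"
  have "p \<noteq> 0" using form_nonzero by (auto simp: p_def)
  then have fin: "finite {r. poly p r = 0}" by (rule poly_roots_finite)
  have root: "poly p (res Y) = 0" if "X ^ j dvd shift_a Y" for Y
  proof -
    have "res (shift_a Y) = 0" using that False by (simp add: fps_X_power_dvd_iff)
    then show ?thesis by (simp add: p_def shift_a_def power2_eq_square power3_eq_cube algebra_simps)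
  qed
  define c where "c r = (SOME Y. X ^ j dvd shift_a Y \<and> res Y = r)" for r
  have "X ^ j dvd Y - c (res Y)" if Y: "X ^ j dvd shift_a Y" for Y
  proof -
    let ?c = "c (res Y)"
    have "\<exists>Z. X ^ j dvd shift_a Z \<and> res Z = res Y" using Y by blast
    from someI_ex[OF this] have c: "X ^ j dvd shift_a ?c" "res ?c = res Y"
      unfolding c_def by blast+
    show ?thesis
    proof (cases "j = 1")
      case True
      then show ?thesis using c(2) by (simp add: fps_X_dvd_iff)
    next
      case False
      \<comment> \<open>The difference quotient of f(1, Y) at the two solutions; its residue is the
        derivative at their common residue.\<close>
      define g where "g = fb + fc * (Y + ?c) + fd * (Y\<^sup>2 + Y * ?c + ?c\<^sup>2)"
      have "shift_a Y - shift_a ?c = (Y - ?c) * g"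
        by (simp add: shift_a_def g_def algebra_simps power2_eq_square power3_eq_cube)
      then have "X ^ j dvd (Y - ?c) * g" using dvd_diff[OF Y c(1)] by simp
      moreover have "res g \<noteq> 0"
      proof
        assume "res g = 0"
        then have "res (shift_b ?c) = 0"
          using c(2) by (simp add: g_def shift_b_def power2_eq_square algebra_simps)
        moreover have "X ^ 2 dvd shift_a ?c"
          using c(1) \<open>j \<noteq> 0\<close> False by (intro dvd_trans[OF le_imp_power_dvd c(1)]) auto
        ultimately show False using cubic_order.form_not_double[OF shift, of ?c] by (simp add: fps_X_dvd_iff)
      qed
      ultimately show ?thesis by (rule fps_X_power_dvd_unit_mult[rotated])
    qed
  qed
  then show ?thesis using fin root by (intro exI[of _ "c ` {r. poly p r = 0}"]) blast
qed

lemma param_restrict: "X ^ (j + p) dvd (c + X ^ j * g) - param p j c (fps_nth g)"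
proof -
  have nth: "fps_nth (\<Sum>i<p. fps_const (fps_nth g i) * X ^ i) i = (if i < p then fps_nth g i else 0)" for i
  proof -
    have "fps_nth (\<Sum>i<p. fps_const (fps_nth g i) * X ^ i) i = (\<Sum>l<p. if i = l then fps_nth g l else 0)"
      by (simp add: fps_sum_nth fps_X_power_nth if_distrib cong: if_cong)
    then show ?thesis by simp
  qed
  have "(c + X ^ j * g) - param p j c (fps_nth g) = X ^ j * (g - (\<Sum>i<p. fps_const (fps_nth g i) * X ^ i))"
    by (simp add: param_def algebra_simps)
  then show ?thesis by (auto simp: fps_X_power_dvd_iff fps_X_power_mult_nth nth)
qed

lemma norm_fps_near_1:
  assumes "res x = 0" "res y = 0"
  shows "res (norm_fps 1 x y) \<noteq> 0"
  unfolding norm_form_cong0 by (simp add: assms norm_form_const)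

text \<open>The ideals with \<open>a = 0\<close> whose parameter \<open>Y\<close> has a prescribed value modulo \<open>t\<^sup>j\<close>, where \<open>j\<close> is the
  exact order of vanishing of the index form, fall into finitely many classes: all but finitely many values
  of the next coefficient of \<open>Y\<close> give isomorphic ideals.\<close>

lemma finite_classes:
  assumes Ys: "\<And>Y. Y \<in> \<Y> \<Longrightarrow> X ^ j dvd Y - c \<and> (\<exists>e. shift_a Y = X ^ j * e \<and> res e \<noteq> 0)"
  shows "\<exists>R\<subseteq>\<Y>. finite R \<and> (\<forall>Y\<in>\<Y>. \<exists>Y'\<in>R. \<exists>u u'. u * u' = 1 \<and> lat 0 b Y' = (*) u ` lat 0 b Y)"
proof (cases "\<Y> = {}")
  case True
  then show ?thesis by auto
next
  case False
  then obtain Y1 where Y1: "Y1 \<in> \<Y>" by blast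
  with Ys obtain e where e: "shift_a Y1 = X ^ j * e" "res e \<noteq> 0" by blast
  define r where "r = res (fc * Y1 + fd * Y1\<^sup>2)"
  define s where "s = [:res e, r:]"
  \<comment> \<open>Its roots are the excluded values of the leading coefficient h: those where s
    vanishes or where u = 1 + (h/s)(w + Yz) is not a unit. Multiplying the norm of u by s^3 removes
    the denominator.\<close>
  define P where "P = s * norm_form [:res fa:] [:res fb:] [:res fc:] [:res fd:] s [:0, 1:] [:0, res Y1:]"
  have P: "poly P h = poly s h * norm_form (res fa) (res fb) (res fc) (res fd) (poly s h) h (h * res Y1)" for h
    by (simp add: P_def norm_form_def det3_def algebra_simps)
  have "poly P 0 = res e * res e ^ 3" unfolding P by (simp add: s_def norm_form_const)
  then have "P \<noteq> 0" using e(2) by auto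
  then have fin: "finite {h. poly P h = 0}" by (rule poly_roots_finite)
  have diff: "\<exists>h. Y = Y' + X ^ j * h" if "Y \<in> \<Y>" "Y' \<in> \<Y>" for Y Y'
  proof -
    have "X ^ j dvd (Y - c) - (Y' - c)"
      by (rule dvd_diff) (use Ys[OF that(1)] Ys[OF that(2)] in auto)
    then have "X ^ j dvd Y - Y'" by simp
    then obtain h where "Y - Y' = X ^ j * h" by (auto simp: dvd_def)
    then have "Y = Y' + X ^ j * h" by (simp add: algebra_simps)
    then show ?thesis by blast
  qed
  \<comment> \<open>For each excluded value that occurs, one ideal is kept as a
    representative.\<close>
  define rep where "rep h0 = (SOME Y. Y \<in> \<Y> \<and> (\<exists>h. Y = Y1 + X ^ j * h \<and> res h = h0))" for h0
  define R where "R = insert Y1 (rep ` {h0. poly P h0 = 0 \<and> (\<exists>Y. Y \<in> \<Y> \<and> (\<exists>h. Y = Y1 + X ^ j * h \<and> res h = h0))})"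
  have rep: "rep h0 \<in> \<Y> \<and> (\<exists>h. rep h0 = Y1 + X ^ j * h \<and> res h = h0)"
    if "\<exists>Y. Y \<in> \<Y> \<and> (\<exists>h. Y = Y1 + X ^ j * h \<and> res h = h0)" for h0
    unfolding rep_def by (rule someI_ex[OF that])
  have sub: "R \<subseteq> \<Y>" using Y1 rep by (auto simp: R_def)
  have finR: "finite R" using fin by (auto simp: R_def intro: finite_subset)
  have classes: "\<exists>Y'\<in>R. \<exists>u u'. u * u' = 1 \<and> lat 0 b Y' = (*) u ` lat 0 b Y" if Y: "Y \<in> \<Y>" for Y
  proof -
    obtain h where h: "Y = Y1 + X ^ j * h" using diff[OF Y Y1] by blast
    show ?thesis
    proof (cases "poly P (res h) = 0")
      case False
      define s' where "s' = e + X ^ 0 * h * (fc * Y1 + fd * Y1\<^sup>2)"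
      have s'0: "res s' = poly s (res h)" by (simp add: s'_def s_def r_def)
      have s'ne: "res s' \<noteq> 0" using False unfolding s'0 P by auto
      define lam where "lam = h * inverse s'"
      have "s' * inverse s' = 1" using inverse_mult_eq_1[OF s'ne] by (simp add: mult.commute)
      then have "s' * lam = h" by (simp add: lam_def mult.left_commute)
      then have "norm_fps (s' * 1) (s' * (lam * X ^ 0)) (s' * (Y1 * (lam * X ^ 0))) = norm_fps s' h (h * Y1)"
        by (simp add: mult.left_commute[of s' Y1] mult.commute[of Y1] flip: mult.assoc)
      then have "s' ^ 3 * norm_fps 1 (lam * X ^ 0) (Y1 * (lam * X ^ 0)) = norm_fps s' h (h * Y1)"
        unfolding norm_form_scale .
      then have "res s' ^ 3 * res (norm_fps 1 (lam * X ^ 0) (Y1 * (lam * X ^ 0))) = res (norm_fps s' h (h * Y1))"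
        by (metis fps_mult_nth_0 fps_nth_power_0)
      moreover have "res (norm_fps s' h (h * Y1)) \<noteq> 0"
        using False unfolding P norm_form_cong0 s'0 by auto
      ultimately have "res (norm_fps 1 (lam * X ^ 0) (Y1 * (lam * X ^ 0))) \<noteq> 0" by auto
      from lat_iso[OF _ e(1) _ s'_def s'ne lam_def this, of b Y] h show ?thesis by (auto simp: R_def)
    next
      case True
      then have ex: "\<exists>Y. Y \<in> \<Y> \<and> (\<exists>h'. Y = Y1 + X ^ j * h' \<and> res h' = res h)"
        using Y h by blast
      define Y2 where "Y2 = rep (res h)"
      have Y2R: "Y2 \<in> R" using True ex unfolding R_def Y2_def by blast
      from rep[OF ex] obtain h2 where Y2: "Y2 \<in> \<Y>" "Y2 = Y1 + X ^ j * h2" "res h2 = res h"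
        unfolding Y2_def by blast
      obtain e2 where e2: "shift_a Y2 = X ^ j * e2" "res e2 \<noteq> 0" using Ys[OF Y2(1)] by blast
      \<comment> \<open>Two parameters with equal leading coefficient differ by a multiple of
        t^(j+1), and for such a difference u is congruent to 1 modulo t.\<close>
      define g where "g = h - h2"
      have g0: "res g = 0" by (simp add: g_def Y2(3))
      have Yg: "Y = Y2 + X ^ (0 + j) * g" unfolding h Y2(2) g_def by (simp add: algebra_simps)
      define s' where "s' = e2 + X ^ 0 * g * (fc * Y2 + fd * Y2\<^sup>2)"
      have s'ne: "res s' \<noteq> 0" using e2(2) g0 by (simp add: s'_def)
      define lam where "lam = g * inverse s'"
      have "res lam = 0" using g0 by (simp add: lam_def)
      then have "res (norm_fps 1 (lam * X ^ 0) (Y2 * (lam * X ^ 0))) \<noteq> 0"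
        by (intro norm_fps_near_1) simp_all
      from lat_iso[OF _ e2(1) Yg s'_def s'ne lam_def this, of b] Y2R show ?thesis by auto
    qed
  qed
  show ?thesis by (intro exI[of _ R] conjI ballI sub finR classes)
qed

lemma ideals_multiple:
  assumes "lat a b Y \<in> ideals C" "lat a b Y = (*) u ` lat a b Y'" "u * u' = 1" "range \<delta> \<subseteq> C"
  shows "lat a b Y' \<in> ideals C" "module_iso C (lat a b Y) (lat a b Y')"
proof -
  have inv: "u' * (u * x) = x" for x using assms(3) by (simp add: mult.assoc[symmetric] mult.commute[of u' u])
  have eq: "lat a b Y' = (*) u' ` lat a b Y" unfolding assms(2) image_image inv by simp
  show "module_iso C (lat a b Y) (lat a b Y')"
    unfolding eq using assms(3) by (intro iso_by_multiple[of u' u]) (simp add: mult.commute)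
  have "\<exists>S. lat a b Y = submodule_of C hull S" using assms(1) by (auto simp: ideals_def C_ideal_def)
  then have "submodule_of C (lat a b Y)" using submodule_of_hull by metis
  then have "c * x \<in> lat a b Y" if "c \<in> C" "x \<in> lat a b Y" for c x using that by (simp add: submodule_of_def)
  then have "c * x \<in> lat a b Y'" if "c \<in> C" "x \<in> lat a b Y'" for c x
    using that unfolding eq by (auto simp: mult.left_commute[of c u'])
  from lat_ideal[OF assms(4) this] show "lat a b Y' \<in> ideals C" by (simp add: ideals_def)
qed

lemma module_iso_refl: "module_iso C M M"
  unfolding module_iso_def by (intro exI[of _ "\<lambda>x. x"]) (auto simp: bij_betw_def)

text \<open>The number of free coefficients is 0 for a = 0, where \<open>finite_classes\<close>
  applies, a for 1 <= a <= n, where \<open>lat_iso\<close> removes the higher ones, and 2n+1-a for a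
  > n, where the element t^(2n+1) x of C fixes the others.\<close>

lemma chart_families:
  assumes D: "range \<delta> \<subseteq> C" and x: "x \<in> A" "\<not> (\<exists>f. \<exists>y\<in>A. x = \<delta> f + t * y)"
    and xC: "t ^ (2 * n + 1) * x \<in> C"
  shows "\<exists>\<F>. finite \<F> \<and> (\<forall>F\<in>\<F>. \<exists>q\<le>enat n. ideal_family \<iota> C N q F) \<and>
    (\<forall>a b Y. a \<le> b \<and> b \<le> N \<and> lat a b Y \<in> ideals C \<longrightarrow> (\<exists>F\<in>\<F>. \<exists>M'\<in>F. module_iso C (lat a b Y) M'))"
proof -
  let ?m = "2 * n + 1"
  obtain x0 x1 x2 where x_el: "x = el x0 x1 x2" using A_ex[OF x(1)] by blast
  have prim: "\<not> (res x1 = 0 \<and> res x2 = 0)"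
  proof
    assume "res x1 = 0 \<and> res x2 = 0"
    then obtain y1 y2 where "x1 = X * y1" "x2 = X * y2" by (auto simp flip: fps_X_dvd_iff simp: dvd_def)
    then have "x = \<delta> x0 + t * el 0 y1 y2"
      unfolding t_elt_def el_scale unfolding el_special(1) by (simp add: x_el el_add)
    then show False using x(2) by blast
  qed
  \<comment> \<open>The slope of x. An ideal with b > 2n+1 contains t^(2n+1) x, which forces its Y
    to agree with this slope modulo t^(b-2n-1).\<close>
  define Yx where "Yx = x2 * inverse x1"
  have xM: "X ^ a dvd X ^ ?m * x1 \<and> X ^ b dvd X ^ ?m * (x2 - Y * x1)" if "lat a b Y \<in> ideals C" for a b Y
  proof -
    have "\<exists>S. lat a b Y = submodule_of C hull S" using that by (auto simp: ideals_def C_ideal_def)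
    then have "submodule_of C (lat a b Y)" using submodule_of_hull by metis
    moreover have "1 \<in> lat a b Y" unfolding el_special(4) by (simp add: el_in_lat_iff)
    ultimately have "t ^ ?m * x * 1 \<in> lat a b Y" using xC unfolding submodule_of_def by blast
    then have "el (X ^ ?m * x0) (X ^ ?m * x1) (X ^ ?m * x2) \<in> lat a b Y"
      unfolding t_elt_power x_el mult_1_right el_scale .
    then show ?thesis unfolding el_in_lat_iff by (simp add: algebra_simps)
  qed
  have big_b: "res x1 \<noteq> 0 \<and> X ^ (b - ?m) dvd Y - Yx" if "lat a b Y \<in> ideals C" "?m < b" for a b Y
  proof -
    have d: "X ^ (b - ?m) dvd x2 - Y * x1"
    proof -
      have eq: "?m + (b - ?m) = b" using that(2) by simp
      have "X ^ (?m + (b - ?m)) dvd X ^ ?m * (x2 - Y * x1)"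
        unfolding eq using xM[OF that(1)] by blast
      then have "X ^ ?m * X ^ (b - ?m) dvd X ^ ?m * (x2 - Y * x1)"
        by (simp only: power_add)
      then show ?thesis unfolding dvd_mult_cancel_left by simp
    qed
    have x1: "res x1 \<noteq> 0"
    proof
      assume 0: "res x1 = 0"
      have "res (x2 - Y * x1) = 0" using d that(2) unfolding fps_X_power_dvd_iff by auto
      then show False using prim 0 by simp
    qed
    have "inverse x1 * x1 = 1" using x1 by (rule inverse_mult_eq_1)
    then have "x2 = Yx * x1" by (simp add: Yx_def mult.assoc)
    then have "X ^ (b - ?m) dvd (Yx - Y) * x1" using d by (simp add: algebra_simps)
    from fps_X_power_dvd_unit_mult[OF x1 this] show ?thesis using x1 by (simp add: dvd_diff_commute)
  qed
  have a_le: "a \<le> ?m" if "lat a b Y \<in> ideals C" "a \<le> b" for a b Y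
  proof (rule ccontr)
    assume "\<not> a \<le> ?m"
    then have "res x1 \<noteq> 0" using big_b[OF that(1)] that(2) by auto
    moreover have "fps_nth (X ^ ?m * x1) ?m = 0"
      using xM[OF that(1)] \<open>\<not> a \<le> ?m\<close> unfolding fps_X_power_dvd_iff by auto
    ultimately show False by (simp add: fps_X_power_mult_nth del: power_Suc power_add_numeral)
  qed
  obtain S where S: "\<And>j. finite (S j)" "\<And>j Y. X ^ j dvd shift_a Y \<Longrightarrow> \<exists>c\<in>S j. X ^ j dvd Y - c"
    using centers by metis
  define \<Y> where "\<Y> b j c = {Y. lat 0 b Y \<in> ideals C \<and> X ^ j dvd Y - c \<and> (\<exists>e. shift_a Y = X ^ j * e \<and> res e \<noteq> 0)}"
    for b j c
  have "\<exists>R\<subseteq>\<Y> b j c. finite R \<and> (\<forall>Y\<in>\<Y> b j c. \<exists>Y'\<in>R. \<exists>u u'. u * u' = 1 \<and> lat 0 b Y' = (*) u ` lat 0 b Y)" for b j c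
    by (rule finite_classes[of _ j c]) (auto simp: \<Y>_def)
  then obtain R where R: "\<And>b j c. R b j c \<subseteq> \<Y> b j c" "\<And>b j c. finite (R b j c)"
    "\<And>b j c Y. Y \<in> \<Y> b j c \<Longrightarrow> \<exists>Y'\<in>R b j c. \<exists>u u'. u * u' = 1 \<and> lat 0 b Y' = (*) u ` lat 0 b Y" by metis
  \<comment> \<open>The values around which families are placed: 0, the slope of x, the roots of
    f(1, Y) modulo powers of t, and the representatives for a = 0.\<close>
  define cs where "cs = insert 0 (insert Yx ((\<Union>j\<le>N. S j) \<union> (\<Union>b\<le>N. \<Union>j\<le>N. \<Union>c\<in>S j. R b j c)))"
  have fin_cs: "finite cs" using S(1) R(2) by (auto simp: cs_def)
  define \<F> where "\<F> = (\<Union>b\<le>N. \<Union>a\<le>b. \<Union>p\<le>n. \<Union>j\<le>N. \<Union>c\<in>cs. {fam C N a b p j c})"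
  have "finite \<F>" unfolding \<F>_def using fin_cs by (intro finite_UN_I) auto
  have fams: "\<exists>q\<le>enat n. ideal_family \<iota> C N q F" if "F \<in> \<F>" for F
  proof -
    from that obtain a b p j c where F: "a \<le> b" "b \<le> N" "p \<le> n" "F = fam C N a b p j c" unfolding \<F>_def by blast
    from fam_family[OF F(1,2), of p C j c] obtain q where q: "q \<le> enat p" "ideal_family \<iota> C N q F" using F(4) by blast
    moreover have "q \<le> enat n" using order_trans[OF q(1), of "enat n"] F(3) by simp
    ultimately show ?thesis by blast
  qed
  have cover: "\<exists>F\<in>\<F>. \<exists>M'\<in>F. module_iso C (lat a b Y) M'" if ab: "a \<le> b" "b \<le> N" and M: "lat a b Y \<in> ideals C" for a b Y
  proof -
    have by_param: ?thesis if "module_iso C (lat a b Y) (lat a b (param p j c h))" "lat a b (param p j c h) \<in> ideals C"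
      "p \<le> n" "j \<le> N" "c \<in> cs" for p j c h
    proof -
      have "fam C N a b p j c \<in> \<F>" using ab that unfolding \<F>_def by blast
      then show ?thesis using fam_member[OF ab that(2)] that(1) by (intro bexI)
    qed
    have by_eq: ?thesis if "Y = c + X ^ j * g" "b - a \<le> j + p" "p \<le> n" "j \<le> N" "c \<in> cs" for p j c g
    proof -
      have "X ^ (b - a) dvd Y - param p j c (fps_nth g)"
        unfolding that(1) by (rule dvd_trans[OF le_imp_power_dvd[OF that(2)] param_restrict])
      then have eq: "lat a b Y = lat a b (param p j c (fps_nth g))" using ab(1) by (rule lat_cong)
      from module_iso_refl[of C "lat a b Y"] have "module_iso C (lat a b Y) (lat a b (param p j c (fps_nth g)))"
        unfolding eq .
      then show ?thesis using by_param that(3-5) M unfolding eq by blast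
    qed
    have cs: "0 \<in> cs" "Yx \<in> cs" "c \<in> S j \<Longrightarrow> j \<le> N \<Longrightarrow> c \<in> cs" "b' \<le> N \<Longrightarrow> j \<le> N \<Longrightarrow> c \<in> S j \<Longrightarrow> Y' \<in> R b' j c \<Longrightarrow> Y' \<in> cs" for c j b' Y'
      unfolding cs_def by blast+
    consider "n + 1 \<le> a" "b \<le> ?m" | "n + 1 \<le> a" "?m < b" | "a = 0" | "1 \<le> a" "a \<le> n" by linarith
    then show ?thesis
    proof cases
      case 1
      show ?thesis
      proof (rule by_eq[of 0 0 Y "?m - a"])
        show "b - a \<le> 0 + (?m - a)" "?m - a \<le> n" using 1 by linarith+
      qed (simp_all add: cs(1))
    next
      case 2
      then obtain g where "Y - Yx = X ^ (b - ?m) * g" using big_b[OF M] by (auto simp: dvd_def)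
      then have "Y = Yx + X ^ (b - ?m) * g" by (simp add: algebra_simps)
      then show ?thesis
      proof (rule by_eq[of Yx "b - ?m" g "?m - a"])
        show "b - a \<le> b - ?m + (?m - a)" "?m - a \<le> n" "b - ?m \<le> N" using 2 ab a_le[OF M ab(1)] by linarith+
      qed (fact cs(2))
    next
      case 3
      show ?thesis
      proof (cases "X ^ b dvd shift_a Y")
        case True
        then obtain c where c: "c \<in> S b" "X ^ b dvd Y - c" using S(2) by blast
        then obtain g where "Y - c = X ^ b * g" by (auto simp: dvd_def)
        then have "Y = c + X ^ b * g" by (simp add: algebra_simps)
        then show ?thesis
        proof (rule by_eq[of c b g 0])
          show "b - a \<le> b + 0" "b \<le> N" using ab by linarith+
          show "c \<in> cs" using cs(3) c(1) ab(2) by blast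
        qed simp
      next
        case False
        then have ne: "shift_a Y \<noteq> 0" by auto
        obtain j e where e: "shift_a Y = X ^ j * e" "res e \<noteq> 0" using fps_order[OF ne] by blast
        have "j \<le> b" using False e(1) le_imp_power_dvd[of b j "X :: 'k fps"] by (metis dvd_triv_left dvd_trans nat_le_linear)
        from S(2)[of j Y] e(1) obtain c where c: "c \<in> S j" "X ^ j dvd Y - c" by (metis dvd_triv_left)
        then have "Y \<in> \<Y> b j c" using M e 3 unfolding \<Y>_def by blast
        from R(3)[OF this] obtain Y' u u' where Y': "Y' \<in> R b j c" "u * u' = 1" "lat 0 b Y' = (*) u ` lat 0 b Y" by blast
        have "lat 0 b Y' \<in> ideals C" using R(1) Y'(1) by (auto simp: \<Y>_def)
        have "lat 0 b Y = (*) u' ` lat 0 b Y'"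
          unfolding Y'(3) image_image using Y'(2) by (simp add: mult.assoc[symmetric] mult.commute[of u' u])
        from ideals_multiple(2)[OF _ this _ D] M 3 Y'(2) have "module_iso C (lat 0 b Y) (lat 0 b Y')" by (simp add: mult.commute)
        moreover have "param 0 0 Y' (\<lambda>_. 0) = Y'" by (simp add: param_def)
        moreover have "Y' \<in> cs" using cs(4)[OF ab(2) order_trans[OF \<open>j \<le> b\<close> ab(2)] c(1) Y'(1)] .
        ultimately show ?thesis using by_param[of 0 0 Y' "\<lambda>_. 0"] 3 \<open>lat 0 b Y' \<in> ideals C\<close> by simp
      qed
    next
      case 4
      show ?thesis
      proof (cases "X ^ (b - 2 * a) dvd shift_a Y")
        case True
        \<comment> \<open>Y is known modulo t^(b-2a) up to finitely many choices; up to t^(b-a),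
          where the lattice no longer depends on Y, at most a coefficients remain.\<close>
        then obtain c where c: "c \<in> S (b - 2 * a)" "X ^ (b - 2 * a) dvd Y - c" using S(2) by blast
        then obtain g where "Y - c = X ^ (b - 2 * a) * g" by (auto simp: dvd_def)
        then have "Y = c + X ^ (b - 2 * a) * g" by (simp add: algebra_simps)
        then show ?thesis
        proof (rule by_eq[of c "b - 2 * a" g a])
          show "b - a \<le> b - 2 * a + a" "a \<le> n" using ab 4 by linarith+
          show le: "b - 2 * a \<le> N" using ab by linarith
          show "c \<in> cs" using cs(3)[OF c(1) le] .
        qed
      next
        case False
        then have ne: "shift_a Y \<noteq> 0" by auto
        obtain j e where e: "shift_a Y = X ^ j * e" "res e \<noteq> 0" using fps_order[OF ne] by blast
        have "j \<le> b - 2 * a" using False e(1) le_imp_power_dvd[of "b - 2 * a" j "X :: 'k fps"]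
          by (metis dvd_triv_left dvd_trans nat_le_linear)
        from S(2)[of j Y] e(1) obtain c where c: "c \<in> S j" "X ^ j dvd Y - c" by (metis dvd_triv_left)
        then obtain g where g: "Y - c = X ^ j * g" by (auto simp: dvd_def)
        then have Yg: "Y = c + X ^ j * g" by (simp add: algebra_simps)
        \<comment> \<open>Y with all coefficients from t^(j+a) on dropped. The change is a multiple
          of t^(a+j), as \<open>lat_iso\<close> requires, and a >= 1 makes its unit conditions
          hold.\<close>
        define Y' where "Y' = param a j c (fps_nth g)"
        have "X ^ (j + a) dvd Y - Y'" unfolding Y'_def Yg by (rule param_restrict)
        then obtain h0 where "Y - Y' = X ^ (j + a) * h0" by (auto simp: dvd_def)
        then have Y': "Y' = Y + X ^ (a + j) * (- h0)" by (simp add: algebra_simps)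
        define s where "s = e + X ^ a * (- h0) * (fc * Y + fd * Y\<^sup>2)"
        have xa: "res (X ^ a :: 'k fps) = 0" using 4 by simp
        have s0: "res s \<noteq> 0" using e(2) xa by (simp add: s_def)
        define lam where "lam = (- h0) * inverse s"
        have "res (norm_fps 1 (lam * X ^ a) (Y * (lam * X ^ a))) \<noteq> 0"
          using xa by (intro norm_fps_near_1) simp_all
        from lat_iso[OF ab(1) e(1) Y' s_def s0 lam_def this] obtain u u' where
          u: "u * u' = 1" "lat a b Y = (*) u ` lat a b Y'" by (elim exE conjE) (rule that)
        note Y'_ideal = ideals_multiple[OF M u(2,1) D, unfolded Y'_def]
        show ?thesis
        proof (rule by_param[OF Y'_ideal(2,1)])
          show "a \<le> n" using 4 by simp
          show le: "j \<le> N" using ab \<open>j \<le> b - 2 * a\<close> by linarith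
          show "c \<in> cs" using cs(3)[OF c(1) le] .
        qed
      qed
    qed
  qed
  show ?thesis
  proof (intro exI[of _ \<F>] conjI ballI allI impI)
    show "finite \<F>" by fact
    show "\<exists>q\<le>enat n. ideal_family \<iota> C N q F" if "F \<in> \<F>" for F using that by (rule fams)
    fix a b Y assume "a \<le> b \<and> b \<le> N \<and> lat a b Y \<in> ideals C"
    then show "\<exists>F\<in>\<F>. \<exists>M'\<in>F. module_iso C (lat a b Y) M'" using cover by simp
  qed
qed

end

subsection \<open>Normalization of ideals\<close>

context fls_algebra
begin

lemma clear_denominators:
  assumes "x \<in> K.span S"
  shows "\<exists>s. t ^ s * x \<in> D.span S"
  using assms
proof (induction rule: K.span_induct_alt)
  case base
  show ?case by (simp add: D.span_zero)
next
  case (step c x y)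
  from step(2) obtain s where s: "t ^ s * y \<in> D.span S" by blast
  define m where "m = nat (- fls_subdegree c)"
  have "0 \<le> fls_subdegree (fls_X ^ m * c)" by (cases "c = 0") (auto simp: m_def)
  then obtain g where g: "fls_X ^ m * c = fl g" by (metis fls_regpart_to_fls_trivial)
  have t: "t ^ m = \<iota> (fls_X ^ m)" for m by (simp add: t_elt_def Demb_def \<iota>_power)
  have "t ^ m * \<iota> c = \<delta> g" unfolding t \<iota>_mult[symmetric] g Demb_def ..
  then have eq: "t ^ (m + s) * (Kscale \<iota> c x + y) =
      Dscale \<iota> (X ^ s * g) x + Dscale \<iota> (X ^ m) (t ^ s * y)"
    by (simp add: Kscale_def Dscale_def power_add \<delta>_mult t_elt_power[symmetric] distrib_left mult_ac
      flip: \<open>t ^ m * \<iota> c = \<delta> g\<close>)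
  have "t ^ (m + s) * (Kscale \<iota> c x + y) \<in> D.span S"
    unfolding eq using D.span_base[OF step(1)] s by (intro D.span_add D.span_scale)
  then show ?case by blast
qed

lemma ring_subset_A:
  assumes "cubic_ring \<iota> C"
  shows "C \<subseteq> A"
proof
  fix x assume x: "x \<in> C"
  from assms obtain B where B: "card B = 3" "D.span B = C" by (auto simp: cubic_ring_def)
  have "finite B" using B(1) by (simp add: card_ge_0_finite)
  then show "x \<in> A"
  proof (rule integral_of_module)
    show "1 \<in> D.span B" using assms B(2) by (simp add: cubic_ring_def)
    show "x * g \<in> D.span B" if "g \<in> B" for g
      using assms x that D.span_base[of g B] unfolding B(2) by (simp add: cubic_ring_def)
  qed
qed

end

lemma module_iso_trans:
  assumes "module_iso C M M'" "module_iso C M' M''"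
  shows "module_iso C M M''"
proof -
  from assms obtain f g where f: "bij_betw f M M'" "\<forall>x\<in>M. \<forall>y\<in>M. f (x + y) = f x + f y" "\<forall>c\<in>C. \<forall>x\<in>M. f (c * x) = c * f x"
    and g: "bij_betw g M' M''" "\<forall>x\<in>M'. \<forall>y\<in>M'. g (x + y) = g x + g y" "\<forall>c\<in>C. \<forall>x\<in>M'. g (c * x) = c * g x"
    unfolding module_iso_def by blast
  have fM: "f x \<in> M'" if "x \<in> M" for x using f(1) that by (auto simp: bij_betw_def)
  show ?thesis unfolding module_iso_def
    using bij_betw_trans[OF f(1) g(1)] f(2,3) g(2,3) fM by (intro exI[of _ "g \<circ> f"]) simp
qed

context cubic_order
begin

lemma dim_3: "K.dim UNIV = 3"
proof -
  have ne: "w \<noteq> 1" "z \<noteq> 1" "w \<noteq> z"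
    using indep[of "- 1" 1 0] indep[of "- 1" 0 1] indep[of 0 1 "- 1"] by (auto simp: \<iota>_minus)
  have fin: "finite {1, w, z}" by simp
  have sum: "(\<Sum>v\<in>{1, w, z}. Kscale \<iota> (u v) v) = \<iota> (u 1) + \<iota> (u w) * w + \<iota> (u z) * z" for u
    using ne by (simp add: Kscale_def add_ac)
  have "K.independent {1, w, z}"
    unfolding K.dependent_finite[OF fin] sum using indep by fastforce
  moreover have "x \<in> K.span {1, w, z}" for x
  proof -
    obtain x0 x1 x2 where "x = \<iota> x0 + \<iota> x1 * w + \<iota> x2 * z" using rep by blast
    then have "x = Kscale \<iota> x0 1 + Kscale \<iota> x1 w + Kscale \<iota> x2 z" by (simp add: Kscale_def)
    then show ?thesis by (auto intro!: K.span_add K.span_scale intro: K.span_base)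
  qed
  ultimately have "K.dim UNIV = card {1, w, z}" by (intro K.dim_unique) auto
  then show ?thesis using ne by simp
qed

text \<open>A D-basis of C is independent over K, hence a K-basis of L by dimension, so powers of t
  bring 1, w and z into C.\<close>

lemma cubic_ring_conductor:
  assumes C: "cubic_ring \<iota> C"
  shows "\<exists>N. tAN N \<subseteq> C"
proof -
  from C obtain B where B: "card B = 3" "\<not> D.dependent B" "D.span B = C" by (auto simp: cubic_ring_def)
  have fin: "finite B" using B(1) by (simp add: card_ge_0_finite)
  have "K.independent B"
    unfolding K.dependent_finite[OF fin]
  proof safe
    fix u v assume v: "v \<in> B" "u v \<noteq> 0" and eq: "(\<Sum>v\<in>B. Kscale \<iota> (u v) v) = 0"
    define s where "s = (\<Sum>v\<in>B. nat (- fls_subdegree (u v)))"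
    have "\<exists>g. fls_X ^ s * u v = fl g" if "v \<in> B" for v
    proof -
      have "nat (- fls_subdegree (u v)) \<le> s" unfolding s_def using that fin by (intro member_le_sum) auto
      then have "0 \<le> fls_subdegree (fls_X ^ s * u v)" by (cases "u v = 0") auto
      then show ?thesis by (metis fls_regpart_to_fls_trivial)
    qed
    then obtain g where g: "\<And>v. v \<in> B \<Longrightarrow> fls_X ^ s * u v = fl (g v)" by metis
    have "(\<Sum>v\<in>B. Dscale \<iota> (g v) v) = (\<Sum>v\<in>B. \<iota> (fls_X ^ s) * Kscale \<iota> (u v) v)"
      by (intro sum.cong refl) (simp add: Dscale_def Kscale_def Demb_def g[symmetric] \<iota>_mult mult_ac)
    also have "\<dots> = 0" unfolding sum_distrib_left[symmetric] eq by simp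
    finally have "g v = 0" using D.independentD[OF B(2) fin subset_refl _ v(1)] by blast
    then have "fls_X ^ s * u v = 0" using g[OF v(1)] by simp
    then show False using v(2) by simp
  qed
  then obtain B' where B': "B \<subseteq> B'" "K.independent B'" "UNIV \<subseteq> K.span B'"
    using K.maximal_independent_subset_extend[of B UNIV] by (metis subset_UNIV)
  then have "K.span B' = K.span UNIV" using K.span_mono[of B' UNIV] by auto
  then have "card B' = 3" using K.dim_eq_card[of B' UNIV] B'(2) dim_3 by simp
  then have "B' = B" using B'(1) B(1) by (metis card_ge_0_finite card_subset_eq zero_less_numeral)
  then have span: "x \<in> K.span B" for x using B'(3) by blast
  obtain s where s: "\<And>x. t ^ s x * x \<in> C"
    using clear_denominators[OF span] unfolding B(3) by metis
  define N where "N = s 1 + s w + s z"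
  have sub: "D.subspace C" using C by (simp add: cubic_ring_def)
  have up: "\<delta> f * (t ^ N * x) \<in> C" if "s x \<le> N" for x f
  proof -
    have "t ^ N = t ^ (N - s x) * t ^ s x" using that by (simp flip: power_add)
    then have "\<delta> f * (t ^ N * x) = Dscale \<iota> (f * X ^ (N - s x)) (t ^ s x * x)"
      by (simp add: Dscale_def \<delta>_mult t_elt_power mult_ac)
    then show ?thesis using D.subspace_scale[OF sub s] by simp
  qed
  have "tAN N \<subseteq> C"
  proof
    fix x assume "x \<in> tAN N"
    then obtain x0 x1 x2 where "x = t ^ N * el x0 x1 x2" unfolding tA_def using A_ex by blast
    then have "x = \<delta> x0 * (t ^ N * 1) + \<delta> x1 * (t ^ N * w) + \<delta> x2 * (t ^ N * z)"
      by (simp add: el_def algebra_simps)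
    then show "x \<in> C" using up[of 1 x0] up[of w x1] up[of z x2] D.subspace_add[OF sub] by (simp add: N_def)
  qed
  then show ?thesis by blast
qed

definition nrm :: "'l \<Rightarrow> 'k fls"
  where "nrm x = norm_fls (co 0 x) (co 1 x) (co 2 x)"

lemma nrm_E: "nrm (E x0 x1 x2) = norm_fls x0 x1 x2"
  by (simp add: nrm_def co_E)

lemma nrm_mult: "nrm (x * y) = nrm x * nrm y"
proof -
  obtain x0 x1 x2 y0 y1 y2 where "x = E x0 x1 x2" "y = E y0 y1 y2" using E_ex by metis
  then show ?thesis by (simp add: E_mult Let_def nrm_E norm_form_mult)
qed

lemma nrm_\<iota>: "nrm (\<iota> c) = c ^ 3"
  by (simp add: \<iota>_eq_E nrm_E norm_form_const)

lemma nrm_A: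
  assumes "x \<in> A"
  shows "\<exists>f. nrm x = fl f"
  using A_ex[OF assms] by (auto simp: el_E nrm_E norm_fps_to_fls[symmetric])

lemma nrm_unit: "nrm x \<noteq> 0 \<Longrightarrow> \<exists>y. x * y = 1"
  using E_ex[of x] E_unit by (auto simp: nrm_E)

text \<open>Dividing by an element of the ideal whose norm has minimal order makes the ideal integral.\<close>

lemma normalize_ideal:
  assumes DC: "range \<delta> \<subseteq> C" and CA: "C \<subseteq> A" and M: "C_ideal \<iota> C M"
  shows "\<exists>u v. u * v = 1 \<and> 1 \<in> (*) u ` M \<and> (*) u ` M \<subseteq> A \<and> submodule_of C ((*) u ` M)"
proof -
  from M obtain S where S: "finite S" "M = submodule_of C hull S" and span: "K.span M = UNIV"
    by (auto simp: C_ideal_def)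
  have sub: "submodule_of C M" unfolding S(2) by (rule submodule_of_hull)
  have scale: "c * x \<in> M" if "c \<in> C" "x \<in> M" for c x using sub that by (simp add: submodule_of_def)
  have diff: "x - y \<in> M" if "x \<in> M" "y \<in> M" for x y using sub that by (simp add: submodule_of_def)
  have zero: "0 \<in> M" using sub by (simp add: submodule_of_def)
  have add: "x + y \<in> M" if "x \<in> M" "y \<in> M" for x y using diff[OF that(1) diff[OF zero that(2)]] by simp
  have subD: "D.subspace M"
    unfolding D.subspace_def Dscale_def using zero add scale DC by blast
  have "1 \<in> K.span M" using span by simp
  from clear_denominators[OF this] obtain s where s: "t ^ s \<in> M"
    using D.span_eq_iff[THEN iffD2, OF subD] by auto
  obtain r0 where r0: "\<And>x. t ^ r0 x * x \<in> A" using integral_multiple[OF rep] by metis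
  define r where "r = (\<Sum>x\<in>S. r0 x)"
  have rS: "t ^ r * x \<in> A" if "x \<in> S" for x
  proof -
    have "r0 x \<le> r" unfolding r_def using that S(1) by (intro member_le_sum) auto
    then have "t ^ r * x = \<delta> (X ^ (r - r0 x)) * (t ^ r0 x * x)"
      by (simp add: t_elt_power mult.assoc[symmetric] \<delta>_mult[symmetric] power_add[symmetric])
    then show ?thesis using r0 integral_add_mult(2) by simp
  qed
  have "submodule_of C {x. t ^ r * x \<in> A}"
    unfolding submodule_of_def using A_ring integral_add_mult(2) CA
    by (auto simp: right_diff_distrib mult.left_commute[of "t ^ r"])
  then have "M \<subseteq> {x. t ^ r * x \<in> A}" unfolding S(2) using rS by (intro hull_minimal) auto
  then have r: "t ^ r * x \<in> A" if "x \<in> M" for x using that by blast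
  have t: "t ^ m = \<iota> (fls_X ^ m)" for m by (simp add: t_elt_def Demb_def \<iota>_power)
  \<comment> \<open>M lies in t^(-r) A, so the orders of norms are bounded below and a minimum
    exists.\<close>
  have low: "- 3 * int r \<le> fls_subdegree (nrm x)" if x: "x \<in> M" "nrm x \<noteq> 0" for x
  proof -
    obtain f where "nrm (t ^ r * x) = fl f" using nrm_A[OF r[OF x(1)]] by blast
    then have "(fls_X ^ r) ^ 3 * nrm x = fl f" by (simp add: nrm_mult t nrm_\<iota>)
    then have "0 \<le> fls_subdegree ((fls_X ^ r) ^ 3 * nrm x)" by (simp add: fls_subdegree_fls_to_fps_gt0)
    then show ?thesis using x(2) by (simp add: fls_subdegree_pow)
  qed
  define h where "h x = nat (fls_subdegree (nrm x) + 3 * int r)" for x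
  have "t ^ s \<in> M \<and> nrm (t ^ s) \<noteq> 0" using s by (simp add: t nrm_\<iota>)
  then obtain \<mu> where \<mu>: "\<mu> \<in> M" "nrm \<mu> \<noteq> 0" and min: "\<And>x. x \<in> M \<and> nrm x \<noteq> 0 \<Longrightarrow> h \<mu> \<le> h x"
    using ex_has_least_nat[of "\<lambda>x. x \<in> M \<and> nrm x \<noteq> 0" "t ^ s" h] by blast
  obtain y where y: "\<mu> * y = 1" using nrm_unit[OF \<mu>(2)] by blast
  have ny: "nrm \<mu> * nrm y = 1" unfolding nrm_mult[symmetric] y using nrm_\<iota>[of 1] by simp
  have "y * x \<in> A" if x: "x \<in> M" for x
  proof -
    obtain x0 x1 x2 where E: "y * x = E x0 x1 x2" using E_ex by blast
    have "E x0 x1 x2 \<in> A"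
    proof (rule integral_of_norms)
      fix c
      have "\<delta> (fps_const c) = \<iota> (fls_const c)" by (simp add: Demb_def)
      then have "\<iota> (fls_const c) \<in> C" using DC by (metis rangeI subsetD)
      \<comment> \<open>With x also x + c \<mu> lies in M, so by minimality its norm is an integral
        multiple of that of \<mu>: every translate x/\<mu> + c has integral norm.\<close>
      then have xc: "x + \<iota> (fls_const c) * \<mu> \<in> M" using x \<mu>(1) add scale by blast
      have "fls_subdegree (nrm \<mu>) \<le> fls_subdegree (nrm (x + \<iota> (fls_const c) * \<mu>))" if "nrm (x + \<iota> (fls_const c) * \<mu>) \<noteq> 0"
        using min[of "x + \<iota> (fls_const c) * \<mu>"] low[OF xc that] low[OF \<mu>] that xc by (simp add: h_def)
      then obtain g where g: "nrm (x + \<iota> (fls_const c) * \<mu>) = fl g * nrm \<mu>"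
        using fls_eq_fps_times[OF \<mu>(2)] by blast
      have "E (x0 + fls_const c) x1 x2 = y * x + \<iota> (fls_const c)" by (simp add: E \<iota>_eq_E E_add)
      also have "\<dots> = y * x + \<iota> (fls_const c) * (\<mu> * y)" by (simp add: y)
      also have "\<dots> = (x + \<iota> (fls_const c) * \<mu>) * y" by (simp add: algebra_simps)
      finally have "norm_fls (x0 + fls_const c) x1 x2 = nrm (x + \<iota> (fls_const c) * \<mu>) * nrm y"
        by (metis nrm_E nrm_mult)
      then show "\<exists>f. norm_fls (x0 + fls_const c) x1 x2 = fl f"
        unfolding g mult.assoc ny by auto
    qed
    then show ?thesis by (simp add: E)
  qed
  moreover have "submodule_of C ((*) y ` M)"
    unfolding submodule_of_def
  proof (intro conjI ballI)
    show "0 \<in> (*) y ` M" using zero by (intro image_eqI[of _ _ 0]) auto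
    show "a - b \<in> (*) y ` M" if "a \<in> (*) y ` M" "b \<in> (*) y ` M" for a b
      using that diff by (auto simp flip: right_diff_distrib)
    show "c * a \<in> (*) y ` M" if "c \<in> C" "a \<in> (*) y ` M" for c a
      using that scale by (auto simp: mult.left_commute[of c y])
  qed
  ultimately show ?thesis using y \<mu>(1)
    by (intro exI[of _ y] exI[of _ \<mu>] conjI) (auto simp: mult.commute intro!: image_eqI[of _ _ \<mu>])
qed

text \<open>Hermite normal form of a lattice containing 1: a is the least order of the w and z
  coordinates, attained by a w coordinate, and b is the least order of the z coordinate among the
  members without w coordinate.\<close>

lemma lattice_chart:
  assumes diff: "\<And>x y. x \<in> M \<Longrightarrow> y \<in> M \<Longrightarrow> x - y \<in> M" and scale: "\<And>f x. x \<in> M \<Longrightarrow> \<delta> f * x \<in> M" and one: "1 \<in> M"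
    and MA: "M \<subseteq> A" and N: "tAN N \<subseteq> M" and div: "\<And>x0 x1 x2. el x0 x1 x2 \<in> M \<Longrightarrow> X ^ a dvd x1 \<and> X ^ a dvd x2"
    and gen: "el y0 y1 y2 \<in> M" "fps_nth y1 a \<noteq> 0"
  shows "\<exists>b Y. a \<le> b \<and> b \<le> N \<and> M = lat a b Y"
proof -
  have zero: "0 \<in> M" using diff[OF one one] by simp
  have add: "x + y \<in> M" if "x \<in> M" "y \<in> M" for x y using diff[OF that(1) diff[OF zero that(2)]] by simp
  have \<delta>M: "\<delta> f \<in> M" for f using scale[OF one, of f] by simp
  have drop: "el 0 x1 x2 \<in> M \<longleftrightarrow> el x0 x1 x2 \<in> M" for x0 x1 x2
  proof -
    have "el x0 x1 x2 = el 0 x1 x2 + \<delta> x0" "el 0 x1 x2 = el x0 x1 x2 - \<delta> x0"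
      unfolding el_special(1) by (simp_all add: el_add el_diff)
    then show ?thesis using add diff \<delta>M by metis
  qed
  from div[OF gen(1)] obtain e Z where eZ: "y1 = X ^ a * e" "y2 = X ^ a * Z" by (auto simp: dvd_def)
  have e0: "res e \<noteq> 0" using gen(2) by (simp add: eZ fps_X_power_mult_nth)
  define Y where "Y = inverse e * Z"
  have inv: "inverse e * e = 1" using e0 by (rule inverse_mult_eq_1)
  have "\<delta> (inverse e) * el 0 y1 y2 = el 0 (X ^ a * (inverse e * e)) (Y * X ^ a)"
    unfolding el_scale eZ Y_def by (simp add: mult_ac)
  then have genM: "el 0 (X ^ a) (Y * X ^ a) \<in> M"
    using scale[of "el 0 y1 y2" "inverse e"] gen(1) drop[of y1 y2 y0] inv by simp
  define P where "P b \<longleftrightarrow> (\<exists>f. el 0 0 f \<in> M \<and> fps_nth f b \<noteq> 0)" for b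
  have "el 0 0 (X ^ N) \<in> M" using N el_in_tA_iff[of 0 0 "X ^ N" N] by auto
  then have PN: "P N" unfolding P_def by (intro exI[of _ "X ^ N"]) simp
  define b where "b = (LEAST b. P b)"
  have "P b" unfolding b_def using PN by (rule LeastI)
  have "b \<le> N" unfolding b_def using PN by (rule Least_le)
  have low: "X ^ b dvd f" if "el 0 0 f \<in> M" for f
    unfolding fps_X_power_dvd_iff
  proof (intro allI impI)
    fix i assume "i < b"
    then have "\<not> P i" unfolding b_def by (rule not_less_Least)
    then show "fps_nth f i = 0" using that by (auto simp: P_def)
  qed
  obtain f where f: "el 0 0 f \<in> M" "fps_nth f b \<noteq> 0" using \<open>P b\<close> by (auto simp: P_def)
  then obtain e' where e': "f = X ^ b * e'" using low by (auto simp: dvd_def)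
  have e'0: "res e' \<noteq> 0" using f(2) by (simp add: e' fps_X_power_mult_nth)
  have "a \<le> b"
  proof (rule ccontr)
    assume "\<not> a \<le> b"
    then have "fps_nth f b = 0" using div[OF f(1)] by (simp add: fps_X_power_dvd_iff)
    then show False using f(2) by simp
  qed
  have inv': "inverse e' * e' = 1" using e'0 by (rule inverse_mult_eq_1)
  have "\<delta> (inverse e') * el 0 0 f = el 0 0 (X ^ b * (inverse e' * e'))" unfolding el_scale e' by (simp add: mult_ac)
  then have bM: "el 0 0 (X ^ b) \<in> M" using scale[OF f(1), of "inverse e'"] inv' by simp
  have "M = lat a b Y"
  proof (intro Set.set_eqI iffI)
    fix x assume x: "x \<in> M"
    then obtain x0 x1 x2 where el: "x = el x0 x1 x2" using MA A_ex by blast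
    have dx: "X ^ a dvd x1" using div x by (simp add: el)
    then obtain p where p: "x1 = X ^ a * p" by (auto simp: dvd_def)
    have "x - \<delta> p * el 0 (X ^ a) (Y * X ^ a) = el x0 0 (x2 - Y * x1)"
      unfolding el el_scale el_diff p by (simp add: mult_ac)
    then have "el x0 0 (x2 - Y * x1) \<in> M" using diff[OF x scale[OF genM, of p]] by simp
    then have "X ^ b dvd x2 - Y * x1" using drop low by blast
    then show "x \<in> lat a b Y" using dx by (simp add: el el_in_lat_iff)
  next
    fix x assume "x \<in> lat a b Y"
    then obtain x0 x1 x2 where x: "x = el x0 x1 x2" "X ^ a dvd x1" "X ^ b dvd x2 - Y * x1" by (auto simp: lat_def)
    then obtain p q where pq: "x1 = X ^ a * p" "x2 - Y * x1 = X ^ b * q" by (auto simp: dvd_def)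
    then have x2: "x2 = Y * x1 + X ^ b * q" by (simp add: algebra_simps)
    have "x = \<delta> x0 + \<delta> p * el 0 (X ^ a) (Y * X ^ a) + \<delta> q * el 0 0 (X ^ b)"
      unfolding x(1) x2 pq(1) el_scale unfolding el_special(1) el_add by (simp add: mult_ac)
    then show "x \<in> M" using add \<delta>M scale genM bM by simp
  qed
  with \<open>a \<le> b\<close> \<open>b \<le> N\<close> show ?thesis by blast
qed

lemma el_swap: "cubic_order.el \<iota> z w x0 x1 x2 = el x0 x2 x1"
proof -
  interpret s: cubic_order \<iota> z w "- fd" "- fc" "- fb" "- fa" by (rule swap)
  show ?thesis by (simp add: s.el_def el_def add_ac)
qed

text \<open>Which of the two charts applies depends on whether the w or the z coordinate attains the
  least order.\<close>

lemma ideal_is_lattice: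
  assumes DC: "range \<delta> \<subseteq> C" and NC: "tAN N \<subseteq> C" and sub: "submodule_of C M" and one: "1 \<in> M" and MA: "M \<subseteq> A"
  shows "\<exists>a b Y. a \<le> b \<and> b \<le> N \<and> (M = lat a b Y \<or> M = cubic_order.lat \<iota> z w a b Y)"
proof -
  have diff: "x - y \<in> M" if "x \<in> M" "y \<in> M" for x y using sub that by (simp add: submodule_of_def)
  have scale: "\<delta> f * x \<in> M" if "x \<in> M" for f x using sub that DC unfolding submodule_of_def by blast
  have NM: "tAN N \<subseteq> M"
  proof
    fix x assume "x \<in> tAN N"
    then have "x * 1 \<in> M" using NC sub one unfolding submodule_of_def by blast
    then show "x \<in> M" by simp
  qed
  define P where "P a \<longleftrightarrow> (\<exists>x0 x1 x2. el x0 x1 x2 \<in> M \<and> (fps_nth x1 a \<noteq> 0 \<or> fps_nth x2 a \<noteq> 0))" for a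
  have "el 0 0 (X ^ N) \<in> M" using NM el_in_tA_iff[of 0 0 "X ^ N" N] by auto
  then have PN: "P N" unfolding P_def by (intro exI[of _ "X ^ N"] exI[of _ 0]) simp
  define a where "a = (LEAST a. P a)"
  have "P a" unfolding a_def using PN by (rule LeastI)
  have div: "X ^ a dvd x1 \<and> X ^ a dvd x2" if "el x0 x1 x2 \<in> M" for x0 x1 x2
  proof -
    have "\<not> P i" if "i < a" for i using that unfolding a_def by (rule not_less_Least)
    then show ?thesis using that unfolding fps_X_power_dvd_iff P_def by blast
  qed
  obtain y0 y1 y2 where y: "el y0 y1 y2 \<in> M" "fps_nth y1 a \<noteq> 0 \<or> fps_nth y2 a \<noteq> 0"
    using \<open>P a\<close> by (auto simp: P_def)
  show ?thesis
  proof (cases "fps_nth y1 a = 0")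
    case False
    have "\<exists>b Y. a \<le> b \<and> b \<le> N \<and> M = lat a b Y"
    proof (rule lattice_chart[where M = M and a = a])
      show "el y0 y1 y2 \<in> M" "fps_nth y1 a \<noteq> 0" by fact+
    qed (fact diff scale one MA NM div)+
    then show ?thesis by metis
  next
    case True
    interpret s: cubic_order \<iota> z w "- fd" "- fc" "- fb" "- fa" by (rule swap)
    have "\<exists>b Y. a \<le> b \<and> b \<le> N \<and> M = s.lat a b Y"
    proof (rule s.lattice_chart[where M = M and a = a])
      show "X ^ a dvd x1 \<and> X ^ a dvd x2" if "s.el x0 x1 x2 \<in> M" for x0 x1 x2
        using div[of x0 x2 x1] that unfolding el_swap by simp
      show "s.el y0 y2 y1 \<in> M" using y(1) unfolding el_swap .
      show "fps_nth y2 a \<noteq> 0" using True y(2) by simp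
    qed (fact diff scale one MA NM)+
    then show ?thesis by metis
  qed
qed

text \<open>The condition that x is not a scalar modulo t does not refer to the basis, so the
  families can be built for both charts from the same x.\<close>

theorem par_upper_bound:
  assumes C: "cubic_ring \<iota> C" and x: "x \<in> A" "\<not> (\<exists>f. \<exists>y\<in>A. x = \<delta> f + t * y)"
    and xC: "t ^ (2 * n + 1) * x \<in> C"
  shows "par \<iota> C \<le> enat n"
proof -
  have DC: "range \<delta> \<subseteq> C" using cubic_ring_D[OF C] by blast
  obtain N where N: "tAN N \<subseteq> C" using cubic_ring_conductor[OF C] by blast
  interpret s: cubic_order \<iota> z w "- fd" "- fc" "- fb" "- fa" by (rule swap)
  from chart_families[OF DC x xC, of N] obtain \<F>1 where \<F>1: "finite \<F>1" "\<forall>F\<in>\<F>1. \<exists>q\<le>enat n. ideal_family \<iota> C N q F"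
    "\<forall>a b Y. a \<le> b \<and> b \<le> N \<and> lat a b Y \<in> ideals C \<longrightarrow> (\<exists>F\<in>\<F>1. \<exists>M'\<in>F. module_iso C (lat a b Y) M')"
    by (elim exE conjE) (rule that)
  from s.chart_families[OF DC x xC, of N] obtain \<F>2 where \<F>2: "finite \<F>2" "\<forall>F\<in>\<F>2. \<exists>q\<le>enat n. ideal_family \<iota> C N q F"
    "\<forall>a b Y. a \<le> b \<and> b \<le> N \<and> s.lat a b Y \<in> ideals C \<longrightarrow> (\<exists>F\<in>\<F>2. \<exists>M'\<in>F. module_iso C (s.lat a b Y) M')"
    by (elim exE conjE) (rule that)
  have cover: "\<exists>F\<in>\<F>1 \<union> \<F>2. \<exists>M'\<in>F. module_iso C M M'" if M: "C_ideal \<iota> C M" for M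
  proof -
    from normalize_ideal[OF DC ring_subset_A[OF C] M] obtain u v where
      u: "u * v = 1" "1 \<in> (*) u ` M" "(*) u ` M \<subseteq> A" "submodule_of C ((*) u ` M)" by (elim exE conjE) (rule that)
    from ideal_is_lattice[OF DC N u(4,2,3)] obtain a b Y where
      ab: "a \<le> b" "b \<le> N" and lat: "(*) u ` M = lat a b Y \<or> (*) u ` M = s.lat a b Y" by (elim exE conjE) (rule that)
    have "\<exists>F\<in>\<F>1 \<union> \<F>2. \<exists>M'\<in>F. module_iso C ((*) u ` M) M'"
    proof (cases "(*) u ` M = lat a b Y")
      case True
      have "lat a b Y \<in> ideals C"
        using u(4) lat_ideal[OF DC, of a b Y] unfolding True ideals_def by (simp add: submodule_of_def)
      then show ?thesis using \<F>1(3) ab unfolding True by blast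
    next
      case False
      then have eq: "(*) u ` M = s.lat a b Y" using lat by simp
      have "s.lat a b Y \<in> ideals C"
        using u(4) s.lat_ideal[OF DC, of a b Y] unfolding eq ideals_def by (simp add: submodule_of_def)
      then show ?thesis using \<F>2(3) ab unfolding eq by blast
    qed
    then obtain F M' where F: "F \<in> \<F>1 \<union> \<F>2" "M' \<in> F" "module_iso C ((*) u ` M) M'" by blast
    from module_iso_trans[OF iso_by_multiple[OF u(1)] F(3)] show ?thesis using F(1,2) by blast
  qed
  show ?thesis unfolding par_le_iff
  proof (intro exI[of _ N] exI[of _ "\<F>1 \<union> \<F>2"] conjI allI impI)
    show "\<forall>F\<in>\<F>1 \<union> \<F>2. \<exists>q\<le>enat n. ideal_family \<iota> C N q F" using \<F>1(2) \<F>2(2) by blast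
    show "finite (\<F>1 \<union> \<F>2)" using \<F>1(1) \<F>2(1) by simp
  qed (fact N cover)+
qed

end

section \<open>The singularities\<close>

subsection \<open>Every ring of the given types contains a multiple of a primitive element\<close>

context cubic_order
begin

lemma primitive_iff:
  "(\<exists>f. \<exists>y\<in>A. el x0 x1 x2 = \<delta> f + t * y) \<longleftrightarrow> res x1 = 0 \<and> res x2 = 0"
proof
  assume "\<exists>f. \<exists>y\<in>A. el x0 x1 x2 = \<delta> f + t * y"
  then obtain f y0 y1 y2 where "el x0 x1 x2 = \<delta> f + t * el y0 y1 y2" using A_ex by metis
  then have "el x0 x1 x2 = el (f + X * y0) (X * y1) (X * y2)"
    unfolding t_elt_def el_scale unfolding el_special(1) el_add by simp
  then show "res x1 = 0 \<and> res x2 = 0" by simp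
next
  assume "res x1 = 0 \<and> res x2 = 0"
  then obtain y1 y2 where "x1 = X * y1" "x2 = X * y2" by (auto simp flip: fps_X_dvd_iff simp: dvd_def)
  then have "el x0 x1 x2 = \<delta> x0 + t * el 0 y1 y2"
    unfolding t_elt_def el_scale unfolding el_special(1) by (simp add: el_add)
  then show "\<exists>f. \<exists>y\<in>A. el x0 x1 x2 = \<delta> f + t * y" by blast
qed

text \<open>Dividing by the largest power t^s common to both coordinates leaves a primitive element.
  Since s <= m, a factor t^(m-s) restores the exponent m.\<close>

lemma primitive_multiple:
  assumes C: "cubic_ring \<iota> C" and c: "el c0 c1 c2 \<in> C" "\<not> (X ^ Suc m dvd c1 \<and> X ^ Suc m dvd c2)"
  shows "\<exists>x\<in>A. \<not> (\<exists>f. \<exists>y\<in>A. x = \<delta> f + t * y) \<and> t ^ m * x \<in> C"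
proof -
  define P where "P i \<longleftrightarrow> fps_nth c1 i \<noteq> 0 \<or> fps_nth c2 i \<noteq> 0" for i
  obtain i where i: "i < Suc m" "P i" using c(2) unfolding fps_X_power_dvd_iff P_def by blast
  define s where "s = (LEAST i. P i)"
  have Ps: "P s" unfolding s_def using i(2) by (rule LeastI)
  have s: "s \<le> m" using Least_le[of P, OF i(2)] i(1) by (simp add: s_def)
  have low: "\<not> P i" if "i < s" for i using that unfolding s_def by (rule not_less_Least)
  then have "X ^ s dvd c1" "X ^ s dvd c2" unfolding fps_X_power_dvd_iff P_def by blast+
  then obtain d1 d2 where d: "c1 = X ^ s * d1" "c2 = X ^ s * d2" by (auto simp: dvd_def)
  have "res d1 \<noteq> 0 \<or> res d2 \<noteq> 0" using Ps by (simp add: P_def d fps_X_power_mult_nth)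
  then have prim: "\<not> (\<exists>f. \<exists>y\<in>A. el 0 d1 d2 = \<delta> f + t * y)" unfolding primitive_iff by simp
  have sub: "D.subspace C" using C by (simp add: cubic_ring_def)
  have "X ^ m = X ^ (m - s) * (X ^ s :: 'k fps)" using s by (simp flip: power_add)
  then have "t ^ m * el 0 d1 d2 = Dscale \<iota> (X ^ (m - s)) (el c0 c1 c2 - \<delta> c0)"
    unfolding Dscale_def t_elt_power el_scale unfolding el_special(1) el_diff unfolding el_special(1)[symmetric] el_scale d
    by (simp add: mult.assoc)
  also have "\<dots> \<in> C" by (intro D.subspace_scale[OF sub] D.subspace_diff[OF sub c(1)] cubic_ring_D[OF C])
  finally show ?thesis using prim by blast
qed

lemma near_1_unit:
  assumes "y \<in> A"
  shows "\<exists>u\<in>A. (1 - t * y) * u = 1"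
proof -
  obtain y0 y1 y2 where y: "y = el y0 y1 y2" using A_ex[OF assms] by blast
  have "1 - t * y = el (1 - X * y0) (- (X * y1)) (- (X * y2))"
    unfolding y t_elt_def el_scale unfolding el_special(4) el_diff by simp
  moreover have "res (norm_fps (1 - X * y0) (- (X * y1)) (- (X * y2))) \<noteq> 0"
    unfolding norm_form_cong0 by (simp add: norm_form_const)
  ultimately show ?thesis using el_unit by metis
qed

text \<open>The unit 1 - ty of A annihilates e.\<close>

lemma idem_zero:
  assumes "e * e = e" "e = t * y" "y \<in> A"
  shows "e = 0"
proof -
  obtain u where u: "(1 - t * y) * u = 1" using near_1_unit[OF assms(3)] by blast
  have "e * (1 - t * y) = 0" using assms(1) by (simp add: right_diff_distrib flip: assms(2))
  then have "e * ((1 - t * y) * u) = 0" by (simp flip: mult.assoc)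
  then show ?thesis by (simp add: u)
qed

lemma idem_in_A:
  assumes "e * e = e"
  shows "e \<in> A"
  using integral_cubic[of e 1 0 0] assms by simp

lemma idem_scalar:
  assumes g: "g * g = g" "g \<noteq> 0" and eq: "g * \<delta> f = t * y" "y \<in> A"
  shows "res f = 0"
proof (rule ccontr)
  assume "res f \<noteq> 0"
  then have "f * inverse f = 1" using inverse_mult_eq_1[of f] by (simp add: mult.commute)
  then have "g = g * (\<delta> f * \<delta> (inverse f))" by (simp flip: \<delta>_mult)
  also have "\<dots> = t * (y * \<delta> (inverse f))" using eq(1) by (simp flip: mult.assoc)
  finally show False using idem_zero[OF g(1), of "y * \<delta> (inverse f)"] g(2) eq(2) integral_add_mult(2) by blast
qed

text \<open>A / tA has dimension 3 over k.\<close>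

lemma not_two_generated:
  assumes "\<And>x. x \<in> A \<Longrightarrow> \<exists>c d. \<exists>y\<in>A. x = kscale \<iota> c p + kscale \<iota> d q + t * y" and pq: "p \<in> A" "q \<in> A"
  shows False
proof -
  obtain p0 p1 p2 q0 q1 q2 where el: "p = el p0 p1 p2" "q = el q0 q1 q2" using A_ex pq by metis
  have *: "\<exists>c d. res x0 = c * res p0 + d * res q0 \<and>
      res x1 = c * res p1 + d * res q1 \<and> res x2 = c * res p2 + d * res q2" for x0 x1 x2
  proof -
    from assms(1)[OF el_in_A] obtain c d y0 y1 y2 where
      "el x0 x1 x2 = kscale \<iota> c p + kscale \<iota> d q + t * el y0 y1 y2" using A_ex by metis
    then have "el x0 x1 x2 = el (fps_const c * p0 + fps_const d * q0 + X * y0)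
        (fps_const c * p1 + fps_const d * q1 + X * y1) (fps_const c * p2 + fps_const d * q2 + X * y2)"
      unfolding el t_elt_def el_scale el_kscale el_add .
    then show ?thesis by (intro exI[of _ c] exI[of _ d]) simp
  qed
  from *[of 1 0 0] *[of 0 1 0] *[of 0 0 1] obtain a1 a2 b1 b2 c1 c2 where
    "1 = a1 * res p0 + a2 * res q0" "0 = a1 * res p1 + a2 * res q1" "0 = a1 * res p2 + a2 * res q2"
    "0 = b1 * res p0 + b2 * res q0" "1 = b1 * res p1 + b2 * res q1" "0 = b1 * res p2 + b2 * res q2"
    "0 = c1 * res p0 + c2 * res q0" "0 = c1 * res p1 + c2 * res q1" "1 = c1 * res p2 + c2 * res q2"
    by auto
  \<comment> \<open>The identity matrix would factor through k^2; padded by zeros, the factors have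
    determinant 0.\<close>
  then have "det3 (1::'k) 0 0 0 1 0 0 0 1 = det3 a1 a2 0 b1 b2 0 c1 c2 0 *
      det3 (res p0) (res p1) (res p2) (res q0) (res q1) (res q2) 0 0 0"
    unfolding det3_mult[symmetric] by simp
  then show False by (simp add: det3_def)
qed

section \<open>A component e A, a maximal ideal of it and the residue field\<close>

context
  fixes e :: 'l and R I :: "'l set"
  assumes e: "e * e = e" and R: "R = (*) e ` A" and I: "maximal_ideal_of R I"
begin

lemma R_iff: "x \<in> R \<longleftrightarrow> x \<in> A \<and> e * x = x"
proof
  assume "x \<in> R"
  then obtain y where "x = e * y" "y \<in> A" by (auto simp: R)
  then show "x \<in> A \<and> e * x = x" using e idem_in_A[OF e] integral_add_mult(2) by (simp flip: mult.assoc)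
qed (auto simp: R intro!: image_eqI)

lemma e_in_R: "e \<in> R"
  using e idem_in_A[OF e] by (simp add: R_iff)

lemma R_mult: "x \<in> R \<Longrightarrow> y \<in> A \<Longrightarrow> x * y \<in> R"
  using integral_add_mult(2) by (auto simp: R_iff simp flip: mult.assoc)

lemma I_sub: "I \<subseteq> R" "0 \<in> I" "x \<in> I \<Longrightarrow> y \<in> I \<Longrightarrow> x - y \<in> I" "c \<in> R \<Longrightarrow> x \<in> I \<Longrightarrow> c * x \<in> I"
  using I by (auto simp: maximal_ideal_of_def submodule_of_def)

lemma I_add: "x \<in> I \<Longrightarrow> y \<in> I \<Longrightarrow> x + y \<in> I"
  using I_sub(3)[of x "0 - y"] I_sub(3)[of 0 y] I_sub(2) by simp

lemma I_mult: "x \<in> I \<Longrightarrow> y \<in> A \<Longrightarrow> x * y \<in> I"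
proof -
  assume x: "x \<in> I" and y: "y \<in> A"
  then have "e * y * x \<in> I" using R_mult[OF e_in_R] I_sub(4) by blast
  moreover have "e * x = x" using x I_sub(1) R_iff by blast
  then have "e * y * x = x * y" by (metis mult.commute mult.left_commute)
  ultimately show ?thesis by simp
qed

lemma e_notin_I: "e \<notin> I"
proof
  assume "e \<in> I"
  then have "e * y \<in> I" if "y \<in> A" for y using that by (rule I_mult)
  then have "R \<subseteq> I" by (auto simp: R)
  then show False using I by (auto simp: maximal_ideal_of_def)
qed

lemma I_complement:
  assumes x: "x \<in> R" "x \<notin> I"
  shows "\<exists>i\<in>I. \<exists>r\<in>R. e = i + x * r"
proof -
  let ?J = "{i + x * r | i r. i \<in> I \<and> r \<in> R}"
  have e_unit: "e * y = y" if "y \<in> R" for y using that R_iff by blast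
  have R_diff: "y - y' \<in> R" if "y \<in> R" "y' \<in> R" for y y'
    using that A_ring(3) by (auto simp: R_iff right_diff_distrib)
  have R_add: "y + y' \<in> R" if "y \<in> R" "y' \<in> R" for y y'
    using that integral_add_mult(1) by (auto simp: R_iff distrib_left)
  have RA: "y \<in> A" if "y \<in> R" for y using that R_iff by blast
  have zero: "0 \<in> R" using I_sub(1,2) by blast
  have "submodule_of R ?J" unfolding submodule_of_def
  proof (intro conjI ballI)
    show "0 \<in> ?J" using I_sub(2) zero by (intro CollectI exI[of _ 0]) auto
    fix y y' assume "y \<in> ?J" "y' \<in> ?J"
    then obtain i r i' r' where "y = i + x * r" "i \<in> I" "r \<in> R" "y' = i' + x * r'" "i' \<in> I" "r' \<in> R" by blast
    then show "y - y' \<in> ?J" using I_sub(3) R_diff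
      by (intro CollectI exI[of _ "i - i'"] exI[of _ "r - r'"]) (auto simp: algebra_simps)
  next
    fix c y assume c: "c \<in> R" "y \<in> ?J"
    then obtain i r where "y = i + x * r" "i \<in> I" "r \<in> R" by blast
    then show "c * y \<in> ?J" using c(1) I_sub(4) R_mult RA
      by (intro CollectI exI[of _ "c * i"] exI[of _ "c * r"]) (auto simp: algebra_simps)
  qed
  moreover have "I \<subseteq> ?J"
  proof
    fix i assume "i \<in> I"
    then show "i \<in> ?J" using zero by (intro CollectI exI[of _ i] exI[of _ 0]) auto
  qed
  moreover have "x \<in> ?J" using I_sub(2) e_in_R e_unit[OF x(1)]
    by (intro CollectI exI[of _ 0] exI[of _ e]) (auto simp: mult.commute)
  moreover have "?J \<subseteq> R"
  proof
    fix y assume "y \<in> ?J"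
    then obtain i r where "y = i + x * r" "i \<in> I" "r \<in> R" by blast
    then show "y \<in> R" using R_add R_mult[OF x(1)] RA I_sub(1) by blast
  qed
  ultimately have "?J = R" using I x(2) unfolding maximal_ideal_of_def by blast
  then have "e \<in> ?J" using e_in_R by simp
  then show ?thesis by blast
qed

lemma I_prime:
  assumes "x \<in> R" "y \<in> R" "x * y \<in> I"
  shows "x \<in> I \<or> y \<in> I"
proof (rule disjCI)
  assume y: "y \<notin> I"
  obtain i r where ir: "i \<in> I" "r \<in> R" "e = i + y * r" using I_complement[OF assms(2) y] by blast
  have "x = e * x" using assms(1) R_iff by simp
  also have "\<dots> = i * x + (x * y) * r" by (simp add: ir(3) algebra_simps)
  finally have x: "x = i * x + (x * y) * r" .
  have "x \<in> A" "r \<in> A" using assms(1) ir(2) R_iff by blast+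
  then have "i * x + (x * y) * r \<in> I" by (intro I_add I_mult[OF ir(1)] I_mult[OF assms(3)])
  then show "x \<in> I" using x by simp
qed

text \<open>As in Nakayama's lemma: otherwise e = i + t e r with i in I, so e times the unit 1 - tr
  lies in I.\<close>

lemma t_in_I: "t * e \<in> I"
proof (rule ccontr)
  assume t: "t * e \<notin> I"
  have tA: "t \<in> A" by (simp add: t_elt_def)
  have "t * e \<in> R" using R_mult[OF e_in_R tA] by (simp add: mult.commute)
  from I_complement[OF this t] obtain i r where ir: "i \<in> I" "r \<in> R" "e = i + t * e * r" by blast
  obtain u where u: "u \<in> A" "(1 - t * r) * u = 1" using near_1_unit ir(2) R_iff by blast
  have "i = e * (1 - t * r)" using ir(3) by (simp add: algebra_simps)
  then have "i * u = e" using u(2) by (simp add: mult.assoc)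
  then have "e \<in> I" using I_mult[OF ir(1) u(1)] by simp
  then show False using e_notin_I by simp
qed

text \<open>Modulo t, hence modulo I, an integral equation of x becomes a monic equation over k. It
  splits into linear factors, and I is prime.\<close>

lemma I_constants:
  assumes x: "x \<in> R"
  shows "\<exists>c. x - kscale \<iota> c e \<in> I"
proof -
  define h where "h c = \<delta> (fps_const c)" for c
  interpret h: comm_ring_hom h
    by unfold_locales (simp_all add: h_def \<delta>_add \<delta>_mult flip: fps_const_add fps_const_mult)
  interpret m: map_poly_comm_ring_hom h ..
  define ev where "ev q = e * poly (map_poly h q) x" for q
  have xA: "x \<in> A" and ex: "e * x = x" using x R_iff by blast+
  have polyA: "poly (map_poly h q) x \<in> A" for q
  proof (induction q)
    case (pCons c q)
    then show ?case using xA by (simp add: m.map_poly_pCons_hom h_def integral_add_mult)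
  qed (simp add: A_ring)
  have roots: "\<exists>c. x - kscale \<iota> c e \<in> I" if "q \<noteq> 0" "ev q \<in> I" for q
    using that
  proof (induction "degree q" arbitrary: q rule: less_induct)
    case less
    show ?case
    proof (cases "degree q = 0")
      case True
      then obtain c where q: "q = [:c:]" using degree_eq_zeroE by blast
      with less.prems(1) have c: "c \<noteq> 0" by auto
      have "e * h c \<in> I" using less.prems(2) c by (simp add: q ev_def map_poly_pCons)
      then have "e * h c * h (inverse c) \<in> I" by (rule I_mult) (simp add: h_def)
      moreover have "h c * h (inverse c) = 1" using c by (simp add: h_def flip: \<delta>_mult)
      ultimately show ?thesis using e_notin_I by (simp add: mult.assoc)
    next
      case False
      then obtain c where "poly q c = 0" using alg_closed_imp_poly_has_root[of q] by auto
      then obtain q' where q: "q = [:- c, 1:] * q'" by (metis dvdE poly_eq_0_iff_dvd)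
      then have q': "q' \<noteq> 0" using less.prems(1) by auto
      then have deg: "degree q' < degree q" unfolding q by (subst degree_mult_eq) auto
      have xc: "x - kscale \<iota> c e \<in> R" using x e_in_R R_mult[OF e_in_R, of "\<delta> (fps_const c)"] A_ring(3)
        by (auto simp: kscale_def R_iff right_diff_distrib mult.left_commute mult.commute)
      have evR: "ev q' \<in> R" unfolding ev_def by (intro R_mult[OF e_in_R] polyA)
      have "ev q = e * ((x - h c) * poly (map_poly h q') x)"
        unfolding q ev_def m.hom_mult by (simp add: m.map_poly_pCons_hom h.hom_uminus left_diff_distrib)
      also have "\<dots> = (e * e) * ((x - h c) * poly (map_poly h q') x)" by (simp only: e)
      also have "\<dots> = (e * (x - h c)) * ev q'" by (simp add: ev_def mult_ac)
      also have "e * (x - h c) = x - kscale \<iota> c e" by (simp add: kscale_def h_def right_diff_distrib ex mult.commute)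
      finally have "(x - kscale \<iota> c e) * ev q' \<in> I" using less.prems(2) by simp
      then show ?thesis using I_prime[OF xc evR] less.hyps[OF deg q'] by blast
    qed
  qed
  obtain n c where n: "x ^ n = (\<Sum>i<n. \<delta> (c i) * x ^ i)" using integral_monic[OF xA] by blast
  define q where "q = monom 1 n - (\<Sum>i<n. monom (res (c i)) i)"
  have "coeff (\<Sum>i<n. monom (res (c i)) i) n = 0"
    unfolding coeff_sum by (intro sum.neutral) auto
  then have "coeff q n = 1" by (simp add: q_def)
  then have "q \<noteq> 0" by auto
  moreover have "ev q \<in> I"
  proof -
    have split: "\<delta> f - h (res f) = t * \<delta> (fps_shift 1 f)" for f
    proof -
      have "f - fps_const (res f) = X * fps_shift 1 f" by (intro fps_ext) simp
      then show ?thesis by (simp add: h_def t_elt_def flip: \<delta>_diff \<delta>_mult)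
    qed
    have "poly (map_poly h q) x = x ^ n - (\<Sum>i<n. h (res (c i)) * x ^ i)"
      unfolding q_def m.hom_minus m.hom_sum by (simp add: poly_sum map_poly_monom poly_monom)
    also have "\<dots> = (\<Sum>i<n. (\<delta> (c i) - h (res (c i))) * x ^ i)"
      by (simp add: n sum_subtractf left_diff_distrib)
    also have "\<dots> = t * (\<Sum>i<n. \<delta> (fps_shift 1 (c i)) * x ^ i)"
      by (simp add: split sum_distrib_left mult.assoc)
    finally have eq: "ev q = (t * e) * (\<Sum>i<n. \<delta> (fps_shift 1 (c i)) * x ^ i)"
      by (simp add: ev_def mult_ac)
    have pow: "x ^ i \<in> A" for i by (induction i) (simp_all add: xA A_ring integral_add_mult)
    have "(\<Sum>i<m. \<delta> (fps_shift 1 (c i)) * x ^ i) \<in> A" for m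
      by (induction m) (simp_all add: A_ring integral_add_mult pow)
    from I_mult[OF t_in_I this] show ?thesis unfolding eq .
  qed
  ultimately show ?thesis by (rule roots)
qed

end

text \<open>If \<alpha> = f + ty, then f lies in the maximal ideal, so t divides f and therefore
  \<alpha>. Then \<tau>^2 lies in tA, and 1 and \<tau> would span A / tA.\<close>

lemma one_branch_primitive:
  assumes v: "has_valuation A \<alpha> k" and k: "k = 1 \<or> k = 2" and y: "\<alpha> = \<delta> f + t * y" "y \<in> A"
  shows False
proof -
  from v obtain \<tau> where \<tau>: "\<tau> \<in> A" "{I. maximal_ideal_of A I} = {(*) \<tau> ` A}" "(*) \<alpha> ` A = (*) (\<tau> ^ k) ` A" and \<alpha>: "\<alpha> \<in> A"
    by (auto simp: has_valuation_def)
  define I where "I = (*) \<tau> ` A"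
  have I: "maximal_ideal_of A I" using \<tau>(2) by (auto simp: I_def)
  have AA: "A = (*) 1 ` A" by simp
  note I_rules = I_sub[OF _ AA I] I_add[OF _ AA I] I_mult[OF _ AA I] e_notin_I[OF _ AA I] t_in_I[OF _ AA I]
    I_constants[OF _ AA I]
  have "\<alpha> * 1 \<in> (*) (\<tau> ^ k) ` A" using A_ring(1) unfolding \<tau>(3)[symmetric] by blast
  then obtain b where "\<alpha> = \<tau> ^ k * b" "b \<in> A" by auto
  moreover have "\<tau> ^ k = \<tau> * \<tau> ^ (k - 1)" using k by (auto simp: power2_eq_square)
  ultimately have "\<alpha> = \<tau> * (\<tau> ^ (k - 1) * b)" "\<tau> ^ (k - 1) * b \<in> A"
    using k \<tau>(1) A_ring(1) by (auto simp: mult.assoc intro!: integral_add_mult)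
  then have \<alpha>I: "\<alpha> \<in> I" unfolding I_def by blast
  have "\<delta> f = \<alpha> - t * y" using y(1) by simp
  then have fI: "\<delta> f \<in> I" using \<alpha>I I_rules(6)[of "t" y] I_rules(8) y(2) I_rules(3) by simp
  have "res f = 0"
  proof (rule ccontr)
    assume "res f \<noteq> 0"
    then have "f * inverse f = 1" using inverse_mult_eq_1[of f] by (simp add: mult.commute)
    then have "\<delta> f * \<delta> (inverse f) = 1" by (simp flip: \<delta>_mult)
    then show False using I_rules(6)[OF _ fI, of "\<delta> (inverse f)"] I_rules(7) by simp
  qed
  then obtain g where g: "f = X * g" using fps_X_factor by blast
  have \<alpha>_t: "\<alpha> = t * (\<delta> g + y)" by (simp add: y(1) g t_elt_def \<delta>_mult algebra_simps)
  have "\<tau> ^ k * 1 \<in> (*) \<alpha> ` A" using A_ring(1) unfolding \<tau>(3) by blast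
  then obtain b where b: "\<tau> ^ k = \<alpha> * b" "b \<in> A" by auto
  have "\<exists>y\<in>A. \<tau> ^ 2 = t * y"
  proof -
    have "\<tau> ^ 2 = \<tau> ^ k * \<tau> ^ (2 - k)" using k by (auto simp: power2_eq_square)
    also have "\<dots> = t * ((\<delta> g + y) * b * \<tau> ^ (2 - k))" by (simp add: b(1) \<alpha>_t mult_ac)
    finally have "\<tau> ^ 2 = t * ((\<delta> g + y) * b * \<tau> ^ (2 - k))" .
    moreover have "(\<delta> g + y) * b * \<tau> ^ (2 - k) \<in> A"
      using k b(2) y(2) \<tau>(1) A_ring(1) by (intro integral_add_mult) auto
    ultimately show ?thesis by blast
  qed
  then obtain y2 where y2: "y2 \<in> A" "\<tau> ^ 2 = t * y2" by blast
  have step: "\<exists>c. \<exists>x'\<in>A. x = kscale \<iota> c 1 + \<tau> * x'" if "x \<in> A" for x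
  proof -
    from I_rules(9)[OF _ that] obtain c where "x - kscale \<iota> c 1 \<in> I" by auto
    then obtain x' where "x - kscale \<iota> c 1 = \<tau> * x'" "x' \<in> A" by (auto simp: I_def)
    then show ?thesis by (intro exI[of _ c] bexI[of _ x']) (auto simp: algebra_simps)
  qed
  show False
  proof (rule not_two_generated[of 1 \<tau>])
    fix x assume "x \<in> A"
    from step[OF this] obtain c x' where x: "x' \<in> A" "x = kscale \<iota> c 1 + \<tau> * x'" by blast
    from step[OF x(1)] obtain d x'' where x': "x'' \<in> A" "x' = kscale \<iota> d 1 + \<tau> * x''" by blast
    have "x = kscale \<iota> c 1 + kscale \<iota> d \<tau> + \<tau> ^ 2 * x''"
      unfolding x(2) x'(2) by (simp add: kscale_def power2_eq_square algebra_simps)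
    then have "x = kscale \<iota> c 1 + kscale \<iota> d \<tau> + t * (y2 * x'')" by (simp add: y2(2) mult.assoc)
    then show "\<exists>c d. \<exists>y\<in>A. x = kscale \<iota> c 1 + kscale \<iota> d \<tau> + t * y"
      using y2(1) x'(1) integral_add_mult(2) by blast
  qed (fact A_ring \<tau>)+
qed

text \<open>The component is a copy of K, so its integral elements form a copy of D, and modulo t
  only constants remain.\<close>

lemma complement_one_dimensional:
  assumes g: "g * g = g" and dim: "K.dim (range ((*) g)) = 1"
  shows "g \<noteq> 0" "x \<in> A \<Longrightarrow> \<exists>c. \<exists>y\<in>A. g * x = kscale \<iota> c g + t * y"
proof -
  from K.basis_exists[of "range ((*) g)"] obtain B where B: "B \<subseteq> range ((*) g)" "K.independent B"
    "range ((*) g) \<subseteq> K.span B" "card B = 1" using dim by metis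
  then obtain b where b: "B = {b}" by (auto simp: card_1_singleton_iff)
  have "b \<noteq> 0" using B(2) K.dependent_zero[of B] b by auto
  moreover from B(1) b obtain b' where "b = g * b'" by auto
  ultimately show g0: "g \<noteq> 0" by auto
  have span: "\<exists>r. g * x = \<iota> r * b" for x
    using B(3) unfolding b K.span_singleton by (auto simp: Kscale_def)
  from span[of 1] obtain s where s: "g = \<iota> s * b" by auto
  then have "s \<noteq> 0" using g0 by auto
  assume x: "x \<in> A"
  obtain r where "g * x = \<iota> r * b" using span by blast
  also have "\<dots> = \<iota> (r / s) * g" using \<open>s \<noteq> 0\<close> unfolding s by (simp flip: mult.assoc \<iota>_mult)
  finally have gx: "g * x = \<iota> (r / s) * g" .
  have "g * x \<in> A" using x idem_in_A[OF g] integral_add_mult(2) by blast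
  then obtain h where "r / s = fl h" using integral_fls[OF g g0, of "r / s"] gx by auto
  then have "g * x = \<delta> h * g" by (simp add: gx Demb_def)
  moreover have "h = fps_const (res h) + X * fps_shift 1 h" by (intro fps_ext) simp
  then have "\<delta> h = \<delta> (fps_const (res h)) + t * \<delta> (fps_shift 1 h)" by (metis \<delta>_add \<delta>_mult t_elt_def)
  ultimately have "g * x = kscale \<iota> (res h) g + t * (\<delta> (fps_shift 1 h) * g)"
    by (simp add: kscale_def algebra_simps)
  then show "\<exists>c. \<exists>y\<in>A. g * x = kscale \<iota> c g + t * y"
    using idem_in_A[OF g] integral_add_mult(2) by blast
qed

text \<open>Multiplication by 1 - e shows that an element of e A of the form f + ty lies in tA. If
  \<alpha> did, e and 1 - e would span A / tA; if e + t^q \<alpha> did, e would lie in the maximal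
  ideal of e A.\<close>

lemma two_branches_primitive:
  assumes two: "two_branches \<iota> e" and v: "has_valuation ((*) e ` A) \<alpha> 1"
  shows "\<not> (\<exists>f. \<exists>y\<in>A. \<alpha> = \<delta> f + t * y)" "\<not> (\<exists>f. \<exists>y\<in>A. e + t ^ q * \<alpha> = \<delta> f + t * y)" "\<alpha> \<in> A" "e \<in> A"
proof -
  let ?R = "(*) e ` A"
  have e: "e * e = e" using two by (simp add: two_branches_def idem_field_def)
  then have g: "(1 - e) * (1 - e) = 1 - e" by (simp add: algebra_simps)
  have "K.dim (range ((*) (1 - e))) = 1" using two by (simp add: two_branches_def)
  note g_dim = complement_one_dimensional[OF g this]
  from v obtain \<tau> where \<tau>: "\<tau> \<in> ?R" "{I. maximal_ideal_of ?R I} = {(*) \<tau> ` ?R}" "(*) \<alpha> ` ?R = (*) \<tau> ` ?R" and \<alpha>: "\<alpha> \<in> ?R"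
    by (auto simp: has_valuation_def)
  define I where "I = (*) \<tau> ` ?R"
  have I: "maximal_ideal_of ?R I" using \<tau>(2) by (auto simp: I_def)
  note R_iff = R_iff[OF e refl I]
  note I_rules = I_sub[OF e refl I] I_add[OF e refl I] I_mult[OF e refl I] e_notin_I[OF e refl I] t_in_I[OF e refl I]
  show eA: "e \<in> A" by (rule idem_in_A[OF e])
  show \<alpha>A: "\<alpha> \<in> A" using \<alpha> R_iff by blast
  have e\<alpha>: "e * \<alpha> = \<alpha>" "e * \<tau> = \<tau>" using \<alpha> \<tau>(1) R_iff by blast+
  have eR: "e \<in> ?R" using e eA R_iff by blast
  have "\<alpha> * e \<in> I" using eR \<tau>(3) unfolding I_def by blast
  then have \<alpha>I: "\<alpha> \<in> I" using e\<alpha> by (simp add: mult.commute)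
  have "\<tau> * e \<in> (*) \<alpha> ` ?R" using eR \<tau>(3) by blast
  then obtain b where b: "\<tau> = \<alpha> * b" "b \<in> A" using e\<alpha> R_iff by (auto simp: mult.commute)
  have divides: "\<exists>y'\<in>A. x = t * y'" if x: "e * x = x" "x = \<delta> f + t * y" "y \<in> A" for x f y
  proof -
    have "(1 - e) * (\<delta> f + t * y) = 0" unfolding x(2)[symmetric] using x(1) by (simp add: algebra_simps)
    then have "(1 - e) * \<delta> f = t * ((e - 1) * y)" by (simp add: algebra_simps)
    moreover have "(e - 1) * y \<in> A" using eA x(3) A_ring integral_add_mult(2) by blast
    ultimately have "res f = 0" by (rule idem_scalar[OF g g_dim(1)])
    then obtain h where "f = X * h" using fps_X_factor by blast
    then have "x = t * (\<delta> h + y)" by (simp add: x(2) t_elt_def \<delta>_mult algebra_simps)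
    then show ?thesis using x(3) integral_add_mult(1) by blast
  qed
  show "\<not> (\<exists>f. \<exists>y\<in>A. \<alpha> = \<delta> f + t * y)"
  proof
    assume "\<exists>f. \<exists>y\<in>A. \<alpha> = \<delta> f + t * y"
    then obtain y where y: "y \<in> A" "\<alpha> = t * y" using divides[OF e\<alpha>(1)] by blast
    show False
    proof (rule not_two_generated[of e "1 - e"])
      fix x assume x: "x \<in> A"
      then have "e * x \<in> ?R" by blast
      from I_constants[OF e refl I this] obtain c where "e * x - kscale \<iota> c e \<in> I" by blast
      then obtain r where r: "e * x - kscale \<iota> c e = \<tau> * r" "r \<in> A" using R_iff by (auto simp: I_def)
      from g_dim(2)[OF x] obtain d y' where y': "y' \<in> A" "(1 - e) * x = kscale \<iota> d (1 - e) + t * y'" by blast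
      have ex: "e * x = kscale \<iota> c e + t * (y * b * r)" using r(1) by (simp add: b(1) y(2) algebra_simps)
      have "x = e * x + (1 - e) * x" by (simp add: algebra_simps)
      also have "\<dots> = kscale \<iota> c e + kscale \<iota> d (1 - e) + t * (y * b * r + y')"
        unfolding ex y'(2) by (simp only: distrib_left add_ac)
      finally have "x = kscale \<iota> c e + kscale \<iota> d (1 - e) + t * (y * b * r + y')" .
      moreover have "y * b * r + y' \<in> A" using y(1) b(2) r(2) y'(1) by (intro integral_add_mult)
      ultimately show "\<exists>c d. \<exists>y\<in>A. x = kscale \<iota> c e + kscale \<iota> d (1 - e) + t * y" by blast
    qed (use eA A_ring in auto)
  qed
  show "\<not> (\<exists>f. \<exists>y\<in>A. e + t ^ q * \<alpha> = \<delta> f + t * y)"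
  proof
    let ?x = "e + t ^ q * \<alpha>"
    assume "\<exists>f. \<exists>y\<in>A. ?x = \<delta> f + t * y"
    moreover have ex: "e * ?x = ?x" using e e\<alpha>(1) by (simp add: distrib_left mult.left_commute[of e])
    ultimately obtain y where y: "y \<in> A" "?x = t * y" using divides[OF ex] by blast
    then have "?x = (t * e) * y" using ex by (metis mult.assoc mult.commute)
    then have "?x \<in> I" using I_rules(6)[OF I_rules(8) y(1)] by simp
    moreover have "\<alpha> * t ^ q \<in> I" using \<alpha>I by (intro I_rules(6)) (simp_all add: t_elt_power)
    ultimately have "?x - \<alpha> * t ^ q \<in> I" by (rule I_rules(3))
    then show False using I_rules(7) by (simp add: mult.commute)
  qed
qed

text \<open>If e were non-zero in two branches, the idempotent of one of them would split it. Cyclic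
  permutation of the three maps gives the remaining pairs.\<close>

lemma primitive_idempotent_branch:
  assumes hom: "K_algebra_hom \<iota> \<pi>1" "K_algebra_hom \<iota> \<pi>2" "K_algebra_hom \<iota> \<pi>3"
    and bij: "bij (\<lambda>x. (\<pi>1 x, \<pi>2 x, \<pi>3 x))" and e: "primitive_idempotent A e"
  shows "\<pi>1 e = 0 \<or> \<pi>2 e = 0" "\<pi>1 e = 0 \<or> \<pi>1 e = 1"
proof -
  have ee: "e * e = e" using e by (simp add: primitive_idempotent_def)
  have "\<pi>1 e * \<pi>1 e = \<pi>1 e" using hom(1) ee by (metis K_algebra_hom_def)
  then show "\<pi>1 e = 0 \<or> \<pi>1 e = 1" by simp
  show "\<pi>1 e = 0 \<or> \<pi>2 e = 0"
  proof (rule ccontr)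
    assume ne: "\<not> ?thesis"
    obtain f where f: "\<pi>1 f = 1" "\<pi>2 f = 0" "\<pi>3 f = 0" using bij by (metis (no_types, lifting) Pair_inject bij_pointE)
    have hom_mult: "\<pi>1 (x * y) = \<pi>1 x * \<pi>1 y" "\<pi>2 (x * y) = \<pi>2 x * \<pi>2 y" "\<pi>3 (x * y) = \<pi>3 x * \<pi>3 y" for x y
      using hom by (simp_all add: K_algebra_hom_def)
    have "(\<pi>1 (f * f), \<pi>2 (f * f), \<pi>3 (f * f)) = (\<pi>1 f, \<pi>2 f, \<pi>3 f)" by (simp add: hom_mult f)
    then have ff: "f * f = f" using bij by (metis (no_types, lifting) bij_pointE)
    define p q where "p = e * f" and "q = e * (1 - f)"
    have "p * p = p" "p * q = 0" "q * q = q" "e = p + q"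
      using ff ee by (simp_all add: p_def q_def algebra_simps) (simp_all flip: mult.assoc add: ee)
    moreover have "p \<noteq> 0"
    proof
      assume "p = 0"
      then have "\<pi>1 e * \<pi>1 f = \<pi>1 0" by (simp add: p_def flip: hom_mult)
      moreover have "\<pi>1 0 = 0" using hom(1) by (metis K_algebra_hom_def \<iota>_0)
      ultimately show False using ne f by simp
    qed
    moreover have "q \<noteq> 0"
    proof
      assume "q = 0"
      then have "e = e * f" by (simp add: q_def right_diff_distrib)
      then have "\<pi>2 e = \<pi>2 e * \<pi>2 f" by (metis hom_mult(2))
      then show False using ne f by simp
    qed
    moreover have "p \<in> A" "q \<in> A" using idem_in_A calculation by blast+
    ultimately show False using e unfolding primitive_idempotent_def by blast
  qed
qed

text \<open>Each of e, e' lives in a single branch, so g = 1 - e - e' is non-zero. Multiplication by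
  g shows that t divides f; multiplication by e then puts the non-zero idempotent e into tA.\<close>

lemma three_branches_primitive:
  assumes three: "three_branches \<iota>" and e: "primitive_idempotent A e" "primitive_idempotent A e'" "e \<noteq> e'"
  shows "\<not> (\<exists>f. \<exists>y\<in>A. e + t ^ q * \<delta> a * e' = \<delta> f + t * y)" "e \<in> A" "e' \<in> A"
proof -
  have ee: "e * e = e" "e \<noteq> 0" "e \<in> A" "e' * e' = e'" "e' \<noteq> 0" "e' \<in> A" using e by (simp_all add: primitive_idempotent_def)
  show "e \<in> A" "e' \<in> A" by fact+
  have split: "p * q = 0 \<or> p * (1 - q) = 0" if p: "primitive_idempotent A p" and q: "q * q = q" for p q
  proof (rule ccontr)
    assume ne: "\<not> ?thesis"
    have pp: "p * p = p" using p by (simp add: primitive_idempotent_def)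
    have id: "(p * q) * (p * q) = p * q" "(p * (1 - q)) * (p * (1 - q)) = p * (1 - q)" "(p * q) * (p * (1 - q)) = 0"
    proof -
      have r: "q * (1 - q) = 0" "(1 - q) * (1 - q) = 1 - q" using q by (simp_all add: algebra_simps)
      have "(p * x) * (p * y) = (p * p) * (x * y)" for x y by (simp only: mult_ac)
      then show "(p * q) * (p * q) = p * q" "(p * (1 - q)) * (p * (1 - q)) = p * (1 - q)" "(p * q) * (p * (1 - q)) = 0"
        using pp q r by simp_all
    qed
    have "p = p * q + p * (1 - q)" by (simp add: algebra_simps)
    then show False using p ne id idem_in_A[OF id(1)] idem_in_A[OF id(2)] unfolding primitive_idempotent_def by blast
  qed
  have orth: "e * e' = 0"
  proof (rule ccontr)
    assume ne: "e * e' \<noteq> 0"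
    then have "e * (1 - e') = 0" "e' * (1 - e) = 0" using split[OF e(1) ee(4)] split[OF e(2) ee(1)] by (auto simp: mult.commute)
    then have "e = e'" by (simp add: right_diff_distrib mult.commute)
    then show False using e(3) by simp
  qed
  define g where "g = 1 - e - e'"
  have eg: "e * g = 0" "e' * g = 0" using orth ee by (simp_all add: g_def algebra_simps)
  have gg: "g * g = g" using eg by (subst (1) g_def) (simp add: algebra_simps)
  from three obtain \<pi>1 \<pi>2 \<pi>3 where hom: "K_algebra_hom \<iota> \<pi>1" "K_algebra_hom \<iota> \<pi>2" "K_algebra_hom \<iota> \<pi>3"
    and bij: "bij (\<lambda>x. (\<pi>1 x, \<pi>2 x, \<pi>3 x))" unfolding three_branches_def by blast
  have b2: "bij (\<lambda>x. (\<pi>2 x, \<pi>3 x, \<pi>1 x))" and b3: "bij (\<lambda>x. (\<pi>3 x, \<pi>1 x, \<pi>2 x))"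
  proof -
    have "bij ((\<lambda>(a, b, c). (b, c, a)) :: 'k fls \<times> 'k fls \<times> 'k fls \<Rightarrow> _)"
      by (rule bij_betw_byWitness[where f' = "\<lambda>(b, c, a). (a, b, c)"]) auto
    from bij_comp[OF bij this] show "bij (\<lambda>x. (\<pi>2 x, \<pi>3 x, \<pi>1 x))" by (simp add: comp_def)
    have "bij ((\<lambda>(a, b, c). (c, a, b)) :: 'k fls \<times> 'k fls \<times> 'k fls \<Rightarrow> _)"
      by (rule bij_betw_byWitness[where f' = "\<lambda>(c, a, b). (a, b, c)"]) auto
    from bij_comp[OF bij this] show "bij (\<lambda>x. (\<pi>3 x, \<pi>1 x, \<pi>2 x))" by (simp add: comp_def)
  qed
  have "g \<noteq> 0"
  proof
    assume "g = 0"
    then have "e + e' = 1" by (simp add: g_def algebra_simps)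
    moreover have "\<pi> (x + y) = \<pi> x + \<pi> y" "\<pi> 1 = 1" if "K_algebra_hom \<iota> \<pi>" for \<pi> x y
      using that by (metis K_algebra_hom_def \<iota>_1)+
    ultimately have sum: "\<pi> e + \<pi> e' = 1" if "K_algebra_hom \<iota> \<pi>" for \<pi> using that by metis
    note p = primitive_idempotent_branch
    show False
      using p[OF hom bij e(1)] p[OF hom bij e(2)] p[OF hom(2,3,1) b2 e(1)] p[OF hom(2,3,1) b2 e(2)]
        p[OF hom(3,1,2) b3 e(1)] p[OF hom(3,1,2) b3 e(2)] sum[OF hom(1)] sum[OF hom(2)] sum[OF hom(3)]
      by (metis add.right_neutral add_0 zero_neq_one)
  qed
  show "\<not> (\<exists>f. \<exists>y\<in>A. e + t ^ q * \<delta> a * e' = \<delta> f + t * y)"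
  proof
    assume "\<exists>f. \<exists>y\<in>A. e + t ^ q * \<delta> a * e' = \<delta> f + t * y"
    then obtain f y where y: "y \<in> A" "e + t ^ q * \<delta> a * e' = \<delta> f + t * y" by blast
    have gA: "g \<in> A" using idem_in_A[OF gg] .
    have "g * (e + t ^ q * \<delta> a * e') = (e * g) + t ^ q * \<delta> a * (e' * g)" by (simp add: algebra_simps)
    also have "\<dots> = 0" by (simp add: eg)
    finally have "g * \<delta> f = t * (- (g * y))" unfolding y(2) by (simp add: algebra_simps eq_neg_iff_add_eq_0)
    moreover have "- (g * y) \<in> A" using gA y(1) integral_add_mult(2) A_ring(4) by blast
    ultimately have "res f = 0" by (rule idem_scalar[OF gg \<open>g \<noteq> 0\<close>])
    then obtain h where "f = X * h" using fps_X_factor by blast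
    then have "e + t ^ q * \<delta> a * e' = t * (\<delta> h + y)" using y(2) by (simp add: t_elt_def \<delta>_mult algebra_simps)
    then have "e * (e + t ^ q * \<delta> a * e') = t * (e * (\<delta> h + y))" by (simp add: mult_ac)
    moreover have "e * (e + t ^ q * \<delta> a * e') = e"
    proof -
      have "e * (e + t ^ q * \<delta> a * e') = e * e + t ^ q * \<delta> a * (e * e')" by (simp add: algebra_simps)
      then show ?thesis by (simp add: orth ee)
    qed
    moreover have "e * (\<delta> h + y) \<in> A" using ee(3) y(1) by (intro integral_add_mult) auto
    ultimately have "e = 0" using idem_zero[OF ee(1)] by metis
    then show False using ee(2) by simp
  qed
qed

lemma ring_of_generator: "\<beta> \<in> ring_of \<iota> \<beta> N"
proof -
  have "0 \<in> tAN N" using A_ring(2) by (auto simp: tA_def intro!: image_eqI[of _ _ 0])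
  then show ?thesis unfolding ring_of_def by (intro CollectI exI[of _ 0] exI[of _ 1]) auto
qed

text \<open>The numbers 12n+6, 12n+7, 12n+8 are 6r, 6r+1, 6r+2 for r = 2n+1, and the other series
  has l = 2n+1: in every case the defining generator is t^(2n+1) times a primitive element.\<close>

theorem singularity_primitive:
  assumes "(\<exists>i\<in>{6..8}. type_E \<iota> (12 * n + i) B) \<or> (\<exists>q. type_E2 \<iota> (2 * n + 1) q B)"
  shows "\<exists>x\<in>A. \<not> (\<exists>f. \<exists>y\<in>A. x = \<delta> f + t * y) \<and> t ^ (2 * n + 1) * x \<in> B"
  using assms
proof (elim disjE bexE exE)
  fix i assume i: "i \<in> {6..8}" and B: "type_E \<iota> (12 * n + i) B"
  have i': "i = 6 \<or> i = 7 \<or> i = 8" using i by auto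
  from B show ?thesis unfolding type_E_def
  proof (elim disjE exE conjE)
    fix r \<alpha> assume r: "12 * n + i = 6 * r" and \<alpha>: "has_valuation A \<alpha> 1" and B: "B = ring_of \<iota> (t ^ r * \<alpha>) (2 * r)"
    have r': "r = 2 * n + 1" using r i' by presburger
    have "\<alpha> \<in> A" using \<alpha> by (simp add: has_valuation_def)
    then show ?thesis using one_branch_primitive[OF \<alpha>] ring_of_generator unfolding B r' by blast
  next
    fix r e \<alpha> assume r: "12 * n + i = 6 * r + 1" and two: "two_branches \<iota> e" and \<alpha>: "has_valuation ((*) e ` A) \<alpha> 1"
      and B: "B = ring_of \<iota> (t ^ r * \<alpha>) (2 * r + 1)"
    have r': "r = 2 * n + 1" using r i' by presburger
    show ?thesis using two_branches_primitive(1,3)[OF two \<alpha>] ring_of_generator unfolding B r' by blast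
  next
    fix r \<alpha> assume r: "12 * n + i = 6 * r + 2" and \<alpha>: "has_valuation A \<alpha> 2" and B: "B = ring_of \<iota> (t ^ r * \<alpha>) (2 * r + 1)"
    have r': "r = 2 * n + 1" using r i' by presburger
    have "\<alpha> \<in> A" using \<alpha> by (simp add: has_valuation_def)
    then show ?thesis using one_branch_primitive[OF \<alpha>] ring_of_generator unfolding B r' by blast
  qed
next
  fix q assume "type_E2 \<iota> (2 * n + 1) q B"
  then show ?thesis unfolding type_E2_def
  proof (elim disjE exE conjE)
    fix q e \<alpha> assume two: "two_branches \<iota> e" and \<alpha>: "has_valuation ((*) e ` A) \<alpha> 1"
      and B: "B = ring_of \<iota> (t ^ (2 * n + 1) * (e + t ^ q * \<alpha>)) (2 * (2 * n + 1) + q)"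
    note p = two_branches_primitive(2-4)[OF two \<alpha>]
    have "e + t ^ q * \<alpha> \<in> A" using p(2,3) by (intro integral_add_mult) (simp_all add: t_elt_power)
    then show ?thesis using p(1) ring_of_generator unfolding B by blast
  next
    fix q e e' a assume three: "three_branches \<iota>" and e: "primitive_idempotent A e" "primitive_idempotent A e'" "e \<noteq> e'"
      and B: "B = ring_of \<iota> (t ^ (2 * n + 1) * (e + t ^ q * \<delta> a * e')) (2 * (2 * n + 1) + q)"
    note p = three_branches_primitive[OF three e]
    have "e + t ^ q * \<delta> a * e' \<in> A" using p(2,3) by (intro integral_add_mult) (simp_all add: t_elt_power)
    then show ?thesis using p(1) ring_of_generator unfolding B by blast
  qed
qed

end

subsection \<open>Normal forms of the index form\<close>

lemma fps_near: "X ^ k dvd f - g \<longleftrightarrow> (\<forall>i<k. fps_nth f i = fps_nth g i)" for f g :: "'k::field fps"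
proof
  assume "X ^ k dvd f - g"
  then obtain h where "f - g = X ^ k * h" by (auto simp: dvd_def)
  then have "f = g + X ^ k * h" by (simp add: algebra_simps)
  then show "\<forall>i<k. fps_nth f i = fps_nth g i" by (simp add: fps_X_power_mult_nth)
next
  assume "\<forall>i<k. fps_nth f i = fps_nth g i"
  then have "f - g = X ^ k * fps_shift k (f - g)" by (intro fps_ext) (simp add: fps_X_power_mult_nth)
  then show "X ^ k dvd f - g" by (rule dvdI)
qed

text \<open>The contraction principle for the t-adic topology on power series without constant
  term.\<close>

lemma fps_fixed_point:
  fixes G :: "'k::field fps \<Rightarrow> 'k fps"
  assumes zero: "\<And>Y. res Y = 0 \<Longrightarrow> res (G Y) = 0"
    and contr: "\<And>Y Z k. res Y = 0 \<Longrightarrow> res Z = 0 \<Longrightarrow> X ^ k dvd Y - Z \<Longrightarrow> X ^ Suc k dvd G Y - G Z"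
  shows "\<exists>Y. res Y = 0 \<and> G Y = Y"
proof -
  define Y where "Y n = (G ^^ n) 0" for n
  have Y0: "res (Y n) = 0" for n by (induction n) (simp_all add: Y_def zero)
  have step: "X ^ n dvd Y (Suc n) - Y n" for n
  proof (induction n)
    case (Suc n)
    from contr[OF Y0 Y0 Suc] show ?case by (simp add: Y_def)
  qed simp
  have stable: "fps_nth (Y (n + d)) i = fps_nth (Y n) i" if "i < n" for n d i
  proof (induction d)
    case (Suc d)
    have "fps_nth (Y (Suc (n + d))) i = fps_nth (Y (n + d)) i" using step[of "n + d"] that unfolding fps_near by simp
    then show ?case using Suc by simp
  qed simp
  \<comment> \<open>Coefficient i no longer changes after i+1 iterations.\<close>
  define L where "L = Abs_fps (\<lambda>i. fps_nth (Y (Suc i)) i)"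
  have L: "fps_nth L i = fps_nth (Y n) i" if "i < n" for n i
    using stable[of i "Suc i" "n - Suc i"] that by (simp add: L_def)
  have L0: "res L = 0" using L[of 0 1] Y0 by simp
  have "fps_nth (G L) i = fps_nth L i" for i
  proof -
    have "X ^ Suc i dvd L - Y (Suc i)" unfolding fps_near using L by blast
    from contr[OF L0 Y0 this] have "fps_nth (G L) i = fps_nth (Y (Suc (Suc i))) i"
      unfolding fps_near by (simp add: Y_def)
    then show ?thesis using L[of i "Suc (Suc i)"] by simp
  qed
  then have "G L = L" by (intro fps_ext) simp
  then show ?thesis using L0 by blast
qed

text \<open>Solving for the linear term gives a fixed point equation. It is contracting near 0
  because the other terms in Y have degree at least 2.\<close>

lemma hensel_cubic:
  fixes a b c d :: "'k::field fps"
  assumes a: "res a = 0" and b: "res b \<noteq> 0"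
  shows "\<exists>Y. res Y = 0 \<and> a + b * Y + c * Y\<^sup>2 + d * Y ^ 3 = 0"
proof -
  define G where "G Y = - (inverse b * (a + c * Y\<^sup>2 + d * Y ^ 3))" for Y
  have inv: "b * inverse b = 1" using inverse_mult_eq_1[OF b] by (simp add: mult.commute)
  have "\<exists>Y. res Y = 0 \<and> G Y = Y"
  proof (rule fps_fixed_point)
    fix Y Z :: "'k fps" and k assume YZ: "res Y = 0" "res Z = 0" "X ^ k dvd Y - Z"
    define H where "H = c * (Y + Z) + d * (Y\<^sup>2 + Y * Z + Z\<^sup>2)"
    have "X dvd H" using YZ(1,2) by (simp add: fps_X_dvd_iff H_def power2_eq_square)
    then have "X ^ k * X dvd (Y - Z) * H" using YZ(3) by (intro mult_dvd_mono)
    moreover have "G Y - G Z = - inverse b * ((Y - Z) * H)"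
      by (simp add: G_def H_def algebra_simps power2_eq_square power3_eq_cube)
    ultimately show "X ^ Suc k dvd G Y - G Z" by (simp add: mult.commute[of X] dvd_mult)
  qed (simp add: G_def a power2_eq_square power3_eq_cube)
  then obtain Y where Y: "res Y = 0" "G Y = Y" by blast
  have "b * Y = b * G Y" using Y(2) by simp
  also have "\<dots> = - (b * inverse b * (a + c * Y\<^sup>2 + d * Y ^ 3))" by (simp add: G_def mult.assoc)
  also have "\<dots> = - (a + c * Y\<^sup>2 + d * Y ^ 3)" unfolding inv by simp
  finally have "a + b * Y + c * Y\<^sup>2 + d * Y ^ 3 = 0" by simp
  then show ?thesis using Y(1) by blast
qed

lemma alg_closed_cubic_root:
  fixes a b c d :: "'k::alg_closed_field"
  assumes "b \<noteq> 0 \<or> c \<noteq> 0 \<or> d \<noteq> 0"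
  shows "\<exists>r. a + b * r + c * r\<^sup>2 + d * r ^ 3 = 0"
proof -
  have "degree [:a, b, c, d:] > 0" using assms by auto
  then obtain r where "poly [:a, b, c, d:] r = 0" using alg_closed_imp_poly_has_root by blast
  then show ?thesis by (intro exI[of _ r]) (simp add: power2_eq_square power3_eq_cube algebra_simps)
qed

context cubic_order
begin

lemma shift_root:
  assumes "res fb \<noteq> 0 \<or> res fc \<noteq> 0 \<or> res fd \<noteq> 0"
  shows "\<exists>r. res (shift_a (fps_const r)) = 0"
proof -
  from alg_closed_cubic_root[OF assms, of "res fa"] obtain r where
    "res fa + res fb * r + res fc * r\<^sup>2 + res fd * r ^ 3 = 0" by blast
  then show ?thesis by (intro exI[of _ r]) (simp add: shift_a_def fps_nth_power_0)
qed

text \<open>If only the coefficient \<open>fa\<close> survives modulo t, the root lies at (0 : 1),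
  out of reach of shifts, and \<open>swap\<close> moves it.\<close>

lemma order_with_root: "\<exists>w z a b c d. cubic_order \<iota> w z a b c d \<and> res a = 0"
proof (cases "res fb \<noteq> 0 \<or> res fc \<noteq> 0 \<or> res fd \<noteq> 0")
  case True
  from shift_root[OF this] obtain r where r: "res (shift_a (fps_const r)) = 0" by blast
  show ?thesis by (intro exI conjI) (rule shift[of "fps_const r"], rule r)
next
  case False
  then show ?thesis by (intro exI conjI) (rule swap, simp)
qed

text \<open>A root that is not triple leaves room for a second one, and one of the two is simple.
  The simple one is placed at (1 : 0), the other at (0 : 1).\<close>

lemma order_with_two_roots:
  assumes a: "res fa = 0" and bc: "res fb \<noteq> 0 \<or> res fc \<noteq> 0"
  shows "\<exists>w z a b c d. cubic_order \<iota> w z a b c d \<and> res a = 0 \<and> res d = 0 \<and> res b \<noteq> 0"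
proof -
  interpret s: cubic_order \<iota> z w "- fd" "- fc" "- fb" "- fa" by (rule swap)
  have "res (- fc) \<noteq> 0 \<or> res (- fb) \<noteq> 0 \<or> res (- fa) \<noteq> 0" using bc by auto
  from s.shift_root[OF this] obtain r where r: "res (s.shift_a (fps_const r)) = 0" by blast
  define Y where "Y = fps_const r"
  note o1 = s.shift[of Y]
  show ?thesis
  proof (cases "res (s.shift_b Y) = 0")
    case False
    show ?thesis
      by (intro exI conjI) (rule o1, use r a False in \<open>simp_all add: Y_def\<close>)
  next
    case True
    have "res (s.shift_c Y) \<noteq> 0"
      using True bc a by (auto simp: s.shift_b_def s.shift_c_def)
    then show ?thesis
      by (intro exI conjI) (rule cubic_order.swap[OF o1], use r a in \<open>simp_all add: Y_def\<close>)
  qed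
qed

text \<open>The cases are a triple root, a simple and a double root, and three simple roots modulo
  t. Simple roots lift by Hensel's lemma, so the coefficients at their ends can be made exactly
  zero.\<close>

lemma normal_form:
  "\<exists>w z a b c d. cubic_order \<iota> w z a b c d \<and>
    (res a = 0 \<and> res b = 0 \<and> res c = 0 \<or>
     a = 0 \<and> res b \<noteq> 0 \<and> res c = 0 \<and> res d = 0 \<or>
     a = 0 \<and> res b \<noteq> 0 \<and> res c \<noteq> 0 \<and> d = 0)"
proof -
  have hensel: "\<exists>Y. res Y = 0 \<and> cubic_order.shift_a a b c d Y = 0"
    if o: "cubic_order \<iota> w z a b c d" "res a = 0" "res b \<noteq> 0" for w z a b c d
  proof -
    from hensel_cubic[OF o(2,3), of c d] obtain Y where "res Y = 0" "a + b * Y + c * Y\<^sup>2 + d * Y ^ 3 = 0" by blast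
    then show ?thesis using cubic_order.shift_a_def[OF o(1), of Y] by auto
  qed
  obtain w1 z1 a1 b1 c1 d1 where o1: "cubic_order \<iota> w1 z1 a1 b1 c1 d1" and a1: "res a1 = 0"
    using order_with_root by blast
  show ?thesis
  proof (cases "res b1 \<noteq> 0 \<or> res c1 \<noteq> 0")
    case False
    with o1 a1 show ?thesis by blast
  next
    case True
    from cubic_order.order_with_two_roots[OF o1 a1 True] obtain w2 z2 a2 b2 c2 d2 where
      o2: "cubic_order \<iota> w2 z2 a2 b2 c2 d2" "res a2 = 0" "res d2 = 0" "res b2 \<noteq> 0"
      by (elim exE conjE) (rule that)
    interpret o2: cubic_order \<iota> w2 z2 a2 b2 c2 d2 by (rule o2)
    obtain Y where Y: "res Y = 0" "o2.shift_a Y = 0" using hensel[OF o2(1,2,4)] by blast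
    note o3 = o2.shift[of Y, unfolded Y(2)]
    have b3: "res (o2.shift_b Y) \<noteq> 0" and c3: "res (o2.shift_c Y) = res c2"
      using Y(1) o2(4) by (simp_all add: o2.shift_b_def o2.shift_c_def power2_eq_square)
    show ?thesis
    proof (cases "res c2 = 0")
      case True
      then show ?thesis using o3 b3 c3 o2(3) by metis
    next
      case False
      note o4 = cubic_order.swap[OF o3]
      interpret o4: cubic_order \<iota> "o2.el (- d2 * Y) 0 1" "o2.el (c2 * Y + d2 * Y\<^sup>2) 1 Y" "- d2" "- o2.shift_c Y" "- o2.shift_b Y" "- 0"
        by (rule o4)
      have n: "res (- d2) = 0" "res (- o2.shift_c Y) \<noteq> 0" using o2(3) False c3 by simp_all
      obtain Z where Z: "res Z = 0" "o4.shift_a Z = 0" using hensel[OF o4 n] by blast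
      note o5 = o4.shift[of Z, unfolded Z(2)]
      have "res (o4.shift_b Z) \<noteq> 0" "res (o4.shift_c Z) \<noteq> 0"
        unfolding o4.shift_b_def o4.shift_c_def using Z(1) n(2) b3 by (simp_all add: power2_eq_square)
      then show ?thesis using o5 by (metis minus_zero)
    qed
  qed
qed

subsection \<open>The ring generated by a primitive element\<close>

text \<open>The index form at x = x1 w + x2 z: up to sign, the determinant of 1, x, x^2 in the basis
  1, w, z.\<close>

definition form :: "'k fps \<Rightarrow> 'k fps \<Rightarrow> 'k fps"
  where "form x1 x2 = fa * x1 ^ 3 + fb * x1\<^sup>2 * x2 + fc * x1 * x2\<^sup>2 + fd * x2 ^ 3"

text \<open>For v = t^m (w + Yz), the square of v is a combination of 1, v and t^(2m) f(1,Y) z. The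
  last term is the only obstruction, and its order is at least 2m + j.\<close>

lemma lat_cubic_ring:
  assumes e: "shift_a Y = X ^ j * e"
  shows "cubic_ring \<iota> (lat m (2 * m + j) Y)"
proof -
  let ?B = "lat m (2 * m + j) Y"
  define s where "s = (X ^ m :: 'k fps)"
  define p where "p = (X ^ j :: 'k fps)"
  have s: "X ^ (2 * m + j) = s * s * p" by (simp add: s_def p_def mult_2 power_add)
  have s0: "s \<noteq> 0" "p \<noteq> 0" by (simp_all add: s_def p_def)
  have in_B: "el x0 x1 x2 \<in> ?B \<longleftrightarrow> s dvd x1 \<and> s * s * p dvd x2 - Y * x1" for x0 x1 x2
    by (simp add: el_in_lat_iff s s_def[symmetric])
  have B_ex: "\<exists>x0 q r. x = el x0 (s * q) (Y * (s * q) + s * s * p * r)" if "x \<in> ?B" for x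
  proof -
    from that obtain x0 x1 x2 where x: "x = el x0 x1 x2" "s dvd x1" "s * s * p dvd x2 - Y * x1"
      unfolding lat_def s s_def[symmetric] by blast
    then obtain q r where "x1 = s * q" "x2 - Y * x1 = s * s * p * r" by (auto simp: dvd_def)
    then show ?thesis using x(1) by (intro exI[of _ x0] exI[of _ q] exI[of _ r]) (simp add: algebra_simps)
  qed
  have el_B: "el x0 (s * q) (Y * (s * q) + s * s * p * r) \<in> ?B" for x0 q r
    unfolding in_B by simp
  have sub: "D.subspace ?B" unfolding D.subspace_def
  proof (intro conjI ballI allI)
    show "0 \<in> ?B" using el_B[of 0 0 0] by (simp add: el_0)
    fix x y assume "x \<in> ?B" "y \<in> ?B"
    then obtain x0 q r y0 q' r' where "x = el x0 (s * q) (Y * (s * q) + s * s * p * r)"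
      "y = el y0 (s * q') (Y * (s * q') + s * s * p * r')" using B_ex by metis
    then have "x + y = el (x0 + y0) (s * (q + q')) (Y * (s * (q + q')) + s * s * p * (r + r'))"
      by (simp add: el_add algebra_simps)
    then show "x + y \<in> ?B" using el_B by simp
  next
    fix c x assume "x \<in> ?B"
    then obtain x0 q r where "x = el x0 (s * q) (Y * (s * q) + s * s * p * r)" using B_ex by blast
    then have "Dscale \<iota> c x = el (c * x0) (s * (c * q)) (Y * (s * (c * q)) + s * s * p * (c * r))"
      by (simp add: Dscale_def el_scale algebra_simps)
    then show "Dscale \<iota> c x \<in> ?B" using el_B by simp
  qed
  moreover have one: "1 \<in> ?B" using el_B[of 1 0 0] unfolding el_special(4) by simp
  moreover have "x * y \<in> ?B" if "x \<in> ?B" "y \<in> ?B" for x y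
  proof -
    from that obtain x0 q r y0 q' r' where x: "x = el x0 (s * q) (Y * (s * q) + s * s * p * r)"
      "y = el y0 (s * q') (Y * (s * q') + s * s * p * r')" using B_ex by metis
    define x2 y2 where "x2 = Y * q + s * p * r" and "y2 = Y * q' + s * p * r'"
    have x: "x = el x0 (s * q) (s * x2)" "y = el y0 (s * q') (s * y2)" unfolding x x2_def y2_def
      by (simp_all add: algebra_simps)
    have "s dvd x0 * (s * q') + s * q * y0 + fb * (s * q * (s * q')) + fd * (s * x2 * (s * y2))"
      by (intro dvd_add) auto
    moreover have "s * s * p dvd x0 * (s * y2) + s * x2 * y0 - fa * (s * q * (s * q')) - fc * (s * x2 * (s * y2))
        - Y * (x0 * (s * q') + s * q * y0 + fb * (s * q * (s * q')) + fd * (s * x2 * (s * y2)))" (is "_ dvd ?T")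
    proof -
      have "?T = s * s * p * (x0 * r' + r * y0) - s * s * (q * q') * shift_a Y
          - s * s * p * ((fc + Y * fd) * (s * (Y * q * r' + Y * q' * r) + s * s * p * r * r'))"
        unfolding x2_def y2_def shift_a_def by (simp add: algebra_simps power2_eq_square power3_eq_cube)
      also have "s * s * (q * q') * shift_a Y = s * s * p * (q * q' * e)" by (simp add: e p_def mult_ac)
      finally show ?thesis by (simp add: dvd_diff)
    qed
    ultimately show ?thesis unfolding x el_mult in_B by blast
  qed
  moreover have "\<exists>S. card S = 3 \<and> \<not> D.dependent S \<and> D.span S = ?B"
  proof -
    define b1 b2 where "b1 = el 0 s (Y * s)" and "b2 = el 0 0 (s * s * p)"
    have comb: "\<delta> f0 * 1 + \<delta> f1 * b1 + \<delta> f2 * b2 = el f0 (s * f1) (Y * (s * f1) + s * s * p * f2)" for f0 f1 f2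
      unfolding b1_def b2_def el_special(4) el_scale el_add el_inject by (simp add: mult_ac)
    have ne: "b1 \<noteq> 1" "b2 \<noteq> 1" "b1 \<noteq> b2"
      unfolding b1_def b2_def el_special(4) el_inject using s0 by simp_all
    have fin: "finite {1, b1, b2}" by simp
    have sum: "(\<Sum>v\<in>{1, b1, b2}. Dscale \<iota> (u v) v) = \<delta> (u 1) * 1 + \<delta> (u b1) * b1 + \<delta> (u b2) * b2" for u
      using ne by (simp add: Dscale_def add_ac)
    have "\<not> D.dependent {1, b1, b2}"
      unfolding D.dependent_finite[OF fin] sum comb el_0[symmetric] el_inject using s0 by auto
    moreover have "D.span {1, b1, b2} = ?B"
    proof
      have "{1, b1, b2} \<subseteq> ?B" using one el_B[of 0 1 0] el_B[of 0 0 1] by (simp add: b1_def b2_def mult.commute)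
      then show "D.span {1, b1, b2} \<subseteq> ?B" using sub by (rule D.span_minimal)
      show "?B \<subseteq> D.span {1, b1, b2}"
      proof
        fix x assume "x \<in> ?B"
        then obtain x0 q r where "x = el x0 (s * q) (Y * (s * q) + s * s * p * r)" using B_ex by blast
        then have "x = Dscale \<iota> x0 1 + Dscale \<iota> q b1 + Dscale \<iota> r b2" unfolding Dscale_def comb .
        moreover have "v \<in> D.span {1, b1, b2}" if "v \<in> {1, b1, b2}" for v using that by (rule D.span_base)
        ultimately show "x \<in> D.span {1, b1, b2}" by (simp add: D.span_add D.span_scale)
      qed
    qed
    ultimately show ?thesis using ne by (intro exI[of _ "{1, b1, b2}"]) simp
  qed
  ultimately show ?thesis unfolding cubic_ring_def by blast
qed

text \<open>Conversely, squaring v puts t^(2m) f(1,Y) z into C, and f(1,Y) is t^j times a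
  unit.\<close>

lemma lat_subset_ring:
  assumes C: "cubic_ring \<iota> C" and gen: "el 0 (X ^ m) (Y * X ^ m) \<in> C"
    and e: "shift_a Y = X ^ j * e" "res e \<noteq> 0"
  shows "lat m (2 * m + j) Y \<subseteq> C"
proof
  have sub: "D.subspace C" and mult: "x \<in> C \<Longrightarrow> y \<in> C \<Longrightarrow> x * y \<in> C" for x y using C by (simp_all add: cubic_ring_def)
  define s where "s = (X ^ m :: 'k fps)"
  define v where "v = el 0 s (Y * s)"
  have vC: "v \<in> C" using gen by (simp add: v_def s_def)
  have scale: "\<delta> f * x \<in> C" if "x \<in> C" for f x using D.subspace_scale[OF sub that, of f] by (simp add: Dscale_def)
  \<comment> \<open>The coefficient of v in its square; subtracting g v removes the w
    coordinate.\<close>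
  define g where "g = s * (fb + fd * Y\<^sup>2)"
  define x0 where "x0 = - (fa * fc * (s * s)) - fa * fd * (s * (Y * s) + Y * s * s) - fb * fd * (Y * s * (Y * s))"
  have x0: "v * v - \<delta> g * v = el x0 0 (- (s * s * shift_a Y))"
    unfolding x0_def v_def el_mult el_scale el_diff el_inject g_def shift_a_def
    by (simp add: algebra_simps power2_eq_square power3_eq_cube)
  have "v * v - \<delta> g * v - \<delta> x0 \<in> C" using mult[OF vC vC] scale[OF vC] cubic_ring_D[OF C] D.subspace_diff[OF sub] by blast
  then have "el 0 0 (- (s * s * shift_a Y)) \<in> C" unfolding x0 unfolding el_special(1) el_diff by simp
  from scale[OF this, of "- inverse e"] have "el 0 0 (s * s * X ^ j * (inverse e * e)) \<in> C"
    unfolding el_scale e(1) by (simp add: mult_ac)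
  then have bC: "el 0 0 (X ^ (2 * m + j)) \<in> C"
    unfolding inverse_mult_eq_1[OF e(2)] by (simp add: s_def mult_2 power_add)
  fix x assume "x \<in> lat m (2 * m + j) Y"
  then obtain y0 y1 y2 where x: "x = el y0 y1 y2" "s dvd y1" "X ^ (2 * m + j) dvd y2 - Y * y1"
    unfolding lat_def s_def by blast
  then obtain p q where pq: "y1 = s * p" "y2 - Y * y1 = X ^ (2 * m + j) * q" by (auto simp: dvd_def)
  then have y2: "y2 = Y * y1 + X ^ (2 * m + j) * q" by (simp add: algebra_simps)
  have "x = \<delta> y0 + \<delta> p * v + \<delta> q * el 0 0 (X ^ (2 * m + j))"
    unfolding x(1) y2 pq(1) v_def el_scale unfolding el_special(1) el_add el_inject by (simp add: mult_ac)
  then show "x \<in> C" using scale[OF vC] scale[OF bC] cubic_ring_D[OF C] D.subspace_add[OF sub] by simp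
qed

lemma ring_of_lat:
  assumes y1: "res y1 \<noteq> 0" and Y: "y2 = Y * y1" and m: "m \<le> b"
  shows "ring_of \<iota> (t ^ m * el y0 y1 y2) b = lat m b Y"
proof (intro Set.set_eqI iffI)
  fix x assume "x \<in> ring_of \<iota> (t ^ m * el y0 y1 y2) b"
  then obtain f g v0 v1 v2 where "x = \<delta> f + t ^ m * el y0 y1 y2 * \<delta> g + el (X ^ b * v0) (X ^ b * v1) (X ^ b * v2)"
    unfolding ring_of_def tA_eq by blast
  then have "x = \<delta> f + \<delta> g * (\<delta> (X ^ m) * el y0 y1 y2) + el (X ^ b * v0) (X ^ b * v1) (X ^ b * v2)"
    by (simp add: t_elt_power mult.commute)
  then have x: "x = el (f + g * (X ^ m * y0) + X ^ b * v0) (g * (X ^ m * y1) + X ^ b * v1)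
      (g * (X ^ m * y2) + X ^ b * v2)"
    unfolding el_scale unfolding el_special(1) el_add by simp
  have "X ^ m dvd X ^ b * v1" using m by (intro dvd_mult2 le_imp_power_dvd)
  then have "X ^ m dvd g * (X ^ m * y1) + X ^ b * v1" by (intro dvd_add) auto
  moreover have "g * (X ^ m * y2) + X ^ b * v2 - Y * (g * (X ^ m * y1) + X ^ b * v1) = X ^ b * (v2 - Y * v1)"
    by (simp add: Y algebra_simps)
  ultimately show "x \<in> lat m b Y" unfolding x el_in_lat_iff by simp
next
  fix x assume "x \<in> lat m b Y"
  then obtain x0 x1 x2 where x: "x = el x0 x1 x2" "X ^ m dvd x1" "X ^ b dvd x2 - Y * x1" unfolding lat_def by blast
  then obtain p q where pq: "x1 = X ^ m * p" "x2 - Y * x1 = X ^ b * q" by (auto simp: dvd_def)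
  then have x2: "x2 = Y * x1 + X ^ b * q" by (simp add: algebra_simps)
  define g where "g = p * inverse y1"
  have g: "g * y1 = p" using inverse_mult_eq_1[OF y1] by (simp add: g_def mult.assoc)
  have "x = \<delta> (x0 - g * (X ^ m * y0)) + t ^ m * el y0 y1 y2 * \<delta> g + el (X ^ b * 0) (X ^ b * 0) (X ^ b * q)"
  proof -
    have "t ^ m * el y0 y1 y2 * \<delta> g = \<delta> g * (\<delta> (X ^ m) * el y0 y1 y2)" by (simp add: t_elt_power mult.commute)
    also have "\<dots> = el (g * (X ^ m * y0)) (X ^ m * (g * y1)) (Y * (X ^ m * (g * y1)))"
      unfolding el_scale by (simp add: Y mult_ac)
    finally have eq: "t ^ m * el y0 y1 y2 * \<delta> g = el (g * (X ^ m * y0)) (X ^ m * p) (Y * (X ^ m * p))"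
      unfolding g .
    show ?thesis unfolding eq x(1) x2 pq(1) unfolding el_special(1) el_add by simp
  qed
  then show "x \<in> ring_of \<iota> (t ^ m * el y0 y1 y2) b" unfolding ring_of_def tA_eq by blast
qed

lemma form_shift: "form y1 (Y * y1) = shift_a Y * y1 ^ 3"
  by (simp add: form_def shift_a_def algebra_simps power2_eq_square power3_eq_cube)

text \<open>Dropping the scalar part and dividing by the unit y1 turns the generator into t^m (w +
  Yz); f is then divided by the cube of y1.\<close>

lemma dominated_chart:
  assumes C: "cubic_ring \<iota> C" and yC: "t ^ m * el y0 y1 y2 \<in> C" and y1: "res y1 \<noteq> 0"
    and u: "form y1 y2 = X ^ j * u" "res u \<noteq> 0"
  shows "dominates \<iota> C (ring_of \<iota> (t ^ m * el y0 y1 y2) (2 * m + j))"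
proof -
  define i where "i = inverse y1"
  have i: "i * y1 = 1" unfolding i_def by (rule inverse_mult_eq_1[OF y1])
  define Y where "Y = y2 * i"
  have Y: "y2 = Y * y1" using i by (simp add: Y_def mult.assoc)
  have "shift_a Y * (i * y1) ^ 3 = X ^ j * (u * i ^ 3)"
    using form_shift[of y1 Y] u(1) Y by (simp add: power_mult_distrib mult_ac)
  then have e: "shift_a Y = X ^ j * (u * i ^ 3)" by (simp add: i)
  have "res i \<noteq> 0" using y1 by (simp add: i_def)
  then have e0: "res (u * i ^ 3) \<noteq> 0" using u(2) by (simp add: fps_nth_power_0)
  have sub: "D.subspace C" using C by (simp add: cubic_ring_def)
  have "Dscale \<iota> i (t ^ m * el y0 y1 y2 - \<delta> (X ^ m * y0)) \<in> C"
    by (intro D.subspace_scale[OF sub] D.subspace_diff[OF sub yC] cubic_ring_D[OF C])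
  moreover have "Dscale \<iota> i (t ^ m * el y0 y1 y2 - \<delta> (X ^ m * y0)) = el 0 (X ^ m * (i * y1)) (Y * (X ^ m * (i * y1)))"
    unfolding Dscale_def t_elt_power el_scale unfolding el_special(1) el_diff unfolding el_special(1)[symmetric] el_scale
    by (simp add: Y mult_ac)
  ultimately have "el 0 (X ^ m) (Y * X ^ m) \<in> C" by (simp add: i)
  then show ?thesis
    using lat_subset_ring[OF C _ e e0] lat_cubic_ring[OF e] C
    unfolding dominates_def by (simp add: ring_of_lat[OF y1 Y])
qed

lemma swapped_form: "cubic_order.form (- fd) (- fc) (- fb) (- fa) x2 x1 = - form x1 x2"
proof -
  interpret s: cubic_order \<iota> z w "- fd" "- fc" "- fb" "- fa" by (rule swap)
  show ?thesis by (simp add: s.form_def form_def algebra_simps)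
qed

lemma dominated:
  assumes C: "cubic_ring \<iota> C" and yC: "t ^ m * el y0 y1 y2 \<in> C" and y: "res y1 \<noteq> 0 \<or> res y2 \<noteq> 0"
    and u: "form y1 y2 = X ^ j * u" "res u \<noteq> 0"
  shows "dominates \<iota> C (ring_of \<iota> (t ^ m * el y0 y1 y2) (2 * m + j))"
proof (cases "res y1 = 0")
  case False
  then show ?thesis using dominated_chart[OF C yC _ u] by simp
next
  case True
  interpret s: cubic_order \<iota> z w "- fd" "- fc" "- fb" "- fa" by (rule swap)
  show ?thesis using s.dominated_chart[OF C, of m y0 y2 y1 j "- u"] yC True y u
    by (simp add: el_swap swapped_form)
qed

text \<open>An element at which f vanishes has no order j. Since C contains some t^N A, the slope
  may be changed by t^Q for any large Q, and f(1, Y) has only finitely many zeros.\<close>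

lemma nonzero_form_chart:
  assumes C: "cubic_ring \<iota> C" and yC: "t ^ m * el y0 y1 y2 \<in> C" and y1: "res y1 \<noteq> 0"
  shows "\<exists>y2'. t ^ m * el y0 y1 y2' \<in> C \<and> form y1 y2' \<noteq> 0"
proof -
  obtain N where N: "tAN N \<subseteq> C" using cubic_ring_conductor[OF C] by blast
  define i where "i = inverse y1"
  have i: "i * y1 = 1" unfolding i_def by (rule inverse_mult_eq_1[OF y1])
  define p where "p = [:fa, fb, fc, fd:]"
  have "p \<noteq> 0" using form_nonzero by (auto simp: p_def)
  then have fin: "finite {r. poly p r = 0}" by (rule poly_roots_finite)
  have inj: "inj_on (\<lambda>Q. y2 * i + X ^ Q) {N..}"
  proof (rule inj_onI)
    fix Q Q' assume "y2 * i + X ^ Q = y2 * i + X ^ Q'"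
    then have "subdegree (X ^ Q :: 'k fps) = subdegree (X ^ Q' :: 'k fps)" by simp
    then show "Q = Q'" by simp
  qed
  have "\<not> (\<lambda>Q. y2 * i + X ^ Q) ` {N..} \<subseteq> {r. poly p r = 0}"
    using fin finite_imageD[OF _ inj] finite_subset infinite_Ici by metis
  then obtain Q where Q: "N \<le> Q" "poly p (y2 * i + X ^ Q) \<noteq> 0" by auto
  define Y where "Y = y2 * i + X ^ Q"
  have "shift_a Y \<noteq> 0" using Q(2)[folded Y_def] by (simp add: p_def shift_a_def algebra_simps power2_eq_square power3_eq_cube)
  then have "form y1 (Y * y1) \<noteq> 0" unfolding form_shift using y1 by auto
  moreover have "t ^ m * el y0 y1 (Y * y1) \<in> C"
  proof -
    have sub: "D.subspace C" using C by (simp add: cubic_ring_def)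
    have "X ^ N dvd (X ^ m * (X ^ Q * y1) :: 'k fps)" using Q(1) by (intro dvd_mult dvd_mult2 le_imp_power_dvd)
    then have z: "el 0 0 (X ^ m * (X ^ Q * y1)) \<in> C" using N by (auto simp: el_in_tA_iff)
    have "Y * y1 = y2 * (i * y1) + X ^ Q * y1" by (simp add: Y_def algebra_simps)
    then have Yy: "Y * y1 = y2 + X ^ Q * y1" by (simp add: i)
    have "t ^ m * el y0 y1 (Y * y1) = t ^ m * el y0 y1 y2 + el 0 0 (X ^ m * (X ^ Q * y1))"
      unfolding Yy t_elt_power el_scale el_add by (simp add: distrib_left)
    then show ?thesis using D.subspace_add[OF sub yC z] by simp
  qed
  ultimately show ?thesis by blast
qed

lemma nonzero_form:
  assumes C: "cubic_ring \<iota> C" and x: "x \<in> A" "\<not> (\<exists>f. \<exists>y\<in>A. x = \<delta> f + t * y)" "t ^ m * x \<in> C"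
  shows "\<exists>y1 y2. t ^ m * el 0 y1 y2 \<in> C \<and> (res y1 \<noteq> 0 \<or> res y2 \<noteq> 0) \<and> form y1 y2 \<noteq> 0"
proof -
  obtain x0 x1 x2 where el: "x = el x0 x1 x2" using A_ex[OF x(1)] by blast
  have prim: "res x1 \<noteq> 0 \<or> res x2 \<noteq> 0" using x(2) unfolding el primitive_iff by simp
  have sub: "D.subspace C" using C by (simp add: cubic_ring_def)
  have "t ^ m * el 0 x1 x2 = t ^ m * x - \<delta> (X ^ m * x0)"
    unfolding el t_elt_power el_scale unfolding el_special(1) el_diff unfolding el_special(1)[symmetric] el_scale by simp
  then have xC: "t ^ m * el 0 x1 x2 \<in> C" using D.subspace_diff[OF sub x(3) cubic_ring_D[OF C]] by simp
  show ?thesis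
  proof (cases "res x1 = 0")
    case False
    from nonzero_form_chart[OF C xC False] False show ?thesis by blast
  next
    case True
    interpret s: cubic_order \<iota> z w "- fd" "- fc" "- fb" "- fa" by (rule swap)
    have x2: "res x2 \<noteq> 0" using True prim by simp
    have "t ^ m * s.el 0 x2 x1 \<in> C" using xC by (simp add: el_swap)
    from s.nonzero_form_chart[OF C this x2] obtain y where "t ^ m * s.el 0 x2 y \<in> C" "s.form x2 y \<noteq> 0" by blast
    then show ?thesis using x2 unfolding el_swap swapped_form by (intro exI[of _ y] exI[of _ x2]) simp
  qed
qed

end

subsection \<open>Construction of the singularities\<close>

text \<open>Elements outside the candidate ideal are units, so every proper ideal is contained in
  it.\<close>

lemma unique_maximal_ideal:
  assumes e: "e \<in> R" "\<And>x. x \<in> R \<Longrightarrow> e * x = x" and \<tau>: "\<tau> \<in> R" "e \<notin> (*) \<tau> ` R"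
    and R: "\<And>x y. x \<in> R \<Longrightarrow> y \<in> R \<Longrightarrow> x - y \<in> R" "\<And>x y. x \<in> R \<Longrightarrow> y \<in> R \<Longrightarrow> x * y \<in> R"
    and unit: "\<And>x. x \<in> R \<Longrightarrow> x \<notin> (*) \<tau> ` R \<Longrightarrow> \<exists>y\<in>R. x * y = e"
  shows "{I. maximal_ideal_of R I} = {(*) \<tau> ` R}"
proof -
  let ?T = "(*) \<tau> ` R"
  have zero: "0 \<in> R" using R(1)[OF e(1) e(1)] by simp
  have T: "submodule_of R ?T" unfolding submodule_of_def
  proof (intro conjI ballI)
    show "0 \<in> ?T" using zero by (intro image_eqI[of _ _ 0]) auto
    show "x - y \<in> ?T" if "x \<in> ?T" "y \<in> ?T" for x y using that R(1) by (auto simp flip: right_diff_distrib)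
    show "c * x \<in> ?T" if "c \<in> R" "x \<in> ?T" for c x using that R(2) by (auto simp: mult.left_commute[of c \<tau>])
  qed
  have TR: "?T \<subset> R" using \<tau> e(1) R(2) by blast
  have ideal: "J = R" if J: "submodule_of R J" "J \<subseteq> R" and x: "x \<in> J" "x \<notin> ?T" for J x
  proof -
    obtain y where y: "y \<in> R" "x * y = e" using unit x J(2) by blast
    have "y * x \<in> J" using J(1) x(1) y(1) unfolding submodule_of_def by blast
    then have "e \<in> J" using y(2) by (simp add: mult.commute)
    have "r \<in> J" if "r \<in> R" for r
    proof -
      have "r * e \<in> J" using J(1) that \<open>e \<in> J\<close> unfolding submodule_of_def by blast
      then show ?thesis using e(2)[OF that] by (simp add: mult.commute)
    qed
    then show ?thesis using J(2) by blast
  qed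
  have "maximal_ideal_of R ?T" unfolding maximal_ideal_of_def
  proof (intro conjI allI impI T TR)
    fix J assume J: "submodule_of R J \<and> ?T \<subseteq> J \<and> J \<subset> R"
    show "J = ?T"
    proof (rule ccontr)
      assume "J \<noteq> ?T"
      then obtain x where "x \<in> J" "x \<notin> ?T" using J by blast
      then show False using ideal[of J x] J by blast
    qed
  qed
  moreover have "I = ?T" if I: "maximal_ideal_of R I" for I
  proof -
    have I': "submodule_of R I" "I \<subset> R" using I by (simp_all add: maximal_ideal_of_def)
    have "I \<subseteq> ?T" using ideal[of I] I' by blast
    then show ?thesis using I T TR unfolding maximal_ideal_of_def by blast
  qed
  ultimately show ?thesis by blast
qed

context cubic_order
begin

lemma nrm_el: "nrm (el x0 x1 x2) = fl (norm_fps x0 x1 x2)"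
  by (simp add: el_E nrm_E norm_fps_to_fls)

text \<open>All translates of y/\<alpha> by constants have integral norm, because the norm of
  \<alpha> has order exactly 1; so y/\<alpha> is integral by
  \<open>integral_of_norms\<close>.\<close>

lemma divides_of_norm:
  assumes \<alpha>: "nrm \<alpha> = fl (X * g)" "res g \<noteq> 0"
    and y: "\<And>c. \<exists>h. nrm (y + \<iota> (fls_const c) * \<alpha>) = fl (X * h)"
  shows "\<exists>v\<in>A. y = \<alpha> * v"
proof -
  have "g \<noteq> 0" using \<alpha>(2) by auto
  then have "nrm \<alpha> \<noteq> 0" by (simp add: \<alpha>(1))
  then obtain u where u: "\<alpha> * u = 1" using nrm_unit by blast
  then have nu: "nrm \<alpha> * nrm u = 1" using nrm_mult[of \<alpha> u] nrm_\<iota>[of 1] by simp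
  obtain x0 x1 x2 where E: "y * u = E x0 x1 x2" using E_ex by blast
  have "E x0 x1 x2 \<in> A"
  proof (rule integral_of_norms)
    fix c
    obtain h where h: "nrm (y + \<iota> (fls_const c) * \<alpha>) = fl (X * h)" using y by blast
    have "X * h = (h * inverse g) * (X * g)"
      using inverse_mult_eq_1[OF \<alpha>(2)] by (simp add: mult.assoc mult.left_commute[of _ X])
    then have h': "nrm (y + \<iota> (fls_const c) * \<alpha>) = fl (h * inverse g) * nrm \<alpha>"
      unfolding h \<alpha>(1) by (simp flip: fls_times_fps_to_fls)
    have "E (x0 + fls_const c) x1 x2 = y * u + \<iota> (fls_const c) * (\<alpha> * u)" by (simp add: E u \<iota>_eq_E E_add)
    also have "\<dots> = (y + \<iota> (fls_const c) * \<alpha>) * u" by (simp add: algebra_simps)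
    finally have "norm_fls (x0 + fls_const c) x1 x2 = nrm (y + \<iota> (fls_const c) * \<alpha>) * nrm u"
      by (metis nrm_E nrm_mult)
    then show "\<exists>f. norm_fls (x0 + fls_const c) x1 x2 = fl f"
      unfolding h' mult.assoc nu by auto
  qed
  then have "y * u \<in> A" by (simp add: E)
  moreover have "y = \<alpha> * (y * u)" using u by (metis mult.commute mult.left_commute mult_1_right)
  ultimately show ?thesis by blast
qed

lemma change_generator:
  assumes C: "cubic_ring \<iota> C" and y: "t ^ m * el 0 y1 y2 \<in> C"
  shows "t ^ m * el c (f * y1) (f * y2) \<in> C"
proof -
  have sub: "D.subspace C" using C by (simp add: cubic_ring_def)
  have "t ^ m * el c (f * y1) (f * y2) = Dscale \<iota> f (t ^ m * el 0 y1 y2) + \<delta> (X ^ m * c)"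
    unfolding Dscale_def t_elt_power el_scale unfolding el_special(1) el_add unfolding el_special(1)[symmetric] el_scale
    by (simp add: mult_ac)
  then show ?thesis using D.subspace_add[OF sub D.subspace_scale[OF sub y] cubic_ring_D[OF C]] by simp
qed

lemma form_scale: "form (f * y1) (f * y2) = f ^ 3 * form y1 y2"
  by (simp add: form_def algebra_simps power2_eq_square power3_eq_cube)

lemma primitive_factor:
  fixes x0 x1 x2 :: "'k fps"
  assumes "x0 \<noteq> 0 \<or> x1 \<noteq> 0 \<or> x2 \<noteq> 0"
  shows "\<exists>r y0 y1 y2. x0 = X ^ r * y0 \<and> x1 = X ^ r * y1 \<and> x2 = X ^ r * y2 \<and>
    (res y0 \<noteq> 0 \<or> res y1 \<noteq> 0 \<or> res y2 \<noteq> 0)"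
proof -
  define P where "P i \<longleftrightarrow> fps_nth x0 i \<noteq> 0 \<or> fps_nth x1 i \<noteq> 0 \<or> fps_nth x2 i \<noteq> 0" for i
  have "\<exists>i. P i" using assms by (auto simp: P_def fps_eq_iff)
  then have P: "P (LEAST i. P i)" by (rule LeastI_ex)
  define r where "r = (LEAST i. P i)"
  have "\<not> P i" if "i < r" for i using that unfolding r_def by (rule not_less_Least)
  then have "X ^ r dvd x0" "X ^ r dvd x1" "X ^ r dvd x2" unfolding fps_X_power_dvd_iff P_def by blast+
  then obtain y0 y1 y2 where y: "x0 = X ^ r * y0" "x1 = X ^ r * y1" "x2 = X ^ r * y2" by (auto simp: dvd_def)
  have "res y0 \<noteq> 0 \<or> res y1 \<noteq> 0 \<or> res y2 \<noteq> 0"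
    using P unfolding r_def[symmetric] by (simp add: P_def y fps_X_power_mult_nth)
  with y show ?thesis by blast
qed

end

section \<open>One branch: a triple root modulo t\<close>

locale one_branch_order = cubic_order \<iota> w z fa fb fc fd
  for \<iota> :: "'k::alg_closed_field fls \<Rightarrow> 'l::comm_ring_1" and w z fa fb fc fd +
  assumes residues: "res fa = 0" "res fb = 0" "res fc = 0"
begin

text \<open>An Eisenstein condition: at the triple root f(1, 0) has order exactly 1, by
  \<open>form_not_double\<close>.\<close>

lemma coefficients:
  obtains a b c where "fa = X * a" "fb = X * b" "fc = X * c" "res a \<noteq> 0" "res fd \<noteq> 0"
proof -
  obtain a b c where abc: "fa = X * a" "fb = X * b" "fc = X * c"
    using residues by (auto simp flip: fps_X_dvd_iff simp: dvd_def)
  have "res a \<noteq> 0"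
  proof
    assume "res a = 0"
    then obtain a' where "a = X * a'" using fps_X_factor by blast
    then have "X ^ 2 dvd fa" "X dvd fb" by (simp_all add: abc power2_eq_square)
    then show False using form_not_double by simp
  qed
  moreover have "res fd \<noteq> 0" using form_nonzero residues by simp
  ultimately show ?thesis using that abc by blast
qed

text \<open>Modulo t^2 the norm is - fa fd^2 x2^3, so z has valuation 1. By \<open>norm_2\<close>
  the norm of w has order 2, so w has valuation 2, while t has valuation 3.\<close>

lemma norm_1:
  "\<exists>g. norm_fps (X * s) x1 x2 = X * g \<and> (res x2 \<noteq> 0 \<longrightarrow> res g \<noteq> 0)"
proof -
  obtain a b c where abc: "fa = X * a" "fb = X * b" "fc = X * c" "res a \<noteq> 0" "res fd \<noteq> 0"
    by (rule coefficients) (rule that)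
  define R where "R = X * s ^ 3 + X * (b * x1 - c * x2) * s\<^sup>2
    + s * (X * a * c * x1\<^sup>2 + (3 * a * fd - X * b * c) * x1 * x2 + b * fd * x2\<^sup>2)
    + a\<^sup>2 * fd * x1 ^ 3 + (2 * a * b * fd - X * a * c\<^sup>2) * x1\<^sup>2 * x2 + (b\<^sup>2 * fd - 2 * a * c * fd) * x1 * x2\<^sup>2"
  have "norm_fps (X * s) x1 x2 = X * (X * R - a * fd\<^sup>2 * x2 ^ 3)"
    unfolding norm_form_def det3_def R_def abc by (simp add: algebra_simps power2_eq_square power3_eq_cube)
  moreover have "res (X * R - a * fd\<^sup>2 * x2 ^ 3) \<noteq> 0" if "res x2 \<noteq> 0"
    using that abc(4,5) by (simp add: fps_nth_power_0)
  ultimately show ?thesis by blast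
qed

lemma norm_2:
  assumes "res x1 \<noteq> 0"
  shows "\<exists>g. norm_fps (X * s) x1 (X * y) = X * (X * g) \<and> res g \<noteq> 0"
proof -
  obtain a b c where abc: "fa = X * a" "fb = X * b" "fc = X * c" "res a \<noteq> 0" "res fd \<noteq> 0"
    by (rule coefficients) (rule that)
  define R where "R = s ^ 3 + (b * x1 - X * c * y) * s\<^sup>2
    + s * (a * c * x1\<^sup>2 + (3 * a * fd - X * b * c) * x1 * y + X * b * fd * y\<^sup>2)
    + (2 * a * b * fd - X * a * c\<^sup>2) * x1\<^sup>2 * y + X * (b\<^sup>2 * fd - 2 * a * c * fd) * x1 * y\<^sup>2
    - X * a * fd\<^sup>2 * y ^ 3"
  have "norm_fps (X * s) x1 (X * y) = X * (X * (X * R + a\<^sup>2 * fd * x1 ^ 3))"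
    unfolding norm_form_def det3_def R_def abc by (simp add: algebra_simps power2_eq_square power3_eq_cube)
  moreover have "res (X * R + a\<^sup>2 * fd * x1 ^ 3) \<noteq> 0"
    using assms abc(4,5) by (simp add: fps_nth_power_0)
  ultimately show ?thesis by blast
qed

lemma norm_0: "res (norm_fps x0 x1 x2) = res x0 ^ 3"
  unfolding norm_form_cong0 by (simp add: residues norm_form_def det3_def power3_eq_cube)

text \<open>A coordinate vector not divisible by t has norm of order 0, 1 or 2; in particular its
  norm is not zero.\<close>

lemma field: "one_branch TYPE('l)"
proof -
  have "\<exists>y. x * y = 1" if x: "x \<noteq> 0" for x :: 'l
  proof -
    obtain s where "t ^ s * x \<in> A" using integral_multiple[OF rep] by blast
    then obtain x0 x1 x2 where el: "t ^ s * x = el x0 x1 x2" using A_ex by blast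
    have "el x0 x1 x2 \<noteq> 0"
    proof
      assume "el x0 x1 x2 = 0"
      then have "t ^ s * x = t ^ s * 0" using el by simp
      then show False using x unfolding t_elt_cancel by simp
    qed
    then have "x0 \<noteq> 0 \<or> x1 \<noteq> 0 \<or> x2 \<noteq> 0" by (auto simp: el_0)
    from primitive_factor[OF this] obtain r y0 y1 y2 where y: "x0 = X ^ r * y0" "x1 = X ^ r * y1" "x2 = X ^ r * y2"
      "res y0 \<noteq> 0 \<or> res y1 \<noteq> 0 \<or> res y2 \<noteq> 0" by blast
    have ne: "norm_fps y0 y1 y2 \<noteq> 0"
    proof (cases "res y0 = 0")
      case False
      then have "res (norm_fps y0 y1 y2) \<noteq> 0" by (simp add: norm_0)
      then show ?thesis by auto
    next
      case True
      then obtain s where s: "y0 = X * s" using fps_X_factor by blast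
      show ?thesis
      proof (cases "res y2 = 0")
        case False
        then show ?thesis using norm_1[of s y1 y2] by (auto simp: s)
      next
        case True
        then obtain v where v: "y2 = X * v" using fps_X_factor by blast
        have "res y1 \<noteq> 0" using y(4) \<open>res y0 = 0\<close> True by simp
        from norm_2[OF this, of s v] show ?thesis by (auto simp: s v)
      qed
    qed
    have "t ^ s * x = \<delta> (X ^ r) * el y0 y1 y2" by (simp add: el y el_scale)
    then have "nrm (t ^ s) * nrm x = nrm (\<delta> (X ^ r)) * nrm (el y0 y1 y2)" by (metis nrm_mult)
    moreover have "nrm (\<delta> (X ^ r)) \<noteq> 0" by (simp add: Demb_def nrm_\<iota> fps_to_fls_power)
    ultimately have "nrm x \<noteq> 0" using ne by (auto simp: nrm_el)
    then show ?thesis by (rule nrm_unit)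
  qed
  moreover have "(1 :: 'l) \<noteq> 0" unfolding el_special(4) el_0[symmetric] el_inject by simp
  ultimately show ?thesis unfolding one_branch_def idem_field_def by auto
qed

lemma divides:
  assumes "res x2 \<noteq> 0"
  shows "\<exists>v\<in>A. el (X * r) y1 y2 = el (X * s) x1 x2 * v"
proof -
  obtain g where g: "norm_fps (X * s) x1 x2 = X * g" "res g \<noteq> 0" using norm_1 assms by blast
  show ?thesis
  proof (rule divides_of_norm)
    show "nrm (el (X * s) x1 x2) = fl (X * g)" by (simp only: nrm_el g)
    fix c
    have eq: "el (X * r) y1 y2 + \<iota> (fls_const c) * el (X * s) x1 x2 =
        el (X * (r + fps_const c * s)) (y1 + fps_const c * x1) (y2 + fps_const c * x2)"
    proof -
      have c: "\<iota> (fls_const c) = \<delta> (fps_const c)" by (simp add: Demb_def)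
      show ?thesis unfolding c el_scale el_add by (simp add: algebra_simps)
    qed
    show "\<exists>h. nrm (el (X * r) y1 y2 + \<iota> (fls_const c) * el (X * s) x1 x2) = fl (X * h)"
      unfolding eq nrm_el using norm_1 by metis
  qed fact
qed

lemma maximal_ideals:
  assumes x2: "res x2 \<noteq> 0"
  shows "{I. maximal_ideal_of A I} = {(*) (el (X * s) x1 x2) ` A}"
proof (rule unique_maximal_ideal[where e = 1])
  show "1 \<notin> (*) (el (X * s) x1 x2) ` A"
  proof
    assume "1 \<in> (*) (el (X * s) x1 x2) ` A"
    then obtain v where "v \<in> A" "el (X * s) x1 x2 * v = 1" by auto
    from el_unit_norm[OF this(2,1)] show False by (simp add: norm_0)
  qed
  fix x assume x: "x \<in> A" "x \<notin> (*) (el (X * s) x1 x2) ` A"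
  obtain y0 y1 y2 where y: "x = el y0 y1 y2" using A_ex[OF x(1)] by blast
  have "res y0 \<noteq> 0"
  proof
    assume "res y0 = 0"
    then obtain r where "y0 = X * r" using fps_X_factor by blast
    then show False using divides[OF x2, of r y1 y2 s x1] x(2) unfolding y by blast
  qed
  then show "\<exists>y\<in>A. x * y = 1" unfolding y by (intro el_unit) (simp add: norm_0)
qed (simp_all add: A_ring integral_add_mult)

lemma valuation_1:
  assumes "res x2 \<noteq> 0"
  shows "has_valuation A (el 0 x1 x2) 1"
  using maximal_ideals[OF assms, of 0 x1] unfolding has_valuation_def
  by (intro conjI bexI[of _ "el 0 x1 x2"]) auto

lemma valuation_2:
  assumes x1: "res x1 \<noteq> 0"
  shows "has_valuation A (el 0 x1 (X * y)) 2"
proof -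
  let ?\<tau> = "el (X * 0) 0 1" and ?\<alpha> = "el (X * 0) x1 (X * y)"
  obtain v where v: "v \<in> A" "?\<alpha> = ?\<tau> * v" using divides[of 1 0 x1 "X * y" 0 0] by auto
  obtain v0 v1 v2 where el: "v = el v0 v1 v2" using A_ex[OF v(1)] by blast
  obtain g where g: "norm_fps (X * 0) 0 1 = X * g" "res g \<noteq> 0" using norm_1[of 0 0 1] by auto
  obtain h where h: "norm_fps (X * 0) x1 (X * y) = X * (X * h)" "res h \<noteq> 0" using norm_2[OF x1] by blast
  have "fl (X * (X * h)) = fl (X * g * norm_fps v0 v1 v2)"
    using arg_cong[OF v(2), of nrm] unfolding nrm_mult el nrm_el g h by (simp add: fls_times_fps_to_fls)
  then have "X * (X * h) = X * (g * norm_fps v0 v1 v2)" by (simp add: mult.assoc)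
  then have hg: "X * h = g * norm_fps v0 v1 v2" by (simp only: mult_left_cancel fps_X_neq_zero simp_thms mult_cancel_left)
  \<comment> \<open>Comparing norms: the cofactor v of the uniformizer is not a unit, so it is
    divisible by the uniformizer again, and the cofactor v' then left has unit norm.\<close>
  have "res (X * h) = 0" by simp
  then have "res v0 = 0" unfolding hg using g(2) by (simp add: norm_0)
  then obtain r where r: "v0 = X * r" using fps_X_factor by blast
  obtain v' where v': "v' \<in> A" "v = ?\<tau> * v'" using divides[of 1 r v1 v2 0 0] by (auto simp: el r)
  obtain u0 u1 u2 where el': "v' = el u0 u1 u2" using A_ex[OF v'(1)] by blast
  have "fl (norm_fps v0 v1 v2) = fl (X * g * norm_fps u0 u1 u2)"
    using arg_cong[OF v'(2), of nrm] unfolding nrm_mult el el' nrm_el g by (simp add: fls_times_fps_to_fls)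
  then have "X * h = X * (g * g * norm_fps u0 u1 u2)" unfolding hg by (simp add: mult_ac)
  then have "h = g * g * norm_fps u0 u1 u2" by (simp only: fps_X_neq_zero simp_thms mult_cancel_left)
  then have "res (norm_fps u0 u1 u2) \<noteq> 0" using h(2) by auto
  from el_unit[OF this] obtain u where u: "u \<in> A" "v' * u = 1" unfolding el' by blast
  have \<alpha>: "?\<alpha> = ?\<tau> ^ 2 * v'" by (simp only: v(2) v'(2) power2_eq_square mult.assoc)
  then have \<tau>: "?\<tau> ^ 2 = ?\<alpha> * u" by (simp only: mult.assoc u(2) mult_1_right)
  have "(*) ?\<alpha> ` A = (*) (?\<tau> ^ 2) ` A"
  proof
    show "(*) ?\<alpha> ` A \<subseteq> (*) (?\<tau> ^ 2) ` A" unfolding \<alpha> using v'(1) integral_add_mult(2) by (auto simp: mult.assoc)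
    show "(*) (?\<tau> ^ 2) ` A \<subseteq> (*) ?\<alpha> ` A" unfolding \<tau> using u(1) integral_add_mult(2) by (auto simp: mult.assoc)
  qed
  moreover have "{I. maximal_ideal_of A I} = {(*) ?\<tau> ` A}" by (rule maximal_ideals) simp
  ultimately show ?thesis unfolding has_valuation_def by (intro conjI bexI[of _ ?\<tau>]) auto
qed

text \<open>If y2 is a unit, the generator has valuation 1 and f has order 0, which gives E_(12n+6);
  otherwise the valuation is 2 and the order 1, which gives E_(12n+8).\<close>

theorem dominates_singularity:
  assumes C: "cubic_ring \<iota> C" and y: "t ^ (2 * n + 1) * el 0 y1 y2 \<in> C" "res y1 \<noteq> 0 \<or> res y2 \<noteq> 0"
  shows "\<exists>B. dominates \<iota> C B \<and> (\<exists>i\<in>{6..8}. type_E \<iota> (12 * n + i) B)"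
proof -
  obtain a b c where abc: "fa = X * a" "fb = X * b" "fc = X * c" "res a \<noteq> 0" "res fd \<noteq> 0"
    by (rule coefficients) (rule that)
  let ?m = "2 * n + 1"
  show ?thesis
  proof (cases "res y2 = 0")
    case False
    have "form y1 y2 = X ^ 0 * form y1 y2" "res (form y1 y2) \<noteq> 0"
      unfolding form_def using False abc(5) by (simp_all add: abc(1-3) fps_nth_power_0)
    from dominated[OF C y this] have "dominates \<iota> C (ring_of \<iota> (t ^ ?m * el 0 y1 y2) (2 * ?m))" by simp
    moreover have "type_E \<iota> (12 * n + 6) (ring_of \<iota> (t ^ ?m * el 0 y1 y2) (2 * ?m))"
      unfolding type_E_def using field valuation_1[OF False]
      by (intro disjI1 exI[of _ ?m] exI[of _ "el 0 y1 y2"] conjI) simp_all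
    moreover have "6 \<in> {6..8::nat}" by simp
    ultimately show ?thesis by blast
  next
    case True
    then obtain v where v: "y2 = X * v" using fps_X_factor by blast
    have y1: "res y1 \<noteq> 0" using True y(2) by simp
    have "form y1 y2 = X ^ 1 * (a * y1 ^ 3 + X * (b * y1\<^sup>2 * v + X * c * y1 * v\<^sup>2 + X * fd * v ^ 3))"
      unfolding form_def by (simp add: abc(1-3) v algebra_simps power2_eq_square power3_eq_cube)
    moreover have "res (a * y1 ^ 3 + X * (b * y1\<^sup>2 * v + X * c * y1 * v\<^sup>2 + X * fd * v ^ 3)) \<noteq> 0"
      using y1 abc(4) by (simp add: fps_nth_power_0)
    ultimately have "dominates \<iota> C (ring_of \<iota> (t ^ ?m * el 0 y1 y2) (2 * ?m + 1))" by (rule dominated[OF C y])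
    moreover have "type_E \<iota> (12 * n + 8) (ring_of \<iota> (t ^ ?m * el 0 y1 y2) (2 * ?m + 1))"
      unfolding type_E_def using field valuation_2[OF y1, of v] v
      by (intro disjI2 exI[of _ ?m] exI[of _ "el 0 y1 y2"] conjI) simp_all
    moreover have "8 \<in> {6..8::nat}" by simp
    ultimately show ?thesis by blast
  qed
qed

end

section \<open>Two branches: a simple and a double root modulo t\<close>

locale two_branch_order = cubic_order \<iota> w z fa fb fc fd
  for \<iota> :: "'k::alg_closed_field fls \<Rightarrow> 'l::comm_ring_1" and w z fa fb fc fd +
  assumes fa_0: "fa = 0" and residues: "res fb \<noteq> 0" "res fc = 0" "res fd = 0"
begin

text \<open>The double root lies at (0 : 1), so \<open>form_not_double\<close> is applied after
  \<open>swap\<close>.\<close>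

lemma coefficients:
  obtains c d where "fc = X * c" "fd = X * d" "res d \<noteq> 0"
proof -
  obtain c d where cd: "fc = X * c" "fd = X * d"
    using residues(2,3) by (auto simp flip: fps_X_dvd_iff simp: dvd_def)
  have "res d \<noteq> 0"
  proof
    assume "res d = 0"
    then obtain d' where "d = X * d'" using fps_X_factor by blast
    then have "X ^ 2 dvd - fd" "X dvd - fc" by (simp_all add: cd power2_eq_square)
    then show False using cubic_order.form_not_double[OF swap] by simp
  qed
  then show ?thesis using that cd by blast
qed

definition ib where "ib = inverse fb"

lemma ib: "fb * ib = 1" "ib * fb = 1" "fb * (ib * x) = x"
  using inverse_mult_eq_1[OF residues(1)] by (simp_all add: ib_def mult.commute[of fb] flip: mult.assoc)

text \<open>The element \<open>p e + q z\<close> of the quadratic component \<open>e A\<close>.\<close>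

definition rl :: "'k fps \<Rightarrow> 'k fps \<Rightarrow> 'l"
  where "rl p q = el p (- (ib * p)) q"

abbreviation "e \<equiv> rl 1 0"

lemma rl_in_A: "rl p q \<in> A"
  by (simp add: rl_def)

lemma rl_mult: "rl p q * rl p' q' = rl (p * p' - fb * fd * (q * q')) (p * q' + q * p' - fc * (q * q'))"
proof -
  have "fb * (- (ib * p) * - (ib * p')) = (fb * ib) * (ib * (p * p'))" by (simp add: mult_ac)
  then have 1: "fb * (- (ib * p) * - (ib * p')) = ib * (p * p')" unfolding ib(1) by simp
  have 2: "ib * (fb * fd * (q * q')) = fd * (q * q')" using ib(2) by (simp flip: mult.assoc)
  show ?thesis unfolding rl_def el_mult el_inject fa_0 1 right_diff_distrib 2 by (simp add: algebra_simps)
qed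

lemma e_mult_el: "e * el y0 y1 y2 = rl y0 y2"
  unfolding rl_def el_mult el_inject fa_0 using ib(3)[of y1] by (simp add: algebra_simps)

lemma rl_scale: "\<delta> f * rl p q = rl (f * p) (f * q)"
  unfolding rl_def el_scale by (simp add: mult_ac)

lemma e_idem: "e * e = e"
  by (simp add: rl_mult)

lemma e_rl: "e * rl p q = rl p q"
  by (simp add: rl_mult)

lemma eA_iff: "x \<in> (*) e ` A \<longleftrightarrow> (\<exists>p q. x = rl p q)"
proof
  assume "x \<in> (*) e ` A"
  then obtain y0 y1 y2 where "x = e * el y0 y1 y2" using A_ex by blast
  then show "\<exists>p q. x = rl p q" unfolding e_mult_el by blast
next
  assume "\<exists>p q. x = rl p q"
  then show "x \<in> (*) e ` A" using e_rl rl_in_A by (metis imageI)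
qed

text \<open>The norm of the quadratic extension e L of K in the basis e, z.\<close>

definition qn where "qn p q = p\<^sup>2 - fc * p * q + fb * fd * q\<^sup>2"

lemma rl_conj: "rl p q * rl (p - fc * q) (- q) = \<delta> (qn p q) * e"
  unfolding rl_mult rl_scale by (simp add: qn_def algebra_simps power2_eq_square)

lemma rl_inject: "rl p q = rl p' q' \<longleftrightarrow> p = p' \<and> q = q'"
  by (auto simp: rl_def)

lemma qn_X:
  assumes "res q \<noteq> 0"
  shows "\<exists>u. qn (X * s) q = X * u \<and> res u \<noteq> 0"
proof -
  obtain c d where cd: "fc = X * c" "fd = X * d" "res d \<noteq> 0" by (rule coefficients) (rule that)
  have "qn (X * s) q = X * (X * s\<^sup>2 - X * c * s * q + fb * d * q\<^sup>2)"
    unfolding qn_def by (simp add: cd algebra_simps power2_eq_square)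
  moreover have "res (X * s\<^sup>2 - X * c * s * q + fb * d * q\<^sup>2) \<noteq> 0"
    using assms residues(1) cd(3) by (simp add: fps_nth_power_0)
  ultimately show ?thesis by blast
qed

lemma qn_0: "res (qn p q) = res p ^ 2"
  by (simp add: qn_def fps_nth_power_0 residues)

lemma idem_field_e: "idem_field e"
proof -
  have "\<exists>y\<in>range ((*) e). x * y = e" if x: "x \<in> range ((*) e)" "x \<noteq> 0" for x
  proof -
    obtain y where y: "x = e * y" using x(1) by auto
    obtain s where "t ^ s * y \<in> A" using integral_multiple[OF rep] by blast
    then have "e * (t ^ s * y) \<in> (*) e ` A" by blast
    then obtain p q where pq: "t ^ s * x = rl p q" unfolding eA_iff y by (auto simp: mult.left_commute)
    have "rl p q \<noteq> 0"
    proof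
      assume "rl p q = 0"
      then have "t ^ s * x = t ^ s * 0" using pq by simp
      then show False using x unfolding t_elt_cancel by simp
    qed
    then have "p \<noteq> 0 \<or> q \<noteq> 0 \<or> (0 :: 'k fps) \<noteq> 0" by (auto simp: rl_def el_0)
    from primitive_factor[OF this] obtain r p' q' where p': "p = X ^ r * p'" "q = X ^ r * q'"
      "res p' \<noteq> 0 \<or> res q' \<noteq> 0" by auto
    have "qn p' q' \<noteq> 0"
    proof (cases "res p' = 0")
      case False
      then have "res (qn p' q') \<noteq> 0" by (simp add: qn_0)
      then show ?thesis by auto
    next
      case True
      then obtain s where "p' = X * s" using fps_X_factor by blast
      then show ?thesis using qn_X[of q' s] p'(3) True by auto
    qed
    moreover have "qn p q = (X ^ r) ^ 2 * qn p' q'" by (simp add: qn_def p' algebra_simps power2_eq_square)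
    ultimately have Q: "fl (qn p q) \<noteq> 0" by simp
    define y' where "y' = \<iota> (fls_X ^ s / fl (qn p q)) * rl (p - fc * q) (- q)"
    have t: "t ^ s = \<iota> (fls_X ^ s)" by (simp add: t_elt_def Demb_def \<iota>_power)
    have "\<iota> (fls_X ^ s / fl (qn p q)) = \<iota> (1 / fl (qn p q)) * t ^ s"
      unfolding t by (simp flip: \<iota>_mult)
    then have "x * y' = \<iota> (1 / fl (qn p q)) * ((t ^ s * x) * rl (p - fc * q) (- q))"
      unfolding y'_def by (simp only: mult_ac)
    also have "\<dots> = \<iota> (1 / fl (qn p q)) * \<delta> (qn p q) * e" unfolding pq rl_conj by (simp only: mult.assoc)
    also have "\<dots> = e" using Q by (simp add: Demb_def flip: \<iota>_mult)
    finally have "x * y' = e" .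
    moreover have "e * y' = y'" by (simp add: y'_def mult.left_commute[of e] e_rl)
    ultimately show ?thesis by (metis rangeI)
  qed
  moreover have "e \<noteq> 0" unfolding rl_def el_0[symmetric] el_inject by simp
  ultimately show ?thesis unfolding idem_field_def using e_idem by blast
qed

lemma dims: "K.dim (range ((*) e)) = 2" "K.dim (range ((*) (1 - e))) = 1"
proof -
  define i where "i = fl ib"
  have i: "fl fb * i = 1" using ib(1) by (simp add: i_def flip: fls_times_fps_to_fls)
  have i': "fl fb * (i * x) = x" for x using i by (simp flip: mult.assoc)
  have e: "e = E 1 (- i) 0" by (simp add: rl_def el_E i_def)
  have z: "z = E 0 0 1" by (simp add: E_def)
  have comb: "\<iota> u * e + \<iota> v * z = E u (u * - i) v" for u v
    unfolding e by (simp add: E_def \<iota>_mult \<iota>_minus algebra_simps)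
  have ex: "e * E y0 y1 y2 = \<iota> y0 * e + \<iota> y2 * z" for y0 y1 y2
    unfolding comb unfolding e E_mult Let_def E_inject fa_0 using i'[of y1] by (simp add: algebra_simps)
  have gx: "(1 - e) * E y0 y1 y2 = \<iota> (fl fb * y1 + y0) * (1 - e)" for y0 y1 y2
  proof -
    have one: "1 = E 1 0 0" using \<iota>_eq_E[of 1] by simp
    have g: "1 - e = E 0 i 0" unfolding e one E_diff by simp
    show ?thesis unfolding g E_mult Let_def E_scale E_inject fa_0 by (simp add: algebra_simps)
  qed
  have ind: "u = 0 \<and> v = 0" if "\<iota> u * e + \<iota> v * z = 0" for u v
  proof -
    have "E u (u * - i) v = E 0 0 0" using that unfolding comb by (simp add: E_def)
    then show ?thesis by simp
  qed
  have ne: "e \<noteq> z" using ind[of 1 "- 1"] by (auto simp: \<iota>_minus)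
  have ez: "z = e * z" using ex[of 0 0 1, folded z] by simp
  show "K.dim (range ((*) e)) = 2"
  proof (rule K.dim_unique[of "{e, z}"])
    show "{e, z} \<subseteq> range ((*) e)" using e_idem ez by (metis empty_subsetI insert_subset rangeI)
    show "range ((*) e) \<subseteq> K.span {e, z}"
    proof
      fix x assume "x \<in> range ((*) e)"
      then obtain y0 y1 y2 where "x = e * E y0 y1 y2" using E_ex by (metis imageE)
      then have "x = Kscale \<iota> y0 e + Kscale \<iota> y2 z" by (simp add: ex Kscale_def)
      moreover have "v \<in> K.span {e, z}" if "v \<in> {e, z}" for v using that by (rule K.span_base)
      ultimately show "x \<in> K.span {e, z}" by (simp add: K.span_add K.span_scale)
    qed
    have fin: "finite {e, z}" by simp
    have sum: "(\<Sum>v\<in>{e, z}. Kscale \<iota> (u v) v) = \<iota> (u e) * e + \<iota> (u z) * z" for u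
      using ne by (simp add: Kscale_def)
    show "K.independent {e, z}" unfolding K.dependent_finite[OF fin] sum using ind by blast
    show "card {e, z} = 2" using ne by simp
  qed
  show "K.dim (range ((*) (1 - e))) = 1"
  proof (rule K.dim_unique[of "{1 - e}"])
    show "{1 - e} \<subseteq> range ((*) (1 - e))" by (auto intro!: image_eqI[of _ _ 1])
    show "range ((*) (1 - e)) \<subseteq> K.span {1 - e}"
    proof
      fix x assume "x \<in> range ((*) (1 - e))"
      then obtain y0 y1 y2 where "x = (1 - e) * E y0 y1 y2" using E_ex by (metis imageE)
      then have "x = Kscale \<iota> (fl fb * y1 + y0) (1 - e)" by (simp only: gx Kscale_def)
      then show "x \<in> K.span {1 - e}" by (simp add: K.span_scale K.span_base)
    qed
    have "e \<noteq> 1" unfolding rl_def el_special(4) el_inject using ib by auto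
    then show "K.independent {1 - e}" by (simp add: K.dependent_single)
    show "card {1 - e} = 1" by simp
  qed
qed

lemma two_branches_e: "two_branches \<iota> e"
  unfolding two_branches_def using idem_field_e dims by simp

lemma valuation_1:
  assumes q: "res q \<noteq> 0"
  shows "has_valuation ((*) e ` A) (rl (X * s) q) 1"
proof -
  let ?\<alpha> = "rl (X * s) q" and ?R = "(*) e ` A"
  obtain c d where cd: "fc = X * c" "fd = X * d" "res d \<noteq> 0" by (rule coefficients) (rule that)
  have rlR: "rl p q \<in> ?R" for p q unfolding eA_iff by blast
  have "{I. maximal_ideal_of ?R I} = {(*) ?\<alpha> ` ?R}"
  proof (rule unique_maximal_ideal[where e = e])
    show "e \<notin> (*) ?\<alpha> ` ?R"
    proof
      assume "e \<in> (*) ?\<alpha> ` ?R"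
      then obtain x where "x \<in> ?R" "e = ?\<alpha> * x" by blast
      then obtain p q' where "e = ?\<alpha> * rl p q'" unfolding eA_iff by blast
      then have "1 = X * s * p - fb * fd * (q * q')" unfolding rl_mult rl_inject by simp
      then have "res (1 :: 'k fps) = res (X * s * p - fb * fd * (q * q'))" by (rule arg_cong)
      then show False by (simp add: residues)
    qed
    fix x assume x: "x \<in> ?R" "x \<notin> (*) ?\<alpha> ` ?R"
    obtain p' q' where x': "x = rl p' q'" using x(1) unfolding eA_iff by blast
    have "res p' \<noteq> 0"
    proof
      assume "res p' = 0"
      then obtain r where r: "p' = X * r" using fps_X_factor by blast
      define u where "u = X * s\<^sup>2 - X * c * s * q + fb * d * q\<^sup>2"
      have u: "res u \<noteq> 0" using q residues(1) cd(3) by (simp add: u_def fps_nth_power_0)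
      \<comment> \<open>The conjugate of the uniformizer times x, divided by t.\<close>
      define V where "V = rl (X * r * (s - c * q) + fb * d * q * q') (s * q' - r * q)"
      have "?\<alpha> * V = \<delta> u * x"
        unfolding V_def x' r rl_mult rl_scale rl_inject u_def cd by (simp add: algebra_simps power2_eq_square)
      then have "\<delta> (inverse u) * (?\<alpha> * V) = \<delta> (inverse u * u) * x" by (simp add: \<delta>_mult mult.assoc)
      then have "x = ?\<alpha> * (\<delta> (inverse u) * V)" unfolding inverse_mult_eq_1[OF u] by (simp add: mult_ac)
      moreover have "\<delta> (inverse u) * V \<in> ?R" unfolding V_def rl_scale by (rule rlR)
      ultimately show False using x(2) by blast
    qed
    then have u: "res (qn p' q') \<noteq> 0" by (simp add: qn_0)
    have "x * (\<delta> (inverse (qn p' q')) * rl (p' - fc * q') (- q')) = \<delta> (inverse (qn p' q')) * (rl p' q' * rl (p' - fc * q') (- q'))"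
      unfolding x' by (simp only: mult_ac)
    also have "\<dots> = \<delta> (inverse (qn p' q') * qn p' q') * e" unfolding rl_conj by (simp only: \<delta>_mult mult.assoc)
    also have "\<dots> = e" unfolding inverse_mult_eq_1[OF u] by simp
    finally show "\<exists>y\<in>?R. x * y = e" unfolding rl_scale using rlR by blast
  next
    fix x y assume "x \<in> ?R" "y \<in> ?R"
    then obtain x' y' where xy: "x = e * x'" "y = e * y'" "x' \<in> A" "y' \<in> A" by blast
    have "x - y = e * (x' - y')" "x * y = e * (x' * y')"
      unfolding xy using e_idem by (simp_all only: right_diff_distrib mult.left_commute mult.assoc) (metis mult.assoc mult.left_commute e_idem)
    then show "x - y \<in> ?R" "x * y \<in> ?R" using xy(3,4) A_ring(3) integral_add_mult(2) by blast+
  qed (use rlR e_rl in \<open>auto simp: eA_iff\<close>)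
  then show ?thesis unfolding has_valuation_def using rlR by (intro conjI bexI[of _ ?\<alpha>]) auto
qed

text \<open>If t divides y1, a scalar moves the generator into e A, where it has valuation 1, and f
  has order 1: type E_(12n+7). Otherwise scaling and translation make it e + t^j \<alpha>, where j
  is the order of y2 and also of f: type E_(2n+1,2j+1).\<close>

theorem dominates_singularity:
  assumes C: "cubic_ring \<iota> C" and y: "t ^ (2 * n + 1) * el 0 y1 y2 \<in> C" "res y1 \<noteq> 0 \<or> res y2 \<noteq> 0"
    and ne: "form y1 y2 \<noteq> 0"
  shows "\<exists>B. dominates \<iota> C B \<and> ((\<exists>i\<in>{6..8}. type_E \<iota> (12 * n + i) B) \<or> (\<exists>q. type_E2 \<iota> (2 * n + 1) q B))"
proof -
  obtain c d where cd: "fc = X * c" "fd = X * d" "res d \<noteq> 0" by (rule coefficients) (rule that)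
  let ?m = "2 * n + 1"
  show ?thesis
  proof (cases "res y1 = 0")
    case True
    then obtain v where v: "y1 = X * v" using fps_X_factor by blast
    have y2: "res y2 \<noteq> 0" using True y(2) by simp
    \<comment> \<open>The scalar - fb y1 cancels the component of y1 w + y2 z outside e A.\<close>
    define \<alpha> where "\<alpha> = rl (X * (- (fb * v))) y2"
    have \<alpha>: "\<alpha> = el (- (fb * y1)) y1 y2" using ib(2) by (simp add: \<alpha>_def rl_def v mult.left_commute[of _ X] flip: mult.assoc)
    have "t ^ ?m * \<alpha> \<in> C" using change_generator[OF C y(1), of "- (fb * y1)" 1] by (simp add: \<alpha>)
    moreover have "form y1 y2 = X ^ 1 * (y2 * (X * fb * v\<^sup>2 + X * c * v * y2 + d * y2\<^sup>2))"
      unfolding form_def by (simp add: fa_0 cd v algebra_simps power2_eq_square power3_eq_cube)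
    moreover have "res (y2 * (X * fb * v\<^sup>2 + X * c * v * y2 + d * y2\<^sup>2)) \<noteq> 0"
      using y2 cd(3) by (simp add: fps_nth_power_0)
    ultimately have "dominates \<iota> C (ring_of \<iota> (t ^ ?m * \<alpha>) (2 * ?m + 1))"
      unfolding \<alpha> using dominated[OF C _ y(2)] by blast
    moreover have "type_E \<iota> (12 * n + 7) (ring_of \<iota> (t ^ ?m * \<alpha>) (2 * ?m + 1))"
      unfolding type_E_def using two_branches_e valuation_1[OF y2, of "- (fb * v)", folded \<alpha>_def]
      by (intro disjI2 disjI1 exI[of _ ?m] exI[of _ e] exI[of _ \<alpha>] conjI) simp_all
    moreover have "7 \<in> {6..8::nat}" by simp
    ultimately show ?thesis by blast
  next
    case False
    have "y2 \<noteq> 0" using ne unfolding form_def by (auto simp: fa_0)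
    then obtain j g where g: "y2 = X ^ j * g" "res g \<noteq> 0" using fps_order by blast
    \<comment> \<open>This factor makes the w coordinate equal to that of e; the scalar part 1 then
      completes e.\<close>
    define f where "f = - (ib * inverse y1)"
    have f0: "res f \<noteq> 0" using False residues(1) by (simp add: f_def ib_def)
    have f: "f * y1 = - ib" using inverse_mult_eq_1[OF False] by (simp add: f_def mult.assoc)
    define \<alpha> where "\<alpha> = rl (X * 0) (f * g)"
    define y where "y = e + t ^ j * \<alpha>"
    have y_el: "y = el 1 (f * y1) (f * y2)"
      unfolding y_def \<alpha>_def t_elt_power rl_scale unfolding rl_def el_add f g(1) by (simp add: mult_ac)
    have "t ^ ?m * y \<in> C" unfolding y_el using \<open>t ^ ?m * el 0 y1 y2 \<in> C\<close> by (rule change_generator[OF C])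
    moreover have "form (f * y1) (f * y2) = X ^ j * (f ^ 3 * (g * (fb * y1\<^sup>2 + X * (c * y1 * y2 + d * y2\<^sup>2))))"
    proof -
      have "form y1 y2 = y2 * (fb * y1\<^sup>2 + X * (c * y1 * y2 + d * y2\<^sup>2))"
        unfolding form_def by (simp add: fa_0 cd algebra_simps power2_eq_square power3_eq_cube)
      then show ?thesis unfolding form_scale by (simp add: g(1) mult_ac)
    qed
    moreover have "res (f ^ 3 * (g * (fb * y1\<^sup>2 + X * (c * y1 * y2 + d * y2\<^sup>2)))) \<noteq> 0"
      using f0 g(2) residues(1) False by (simp add: fps_nth_power_0)
    moreover have "res (f * y1) \<noteq> 0 \<or> res (f * y2) \<noteq> 0" using f0 False by simp
    ultimately have "dominates \<iota> C (ring_of \<iota> (t ^ ?m * y) (2 * ?m + j))"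
      unfolding y_el using dominated[OF C] by blast
    moreover have "has_valuation ((*) e ` A) \<alpha> 1" unfolding \<alpha>_def using f0 g(2) by (intro valuation_1) simp
    then have "type_E2 \<iota> ?m (2 * j + 1) (ring_of \<iota> (t ^ ?m * y) (2 * ?m + j))"
      unfolding type_E2_def y_def using two_branches_e
      by (intro disjI1 exI[of _ j] exI[of _ e] exI[of _ \<alpha>] conjI) simp_all
    ultimately show ?thesis by blast
  qed
qed

end

section \<open>Three branches: distinct roots modulo t\<close>

locale three_branch_order = cubic_order \<iota> w z fa fb fc fd
  for \<iota> :: "'k::alg_closed_field fls \<Rightarrow> 'l::comm_ring_1" and w z fa fb fc fd +
  assumes zero: "fa = 0" "fd = 0" and residues: "res fb \<noteq> 0" "res fc \<noteq> 0"
begin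

definition ib where "ib = inverse fb"
definition ic where "ic = inverse fc"

lemma ib: "fb * ib = 1" "ib * fb = 1" "fb * (ib * x) = x" "ib * (fb * x) = x"
  using inverse_mult_eq_1[OF residues(1)] by (simp_all add: ib_def mult.commute[of fb] flip: mult.assoc)

lemma ic: "fc * ic = 1" "ic * fc = 1" "fc * (ic * x) = x" "ic * (fc * x) = x"
  using inverse_mult_eq_1[OF residues(2)] by (simp_all add: ic_def mult.commute[of fc] flip: mult.assoc)

text \<open>Since e A = D e, an idempotent below e is h e with h^2 = h in D, hence 0 or e.\<close>

lemma primitive:
  assumes e: "e * e = e" "e \<noteq> 0" and line: "\<And>x. x \<in> A \<Longrightarrow> \<exists>h. e * x = \<delta> h * e"
  shows "primitive_idempotent A e"
proof -
  have False if fg: "f \<in> A" "f * f = f" "f * g = 0" "f \<noteq> 0" "g \<noteq> 0" "e = f + g" for f g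
  proof -
    obtain h where h: "e * f = \<delta> h * e" using line fg(1) by blast
    have "e * f = f * f + f * g" by (simp add: fg(6) algebra_simps)
    then have "e * f = f" by (simp add: fg(2,3))
    then have f: "f = \<delta> h * e" using h by simp
    have "\<delta> h * e * (\<delta> h * e) = \<delta> h * e" using fg(2) f by simp
    then have "\<delta> (h * h) * e = \<delta> h * e" using e(1) by (simp add: \<delta>_mult mult.left_commute mult.assoc)
    then have *: "\<delta> (h * h - h) * e = 0" by (simp add: \<delta>_diff left_diff_distrib)
    have "h * h - h = 0"
    proof (rule ccontr)
      assume "h * h - h \<noteq> 0"
      then have "\<iota> (1 / fl (h * h - h)) * \<delta> (h * h - h) = 1" unfolding Demb_def by (simp flip: \<iota>_mult)
      then have "e = \<iota> (1 / fl (h * h - h)) * (\<delta> (h * h - h) * e)" by (simp flip: mult.assoc)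
      then show False using * e(2) by simp
    qed
    then have "h * (h - 1) = 0" by (simp add: algebra_simps)
    then have "h = 0 \<or> h = 1" by auto
    then show False using f fg(4,5,6) by auto
  qed
  then show ?thesis using e idem_in_A[OF e(1)] unfolding primitive_idempotent_def by blast
qed

text \<open>With fa = fd = 0 the table reads w^2 = fb w, z^2 = - fc z, wz = 0, so w/fb and - z/fc
  are orthogonal idempotents; the third one is their complement.\<close>

lemma primitive_idempotents:
  "primitive_idempotent A (el 0 ib 0)" "primitive_idempotent A (el 0 0 (- ic))" "primitive_idempotent A (el 1 (- ib) ic)"
proof -
  have 1: "el 0 ib 0 * el y0 y1 y2 = \<delta> (y0 + fb * y1) * el 0 ib 0" for y0 y1 y2
    unfolding el_mult el_scale el_inject zero by (simp add: algebra_simps)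
  have 2: "el 0 0 (- ic) * el y0 y1 y2 = \<delta> (y0 - fc * y2) * el 0 0 (- ic)" for y0 y1 y2
    unfolding el_mult el_scale el_inject zero by (simp add: algebra_simps)
  have 3: "el 1 (- ib) ic * el y0 y1 y2 = \<delta> y0 * el 1 (- ib) ic" for y0 y1 y2
    unfolding el_mult el_scale el_inject zero using ib(3)[of y1] ic(3)[of y2] by (simp add: algebra_simps)
  have ne: "ib \<noteq> 0" "ic \<noteq> 0" using ib(1) ic(1) by auto
  have line: "\<exists>h. g * x = \<delta> h * g" if "\<And>y0 y1 y2. \<exists>h. g * el y0 y1 y2 = \<delta> h * g" "x \<in> A" for g x
    using A_ex[OF that(2)] that(1) by blast
  show "primitive_idempotent A (el 0 ib 0)"
    by (rule primitive[OF _ _ line]) (use 1 ne in \<open>auto simp: ib el_0[symmetric]\<close>)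
  show "primitive_idempotent A (el 0 0 (- ic))"
    by (rule primitive[OF _ _ line]) (use 2 ne in \<open>auto simp: ic el_0[symmetric]\<close>)
  show "primitive_idempotent A (el 1 (- ib) ic)"
    by (rule primitive[OF _ _ line]) (use 3 in \<open>auto simp: el_0[symmetric]\<close>)
qed

lemma three_branches: "three_branches \<iota>"
proof -
  let ?b = "fl fb" and ?c = "fl fc"
  \<comment> \<open>The components along w/fb, - z/fc and the complement 1 - w/fb + z/fc.\<close>
  define \<pi>1 where "\<pi>1 x = co 0 x + ?b * co 1 x" for x
  define \<pi>2 where "\<pi>2 x = co 0 x - ?c * co 2 x" for x
  define \<pi>3 where "\<pi>3 x = co 0 x" for x
  have \<pi>: "\<pi>1 (E x0 x1 x2) = x0 + ?b * x1" "\<pi>2 (E x0 x1 x2) = x0 - ?c * x2" "\<pi>3 (E x0 x1 x2) = x0" for x0 x1 x2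
    by (simp_all add: \<pi>1_def \<pi>2_def \<pi>3_def co_E)
  have mult: "E x0 x1 x2 * E y0 y1 y2 = E (x0 * y0) (x0 * y1 + x1 * y0 + ?b * (x1 * y1)) (x0 * y2 + x2 * y0 - ?c * (x2 * y2))"
    for x0 x1 x2 y0 y1 y2
    unfolding E_mult Let_def zero by simp
  have all_E: "P x y" if "\<And>x0 x1 x2 y0 y1 y2. P (E x0 x1 x2) (E y0 y1 y2)" for P x y
    using that E_ex by metis
  have hom: "K_algebra_hom \<iota> \<pi>1 \<and> K_algebra_hom \<iota> \<pi>2 \<and> K_algebra_hom \<iota> \<pi>3"
    unfolding K_algebra_hom_def
  proof (intro conjI allI)
    show "\<pi>1 (x + y) = \<pi>1 x + \<pi>1 y" for x y by (rule all_E) (simp add: E_add \<pi> algebra_simps)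
    show "\<pi>2 (x + y) = \<pi>2 x + \<pi>2 y" for x y by (rule all_E) (simp add: E_add \<pi> algebra_simps)
    show "\<pi>3 (x + y) = \<pi>3 x + \<pi>3 y" for x y by (rule all_E) (simp add: E_add \<pi>)
    show "\<pi>1 (x * y) = \<pi>1 x * \<pi>1 y" for x y by (rule all_E) (simp add: mult \<pi> algebra_simps)
    show "\<pi>2 (x * y) = \<pi>2 x * \<pi>2 y" for x y by (rule all_E) (simp add: mult \<pi> algebra_simps)
    show "\<pi>3 (x * y) = \<pi>3 x * \<pi>3 y" for x y by (rule all_E) (simp add: mult \<pi>)
  qed (simp_all add: \<iota>_eq_E \<pi>)
  have b: "?b * fl ib = 1" "?c * fl ic = 1"
    using ib(1) ic(1) by (simp_all flip: fls_times_fps_to_fls)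
  have b': "?b * (fl ib * x) = x" "?c * (fl ic * x) = x" "fl ib * (?b * x) = x" "fl ic * (?c * x) = x" for x
    using b b(1)[unfolded mult.commute[of ?b]] b(2)[unfolded mult.commute[of ?c]] by (simp_all flip: mult.assoc)
  have "bij (\<lambda>x. (\<pi>1 x, \<pi>2 x, \<pi>3 x))"
  proof (rule bij_betw_byWitness[where f' = "\<lambda>(p, q, r). E r (fl ib * (p - r)) (fl ic * (r - q))"])
    show "\<forall>x\<in>UNIV. (\<lambda>(p, q, r). E r (fl ib * (p - r)) (fl ic * (r - q))) (\<pi>1 x, \<pi>2 x, \<pi>3 x) = x"
    proof
      fix x
      obtain x0 x1 x2 where "x = E x0 x1 x2" using E_ex by blast
      then show "(\<lambda>(p, q, r). E r (fl ib * (p - r)) (fl ic * (r - q))) (\<pi>1 x, \<pi>2 x, \<pi>3 x) = x"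
        by (simp add: \<pi> b')
    qed
  qed (auto simp: \<pi> b')
  then show ?thesis unfolding three_branches_def using hom by blast
qed

text \<open>The components of y1 w + y2 z are fb y1, - fc y2 and 0, and up to units f is the product
  y1 y2 s of their differences. As y1 is a unit, at most one of y2 and s is divisible by t, and its
  order is j. The branch whose component differs from both others by a unit carries e.\<close>

lemma unit_chart:
  assumes C: "cubic_ring \<iota> C" and y: "t ^ m * el 0 y1 y2 \<in> C" and y1: "res y1 \<noteq> 0" and ne: "form y1 y2 \<noteq> 0"
  shows "\<exists>B q. dominates \<iota> C B \<and> type_E2 \<iota> m q B"
proof -
  define s where "s = fb * y1 + fc * y2"
  have form: "form y1 y2 = y1 * y2 * s"
    unfolding form_def by (simp add: zero s_def algebra_simps power2_eq_square)
  have i: "inverse y1 * y1 = 1" using y1 by (rule inverse_mult_eq_1)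
  show ?thesis
  proof (cases "res s = 0")
    case False
    have "y2 \<noteq> 0" using ne form by auto
    then obtain j g where g: "y2 = X ^ j * g" "res g \<noteq> 0" using fps_order by blast
    define f where "f = ib * inverse y1"
    have f: "f * y1 = ib" using i by (simp add: f_def mult.assoc)
    have f0: "res f \<noteq> 0" using y1 residues by (simp add: f_def ib_def)
    define a where "a = - (fc * f * g)"
    have a0: "res a \<noteq> 0" using f0 g(2) residues by (simp add: a_def)
    define y where "y = el 0 ib 0 + t ^ j * \<delta> a * el 0 0 (- ic)"
    have "X ^ j * (a * - ic) = f * y2" using ic(3)[of "X ^ j * (f * g)"] by (simp add: a_def g(1) mult_ac)
    then have y_el: "y = el 0 (f * y1) (f * y2)"
      unfolding y_def t_elt_power mult.assoc el_scale el_add f by simp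
    have "t ^ m * y \<in> C" unfolding y_el using \<open>t ^ m * el 0 y1 y2 \<in> C\<close> by (rule change_generator[OF C])
    moreover have "form (f * y1) (f * y2) = X ^ j * (f ^ 3 * (y1 * g * s))"
      unfolding form_scale form by (simp add: g(1) mult_ac)
    moreover have "res (f ^ 3 * (y1 * g * s)) \<noteq> 0" using f0 g(2) y1 False by (simp add: fps_nth_power_0)
    moreover have "res (f * y1) \<noteq> 0 \<or> res (f * y2) \<noteq> 0" using f0 y1 by simp
    ultimately have "dominates \<iota> C (ring_of \<iota> (t ^ m * y) (2 * m + j))"
      unfolding y_el using dominated[OF C] by blast
    moreover have "type_E2 \<iota> m (2 * j) (ring_of \<iota> (t ^ m * y) (2 * m + j))"
    proof -
      have "a dvd 1" using inverse_mult_eq_1[OF a0] by (metis dvd_triv_right)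
      moreover have "\<not> X dvd a - 1" if "j = 0"
      proof
        assume "X dvd a - 1"
        then have "res a = 1" by (simp add: fps_X_dvd_iff)
        moreover have "y2 = g" using that g(1) by simp
        \<comment> \<open>For j = 0, the condition that a is not 1 modulo t is precisely that s is a
          unit.\<close>
        moreover have "res s = res fb * res y1 * (1 - res a)"
          using \<open>y2 = g\<close> y1 residues by (simp add: s_def a_def f_def ib_def field_simps)
        ultimately show False using False by simp
      qed
      moreover have "el 0 ib 0 \<noteq> el 0 0 (- ic)" using ib(1) by auto
      ultimately show ?thesis unfolding type_E2_def y_def using three_branches primitive_idempotents
        by (intro disjI2 exI[of _ j] exI[of _ "el 0 ib 0"] exI[of _ "el 0 0 (- ic)"] exI[of _ a] conjI) simp_all
    qed
    ultimately show ?thesis by blast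
  next
    case True
    have "s \<noteq> 0" using ne form by auto
    then obtain j g where g: "s = X ^ j * g" "res g \<noteq> 0" using fps_order by blast
    have j: "j \<noteq> 0" using True g by (cases "j = 0") auto
    have y2: "res y2 \<noteq> 0" using True y1 residues by (auto simp: s_def)
    \<comment> \<open>With scalar part 1 the scaled generator has components 0, t^j a and 1, so e is
      the idempotent of the third branch.\<close>
    define f where "f = - (ib * inverse y1)"
    have f: "f * y1 = - ib" using i by (simp add: f_def mult.assoc)
    have f0: "res f \<noteq> 0" using y1 residues by (simp add: f_def ib_def)
    define a where "a = - (f * g)"
    have a0: "res a \<noteq> 0" using f0 g(2) by (simp add: a_def)
    define y where "y = el 1 (- ib) ic + t ^ j * \<delta> a * el 0 0 (- ic)"
    have "ic + X ^ j * (a * - ic) = ic * (1 + f * s)" by (simp add: a_def g(1) algebra_simps)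
    also have "f * s = - 1 + f * (fc * y2)" using f ib(1) by (simp add: s_def distrib_left mult.left_commute[of f])
    also have "ic * (1 + (- 1 + f * (fc * y2))) = f * y2" using ic(4)[of "f * y2"] by (simp add: mult_ac)
    finally have y_el: "y = el 1 (f * y1) (f * y2)"
      unfolding y_def t_elt_power mult.assoc el_scale el_add f by simp
    have "t ^ m * y \<in> C" unfolding y_el using \<open>t ^ m * el 0 y1 y2 \<in> C\<close> by (rule change_generator[OF C])
    moreover have "form (f * y1) (f * y2) = X ^ j * (f ^ 3 * (y1 * y2 * g))"
      unfolding form_scale form by (simp add: g(1) mult_ac)
    moreover have "res (f ^ 3 * (y1 * y2 * g)) \<noteq> 0" using f0 g(2) y1 y2 by (simp add: fps_nth_power_0)
    moreover have "res (f * y1) \<noteq> 0 \<or> res (f * y2) \<noteq> 0" using f0 y1 by simp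
    ultimately have "dominates \<iota> C (ring_of \<iota> (t ^ m * y) (2 * m + j))"
      unfolding y_el using dominated[OF C] by blast
    moreover have "type_E2 \<iota> m (2 * j) (ring_of \<iota> (t ^ m * y) (2 * m + j))"
    proof -
      have "a dvd 1" using inverse_mult_eq_1[OF a0] by (metis dvd_triv_right)
      then show ?thesis unfolding type_E2_def y_def using three_branches primitive_idempotents j
        by (intro disjI2 exI[of _ j] exI[of _ "el 1 (- ib) ic"] exI[of _ "el 0 0 (- ic)"] exI[of _ a] conjI) simp_all
    qed
    ultimately show ?thesis by blast
  qed
qed

theorem dominates_singularity:
  assumes C: "cubic_ring \<iota> C" and y: "t ^ m * el 0 y1 y2 \<in> C" "res y1 \<noteq> 0 \<or> res y2 \<noteq> 0"
    and ne: "form y1 y2 \<noteq> 0"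
  shows "\<exists>B q. dominates \<iota> C B \<and> type_E2 \<iota> m q B"
proof (cases "res y1 = 0")
  case False
  then show ?thesis using unit_chart[OF C y(1) _ ne] by blast
next
  case True
  interpret o: cubic_order \<iota> z w "- fd" "- fc" "- fb" "- fa" by (rule swap)
  interpret s: three_branch_order \<iota> z w "- fd" "- fc" "- fb" "- fa"
    using zero residues by unfold_locales simp_all
  show ?thesis using s.unit_chart[OF C, of m y2 y1] y True ne by (simp add: el_swap swapped_form)
qed

end

theorem theorem4p1:
  fixes \<iota> :: "'k::alg_closed_field fls \<Rightarrow> 'l::comm_ring_1" and C :: "'l set" and n :: nat
  assumes "cubic_algebra \<iota>" and "cubic_ring \<iota> C"
  shows "par \<iota> C \<le> enat n \<longleftrightarrow>
    (\<exists>B. dominates \<iota> C B \<and>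
      ((\<exists>i\<in>{6..8}. type_E \<iota> (12 * n + i) B) \<or> (\<exists>q. type_E2 \<iota> (2 * n + 1) q B)))"
proof -
  obtain w0 z0 a0 b0 c0 d0 where "cubic_order \<iota> w0 z0 a0 b0 c0 d0"
    using cubic_order_of_algebra[OF assms(1)] by blast
  from cubic_order.normal_form[OF this] obtain w z a b c d where o: "cubic_order \<iota> w z a b c d" and
    nf: "res a = 0 \<and> res b = 0 \<and> res c = 0 \<or>
     a = 0 \<and> res b \<noteq> 0 \<and> res c = 0 \<and> res d = 0 \<or>
     a = 0 \<and> res b \<noteq> 0 \<and> res c \<noteq> 0 \<and> d = 0"
    by (elim exE conjE) (rule that)
  interpret cubic_order \<iota> w z a b c d by (rule o)
  note C = assms(2)
  show ?thesis
  proof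
    assume "par \<iota> C \<le> enat n"
    then have "\<not> C \<subseteq> {el x0 x1 x2 | x0 x1 x2. X ^ (2 * Suc n) dvd x1 \<and> X ^ (2 * Suc n) dvd x2}"
      using par_lower_bound[OF C] by blast
    then obtain x where x: "x \<in> C" "x \<notin> {el x0 x1 x2 | x0 x1 x2. X ^ (2 * Suc n) dvd x1 \<and> X ^ (2 * Suc n) dvd x2}"
      by blast
    obtain x0 x1 x2 where el: "x = el x0 x1 x2" using x(1) ring_subset_A[OF C] A_ex by blast
    \<comment> \<open>Here 2 (n+1) = (2n+1) + 1: a ring not contained in D + t^(2n+2) A has a member
      of order at most 2n+1 modulo D.\<close>
    have "\<not> (X ^ Suc (2 * n + 1) dvd x1 \<and> X ^ Suc (2 * n + 1) dvd x2)"
      using x(2) unfolding el by auto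
    from primitive_multiple[OF C _ this] x(1) el obtain x' where
      "x' \<in> A" "\<not> (\<exists>f. \<exists>y\<in>A. x' = \<delta> f + t * y)" "t ^ (2 * n + 1) * x' \<in> C" by blast
    from nonzero_form[OF C this] obtain y1 y2 where y: "t ^ (2 * n + 1) * el 0 y1 y2 \<in> C"
      "res y1 \<noteq> 0 \<or> res y2 \<noteq> 0" "form y1 y2 \<noteq> 0" by blast
    from nf show "\<exists>B. dominates \<iota> C B \<and> ((\<exists>i\<in>{6..8}. type_E \<iota> (12 * n + i) B) \<or> (\<exists>q. type_E2 \<iota> (2 * n + 1) q B))"
    proof (elim disjE)
      assume "res a = 0 \<and> res b = 0 \<and> res c = 0"
      then interpret one_branch_order \<iota> w z a b c d by unfold_locales simp_all
      show ?thesis using dominates_singularity[OF C y(1,2)] by blast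
    next
      assume "a = 0 \<and> res b \<noteq> 0 \<and> res c = 0 \<and> res d = 0"
      then interpret two_branch_order \<iota> w z a b c d by unfold_locales simp_all
      show ?thesis using dominates_singularity[OF C y] .
    next
      assume "a = 0 \<and> res b \<noteq> 0 \<and> res c \<noteq> 0 \<and> d = 0"
      then interpret three_branch_order \<iota> w z a b c d by unfold_locales simp_all
      show ?thesis using dominates_singularity[OF C y] by blast
    qed
  next
    assume "\<exists>B. dominates \<iota> C B \<and> ((\<exists>i\<in>{6..8}. type_E \<iota> (12 * n + i) B) \<or> (\<exists>q. type_E2 \<iota> (2 * n + 1) q B))"
    then obtain B where B: "dominates \<iota> C B" "(\<exists>i\<in>{6..8}. type_E \<iota> (12 * n + i) B) \<or> (\<exists>q. type_E2 \<iota> (2 * n + 1) q B)" by blast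
    obtain x where x: "x \<in> A" "\<not> (\<exists>f. \<exists>y\<in>A. x = \<delta> f + t * y)" "t ^ (2 * n + 1) * x \<in> B"
      using singularity_primitive[OF B(2)] by blast
    have "t ^ (2 * n + 1) * x \<in> C" using B(1) x(3) by (auto simp: dominates_def)
    then show "par \<iota> C \<le> enat n" by (rule par_upper_bound[OF C x(1,2)])
  qed
qed

end
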